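(* Let $\mathcal F:\mathcal P_2(\mathbb R^d)\to\mathbb R\cup\{+\infty\}$ be defined by $$\mathcal F(\rho)=\int_{\mathbb R^d}V(x)\rho(x)\,dx+\frac12\int_{\mathbb R^d}(W*\rho)(x)\rho(x)\,dx+\int_{\mathbb R^d}f(\rho(x))\,dx$$ if $\rho$ is absolutely continuous with respect to Lebesgue measure, and $\mathcal F(\rho)=+\infty$ otherwise, where $V,W:\mathbb R^d\to\mathbb R$ and $f:\mathbb R_+\to\mathbb R$ is continuous. Assume that: (a) $V,W$ are nonnegative, and $f$ is either nonnegative or a positive multiple of $s\in\mathbb R_+\mapsto s\log s$; (b) $V,W$ are of class $C^1$ with globally Lipschitz derivatives; (c) $f$ is convex with superlinear growth and satisfies the McCann condition: $s\mapsto s^df(s^{-d})$ is convex and nonincreasing on $(0,+\infty)$. Then there exist $\lambda,K\in\mathbb R$ such that $\mathcal F$ satisfies Hypothesis (A) (stated in the context) with constants $\lambda$ and $K$.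
   Context: $\mathcal P_2(\mathbb R^d)$: Borel probability measures on $\mathbb R^d$ with finite second moment. Superlinear growth: $f(s)/s\to+\infty$ as $s\to+\infty$. For $t>0$, $\sigma_t$ has density $(2\pi t)^{-d/2}e^{-|x|^2/(2t)}$; $\sigma_0=\delta_0$. $\lambda$-convexity along generalized geodesics: with $\pi_1,\pi_2,\pi_3:(\mathbb R^d)^3\to\mathbb R^d$ the canonical projections, $\mathcal F$ is $\lambda$-convex along generalized geodesics if for all $\mu,\nu,\rho\in\mathcal P_2(\mathbb R^d)$ and every $\Pi\in\mathcal P_2((\mathbb R^d)^3)$ such that $(\pi_1,\pi_2)_\#\Pi$ is an optimal (quadratic cost) transport plan between $\mu$ and $\nu$ and $(\pi_1,\pi_3)_\#\Pi$ is an optimal transport plan between $\mu$ and $\rho$, for all $t\in[0,1]$, $$\mathcal F((t\pi_3+(1-t)\pi_2)_\#\Pi)\le t\mathcal F(\rho)+(1-t)\mathcal F(\nu)-\tfrac\lambda2t(1-t)\int|y-z|^2\,d(\pi_2,\pi_3)_\#\Pi(y,z).$$ Hypothesis (A) with constants $\lambda,K$: (1) $\mathcal F$ is lower semicontinuous along sequences in $\mathcal P_2(\mathbb R^d)$ that converge narrowly (in duality with bounded continuous functions) and have uniformly bounded second moments; (2) $\mathcal F$ is $\lambda$-convex along generalized geodesics; (3) for all $\mu\in\mathcal P_2(\mathbb R^d)$ and $t\ge0$, $\mathcal F(\mu*\sigma_t)\le\mathcal F(\mu)+K\frac t2$.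
   Formalization: λ-convexity along generalized geodesics is required for every Π when μ is absolutely continuous, and for some Π when μ is arbitrary; for every Π over every μ it is false (μ=δ_0, Π=law(0,X,-X), X uniform on a centred ball, t=1/2). *)

theory Defs
  imports "HOL-Probability.Probability"
begin

subsection \<open>Probability measures with finite second moment\<close>

definition P2 :: "'a::euclidean_space measure set" where
  "P2 = {\<mu>. sets \<mu> = sets borel \<and> prob_space \<mu> \<and> integrable \<mu> (\<lambda>x. (norm x)\<^sup>2)}"

definition narrowly_converges ::
    "(nat \<Rightarrow> 'a::euclidean_space measure) \<Rightarrow> 'a measure \<Rightarrow> bool" where
  "narrowly_converges M \<mu> \<longleftrightarrow>
     (\<forall>g :: 'a \<Rightarrow> real. continuous_on UNIV g \<and> bounded (range g) \<longrightarrow>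
        (\<lambda>k. \<integral>x. g x \<partial>M k) \<longlonglongrightarrow> (\<integral>x. g x \<partial>\<mu>))"

definition heat_measure :: "real \<Rightarrow> 'a::euclidean_space measure" where
  "heat_measure t =
     (if t > 0
      then density lborel (\<lambda>x. ennreal ((2 * pi * t) powr (- (real DIM('a) / 2)) *
                                         exp (- ((norm x)\<^sup>2 / (2 * t)))))
      else return borel 0)"

subsection \<open>Optimal plans and convexity along generalized geodesics\<close>

definition transport_plans ::
    "'a::euclidean_space measure \<Rightarrow> 'a measure \<Rightarrow> ('a \<times> 'a) measure set" where
  "transport_plans \<mu> \<nu> = {\<gamma>. sets \<gamma> = sets borel \<and> prob_space \<gamma> \<and>
                             distr \<gamma> borel fst = \<mu> \<and> distr \<gamma> borel snd = \<nu>}"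

definition quadratic_cost :: "('a::euclidean_space \<times> 'a) measure \<Rightarrow> ennreal" where
  "quadratic_cost \<gamma> = (\<integral>\<^sup>+(x, y). ennreal ((norm (x - y))\<^sup>2) \<partial>\<gamma>)"

definition optimal_plan ::
    "'a::euclidean_space measure \<Rightarrow> 'a measure \<Rightarrow> ('a \<times> 'a) measure \<Rightarrow> bool" where
  "optimal_plan \<mu> \<nu> \<gamma> \<longleftrightarrow>
     \<gamma> \<in> transport_plans \<mu> \<nu> \<and>
     (\<forall>\<gamma>' \<in> transport_plans \<mu> \<nu>. quadratic_cost \<gamma> \<le> quadratic_cost \<gamma>')"

definition gen_geodesic_plans ::
    "'a::euclidean_space measure \<Rightarrow> 'a measure \<Rightarrow> 'a measure \<Rightarrow> ('a \<times> 'a \<times> 'a) measure set" where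
  "gen_geodesic_plans \<mu> \<nu> \<rho> =
     {\<Gamma> \<in> P2. optimal_plan \<mu> \<nu> (distr \<Gamma> borel (\<lambda>(x, y, z). (x, y))) \<and>
               optimal_plan \<mu> \<rho> (distr \<Gamma> borel (\<lambda>(x, y, z). (x, z)))}"

text \<open>In \<^type>\<open>ereal\<close> one has \<open>0 * \<infinity> = 0\<close>, so the endpoint cases \<open>t = 0\<close> and \<open>t = 1\<close> are
  trivially true.\<close>

definition convex_along_plan ::
    "real \<Rightarrow> ('a::euclidean_space measure \<Rightarrow> ereal) \<Rightarrow>
     'a measure \<Rightarrow> 'a measure \<Rightarrow> ('a \<times> 'a \<times> 'a) measure \<Rightarrow> bool" where
  "convex_along_plan lam F \<nu> \<rho> \<Gamma> \<longleftrightarrow>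
     (\<forall>t \<in> {0..1}.
        F (distr \<Gamma> borel (\<lambda>(x, y, z). t *\<^sub>R z + (1 - t) *\<^sub>R y))
          \<le> ereal t * F \<rho> + ereal (1 - t) * F \<nu>
             - ereal (lam / 2 * t * (1 - t) *
                 (\<integral>(y, z). (norm (y - z))\<^sup>2 \<partial>distr \<Gamma> borel (\<lambda>(x, y, z). (y, z)))))"

text \<open>The inequality is required along every plan when the base point \<open>\<mu>\<close> is absolutely
  continuous, and along some plan, as in Ambrosio--Gigli--Savare, for an arbitrary base point.
  Asking for every plan over a singular base point would be too much: for the Dirac mass at
  \<open>0\<close> every coupling of \<open>\<nu>\<close> and \<open>\<rho>\<close> is admissible, also the one carried by \<open>z = - y\<close>, whose
  midpoint is again the Dirac mass at \<open>0\<close>; a functional that is infinite there and finite at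
  some symmetric measure would never be \<open>\<lambda>\<close>-convex.\<close>

definition convex_along_gen_geodesics ::
    "real \<Rightarrow> ('a::euclidean_space measure \<Rightarrow> ereal) \<Rightarrow> bool" where
  "convex_along_gen_geodesics lam F \<longleftrightarrow>
     (\<forall>\<mu>\<in>P2. \<forall>\<nu>\<in>P2. \<forall>\<rho>\<in>P2.
        (absolutely_continuous lborel \<mu> \<longrightarrow>
           (\<forall>\<Gamma> \<in> gen_geodesic_plans \<mu> \<nu> \<rho>. convex_along_plan lam F \<nu> \<rho> \<Gamma>)) \<and>
        (\<exists>\<Gamma> \<in> gen_geodesic_plans \<mu> \<nu> \<rho>. convex_along_plan lam F \<nu> \<rho> \<Gamma>))"

subsection \<open>Hypothesis (A)\<close>

text \<open>The first conjunct expresses that \<open>F\<close> takes its values in the reals and \<open>+\<infinity>\<close>.\<close>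

definition hypothesis_A ::
    "real \<Rightarrow> real \<Rightarrow> ((real ^ 'n) measure \<Rightarrow> ereal) \<Rightarrow> bool" where
  "hypothesis_A lam K F \<longleftrightarrow>
     (\<forall>\<mu>\<in>P2. F \<mu> \<noteq> -\<infinity>) \<and>
     (\<forall>M \<mu>. range M \<subseteq> P2 \<and> \<mu> \<in> P2 \<and> narrowly_converges M \<mu> \<and>
        (\<exists>C. \<forall>k. (\<integral>x. (norm x)\<^sup>2 \<partial>M k) \<le> C)
        \<longrightarrow> F \<mu> \<le> liminf (\<lambda>k. F (M k))) \<and>
     convex_along_gen_geodesics lam F \<and>
     (\<forall>\<mu>\<in>P2. \<forall>t\<ge>0. F (\<mu> \<star> heat_measure t) \<le> F \<mu> + ereal (K * (t / 2)))"

subsection \<open>The functional\<close>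

text \<open>Integral with values in the extended reals: positive part minus negative part. It is
  meaningful when at most one of the two is infinite.\<close>

definition ext_integral :: "'a measure \<Rightarrow> ('a \<Rightarrow> real) \<Rightarrow> ereal" where
  "ext_integral M g =
     enn2ereal (\<integral>\<^sup>+x. ennreal (g x) \<partial>M) - enn2ereal (\<integral>\<^sup>+x. ennreal (- g x) \<partial>M)"

definition leb_density :: "'a::euclidean_space measure \<Rightarrow> 'a \<Rightarrow> real" where
  "leb_density \<mu> x = enn2real (RN_deriv lborel \<mu> x)"

definition conv_fun :: "('a::euclidean_space \<Rightarrow> real) \<Rightarrow> ('a \<Rightarrow> real) \<Rightarrow> 'a \<Rightarrow> real" where
  "conv_fun W r x = (\<integral>y. W (x - y) * r y \<partial>lborel)"

definition energy ::
    "('a::euclidean_space \<Rightarrow> real) \<Rightarrow> ('a \<Rightarrow> real) \<Rightarrow> (real \<Rightarrow> real) \<Rightarrow> 'a measure \<Rightarrow> ereal" where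
  "energy V W f \<mu> =
     (if absolutely_continuous lborel \<mu>
      then let r = leb_density \<mu> in
             ext_integral lborel (\<lambda>x. V x * r x)
             + ereal (1 / 2) * ext_integral lborel (\<lambda>x. conv_fun W r x * r x)
             + ext_integral lborel (\<lambda>x. f (r x))
      else \<infinity>)"

text \<open>Class \<open>C\<^sup>1\<close> with globally Lipschitz derivative; continuity of the gradient follows from
  the Lipschitz bound.\<close>

definition C1_Lipschitz_deriv :: "('a::euclidean_space \<Rightarrow> real) \<Rightarrow> bool" where
  "C1_Lipschitz_deriv U \<longleftrightarrow>
     (\<exists>G L. (\<forall>x. GDERIV U x :> G x) \<and> L-lipschitz_on UNIV G)"

end

(*
  V and W enter through the quadratic bounds |Phi (p + h) - Phi p - g . h| <= L |h|^2 for the pair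
  potential Phi (x, y) = V x + W (x - y) / 2, which give semiconvexity along any coupling, Fatou lower
  semicontinuity and, by symmetry of the Gaussian, growth of order t under the heat flow; Jensen's
  inequality shows that the internal energy does not increase.

  Displacement convexity of the internal energy along generalized geodesics is obtained without the
  regularity theory of optimal maps. Two absolutely continuous measures are coupled by splitting space
  recursively, coordinate after coordinate, at quantiles into matching cells of equal mass; in the limit
  of small cells this Knothe type coupling satisfies McCann's inequality, because the volume of a box is
  dim-th power concave and f is applied to cell averages. If the base point has finite support, the
  pieces of the two optimal plans over distinct atoms are separated by parallel hyperplanes, so the
  interpolated pieces do not overlap and the piecewise couplings add up. A general base point is
  approximated by discrete ones, using Skorohod representations (obtained on the real line through a
  space filling curve) and stability of optimality. Over an absolutely continuous base point the
  plan is unique, since its support is monotone and hence single valued almost everywhere.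
*)
theory Submission
  imports Defs
begin

subsection \<open>Skorohod representations in Euclidean space\<close>

text \<open>The freedom behind the convexity proof: over an atom x of the base point, optimality
  constrains the law of y given x and the law of z given x, but not how the two are coupled. This
  coupling is chosen to suit McCann's condition. The price is that the base point must first be
  discrete, and that everything has to survive two limits, small cells and then finer base points.
  The internal energy therefore enters as the predicate \<open>energy_le\<close> with a real bound,
  closed under narrow limits with bounded second moments; it includes absolute continuity, which
  superlinear growth of f restores in the limit. The entropy has a negative part; it is controlled
  by a first moment plus a constant, and first moments converge when second moments stay bounded.
  With Lipschitz constants L and M of the gradients of V and W, the result is lambda = - 4 (L + M)
  and K = 4 (L + M) d.\<close>

definition schoenberg_bit :: "real \<Rightarrow> real" where
  "schoenberg_bit t = max 0 (min 1 (1/2 - cos (pi * t)))"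

text \<open>\<open>schoenberg_bit\<close> is even with period 2, equals 0 on [0, 1/3] and 1 on
  [2/3, 1]. Multiplying t by 3^n moves the first n ternary digits, all 0 or 2, into an even integer,
  which the period discards. The remainder s starts with the digit 2 * d n, so it lies in the left
  or in the right third.\<close>

lemma schoenberg_bit_ternary:
  fixes d :: "nat \<Rightarrow> nat"
  assumes d: "\<And>i. d i \<le> 1"
  defines "t \<equiv> (\<Sum>i. 2 * real (d i) / 3 ^ (i + 1))"
  shows "schoenberg_bit (3 ^ n * t) = d n" "0 \<le> t" "t \<le> 1"
proof -
  have sm: "summable (\<lambda>i. 2 * real (e i) / 3 ^ (i + 1))" if "\<And>i. e i \<le> 1" for e :: "nat \<Rightarrow> nat"
  proof (rule summable_comparison_test')
    show "summable (\<lambda>i. (2/3::real) * (1/3) ^ i)" by (intro summable_mult summable_geometric) auto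
    show "norm (2 * real (e i) / 3 ^ (i + 1)) \<le> (2/3::real) * (1/3) ^ i" for i
      using that[of i] by (simp add: power_divide field_simps)
  qed
  have bd: "0 \<le> (\<Sum>i. 2 * real (e i) / 3 ^ (i + 1)) \<and> (\<Sum>i. 2 * real (e i) / 3 ^ (i + 1)) \<le> 1"
    if e: "\<And>i. e i \<le> 1" for e :: "nat \<Rightarrow> nat"
  proof
    show "0 \<le> (\<Sum>i. 2 * real (e i) / 3 ^ (i + 1))" by (intro suminf_nonneg sm e) auto
    have "(\<Sum>i. 2 * real (e i) / 3 ^ (i + 1)) \<le> (\<Sum>i. (2/3::real) * (1/3) ^ i)"
    proof (intro suminf_le sm e)
      show "summable (\<lambda>i. (2/3::real) * (1/3) ^ i)" by (intro summable_mult summable_geometric) auto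
      show "2 * real (e i) / 3 ^ (i + 1) \<le> (2/3::real) * (1/3) ^ i" for i
        using e[of i] by (simp add: power_divide field_simps)
    qed
    also have "\<dots> = (2/3) * (1 / (1 - 1/3))"
      by (subst suminf_mult, intro summable_geometric) (simp_all add: suminf_geometric)
    finally show "(\<Sum>i. 2 * real (e i) / 3 ^ (i + 1)) \<le> 1" by simp
  qed
  show "0 \<le> t" "t \<le> 1" using bd[OF d] unfolding t_def by auto
  define s where "s = (\<Sum>i. 2 * real (d (i + n)) / 3 ^ (i + 1))"
  define r where "r = (\<Sum>i. 2 * real (d (i + Suc n)) / 3 ^ (i + 1))"
  have r: "0 \<le> r" "r \<le> 1" using bd[of "\<lambda>i. d (i + Suc n)"] d unfolding r_def by auto
  have "s = (\<Sum>i. 2 * real (d (i + 1 + n)) / 3 ^ (i + 1 + 1)) + (\<Sum>i<1. 2 * real (d (i + n)) / 3 ^ (i + 1))"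
    unfolding s_def by (rule suminf_split_initial_segment) (intro sm d)
  also have "(\<Sum>i. 2 * real (d (i + 1 + n)) / 3 ^ (i + 1 + 1)) = (\<Sum>i. (1/3) * (2 * real (d (i + Suc n)) / 3 ^ (i + 1)))"
    by (intro suminf_cong) (simp add: field_simps)
  also have "\<dots> = r / 3" unfolding r_def by (subst suminf_mult) (auto intro!: sm[of "\<lambda>i. d (i + Suc n)", simplified] d[simplified])
  finally have s: "s = r / 3 + 2 * real (d n) / 3" by simp
  have "t = (\<Sum>i. 2 * real (d (i + n)) / 3 ^ (i + n + 1)) + (\<Sum>i<n. 2 * real (d i) / 3 ^ (i + 1))"
    unfolding t_def by (rule suminf_split_initial_segment) (intro sm d)
  also have "(\<Sum>i. 2 * real (d (i + n)) / 3 ^ (i + n + 1)) = (\<Sum>i. (1/3^n) * (2 * real (d (i + n)) / 3 ^ (i + 1)))"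
    by (intro suminf_cong) (simp add: field_simps power_add)
  also have "\<dots> = s / 3 ^ n" unfolding s_def by (subst suminf_mult) (auto intro!: sm[of "\<lambda>i. d (i + n)", simplified] d[simplified])
  finally have "3 ^ n * t = s + (\<Sum>i<n. 3 ^ n * (2 * real (d i) / 3 ^ (i + 1)))"
    by (simp add: field_simps sum_distrib_left)
  also have "(\<Sum>i<n. 3 ^ n * (2 * real (d i) / 3 ^ (i + 1))) = 2 * real (\<Sum>i<n. d i * 3 ^ (n - Suc i))"
    unfolding of_nat_sum sum_distrib_left
  proof (intro sum.cong refl)
    fix i assume "i \<in> {..<n}"
    then have "(3::real) ^ n = 3 ^ (i + 1) * 3 ^ (n - Suc i)" 
      by (subst power_add[symmetric]) (simp add: Suc_leI)
    then show "3 ^ n * (2 * real (d i) / 3 ^ (i + 1)) = 2 * real (d i * 3 ^ (n - Suc i))" by simp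
  qed
  finally have "pi * (3 ^ n * t) = pi * s + real (\<Sum>i<n. d i * 3 ^ (n - Suc i)) * (2 * pi)"
    by (simp add: algebra_simps)
  then have cos: "cos (pi * (3 ^ n * t)) = cos (pi * s)"
  proof -
    define N where "N = (\<Sum>i<n. d i * 3 ^ (n - Suc i))"
    assume "pi * (3 ^ n * t) = pi * s + real (\<Sum>i<n. d i * 3 ^ (n - Suc i)) * (2 * pi)"
    then have "pi * (3 ^ n * t) = pi * s + real (2 * N) * pi" unfolding N_def by simp
    moreover have "cos (real (2 * N) * pi) = 1" "sin (real (2 * N) * pi) = 0"
      by (simp_all only: cos_npi sin_npi) simp
    ultimately show ?thesis by (simp add: cos_add)
  qed
  have "d n = 0 \<or> d n = 1" using d[of n] by linarith
  then show "schoenberg_bit (3 ^ n * t) = d n"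
  proof
    assume "d n = 0"
    then have "cos (pi * s) \<ge> cos (pi / 3)" using s r by (intro cos_monotone_0_pi_le) auto
    with \<open>d n = 0\<close> show ?thesis unfolding schoenberg_bit_def cos by (auto simp: cos_60)
  next
    assume 1: "d n = 1"
    then have "cos (pi - pi / 3) \<ge> cos (pi * s)" using s r by (intro cos_monotone_0_pi_le) (auto simp: field_simps)
    with 1 show ?thesis unfolding schoenberg_bit_def cos by (auto simp: cos_120)
  qed
qed

text \<open>The k-th digit is the increment floor (2^(k+1) u) - 2 floor (2^k u), so the partial sums
  telescope to floor (2^n u) / 2^n.\<close>

lemma binary_expansion:
  fixes u :: real
  assumes "0 \<le> u" "u < 1"
  obtains a :: "nat \<Rightarrow> nat" where "\<And>k. a k \<le> 1" "(\<lambda>k. real (a k) / 2 ^ (k + 1)) sums u"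
proof -
  define a where "a k = nat (\<lfloor>2 ^ (k + 1) * u\<rfloor> - 2 * \<lfloor>2 ^ k * u\<rfloor>)" for k
  have fl: "0 \<le> \<lfloor>2 ^ (k + 1) * u\<rfloor> - 2 * \<lfloor>2 ^ k * u\<rfloor>" "\<lfloor>2 ^ (k + 1) * u\<rfloor> - 2 * \<lfloor>2 ^ k * u\<rfloor> \<le> 1" for k
  proof -
    have "2 ^ (k+1) * u = 2 * (2 ^ k * u)" by simp
    then show "0 \<le> \<lfloor>2 ^ (k + 1) * u\<rfloor> - 2 * \<lfloor>2 ^ k * u\<rfloor>" "\<lfloor>2 ^ (k + 1) * u\<rfloor> - 2 * \<lfloor>2 ^ k * u\<rfloor> \<le> 1"
      by linarith+
  qed
  have ra: "real (a k) = real_of_int (\<lfloor>2 ^ (k + 1) * u\<rfloor> - 2 * \<lfloor>2 ^ k * u\<rfloor>)" for k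
    unfolding a_def using fl(1)[of k] by simp
  have sum: "(\<Sum>k<n. real (a k) / 2 ^ (k + 1)) = \<lfloor>2 ^ n * u\<rfloor> / 2 ^ n" for n
  proof (induction n)
    case 0
    have "\<lfloor>u\<rfloor> = 0" using assms by linarith
    then show ?case by simp
  next
    case (Suc n)
    then show ?case using ra[of n] by (simp add: field_simps)
  qed
  have "(\<lambda>n. \<lfloor>2 ^ n * u\<rfloor> / 2 ^ n) \<longlonglongrightarrow> u"
  proof (rule tendsto_sandwich)
    show "\<forall>\<^sub>F n in sequentially. u - (1/2) ^ n \<le> \<lfloor>2 ^ n * u\<rfloor> / 2 ^ n"
    proof (intro always_eventually allI)
      fix n :: nat
      have "2 ^ n * u - 1 \<le> \<lfloor>2 ^ n * u\<rfloor>" by linarith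
      then have "(2 ^ n * u - 1) / 2 ^ n \<le> \<lfloor>2 ^ n * u\<rfloor> / 2 ^ n" by (intro divide_right_mono) auto
      then show "u - (1/2) ^ n \<le> \<lfloor>2 ^ n * u\<rfloor> / 2 ^ n" by (simp add: diff_divide_distrib power_divide)
    qed
    show "\<forall>\<^sub>F n in sequentially. \<lfloor>2 ^ n * u\<rfloor> / 2 ^ n \<le> u"
      by (intro always_eventually allI) (simp add: field_simps)
    have "(\<lambda>n. u - (1/2) ^ n) \<longlonglongrightarrow> u - 0"
      by (intro tendsto_diff tendsto_const LIMSEQ_power_zero) auto
    then show "(\<lambda>n. u - (1/2) ^ n) \<longlonglongrightarrow> u" by simp
  qed auto
  then have "(\<lambda>k. real (a k) / 2 ^ (k + 1)) sums u" unfolding sums_def sum .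
  moreover have "a k \<le> 1" for k using fl(2)[of k] unfolding a_def by linarith
  ultimately show ?thesis using that by blast
qed

text \<open>Schoenberg's curve: the ternary digits of one real s carry the binary digits of all
  coordinates at once, and \<open>schoenberg_bit\<close> reads them off continuously.
  \<open>kk\<close> is a continuous staircase equal to K on [2 K, 2 K + 1], so this stretch of time
  covers the open cube of half side K, and the whole curve covers the space.\<close>

lemma space_filling_curve:
  obtains psi :: "real \<Rightarrow> 'a::euclidean_space"
  where "continuous_on UNIV psi" "\<And>K x. (\<And>b. b \<in> Basis \<Longrightarrow> \<bar>x \<bullet> b\<bar> < real K) \<Longrightarrow> x \<in> psi ` {0..2 * real K + 1}"
proof -
  obtain idx :: "'a \<Rightarrow> nat" where idx: "inj_on idx Basis"
    using finite_imp_inj_to_nat_seg[OF finite_Basis] by blast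
  define \<iota> where "\<iota> k b = prod_encode (k, idx b)" for k b
  define xx where "xx b s = (\<Sum>k. schoenberg_bit (3 ^ \<iota> k b * s) / 2 ^ (k + 1))" for b s
  define kk where "kk s = (s - arccos (cos (pi * s)) / pi) / 2" for s :: real
  define psi where "psi s = kk s *\<^sub>R (\<Sum>b\<in>Basis. (2 * xx b s - 1) *\<^sub>R b)" for s
  have sb: "0 \<le> schoenberg_bit t" "schoenberg_bit t \<le> 1" for t unfolding schoenberg_bit_def by auto
  have cxx: "continuous_on UNIV (xx b)" for b
  proof -
    have "uniform_limit UNIV (\<lambda>n s. \<Sum>k<n. schoenberg_bit (3 ^ \<iota> k b * s) / 2 ^ (k + 1)) (xx b) sequentially"
      unfolding xx_def
    proof (rule Weierstrass_m_test)
      show "norm (schoenberg_bit (3 ^ \<iota> k b * s) / 2 ^ (k + 1)) \<le> (1/2) ^ (k+1)" for k s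
        using sb[of "3 ^ \<iota> k b * s"] by (simp add: power_divide divide_right_mono)
      show "summable (\<lambda>k. (1/2::real) ^ (k+1))" using summable_geometric[of "1/2::real"] by (simp add: summable_mult)
    qed
    then show ?thesis
      by (rule uniform_limit_theorem[rotated])
        (auto intro!: always_eventually continuous_intros simp: schoenberg_bit_def)
  qed
  have "continuous_on UNIV kk" unfolding kk_def by (auto intro!: continuous_intros)
  then have cont: "continuous_on UNIV psi" unfolding psi_def by (intro continuous_intros cxx)
  have "x \<in> psi ` {0..2 * real K + 1}" if x: "\<And>b. b \<in> Basis \<Longrightarrow> \<bar>x \<bullet> b\<bar> < real K" for K x
  proof -
    have K: "K > 0" using x[OF SOME_Basis] by (cases K) auto
    define u where "u b = ((x \<bullet> b) / K + 1) / 2" for b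
    have "\<forall>b\<in>Basis. \<exists>a::nat \<Rightarrow> nat. (\<forall>k. a k \<le> 1) \<and> (\<lambda>k. real (a k) / 2 ^ (k + 1)) sums u b"
    proof
      fix b :: 'a assume "b \<in> Basis"
      then have "0 \<le> u b" "u b < 1" using x[of b] K unfolding u_def by (auto simp: field_simps abs_less_iff)
      then show "\<exists>a::nat \<Rightarrow> nat. (\<forall>k. a k \<le> 1) \<and> (\<lambda>k. real (a k) / 2 ^ (k + 1)) sums u b"
        using binary_expansion by metis
    qed
    then obtain a :: "'a \<Rightarrow> nat \<Rightarrow> nat" where a: "\<And>b k. b \<in> Basis \<Longrightarrow> a b k \<le> 1" 
       "\<And>b. b \<in> Basis \<Longrightarrow> (\<lambda>k. real (a b k) / 2 ^ (k + 1)) sums u b" by metis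
    define d where "d n = (let (k, j) = prod_decode n in if j \<in> idx ` Basis then a (the_inv_into Basis idx j) k else 0)" for n
    have d: "d n \<le> 1" for n unfolding d_def using a(1) the_inv_into_into[OF idx] by (auto split: prod.split)
    have d\<iota>: "d (\<iota> k b) = a b k" if "b \<in> Basis" for k b
      unfolding d_def \<iota>_def using that by (simp add: the_inv_into_f_f[OF idx])
    define t where "t = (\<Sum>i. 2 * real (d i) / 3 ^ (i + 1))"
    note t = schoenberg_bit_ternary[of d, OF d, folded t_def]
    define s where "s = t + 2 * real K"
    have per: "cos (pi * (m * s)) = cos (pi * (m * t))" if "m = real M" for m M
    proof -
      have "pi * (m * s) = pi * (m * t) + real (2 * M * K) * pi" unfolding s_def that by (simp add: algebra_simps)
      moreover have "cos (real (2 * M * K) * pi) = 1" "sin (real (2 * M * K) * pi) = 0"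
        by (simp_all only: cos_npi sin_npi) simp
      ultimately show ?thesis by (simp add: cos_add)
    qed
    have "schoenberg_bit (3 ^ n * s) = d n" for n
      using t(1)[of n] per[of "3^n" "3^n"] unfolding schoenberg_bit_def by simp
    then have "xx b s = u b" if "b \<in> Basis" for b
      unfolding xx_def using d\<iota>[OF that] a(2)[OF that] by (simp add: sums_iff)
    moreover have "kk s = K"
    proof -
      have "cos (pi * s) = cos (pi * t)" using per[of 1 1] by simp
      moreover have "arccos (cos (pi * t)) = pi * t" using t by (intro arccos_cos) auto
      ultimately show ?thesis unfolding kk_def s_def by simp
    qed
    ultimately have "psi s = real K *\<^sub>R (\<Sum>b\<in>Basis. ((x \<bullet> b) / K) *\<^sub>R b)"
      unfolding psi_def u_def by (simp add: add_divide_distrib)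
    also have "\<dots> = x" using K by (simp add: scaleR_sum_right euclidean_representation)
    finally have "psi s = x" .
    moreover have "s \<in> {0..2 * real K + 1}" using t unfolding s_def by auto
    ultimately show ?thesis by blast
  qed
  with cont show ?thesis using that by blast
qed


text \<open>\<open>c x\<close> is the first time at which the curve reaches x. Its sublevel set at a
  is the compact image of [0, a], which makes \<open>c\<close> Borel. The bound 2 K + 1 later
  carries tightness from the space to the line.\<close>

lemma borel_section_of_curve:
  obtains psi :: "real \<Rightarrow> 'a::euclidean_space" and c :: "'a \<Rightarrow> real"
  where "continuous_on UNIV psi" "c \<in> borel_measurable borel" "\<And>x. psi (c x) = x"
    "\<And>K x. norm x < real K \<Longrightarrow> 0 \<le> c x \<and> c x \<le> 2 * real K + 1"
proof -
  obtain psi :: "real \<Rightarrow> 'a" where cont: "continuous_on UNIV psi"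
    and surj: "\<And>K x. (\<And>b. b \<in> Basis \<Longrightarrow> \<bar>x \<bullet> b\<bar> < real K) \<Longrightarrow> x \<in> psi ` {0..2 * real K + 1}"
    using space_filling_curve by blast
  have surj': "x \<in> psi ` {0..2 * real K + 1}" if "norm x < real K" for K x
    using that by (intro surj) (meson Basis_le_norm le_less_trans)
  define T where "T x = {s. 0 \<le> s \<and> psi s = x}" for x
  define c where "c x = Inf (T x)" for x
  have clo: "closed (T x)" for x
  proof -
    have "T x = {0..} \<inter> psi -` {x}" unfolding T_def by auto
    then show ?thesis using continuous_closed_vimage[of "{x}" psi] cont
      by (auto intro!: closed_Int simp: continuous_on_eq_continuous_at)
  qed
  have ne: "T x \<noteq> {}" for x
  proof -
    obtain K :: nat where "norm x < real K" using reals_Archimedean2 by blast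
    then show ?thesis using surj' unfolding T_def by fastforce
  qed
  have bdd: "bdd_below (T x)" for x unfolding T_def by (intro bdd_belowI[of _ 0]) auto
  have cT: "c x \<in> T x" for x unfolding c_def using closed_contains_Inf[OF ne bdd clo] .
  have c: "0 \<le> c x" "psi (c x) = x" for x using cT[of x] unfolding T_def by auto
  have min: "c x \<le> s" if "0 \<le> s" "psi s = x" for x s
    unfolding c_def using that by (intro cInf_lower bdd) (auto simp: T_def)
  have "c \<in> borel_measurable borel"
  proof (rule borel_measurableI_le)
    fix a :: real
    have "{x \<in> space borel. c x \<le> a} = psi ` {0..a}"
    proof (intro equalityI subsetI)
      fix x assume "x \<in> {x \<in> space borel. c x \<le> a}"
      then show "x \<in> psi ` {0..a}" using c[of x] by (intro image_eqI[of _ _ "c x"]) auto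
    qed (auto intro: order_trans[OF min])
    moreover have "compact (psi ` {0..a})"
      using cont by (intro compact_continuous_image) (auto intro: continuous_on_subset)
    ultimately show "{x \<in> space borel. c x \<le> a} \<in> sets borel" by (simp add: borel_closed compact_imp_closed)
  qed
  moreover have "0 \<le> c x \<and> c x \<le> 2 * real K + 1" if nx: "norm x < real K" for K x
  proof -
    obtain s where "s \<in> {0..2 * real K + 1}" "psi s = x" using surj'[OF nx] by auto
    then show ?thesis using c[of x] min[of s x] by auto
  qed
  ultimately show ?thesis using that cont c by blast
qed

lemma tail_le_second_moment:
  fixes M :: "'a::euclidean_space measure"
  assumes "prob_space M" "sets M = sets borel" "integrable M (\<lambda>x. norm x ^ 2)"
    and "(LINT x|M. norm x ^ 2) \<le> C" "K > 0"
  shows "measure M {x. norm x \<ge> K} \<le> C / K\<^sup>2"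
proof -
  interpret prob_space M by fact
  have sp: "space M = UNIV" using sets_eq_imp_space_eq[OF assms(2)] by simp
  have "measure M {x\<in>space M. K\<^sup>2 \<le> norm x ^ 2} \<le> (LINT x|M. norm x ^ 2) / K\<^sup>2"
    using assms by (intro integral_Markov_inequality_measure[where A="{}"]) auto
  also have "\<dots> \<le> C / K\<^sup>2" using assms by (intro divide_right_mono) auto
  also have "{x\<in>space M. K\<^sup>2 \<le> norm x ^ 2} = {x. norm x \<ge> K}"
    using assms(5) by (simp add: sp power_mono_iff[of K "norm _" 2])
  finally show ?thesis .
qed

text \<open>The measures are pushed to the line by the Borel section \<open>c\<close>, Skorohod's
  theorem is applied there, and the random variables return through the continuous curve
  \<open>psi\<close>. Since \<open>psi\<close> inverts \<open>c\<close>, the original laws are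
  recovered exactly, and continuity of \<open>psi\<close> carries the pointwise limit back.\<close>

lemma skorohod_subsequence:
  fixes M :: "nat \<Rightarrow> 'a::euclidean_space measure"
  assumes M: "\<And>k. prob_space (M k)" "\<And>k. sets (M k) = sets borel"
    "\<And>k. integrable (M k) (\<lambda>x. norm x ^ 2)" "\<And>k. (\<integral>x. norm x ^ 2 \<partial>M k) \<le> C"
  obtains r :: "nat \<Rightarrow> nat" and Om :: "real measure" and X Y
  where "strict_mono r" "prob_space Om" "\<And>k. X k \<in> borel_measurable Om" "Y \<in> borel_measurable Om"
    "\<And>k. distr Om borel (X k) = M (r k)" "\<And>w. w \<in> space Om \<Longrightarrow> (\<lambda>k. X k w) \<longlonglongrightarrow> Y w"
proof -
  obtain psi :: "real \<Rightarrow> 'a" and c where psi: "continuous_on UNIV psi" and c[measurable]: "c \<in> borel_measurable borel"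
    and psic: "\<And>x. psi (c x) = x" and cb: "\<And>K x. norm x < real K \<Longrightarrow> 0 \<le> c x \<and> c x \<le> 2 * real K + 1"
    using borel_section_of_curve by blast
  have psim[measurable]: "psi \<in> borel_measurable borel" using psi by (rule borel_measurable_continuous_onI)
  have mc[measurable]: "c \<in> borel_measurable (M k)" for k using c by (simp add: measurable_cong_sets[OF M(2) refl])
  have spM: "space (M k) = UNIV" for k using sets_eq_imp_space_eq[OF M(2)] by simp
  define N where "N k = distr (M k) borel c" for k
  have rd: "real_distribution (N k)" for k
    unfolding N_def real_distribution_def real_distribution_axioms_def
    using prob_space.prob_space_distr[OF M(1) mc] by simp
  \<comment> \<open>Outside the ball of radius K the mass is at most C / K^2 by Markov, and
    \<open>c\<close> maps the ball into [0, 2 K + 1]. The left end is -1 because tightness is stated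
    with intervals open on the left.\<close>
  have "tight N" unfolding tight_def
  proof (intro conjI allI impI rd)
    fix ep :: real assume ep: "ep > 0"
    have C: "C \<ge> 0" by (rule order_trans[OF _ M(4)[of 0]]) simp
    obtain K :: nat where K: "real K > max 1 (C / ep)" using reals_Archimedean2 by blast
    have "C < ep * (real K)\<^sup>2"
    proof -
      have "C < ep * K" using K ep by (simp add: field_simps)
      also have "\<dots> \<le> ep * (real K)\<^sup>2" using K ep by (intro mult_left_mono) (auto simp: power2_eq_square)
      finally show ?thesis .
    qed
    then have CK: "C / (real K)\<^sup>2 < ep" using K by (simp add: field_simps)
    show "\<exists>a b. a < b \<and> (\<forall>n. 1 - ep < measure (N n) {a<..b})"
    proof (rule exI[of _ "-1"], rule exI[of _ "2 * real K + 1"], intro conjI allI)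
      fix n
      interpret prob_space "M n" by (rule M)
      have "prob {x. norm x \<ge> K} \<le> C / (real K)\<^sup>2" using K by (intro tail_le_second_moment M) auto
      then have "prob (space (M n) - {x. norm x \<ge> K}) > 1 - ep"
        using CK by (subst prob_compl) (auto simp: M)
      also have "prob (space (M n) - {x. norm x \<ge> K}) \<le> prob (c -` {-1<..2 * real K + 1} \<inter> space (M n))"
      proof (intro finite_measure_mono subsetI)
        fix x assume "x \<in> space (M n) - {x. norm x \<ge> K}"
        then show "x \<in> c -` {-1<..2 * real K + 1} \<inter> space (M n)"
          using cb[of x K] by auto
      qed (auto intro: measurable_sets)
      also have "\<dots> = measure (N n) {-1<..2 * real K + 1}" unfolding N_def by (subst measure_distr) auto
      finally show "1 - ep < measure (N n) {-1<..2 * real K + 1}" .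
    qed simp
  qed
  from tight_imp_convergent_subsubsequence[OF this, of id]
  obtain r L where r: "strict_mono (r :: nat \<Rightarrow> nat)" "real_distribution L" "weak_conv_m (N \<circ> r) L"
    by (auto simp: strict_mono_def)
  obtain Om :: "real measure" and S T where sk: "prob_space Om" "\<forall>n. S n \<in> borel_measurable Om"
    "\<forall>n. distr Om borel (S n) = N (r n)" "T \<in> borel_measurable Om"
    "\<forall>w\<in>space Om. (\<lambda>n. S n w) \<longlonglongrightarrow> T w"
    using Skorohod[OF _ r(2,3)] rd unfolding measurable_lborel1 comp_def by blast
  note Om = sk(1) and [measurable] = sk(2)[rule_format] sk(4) and S = sk(3)[rule_format] and ST = sk(5)[rule_format]
  show ?thesis
  proof (rule that[OF r(1) Om, of "\<lambda>k w. psi (S k w)" "\<lambda>w. psi (T w)"])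
    show "distr Om borel (\<lambda>w. psi (S k w)) = M (r k)" for k
    proof -
      have "distr Om borel (\<lambda>w. psi (S k w)) = distr (distr Om borel (S k)) borel psi"
        by (subst distr_distr) (auto simp: comp_def)
      also have "\<dots> = distr (M (r k)) borel (\<lambda>x. x)"
        unfolding S N_def by (subst distr_distr) (auto simp: comp_def psic)
      also have "\<dots> = M (r k)" by (rule distr_id2) (simp add: M)
      finally show ?thesis .
    qed
    show "(\<lambda>k. psi (S k w)) \<longlonglongrightarrow> psi (T w)" if "w \<in> space Om" for w
      using psi ST[OF that] by (intro continuous_on_tendsto_compose[OF psi]) auto
  qed auto
qed

section \<open>Narrow convergence and almost sure representations\<close>

abbreviation converges_AE :: "'w measure \<Rightarrow> (nat \<Rightarrow> 'w \<Rightarrow> 'a::topological_space) \<Rightarrow> ('w \<Rightarrow> 'a) \<Rightarrow> bool" where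
  "converges_AE M X Y \<equiv> AE w in M. (\<lambda>k. X k w) \<longlonglongrightarrow> Y w"

abbreviation moment2 :: "'w measure \<Rightarrow> ('w \<Rightarrow> 'a::real_normed_vector) \<Rightarrow> ennreal" where
  "moment2 M X \<equiv> \<integral>\<^sup>+w. ennreal (norm (X w) ^ 2) \<partial>M"

lemma P2_sets: "mu \<in> P2 \<Longrightarrow> sets mu = sets borel"
  and P2_prob: "mu \<in> P2 \<Longrightarrow> prob_space mu"
  and P2_integrable: "mu \<in> P2 \<Longrightarrow> integrable mu (\<lambda>x. norm x ^ 2)"
  by (auto simp: P2_def)

lemma second_moment_le_iff:
  assumes "mu \<in> P2" "0 \<le> C"
  shows "(\<integral>\<^sup>+x. ennreal (norm x ^ 2) \<partial>mu) \<le> ennreal C \<longleftrightarrow> (LINT x|mu. norm x ^ 2) \<le> C"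
  using nn_integral_eq_integral[OF P2_integrable[OF assms(1)]] assms(2) by simp

lemma P2_iff_nn_integral:
  "mu \<in> P2 \<longleftrightarrow> sets mu = sets borel \<and> prob_space mu \<and> (\<integral>\<^sup>+x. ennreal (norm x ^ 2) \<partial>mu) < \<infinity>"
proof (cases "sets mu = sets borel")
  case True
  have "(\<lambda>x. norm x ^ 2) \<in> borel_measurable mu"
    by (simp add: measurable_cong_sets[OF True refl])
  then show ?thesis by (simp add: P2_def integrable_iff_bounded True)
qed (simp add: P2_def)

lemma (in prob_space) distr_in_P2_iff:
  assumes "X \<in> borel_measurable M"
  shows "distr M borel X \<in> P2 \<longleftrightarrow> moment2 M X < \<infinity>"
  using assms by (simp add: P2_iff_nn_integral prob_space_distr nn_integral_distr)

lemma narrow_limit_unique: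
  fixes M N :: "'a::euclidean_space measure"
  assumes "prob_space M" "prob_space N" and sM: "sets M = sets borel" and sN: "sets N = sets borel"
    and eq: "\<And>g :: 'a \<Rightarrow> real. continuous_on UNIV g \<Longrightarrow> bounded (range g) \<Longrightarrow> (LINT x|M. g x) = (LINT x|N. g x)"
  shows "M = N"
proof (rule measure_eqI_generator_eq[where E = "Collect closed" and \<Omega> = UNIV and A = "\<lambda>_. UNIV"])
  interpret M: prob_space M by fact
  interpret N: prob_space N by fact
  show "Int_stable (Collect (closed :: 'a set \<Rightarrow> bool))" by (auto simp: Int_stable_def)
  show "sets M = sigma_sets UNIV (Collect closed)" "sets N = sigma_sets UNIV (Collect closed)"
    using sM sN by (simp_all add: borel_eq_closed)
  show "emeasure M X = emeasure N X" if "X \<in> Collect closed" for X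
  \<comment> \<open>\<open>infdist\<close> to the empty set is 0, so the functions
    \<open>g n\<close> would be constantly 1 instead of tending to the indicator of the empty
    set.\<close>
  proof (cases "X = {}")
    case False
    define g where "g n x = max 0 (1 - real n * infdist x X)" for n and x :: 'a
    have cl: "closed X" using that by simp
    have bX: "X \<in> sets borel" using cl by (rule borel_closed)
    have cg: "continuous_on UNIV (g n)" for n unfolding g_def by (intro continuous_intros)
    have gb: "0 \<le> g n x" "g n x \<le> 1" for n x unfolding g_def by (auto simp: infdist_nonneg)
    have lim: "(\<lambda>n. g n x) \<longlonglongrightarrow> indicator X x" for x
    proof (cases "x \<in> X")
      case True then show ?thesis unfolding g_def by simp
    next
      case nx: False
      then have pos: "infdist x X > 0" using infdist_pos_not_in_closed[OF cl False] by simp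
      then obtain K :: nat where K: "real K * infdist x X > 1" by (metis reals_Archimedean3)
      have "g n x = 0" if "n \<ge> K" for n
      proof -
        have "real n * infdist x X \<ge> real K * infdist x X" using that pos by (intro mult_right_mono) auto
        with K show ?thesis unfolding g_def by simp
      qed
      then show ?thesis using nx by (auto intro!: tendsto_eventually eventually_sequentiallyI)
    qed
    have conv: "(\<lambda>n. LINT x|L. g n x) \<longlonglongrightarrow> measure L X" if L: "prob_space L" "sets L = sets borel" for L
    proof -
      interpret L: prob_space L by fact
      have [measurable]: "g n \<in> borel_measurable L" for n
        using borel_measurable_continuous_onI[OF cg] by (simp add: measurable_cong_sets[OF L(2) refl])
      have [measurable]: "X \<in> sets L" using L bX by simp
      have "(\<lambda>n. LINT x|L. g n x) \<longlonglongrightarrow> (LINT x|L. indicator X x)"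
        using gb lim by (intro integral_dominated_convergence[where w="\<lambda>_. 1"]) auto
      then show ?thesis by simp
    qed
    have "(LINT x|M. g n x) = (LINT x|N. g n x)" for n
      using gb by (intro eq cg) (auto intro!: boundedI[of _ 1])
    then have "measure M X = measure N X"
      using LIMSEQ_unique[OF conv[OF assms(1) sM]] conv[OF assms(2) sN] by simp
    then show ?thesis by (simp add: M.emeasure_eq_measure N.emeasure_eq_measure)
  qed simp
qed (use prob_space.finite_measure[OF assms(1)] in "auto simp: finite_measure.emeasure_finite")

lemma narrowly_converges_subseq:
  "narrowly_converges M mu \<Longrightarrow> strict_mono r \<Longrightarrow> narrowly_converges (\<lambda>k. M (r k)) mu"
  unfolding narrowly_converges_def using LIMSEQ_subseq_LIMSEQ by (fastforce simp: comp_def)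

lemma narrowly_converges_const: "narrowly_converges (\<lambda>_. mu) mu"
  by (simp add: narrowly_converges_def)

lemma (in prob_space) narrowly_converges_distr:
  fixes X :: "nat \<Rightarrow> 'a \<Rightarrow> 'b::euclidean_space"
  assumes [measurable]: "\<And>k. X k \<in> borel_measurable M" "Y \<in> borel_measurable M"
    and lim: "converges_AE M X Y"
  shows "narrowly_converges (\<lambda>k. distr M borel (X k)) (distr M borel Y)"
  unfolding narrowly_converges_def
proof (intro allI impI, elim conjE)
  fix g :: "'b \<Rightarrow> real" assume g: "continuous_on UNIV g" "bounded (range g)"
  have [measurable]: "g \<in> borel_measurable borel" using g(1) by (rule borel_measurable_continuous_onI)
  obtain B where B: "\<And>x. norm (g x) \<le> B" using g(2) by (auto simp: bounded_iff)
  have "(\<lambda>k. LINT w|M. g (X k w)) \<longlonglongrightarrow> (LINT w|M. g (Y w))"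
  proof (rule integral_dominated_convergence[where w="\<lambda>_. B"])
    show "AE w in M. (\<lambda>k. g (X k w)) \<longlonglongrightarrow> g (Y w)"
      using lim by eventually_elim (auto intro: continuous_on_tendsto_compose[OF g(1)])
  qed (use B in auto)
  then show "(\<lambda>k. \<integral>x. g x \<partial>distr M borel (X k)) \<longlonglongrightarrow> (\<integral>x. g x \<partial>distr M borel Y)"
    by (simp add: integral_distr)
qed

lemma narrowly_converges_unique:
  fixes M N :: "'a::euclidean_space measure"
  assumes "prob_space M" "prob_space N" "sets M = sets borel" "sets N = sets borel"
    "narrowly_converges L M" "narrowly_converges L N"
  shows "M = N"
  using assms unfolding narrowly_converges_def by (intro narrow_limit_unique) (blast intro: LIMSEQ_unique)+

lemma (in prob_space) distr_limit_eq:
  fixes X :: "nat \<Rightarrow> 'a \<Rightarrow> 'b::euclidean_space"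
  assumes X: "\<And>k. X k \<in> borel_measurable M" "Y \<in> borel_measurable M"
    and lim: "converges_AE M X Y"
    and "prob_space mu" "sets mu = sets borel" "narrowly_converges (\<lambda>k. distr M borel (X k)) mu"
  shows "distr M borel Y = mu"
  using narrowly_converges_distr[OF X lim] assms prob_space_distr[OF X(2)]
  by (intro narrowly_converges_unique[of _ mu "\<lambda>k. distr M borel (X k)"]) auto

lemma nn_integral_le_of_limit:
  fixes u :: "nat \<Rightarrow> 'a \<Rightarrow> real"
  assumes [measurable]: "\<And>k. u k \<in> borel_measurable M" "v \<in> borel_measurable M"
    and lim: "AE x in M. (\<lambda>k. u k x) \<longlonglongrightarrow> v x"
    and C: "(\<lambda>k. \<integral>\<^sup>+x. ennreal (u k x) \<partial>M) \<longlonglongrightarrow> C"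
  shows "(\<integral>\<^sup>+x. ennreal (v x) \<partial>M) \<le> C"
proof -
  have "(\<integral>\<^sup>+x. ennreal (v x) \<partial>M) = (\<integral>\<^sup>+x. liminf (\<lambda>k. ennreal (u k x)) \<partial>M)"
  proof (rule nn_integral_cong_AE)
    show "AE x in M. ennreal (v x) = liminf (\<lambda>k. ennreal (u k x))"
      using lim by eventually_elim (metis lim_imp_Liminf tendsto_ennrealI trivial_limit_sequentially)
  qed
  also have "\<dots> \<le> liminf (\<lambda>k. \<integral>\<^sup>+x. ennreal (u k x) \<partial>M)" by (rule nn_integral_liminf) auto
  also have "\<dots> = C" using C by (rule lim_imp_Liminf[OF trivial_limit_sequentially])
  finally show ?thesis .
qed

lemma nn_integral_le_of_limit_bounded:
  fixes u :: "nat \<Rightarrow> 'a \<Rightarrow> real"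
  assumes [measurable]: "\<And>k. u k \<in> borel_measurable M" "v \<in> borel_measurable M"
    and lim: "AE x in M. (\<lambda>k. u k x) \<longlonglongrightarrow> v x"
    and C: "\<And>k. (\<integral>\<^sup>+x. ennreal (u k x) \<partial>M) \<le> C"
  shows "(\<integral>\<^sup>+x. ennreal (v x) \<partial>M) \<le> C"
proof -
  have "(\<integral>\<^sup>+x. ennreal (v x) \<partial>M) = (\<integral>\<^sup>+x. liminf (\<lambda>k. ennreal (u k x)) \<partial>M)"
  proof (rule nn_integral_cong_AE)
    show "AE x in M. ennreal (v x) = liminf (\<lambda>k. ennreal (u k x))"
      using lim by eventually_elim (metis lim_imp_Liminf tendsto_ennrealI trivial_limit_sequentially)
  qed
  also have "\<dots> \<le> liminf (\<lambda>k. \<integral>\<^sup>+x. ennreal (u k x) \<partial>M)" by (rule nn_integral_liminf) auto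
  also have "\<dots> \<le> C" using C by (intro Liminf_le) auto
  finally show ?thesis .
qed

text \<open>Compactness under a second moment bound. The limit is delivered as an almost sure one on
  a common space, so that later limit passages become Fatou's lemma or dominated convergence, also
  for functions of the variables such as interpolants.\<close>

lemma skorohod_P2:
  fixes M :: "nat \<Rightarrow> 'a::euclidean_space measure"
  assumes M: "\<And>k. M k \<in> P2" "\<And>k. (\<integral>x. norm x ^ 2 \<partial>M k) \<le> C"
  obtains r :: "nat \<Rightarrow> nat" and Om :: "real measure" and X Y
  where "strict_mono r" "prob_space Om" "\<And>k. X k \<in> borel_measurable Om" "Y \<in> borel_measurable Om"
    "\<And>k. distr Om borel (X k) = M (r k)" "converges_AE Om X Y"
    "distr Om borel Y \<in> P2" "(\<integral>x. norm x ^ 2 \<partial>distr Om borel Y) \<le> C"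
    "\<And>k. moment2 Om (X k) \<le> ennreal C"
proof -
  obtain r :: "nat \<Rightarrow> nat" and Om :: "real measure" and X Y
    where r: "strict_mono r" "prob_space Om" and [measurable]: "\<And>k. X k \<in> borel_measurable Om" "Y \<in> borel_measurable Om"
      and X: "\<And>k. distr Om borel (X k) = M (r k)" and lim: "\<And>w. w \<in> space Om \<Longrightarrow> (\<lambda>k. X k w) \<longlonglongrightarrow> Y w"
    using skorohod_subsequence[of M C] M P2_prob P2_sets P2_integrable by metis
  interpret prob_space Om by fact
  have C0: "C \<ge> 0" using order_trans[OF _ M(2)[of 0]] by simp
  have AE: "converges_AE Om X Y" using lim by auto
  have bd: "moment2 Om (X k) \<le> ennreal C" for k
  proof -
    have "(\<integral>\<^sup>+x. ennreal (norm x ^ 2) \<partial>M (r k)) \<le> ennreal C"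
      using M C0 by (simp add: second_moment_le_iff)
    then show ?thesis unfolding X[symmetric] by (simp add: nn_integral_distr)
  qed
  have "moment2 Om Y \<le> ennreal C"
  proof (rule nn_integral_le_of_limit_bounded[where u="\<lambda>k w. norm (X k w) ^ 2"])
    show "AE w in Om. (\<lambda>k. norm (X k w) ^ 2) \<longlonglongrightarrow> norm (Y w) ^ 2"
      using AE by eventually_elim (intro tendsto_intros)
  qed (use bd in auto)
  then have Y: "distr Om borel Y \<in> P2" "(\<integral>\<^sup>+x. ennreal (norm x ^ 2) \<partial>distr Om borel Y) \<le> ennreal C"
    by (auto simp: distr_in_P2_iff nn_integral_distr intro: le_less_trans)
  show ?thesis
    by (rule that[OF r _ _ X AE Y(1) _ bd]) (use Y second_moment_le_iff[OF Y(1) C0] in auto)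
qed

text \<open>A uniformly bounded second moment makes functions of at most linear growth uniformly
  integrable.\<close>

lemma (in prob_space) expectation_tendsto_linear_growth:
  fixes X :: "nat \<Rightarrow> 'a \<Rightarrow> 'b::euclidean_space" and g :: "'b \<Rightarrow> real"
  assumes [measurable]: "\<And>k. X k \<in> borel_measurable M" "Y \<in> borel_measurable M"
    and lim: "converges_AE M X Y"
    and X: "\<And>k. moment2 M (X k) \<le> ennreal C"
    and g: "continuous_on UNIV g" and B: "\<And>x. \<bar>g x\<bar> \<le> B * (1 + norm x)"
  shows "(\<lambda>k. LINT w|M. g (X k w)) \<longlonglongrightarrow> (LINT w|M. g (Y w))"
proof -
  have [measurable]: "g \<in> borel_measurable borel" using g by (rule borel_measurable_continuous_onI)
  \<comment> \<open>A bound for the second moment of g (Z w), from (1 + r)^2 <= 2 (1 + r^2).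
    Truncation at level R changes a number s by at most s^2 / R, hence the expectation by at most D
    / R, uniformly in k.\<close>
  define D where "D = 2 * B\<^sup>2 * (1 + max 0 C)"
  have D0: "D \<ge> 0" unfolding D_def by simp
  have Y: "moment2 M Y \<le> ennreal C"
  proof (rule nn_integral_le_of_limit_bounded[where u="\<lambda>k w. norm (X k w) ^ 2"])
    show "AE w in M. (\<lambda>k. norm (X k w) ^ 2) \<longlonglongrightarrow> norm (Y w) ^ 2"
      using lim by eventually_elim (intro tendsto_intros)
  qed (use X in auto)
  define T where "T R s = max (- R) (min R s)" for R s :: real
  have trunc: "integrable M (\<lambda>w. g (Z w)) \<and> \<bar>(LINT w|M. g (Z w)) - (LINT w|M. T R (g (Z w)))\<bar> \<le> D / R"
    if [measurable]: "Z \<in> borel_measurable M" and Z: "moment2 M Z \<le> ennreal C"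
      and R: "R > 0" for Z R
  proof
    have iZ: "integrable M (\<lambda>w. norm (Z w) ^ 2)"
      using Z by (auto simp: integrable_iff_bounded intro: le_less_trans)
    have EZ: "(LINT w|M. norm (Z w) ^ 2) \<le> max 0 C"
      using Z nn_integral_eq_integral[OF iZ] by (cases "C \<ge> 0") (auto simp: ennreal_neg)
    have sq: "(g x)\<^sup>2 \<le> 2 * B\<^sup>2 * (1 + norm x ^ 2)" for x
    proof -
      have "(g x)\<^sup>2 \<le> (B * (1 + norm x))\<^sup>2" using power_mono[OF B[of x], of 2] by simp
      also have "\<dots> = B\<^sup>2 * (1 + norm x)\<^sup>2" by (simp add: power_mult_distrib)
      also have "\<dots> \<le> B\<^sup>2 * (2 * (1 + norm x ^ 2))"
        using zero_le_power2[of "norm x - 1"] by (intro mult_left_mono) (auto simp: power2_eq_square algebra_simps)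
      finally show ?thesis by (simp add: algebra_simps)
    qed
    have isq: "integrable M (\<lambda>w. (g (Z w))\<^sup>2)"
    proof (rule Bochner_Integration.integrable_bound)
      show "integrable M (\<lambda>w. 2 * B\<^sup>2 * (1 + norm (Z w) ^ 2))" using iZ by simp
      show "AE w in M. norm ((g (Z w))\<^sup>2) \<le> norm (2 * B\<^sup>2 * (1 + norm (Z w) ^ 2))"
        using sq by (intro AE_I2) (simp add: abs_of_nonneg)
    qed simp
    show ig: "integrable M (\<lambda>w. g (Z w))" by (rule square_integrable_imp_integrable[OF _ isq]) simp
    have iT: "integrable M (\<lambda>w. T R (g (Z w)))"
      using R by (intro integrable_const_bound[where B=R]) (auto simp: T_def)
    have "\<bar>(LINT w|M. g (Z w)) - (LINT w|M. T R (g (Z w)))\<bar> = \<bar>LINT w|M. g (Z w) - T R (g (Z w))\<bar>"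
      using ig iT by simp
    also have "\<dots> \<le> (LINT w|M. (2 * B\<^sup>2 * (1 + norm (Z w) ^ 2)) / R)"
    proof (rule order_trans[OF integral_abs_bound], rule integral_mono)
      show "integrable M (\<lambda>x. \<bar>g (Z x) - T R (g (Z x))\<bar>)"
        by (intro integrable_abs Bochner_Integration.integrable_diff ig iT)
      show "\<bar>g (Z w) - T R (g (Z w))\<bar> \<le> (2 * B\<^sup>2 * (1 + norm (Z w) ^ 2)) / R" for w
      proof -
        have "\<bar>s - T R s\<bar> * R \<le> s\<^sup>2" for s
        proof (cases "\<bar>s\<bar> \<le> R")
          case True then show ?thesis by (auto simp: T_def)
        next
          case False
          then have "\<bar>s - T R s\<bar> * R \<le> \<bar>s\<bar> * \<bar>s\<bar>" using R by (intro mult_mono) (auto simp: T_def)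
          then show ?thesis by (simp add: power2_eq_square)
        qed
        from order_trans[OF this sq] show ?thesis using R by (simp add: field_simps)
      qed
    qed (use iZ in auto)
    also have "\<dots> = 2 * B\<^sup>2 * (1 + (LINT w|M. norm (Z w) ^ 2)) / R"
      using iZ by (simp add: prob_space)
    also have "\<dots> \<le> D / R" unfolding D_def using EZ R by (intro divide_right_mono mult_left_mono) auto
    finally show "\<bar>(LINT w|M. g (Z w)) - (LINT w|M. T R (g (Z w)))\<bar> \<le> D / R" .
  qed
  show ?thesis
  proof (rule LIMSEQ_I)
    fix e :: real assume e: "e > 0"
    define R where "R = 4 * D / e + 1"
    have R: "R > 0" using D0 e unfolding R_def by (simp add: add_nonneg_pos)
    have DR: "D / R \<le> e / 4" using D0 e R unfolding R_def by (simp add: field_simps)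
    have "(\<lambda>k. LINT w|M. T R (g (X k w))) \<longlonglongrightarrow> (LINT w|M. T R (g (Y w)))"
    proof (rule integral_dominated_convergence[where w="\<lambda>_. R"])
      have cT: "continuous_on UNIV (\<lambda>x. T R (g x))" unfolding T_def by (intro continuous_intros g)
      show "AE w in M. (\<lambda>k. T R (g (X k w))) \<longlonglongrightarrow> T R (g (Y w))"
        using lim by eventually_elim (auto intro: continuous_on_tendsto_compose[OF cT])
    qed (use R in "auto simp: T_def")
    from LIMSEQ_D[OF this, of "e / 4"] e obtain k0 where
      k0: "\<And>k. k \<ge> k0 \<Longrightarrow> \<bar>(LINT w|M. T R (g (X k w))) - (LINT w|M. T R (g (Y w)))\<bar> < e / 4" by auto
    show "\<exists>k0. \<forall>k\<ge>k0. norm ((LINT w|M. g (X k w)) - (LINT w|M. g (Y w))) < e"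
    proof (intro exI allI impI)
      fix k assume "k \<ge> k0"
      from k0[OF this] trunc[OF assms(1) X R, THEN conjunct2, of k] trunc[OF assms(2) Y R, THEN conjunct2] DR e
      show "norm ((LINT w|M. g (X k w)) - (LINT w|M. g (Y w))) < e"
        unfolding real_norm_def by linarith
    qed
  qed
qed

subsection \<open>Optimal plans\<close>

lemma transport_plansD:
  assumes "gam \<in> transport_plans mu nu"
  shows "sets gam = sets borel" "prob_space gam" "distr gam borel fst = mu" "distr gam borel snd = nu"
  using assms unfolding transport_plans_def by blast+

lemma borel_measurable_sets_eq:
  "sets M = sets borel \<Longrightarrow> g \<in> borel_measurable borel \<Longrightarrow> g \<in> borel_measurable M"
  using measurable_cong_sets[of M borel borel borel] by simp

lemma fst_snd_borel [measurable]:
  "fst \<in> borel_measurable (borel :: ('a::second_countable_topology \<times> 'b::second_countable_topology) measure)"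
  "snd \<in> borel_measurable (borel :: ('a \<times> 'b) measure)"
  by (auto intro!: borel_measurable_continuous_onI continuous_intros)

lemma transport_plan_nn_integral:
  assumes gam: "gam \<in> transport_plans mu nu" and [measurable]: "g \<in> borel_measurable borel"
  shows "(\<integral>\<^sup>+p. g (fst p) \<partial>gam) = (\<integral>\<^sup>+x. g x \<partial>mu)" "(\<integral>\<^sup>+p. g (snd p) \<partial>gam) = (\<integral>\<^sup>+y. g y \<partial>nu)"
proof -
  note [measurable] = borel_measurable_sets_eq[OF transport_plansD(1)[OF gam] fst_snd_borel(1)]
    borel_measurable_sets_eq[OF transport_plansD(1)[OF gam] fst_snd_borel(2)]
  show "(\<integral>\<^sup>+p. g (fst p) \<partial>gam) = (\<integral>\<^sup>+x. g x \<partial>mu)" "(\<integral>\<^sup>+p. g (snd p) \<partial>gam) = (\<integral>\<^sup>+y. g y \<partial>nu)"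
    unfolding transport_plansD(3)[OF gam, symmetric] transport_plansD(4)[OF gam, symmetric]
    by (simp_all add: nn_integral_distr)
qed

lemma norm_prod_sq: "(norm p)\<^sup>2 = norm (fst p) ^ 2 + norm (snd p) ^ 2"
  by (simp add: norm_prod_def)

lemma transport_plan_second_moment:
  assumes "gam \<in> transport_plans mu nu" "mu \<in> P2" "nu \<in> P2"
  shows "gam \<in> P2" "(LINT p|gam. norm p ^ 2) = (LINT x|mu. norm x ^ 2) + (LINT y|nu. norm y ^ 2)"
proof -
  note [measurable] = borel_measurable_sets_eq[OF transport_plansD(1)[OF assms(1)] fst_snd_borel(1)]
    borel_measurable_sets_eq[OF transport_plansD(1)[OF assms(1)] fst_snd_borel(2)]
  have eq: "(\<integral>\<^sup>+p. ennreal (norm p ^ 2) \<partial>gam) = (\<integral>\<^sup>+x. ennreal (norm x ^ 2) \<partial>mu) + (\<integral>\<^sup>+y. ennreal (norm y ^ 2) \<partial>nu)"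
    by (simp add: norm_prod_sq nn_integral_add
        transport_plan_nn_integral[OF assms(1), of "\<lambda>x. ennreal (norm x ^ 2)"])
  also have "\<dots> = ennreal ((LINT x|mu. norm x ^ 2) + (LINT y|nu. norm y ^ 2))"
    by (simp add: nn_integral_eq_integral[OF P2_integrable] assms)
  finally have eq': "(\<integral>\<^sup>+p. ennreal (norm p ^ 2) \<partial>gam) = ennreal ((LINT x|mu. norm x ^ 2) + (LINT y|nu. norm y ^ 2))" .
  then show P: "gam \<in> P2" using transport_plansD[OF assms(1)] by (auto simp: P2_iff_nn_integral)
  show "(LINT p|gam. norm p ^ 2) = (LINT x|mu. norm x ^ 2) + (LINT y|nu. norm y ^ 2)"
  proof -
    have "ennreal (LINT p|gam. norm p ^ 2) = ennreal ((LINT x|mu. norm x ^ 2) + (LINT y|nu. norm y ^ 2))"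
      using eq' nn_integral_eq_integral[OF P2_integrable[OF P]] by (simp del: ennreal_plus)
    then show ?thesis by (subst (asm) ennreal_inj) auto
  qed
qed

lemma quadratic_cost_eq: "quadratic_cost gam = (\<integral>\<^sup>+p. ennreal (norm (fst p - snd p) ^ 2) \<partial>gam)"
  unfolding quadratic_cost_def by (intro nn_integral_cong) (auto split: prod.split)

lemma norm_diff_sq_le: "(norm (x - y))\<^sup>2 \<le> 2 * (norm x ^ 2 + norm y ^ 2)" for x y :: "'a::real_inner"
  using zero_le_power2[of "norm (x + y)"] by (simp add: power2_norm_eq_inner inner_simps inner_commute)

lemma quadratic_cost_finite:
  assumes "gam \<in> P2"
  shows "quadratic_cost gam < \<infinity>" "integrable gam (\<lambda>p. norm (fst p - snd p) ^ 2)"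
proof -
  note [measurable] = borel_measurable_sets_eq[OF P2_sets[OF assms] fst_snd_borel(1)]
    borel_measurable_sets_eq[OF P2_sets[OF assms] fst_snd_borel(2)]
  show *: "integrable gam (\<lambda>p. norm (fst p - snd p) ^ 2)"
  proof (rule Bochner_Integration.integrable_bound)
    show "integrable gam (\<lambda>p. 2 * norm p ^ 2)" using P2_integrable[OF assms] by simp
    show "AE p in gam. norm (norm (fst p - snd p) ^ 2) \<le> norm (2 * norm p ^ 2)"
      using norm_diff_sq_le by (intro AE_I2) (auto simp: norm_prod_sq)
  qed simp
  show "quadratic_cost gam < \<infinity>"
    using * by (simp add: quadratic_cost_eq integrable_iff_bounded)
qed

lemma pair_measure_plan:
  assumes "mu \<in> P2" "nu \<in> P2"
  shows "mu \<Otimes>\<^sub>M nu \<in> transport_plans mu nu"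
proof -
  interpret m: prob_space mu using assms by (simp add: P2_prob)
  interpret n: prob_space nu using assms by (simp add: P2_prob)
  interpret pair_prob_space mu nu ..
  have s: "sets (mu \<Otimes>\<^sub>M nu) = sets borel"
    using sets_pair_measure_cong[OF P2_sets P2_sets, OF assms] unfolding borel_prod .
  have 1: "distr (mu \<Otimes>\<^sub>M nu) borel fst = distr (mu \<Otimes>\<^sub>M nu) mu fst"
    by (intro distr_cong) (auto simp: P2_sets assms)
  have 2: "distr (mu \<Otimes>\<^sub>M nu) borel snd = distr (mu \<Otimes>\<^sub>M nu) nu snd"
    by (intro distr_cong) (auto simp: P2_sets assms)
  have 3: "distr (mu \<Otimes>\<^sub>M nu) nu snd = nu"
  proof (rule measure_eqI)
    fix A assume A: "A \<in> sets (distr (mu \<Otimes>\<^sub>M nu) nu snd)"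
    then have "emeasure (distr (mu \<Otimes>\<^sub>M nu) nu snd) A = emeasure (mu \<Otimes>\<^sub>M nu) (space mu \<times> A)"
      by (auto simp: emeasure_distr space_pair_measure dest: sets.sets_into_space intro!: arg_cong[where f="emeasure _"])
    also have "\<dots> = emeasure nu A" using A by (simp add: n.emeasure_pair_measure_Times m.emeasure_space_1)
    finally show "emeasure (distr (mu \<Otimes>\<^sub>M nu) nu snd) A = emeasure nu A" .
  qed simp
  show ?thesis
    unfolding transport_plans_def mem_Collect_eq
    by (intro conjI s prob_space_axioms trans[OF 1 n.distr_pair_fst] trans[OF 2 3])
qed

text \<open>Direct method: all plans have the same second moment, the sum of those of the marginals,
  so a minimizing sequence has a subsequence with an almost surely convergent representation. The
  limit keeps the marginals, and by Fatou its cost is at most the infimum.\<close>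

lemma exists_optimal_plan:
  assumes mu: "mu \<in> P2" and nu: "nu \<in> P2"
  shows "\<exists>gam. optimal_plan mu nu gam"
proof -
  define C where "C = (LINT x|mu. norm x ^ 2) + (LINT y|nu. norm y ^ 2)"
  obtain u where u: "\<And>n. u n \<in> quadratic_cost ` transport_plans mu nu"
    and ulim: "u \<longlonglongrightarrow> Inf (quadratic_cost ` transport_plans mu nu)"
    using Inf_as_limit[of "quadratic_cost ` transport_plans mu nu"] pair_measure_plan[OF assms] by auto
  have "\<forall>n. \<exists>gam. gam \<in> transport_plans mu nu \<and> u n = quadratic_cost gam" using u by auto
  then obtain g where g: "\<And>n. g n \<in> transport_plans mu nu" and ug: "\<And>n. u n = quadratic_cost (g n)" by metis
  have gP2: "g n \<in> P2" and gC: "(\<integral>p. norm p ^ 2 \<partial>g n) \<le> C" for n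
    using transport_plan_second_moment[OF g[of n] assms] unfolding C_def by simp_all
  obtain r :: "nat \<Rightarrow> nat" and Om :: "real measure" and X Y
    where r: "strict_mono r" "prob_space Om" and [measurable]: "\<And>k. X k \<in> borel_measurable Om" "Y \<in> borel_measurable Om"
    and X: "\<And>k. distr Om borel (X k) = g (r k)" and lim: "converges_AE Om X Y"
    and Y: "distr Om borel Y \<in> P2"
    by (rule skorohod_P2[of g C, OF gP2 gC]) blast
  interpret prob_space Om by fact
  have fstX: "distr Om borel (\<lambda>w. fst (X k w)) = mu" "distr Om borel (\<lambda>w. snd (X k w)) = nu" for k
    using transport_plansD(3,4)[OF g[of "r k"]] unfolding X[symmetric] by (simp_all add: distr_distr comp_def)
  have m1: "distr Om borel (\<lambda>w. fst (Y w)) = mu"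
  proof (rule distr_limit_eq[where X="\<lambda>k w. fst (X k w)"])
    show "AE w in Om. (\<lambda>k. fst (X k w)) \<longlonglongrightarrow> fst (Y w)" using lim by eventually_elim (rule tendsto_fst)
  qed (auto simp: fstX narrowly_converges_const P2_prob P2_sets mu)
  have m2: "distr Om borel (\<lambda>w. snd (Y w)) = nu"
  proof (rule distr_limit_eq[where X="\<lambda>k w. snd (X k w)"])
    show "AE w in Om. (\<lambda>k. snd (X k w)) \<longlonglongrightarrow> snd (Y w)" using lim by eventually_elim (rule tendsto_snd)
  qed (auto simp: fstX narrowly_converges_const P2_prob P2_sets nu)
  have plan: "distr Om borel Y \<in> transport_plans mu nu"
    unfolding transport_plans_def using m1 m2 by (simp add: prob_space_distr distr_distr comp_def)
  have "quadratic_cost (distr Om borel Y) \<le> Inf (quadratic_cost ` transport_plans mu nu)"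
    unfolding quadratic_cost_eq
  proof (subst nn_integral_distr)
    show "(\<integral>\<^sup>+w. ennreal (norm (fst (Y w) - snd (Y w)) ^ 2) \<partial>Om)
        \<le> (INF gam\<in>transport_plans mu nu. \<integral>\<^sup>+p. ennreal (norm (fst p - snd p) ^ 2) \<partial>gam)"
    proof (rule nn_integral_le_of_limit[where u="\<lambda>k w. norm (fst (X k w) - snd (X k w)) ^ 2"])
      show "AE w in Om. (\<lambda>k. norm (fst (X k w) - snd (X k w)) ^ 2) \<longlonglongrightarrow> norm (fst (Y w) - snd (Y w)) ^ 2"
        using lim by eventually_elim (intro tendsto_intros)
      have "(\<integral>\<^sup>+w. ennreal (norm (fst (X k w) - snd (X k w)) ^ 2) \<partial>Om) = u (r k)" for k
        unfolding ug quadratic_cost_eq X[symmetric] by (subst nn_integral_distr) auto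
      then show "(\<lambda>k. \<integral>\<^sup>+w. ennreal (norm (fst (X k w) - snd (X k w)) ^ 2) \<partial>Om)
          \<longlonglongrightarrow> (INF gam\<in>transport_plans mu nu. \<integral>\<^sup>+p. ennreal (norm (fst p - snd p) ^ 2) \<partial>gam)"
        using LIMSEQ_subseq_LIMSEQ[OF ulim r(1)] unfolding quadratic_cost_eq comp_def by simp
    qed auto
  qed auto
  then show ?thesis unfolding optimal_plan_def using plan by (blast intro: order_trans INF_lower)
qed

text \<open>An optimal plan for marginals \<open>(distr mu borel (P k), nu)\<close> stays optimal in the limit \<open>P k \<rightarrow> id\<close>:
  a competitor \<open>gam'\<close> for the limit marginals is turned into one for the perturbed marginals by
  moving only the first coordinate with \<open>P k\<close>.\<close>

lemma optimal_plan_limit: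
  fixes Om :: "'w measure" and X :: "nat \<Rightarrow> 'w \<Rightarrow> 'a::euclidean_space \<times> 'a"
  assumes mu: "mu \<in> P2" and nu: "nu \<in> P2" and "prob_space Om"
    and [measurable]: "\<And>k. X k \<in> borel_measurable Om" "Y \<in> borel_measurable Om"
    and lim: "converges_AE Om X Y"
    and P[measurable]: "\<And>k. P k \<in> borel_measurable borel"
    and Plim: "\<And>x. (\<lambda>k. P k x) \<longlonglongrightarrow> x" and Pb: "\<And>k x. norm (P k x) \<le> 2 * norm x"
    and opt: "\<And>k. optimal_plan (distr mu borel (P k)) nu (distr Om borel (X k))"
  shows "optimal_plan mu nu (distr Om borel Y)"
proof -
  interpret prob_space Om by fact
  interpret m: prob_space mu using mu by (rule P2_prob)
  note [measurable_cong] = P2_sets[OF mu]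
  have g: "distr Om borel (X k) \<in> transport_plans (distr mu borel (P k)) nu" for k
    using opt by (simp add: optimal_plan_def)
  have fstX: "distr Om borel (\<lambda>w. fst (X k w)) = distr mu borel (P k)" "distr Om borel (\<lambda>w. snd (X k w)) = nu" for k
    using transport_plansD(3,4)[OF g[of k]] by (simp_all add: distr_distr comp_def)
  have "narrowly_converges (\<lambda>k. distr mu borel (P k)) (distr mu borel (\<lambda>x. x))"
    using Plim by (intro m.narrowly_converges_distr) auto
  also have "distr mu borel (\<lambda>x. x) = mu" by (rule distr_id2) (simp add: P2_sets mu)
  finally have nc: "narrowly_converges (\<lambda>k. distr mu borel (P k)) mu" .
  have m1: "distr Om borel (\<lambda>w. fst (Y w)) = mu"
  proof (rule distr_limit_eq[where X="\<lambda>k w. fst (X k w)"])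
    show "AE w in Om. (\<lambda>k. fst (X k w)) \<longlonglongrightarrow> fst (Y w)" using lim by eventually_elim (rule tendsto_fst)
  qed (auto simp: fstX nc P2_prob P2_sets mu)
  have m2: "distr Om borel (\<lambda>w. snd (Y w)) = nu"
  proof (rule distr_limit_eq[where X="\<lambda>k w. snd (X k w)"])
    show "AE w in Om. (\<lambda>k. snd (X k w)) \<longlonglongrightarrow> snd (Y w)" using lim by eventually_elim (rule tendsto_snd)
  qed (auto simp: fstX narrowly_converges_const P2_prob P2_sets nu)
  have plan: "distr Om borel Y \<in> transport_plans mu nu"
    unfolding transport_plans_def using m1 m2 by (simp add: prob_space_distr distr_distr comp_def)
  have "quadratic_cost (distr Om borel Y) \<le> quadratic_cost gam'" if gam': "gam' \<in> transport_plans mu nu" for gam'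
  proof -
    note [measurable_cong] = transport_plansD(1)[OF gam']
    interpret g: prob_space gam' using gam' by (rule transport_plansD)
    have gamP2: "gam' \<in> P2" using transport_plan_second_moment[OF gam' mu nu] by simp
    define c where "c k = (\<integral>\<^sup>+p. ennreal (norm (P k (fst p) - snd p) ^ 2) \<partial>gam')" for k
    have "c \<longlonglongrightarrow> quadratic_cost gam'"
      unfolding c_def quadratic_cost_eq
    \<comment> \<open>The dominating function: |a - b|^2 <= 2 |a|^2 + 2 |b|^2 together with |P k x|
      <= 2 |x| gives 8 |x|^2 + 2 |y|^2.\<close>
    proof (rule nn_integral_dominated_convergence[where w="\<lambda>p. ennreal (8 * norm p ^ 2)"])
      show "AE p in gam'. (\<lambda>k. ennreal (norm (P k (fst p) - snd p) ^ 2)) \<longlonglongrightarrow> ennreal (norm (fst p - snd p) ^ 2)"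
        by (intro AE_I2 tendsto_intros Plim)
      show "AE p in gam'. ennreal (norm (P k (fst p) - snd p) ^ 2) \<le> ennreal (8 * norm p ^ 2)" for k
      proof (intro AE_I2 ennreal_leI)
        fix p :: "'a \<times> 'a"
        have "(norm (P k (fst p)))\<^sup>2 \<le> (2 * norm (fst p))\<^sup>2" using Pb by (intro power_mono) auto
        then show "(norm (P k (fst p) - snd p))\<^sup>2 \<le> 8 * norm p ^ 2"
          using norm_diff_sq_le[of "P k (fst p)" "snd p"] by (simp add: norm_prod_sq power_mult_distrib) (smt (verit) zero_le_power2)
      qed
      show "(\<integral>\<^sup>+p. ennreal (8 * norm p ^ 2) \<partial>gam') < \<infinity>"
        using P2_integrable[OF gamP2] nn_integral_cmult[of "\<lambda>p. ennreal (norm p ^ 2)" gam' 8]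
        by (simp add: integrable_iff_bounded ennreal_mult ennreal_mult_less_top)
    qed auto
    moreover have "(\<integral>\<^sup>+w. ennreal (norm (fst (X k w) - snd (X k w)) ^ 2) \<partial>Om) \<le> c k" for k
    proof -
      define gamk where "gamk = distr gam' borel (\<lambda>p. (P k (fst p), snd p))"
      have [measurable]: "(\<lambda>p :: 'a \<times> 'a. (P k (fst p), snd p)) \<in> borel_measurable borel"
        by (rule borel_measurable_Pair) auto
      have "distr gam' borel (\<lambda>p. P k (fst p)) = distr mu borel (P k)"
        unfolding transport_plansD(3)[OF gam', symmetric] by (simp add: distr_distr comp_def)
      moreover have "distr gam' borel (\<lambda>p. snd p) = nu" using transport_plansD(4)[OF gam'] by simp
      ultimately have "gamk \<in> transport_plans (distr mu borel (P k)) nu"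
        unfolding transport_plans_def gamk_def by (simp add: g.prob_space_distr distr_distr comp_def)
      then have "quadratic_cost (distr Om borel (X k)) \<le> quadratic_cost gamk"
        using opt by (simp add: optimal_plan_def)
      then show ?thesis unfolding quadratic_cost_eq gamk_def c_def by (simp add: nn_integral_distr)
    qed
    ultimately have "(\<integral>\<^sup>+w. ennreal (norm (fst (Y w) - snd (Y w)) ^ 2) \<partial>Om) \<le> quadratic_cost gam'"
    proof -
      assume c: "c \<longlonglongrightarrow> quadratic_cost gam'"
        and le: "\<And>k. (\<integral>\<^sup>+w. ennreal (norm (fst (X k w) - snd (X k w)) ^ 2) \<partial>Om) \<le> c k"
      have "(\<integral>\<^sup>+w. ennreal (norm (fst (Y w) - snd (Y w)) ^ 2) \<partial>Om)
          = (\<integral>\<^sup>+w. liminf (\<lambda>k. ennreal (norm (fst (X k w) - snd (X k w)) ^ 2)) \<partial>Om)"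
      proof (rule nn_integral_cong_AE)
        show "AE w in Om. ennreal (norm (fst (Y w) - snd (Y w)) ^ 2)
             = liminf (\<lambda>k. ennreal (norm (fst (X k w) - snd (X k w)) ^ 2))"
          using lim
          by eventually_elim (intro lim_imp_Liminf[symmetric] trivial_limit_sequentially tendsto_intros)
      qed
      also have "\<dots> \<le> liminf (\<lambda>k. \<integral>\<^sup>+w. ennreal (norm (fst (X k w) - snd (X k w)) ^ 2) \<partial>Om)"
        by (rule nn_integral_liminf) auto
      also have "\<dots> \<le> liminf c" using le by (intro Liminf_mono) auto
      also have "\<dots> = quadratic_cost gam'" using c by (rule lim_imp_Liminf[OF trivial_limit_sequentially])
      finally show ?thesis .
    qed
    then show ?thesis by (simp add: quadratic_cost_eq nn_integral_distr)
  qed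
  with plan show ?thesis by (auto simp: optimal_plan_def)
qed


section \<open>Monotonicity of the support of optimal plans\<close>

lemma AE_pair_measureI_borel:
  fixes gam :: "'a::euclidean_space measure"
  assumes "sets gam = sets borel"
  shows "sets (gam \<Otimes>\<^sub>M gam) = sets borel"
  using sets_pair_measure_cong[OF assms assms] unfolding borel_prod .

text \<open>If a set of positive measure of pairs \<open>((x, y), (x', y'))\<close> violates monotonicity, exchanging \<open>y\<close> and
  \<open>y'\<close> on it (a symmetric set, so the marginals are unchanged) lowers the cost.\<close>

lemma optimal_plan_AE_monotone:
  fixes mu nu :: "'a::euclidean_space measure"
  assumes opt: "optimal_plan mu nu gam" and mu: "mu \<in> P2" and nu: "nu \<in> P2"
  shows "AE z in gam \<Otimes>\<^sub>M gam. 0 \<le> (fst (fst z) - fst (snd z)) \<bullet> (snd (fst z) - snd (snd z))"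
proof -
  have plan: "gam \<in> transport_plans mu nu" using opt by (simp add: optimal_plan_def)
  have gamP2: "gam \<in> P2" using transport_plan_second_moment[OF plan mu nu] by simp
  interpret g: prob_space gam using plan by (rule transport_plansD)
  interpret gg: pair_prob_space gam gam ..
  define Q where "Q = gam \<Otimes>\<^sub>M gam"
  have sQ[measurable_cong]: "sets Q = sets borel" unfolding Q_def by (rule AE_pair_measureI_borel[OF P2_sets[OF gamP2]])
  interpret Q: prob_space Q unfolding Q_def by (rule gg.prob_space_axioms)
  have [measurable_cong]: "sets gam = sets borel" using gamP2 by (rule P2_sets)
  define b where "b z = (fst (fst z) - fst (snd z)) \<bullet> (snd (fst z) - snd (snd z))" for z :: "('a \<times> 'a) \<times> 'a \<times> 'a"
  define T where "T z = (fst (fst z), if b z < 0 then snd (snd z) else snd (fst z))" for z :: "('a \<times> 'a) \<times> 'a \<times> 'a"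
  define s where "s z = (snd z, fst z)" for z :: "('a \<times> 'a) \<times> 'a \<times> 'a"
  have "continuous_on UNIV b" unfolding b_def by (intro continuous_intros)
  then have bm[measurable]: "b \<in> borel_measurable borel" by (rule borel_measurable_continuous_onI)
  have Tm[measurable]: "T \<in> borel_measurable borel" unfolding T_def by (intro borel_measurable_Pair) measurable
  have sm[measurable]: "s \<in> borel_measurable borel" unfolding s_def by (intro borel_measurable_Pair) measurable
  have bs: "b (s z) = b z" for z unfolding b_def s_def by (simp add: inner_diff_left inner_diff_right)
  have ds: "distr Q borel s = Q"
  proof -
    have "distr Q borel s = distr (gam \<Otimes>\<^sub>M gam) (gam \<Otimes>\<^sub>M gam) (\<lambda>(x, y). (y, x))"
      unfolding Q_def s_def by (intro distr_cong) (auto simp: sQ[unfolded Q_def])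
    then show ?thesis unfolding Q_def using gg.distr_pair_swap by simp
  qed
  have swap: "(\<integral>\<^sup>+z. h (s z) \<partial>Q) = (\<integral>\<^sup>+z. h z \<partial>Q)" if [measurable]: "h \<in> borel_measurable borel" for h
  proof -
    have "(\<integral>\<^sup>+z. h z \<partial>Q) = (\<integral>\<^sup>+z. h z \<partial>distr Q borel s)" by (simp add: ds)
    then show ?thesis by (simp add: nn_integral_distr)
  qed
  have swapi: "(LINT z|Q. h (s z)) = (LINT z|Q. h z)" if [measurable]: "h \<in> borel_measurable borel" for h :: "_ \<Rightarrow> real"
  proof -
    have "(LINT z|Q. h z) = (\<integral>z. h z \<partial>distr Q borel s)" by (simp add: ds)
    then show ?thesis by (simp add: integral_distr)
  qed
  have dfst: "distr Q borel fst = gam"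
  proof -
    have "distr Q borel fst = distr (gam \<Otimes>\<^sub>M gam) gam fst" unfolding Q_def by (intro distr_cong) (auto simp: P2_sets gamP2)
    then show ?thesis using g.distr_pair_fst[of gam] by simp
  qed
  define gam' where "gam' = distr Q borel T"
  have "distr gam' borel fst = distr gam borel fst"
    unfolding gam'_def dfst[symmetric] by (simp add: distr_distr comp_def T_def)
  moreover have "distr gam' borel snd = distr gam borel snd"
  proof (rule measure_eqI)
    fix E :: "'a set" assume "E \<in> sets (distr gam' borel snd)"
    then have E[measurable]: "E \<in> sets borel" by simp
    have "emeasure (distr gam' borel snd) E = (\<integral>\<^sup>+z. indicator E (snd (T z)) \<partial>Q)"
      unfolding gam'_def by (simp add: nn_integral_distr flip: nn_integral_indicator)
    also have "\<dots> = (\<integral>\<^sup>+z. indicator {z. b z < 0} (s z) * indicator E (snd (fst (s z))) + indicator {z. \<not> b z < 0} z * indicator E (snd (fst z)) \<partial>Q)"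
      by (intro nn_integral_cong) (auto simp: T_def bs indicator_def, auto simp: s_def)
    also have "\<dots> = (\<integral>\<^sup>+z. indicator {z. b z < 0} (s z) * indicator E (snd (fst (s z))) \<partial>Q)
       + (\<integral>\<^sup>+z. indicator {z. \<not> b z < 0} z * indicator E (snd (fst z)) \<partial>Q)"
      by (rule nn_integral_add) measurable
    also have "(\<integral>\<^sup>+z. indicator {z. b z < 0} (s z) * indicator E (snd (fst (s z))) \<partial>Q)
       = (\<integral>\<^sup>+z. indicator {z. b z < 0} z * indicator E (snd (fst z)) \<partial>Q)"
      by (rule swap[of "\<lambda>z. indicator {z. b z < 0} z * indicator E (snd (fst z))"]) measurable
    also have "(\<integral>\<^sup>+z. indicator {z. b z < 0} z * indicator E (snd (fst z)) \<partial>Q) + (\<integral>\<^sup>+z. indicator {z. \<not> b z < 0} z * indicator E (snd (fst z)) \<partial>Q)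
      = (\<integral>\<^sup>+z. indicator {z. b z < 0} z * indicator E (snd (fst z)) + indicator {z. \<not> b z < 0} z * indicator E (snd (fst z)) \<partial>Q)"
      by (rule nn_integral_add[symmetric]) measurable
    also have "\<dots> = (\<integral>\<^sup>+z. indicator E (snd (fst z)) \<partial>Q)"
      by (intro nn_integral_cong) (auto simp: indicator_def)
    also have "\<dots> = emeasure (distr gam borel snd) E"
      unfolding dfst[symmetric] by (simp add: nn_integral_distr flip: nn_integral_indicator)
    finally show "emeasure (distr gam' borel snd) E = emeasure (distr gam borel snd) E" .
  qed simp
  ultimately have plan': "gam' \<in> transport_plans mu nu"
    using transport_plansD[OF plan] by (simp add: transport_plans_def gam'_def Q.prob_space_distr)
  have gam'P2: "gam' \<in> P2" using transport_plan_second_moment[OF plan' mu nu] by simp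
  define c where "c p = norm (fst p - snd p) ^ 2" for p :: "'a \<times> 'a"
  have cm[measurable]: "c \<in> borel_measurable borel" unfolding c_def by measurable
  have ic: "integrable gam c" "integrable gam' c"
    using quadratic_cost_finite(2)[OF gamP2] quadratic_cost_finite(2)[OF gam'P2] unfolding c_def .
  have i1: "integrable Q (\<lambda>z. c (fst z))" using ic(1) unfolding dfst[symmetric] by (simp add: integrable_distr_eq)
  have i2: "integrable Q (\<lambda>z. c (T z))" using ic(2) unfolding gam'_def by (simp add: integrable_distr_eq)
  have "ennreal (LINT p|gam. c p) \<le> ennreal (LINT p|gam'. c p)"
  proof -
    have "quadratic_cost gam \<le> quadratic_cost gam'" using opt plan' unfolding optimal_plan_def by blast
    then have "(\<integral>\<^sup>+p. ennreal (c p) \<partial>gam) \<le> (\<integral>\<^sup>+p. ennreal (c p) \<partial>gam')"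
      unfolding quadratic_cost_eq c_def .
    moreover have c0: "AE p in M. 0 \<le> c p" for M by (simp add: c_def)
    ultimately show ?thesis by (simp only: nn_integral_eq_integral[OF ic(1) c0] nn_integral_eq_integral[OF ic(2) c0])
  qed
  then have "(LINT p|gam. c p) \<le> (LINT p|gam'. c p)"
    by (subst (asm) ennreal_le_iff) (rule integral_nonneg_AE, simp add: c_def)
  then have le: "(LINT z|Q. c (fst z)) \<le> (LINT z|Q. c (T z))"
    unfolding gam'_def dfst[symmetric] by (simp add: integral_distr)
  define D where "D z = c (T z) - c (fst z)" for z
  have Dm[measurable]: "D \<in> borel_measurable borel" unfolding D_def by measurable
  have iD: "integrable Q D" unfolding D_def by (intro Bochner_Integration.integrable_diff i1 i2)
  have iDs: "integrable Q (\<lambda>z. D (s z))"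
  proof -
    have "integrable (distr Q borel s) D" using iD by (simp add: ds)
    then show ?thesis by (simp add: integrable_distr_eq)
  qed
  \<comment> \<open>Exchanging y and y' changes the total cost of the two pairs by 2 (x - x') . (y -
    y'). Optimality makes the integral of \<open>D\<close> nonnegative and therefore, by symmetry
    under \<open>s\<close>, also that of \<open>min 0 b\<close>; being nonpositive,
    \<open>min 0 b\<close> vanishes almost everywhere.\<close>
  have Dsum: "D z + D (s z) = 2 * min 0 (b z)" for z
  proof (cases "b z < 0")
    case True
    then show ?thesis unfolding D_def T_def bs
      by (simp add: c_def s_def b_def power2_norm_eq_inner inner_diff_left inner_diff_right inner_commute)
  next
    case False
    then show ?thesis unfolding D_def T_def bs by (simp add: c_def s_def)
  qed
  have imin: "integrable Q (\<lambda>z. min 0 (b z))"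
  proof -
    have "integrable Q (\<lambda>z. (D z + D (s z)) / 2)" using iD iDs by simp
    then show ?thesis by (simp add: Dsum)
  qed
  have "0 \<le> (LINT z|Q. D z)" unfolding D_def using le i1 i2 by simp
  moreover have "(LINT z|Q. D z) + (LINT z|Q. D (s z)) = (LINT z|Q. 2 * min 0 (b z))"
    using iD iDs by (simp add: Dsum flip: Bochner_Integration.integral_add)
  ultimately have "(LINT z|Q. - min 0 (b z)) \<le> 0" using swapi[OF Dm] by simp
  moreover have "0 \<le> (LINT z|Q. - min 0 (b z))" by (intro integral_nonneg_AE) auto
  ultimately have "(LINT z|Q. - min 0 (b z)) = 0" by linarith
  then have "AE z in Q. - min 0 (b z) = 0"
    by (subst (asm) integral_nonneg_eq_0_iff_AE) (use imin in auto)
  then show ?thesis unfolding Q_def b_def[symmetric] by eventually_elim (auto simp: min_def split: if_splits)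
qed

definition measure_support :: "'a::topological_space measure \<Rightarrow> 'a set" where
  "measure_support M = {x. \<forall>U. open U \<and> x \<in> U \<longrightarrow> emeasure M U \<noteq> 0}"

lemma closed_measure_support: "closed (measure_support M)"
proof -
  have "- measure_support M = \<Union>{U. open U \<and> emeasure M U = 0}" by (auto simp: measure_support_def)
  then show ?thesis by (auto simp: closed_def)
qed

text \<open>The complement of the support is covered by the null sets of a countable basis.\<close>

lemma AE_measure_support:
  fixes M :: "'a::second_countable_topology measure"
  assumes sM: "sets M = sets borel"
  shows "AE x in M. x \<in> measure_support M"
proof -
  obtain B :: "'a set set" where B: "countable B" "topological_basis B" using ex_countable_basis by blast
  have "(\<Union>U\<in>{U\<in>B. emeasure M U = 0}. U) \<in> null_sets M"
    using B sM topological_basis_open[OF B(2)] by (intro null_sets_UN') (auto simp: null_sets_def)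
  moreover have "{x\<in>space M. x \<notin> measure_support M} \<subseteq> (\<Union>U\<in>{U\<in>B. emeasure M U = 0}. U)"
  proof
    fix x assume "x \<in> {x\<in>space M. x \<notin> measure_support M}"
    then obtain U where U: "open U" "x \<in> U" "emeasure M U = 0" by (auto simp: measure_support_def)
    then obtain V where V: "V \<in> B" "x \<in> V" "V \<subseteq> U" using topological_basisE[OF B(2)] by metis
    then have "emeasure M V \<le> emeasure M U" using U sM by (intro emeasure_mono) auto
    then show "x \<in> (\<Union>U\<in>{U\<in>B. emeasure M U = 0}. U)" using U V by auto
  qed
  ultimately show ?thesis by (rule AE_I')
qed

text \<open>From almost every pair to every pair of support points: a strict violation is an open
  condition, so it would hold on a product of two neighbourhoods, and each of them has positive mass
  because it contains a point of the support.\<close>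

lemma optimal_plan_support_monotone:
  fixes mu nu :: "'a::euclidean_space measure"
  assumes opt: "optimal_plan mu nu gam" and mu: "mu \<in> P2" and nu: "nu \<in> P2"
    and p: "(x, y) \<in> measure_support gam" and q: "(x', y') \<in> measure_support gam"
  shows "0 \<le> (x - x') \<bullet> (y - y')"
proof (rule ccontr)
  assume neg: "\<not> 0 \<le> (x - x') \<bullet> (y - y')"
  define b where "b z = (fst (fst z) - fst (snd z)) \<bullet> (snd (fst z) - snd (snd z))" for z :: "('a \<times> 'a) \<times> 'a \<times> 'a"
  have plan: "gam \<in> transport_plans mu nu" using opt by (simp add: optimal_plan_def)
  interpret g: prob_space gam using plan by (rule transport_plansD)
  note sg = transport_plansD(1)[OF plan]
  have "continuous_on UNIV b" unfolding b_def by (intro continuous_intros)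
  then have "open (b -` {..<0})" by (rule open_vimage[rotated]) auto
  moreover have "((x, y), (x', y')) \<in> b -` {..<0}" using neg by (simp add: b_def)
  ultimately obtain U U' where U: "open U" "open U'" "(x, y) \<in> U" "(x', y') \<in> U'" "U \<times> U' \<subseteq> b -` {..<0}"
    by (rule open_prod_elim) (auto simp: mem_Times_iff)
  have "AE z in gam \<Otimes>\<^sub>M gam. z \<notin> U \<times> U'"
    using optimal_plan_AE_monotone[OF opt mu nu] unfolding b_def[symmetric]
    by eventually_elim (use U(5) in auto)
  moreover have "U \<times> U' \<in> sets (gam \<Otimes>\<^sub>M gam)" using U by (intro pair_measureI) (auto simp: sg)
  ultimately have "emeasure (gam \<Otimes>\<^sub>M gam) (U \<times> U') = 0"
    using AE_iff_null_sets by blast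
  then have "emeasure gam U * emeasure gam U' = 0"
    using U by (subst (asm) g.emeasure_pair_measure_Times) (auto simp: sg)
  then show False using p q U by (auto simp: measure_support_def)
qed

section \<open>Mixtures of measures and of plans\<close>

definition mixture :: "'i pmf \<Rightarrow> ('i \<Rightarrow> 'b::topological_space measure) \<Rightarrow> 'b measure" where
  "mixture p K = measure_pmf p \<bind> K"

context
  fixes p :: "'i pmf" and K :: "'i \<Rightarrow> 'b::topological_space measure"
  assumes prob: "\<And>i. prob_space (K i)" and sets: "\<And>i. sets (K i) = sets borel"
begin

lemma mixture_kernel: "K \<in> measurable (measure_pmf p) (subprob_algebra borel)"
  using prob sets by (auto simp: space_subprob_algebra intro: prob_space_imp_subprob_space)

lemma sets_mixture: "sets (mixture p K) = sets borel"
  unfolding mixture_def by (rule sets_bind) (auto simp: sets)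

lemma nn_integral_mixture:
  assumes "f \<in> borel_measurable borel"
  shows "(\<integral>\<^sup>+x. f x \<partial>mixture p K) = (\<integral>\<^sup>+i. \<integral>\<^sup>+x. f x \<partial>K i \<partial>measure_pmf p)"
  unfolding mixture_def using assms mixture_kernel by (rule nn_integral_bind)

lemma emeasure_mixture:
  assumes "A \<in> sets borel"
  shows "emeasure (mixture p K) A = (\<integral>\<^sup>+i. emeasure (K i) A \<partial>measure_pmf p)"
  unfolding mixture_def by (rule emeasure_bind[OF _ mixture_kernel assms]) simp

lemma prob_space_mixture: "prob_space (mixture p K)"
proof
  have "space (mixture p K) = UNIV" using sets_eq_imp_space_eq[OF sets_mixture] by simp
  moreover have "emeasure (K i) UNIV = 1" for i
    using prob_space.emeasure_space_1[OF prob] sets_eq_imp_space_eq[OF sets] by (metis space_borel)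
  ultimately show "emeasure (mixture p K) (space (mixture p K)) = 1"
    by (simp add: emeasure_mixture)
qed

lemma distr_mixture:
  assumes "f \<in> borel_measurable borel"
  shows "distr (mixture p K) borel f = mixture p (\<lambda>i. distr (K i) borel f)"
  unfolding mixture_def by (rule distr_bind[OF mixture_kernel]) (use assms in auto)

end

lemma mixture_const: "prob_space M \<Longrightarrow> sets M = sets borel \<Longrightarrow> mixture p (\<lambda>_. M) = M"
  by (rule measure_eqI)
    (simp_all add: sets_mixture emeasure_mixture measure_pmf.emeasure_space_1[simplified])

lemma distr_mixture_const:
  assumes "\<And>i. prob_space (K i)" "\<And>i. sets (K i) = sets borel" "f \<in> borel_measurable borel"
    "\<And>i. distr (K i) borel f = M"
  shows "distr (mixture p K) borel f = M"
proof -
  have "distr (mixture p K) borel f = mixture p (\<lambda>_. M)"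
    using assms by (simp add: distr_mixture)
  also have "\<dots> = M"
    using assms(4)[of undefined] prob_space.prob_space_distr[OF assms(1)[of undefined]] assms(3)
      measurable_cong_sets[OF assms(2)[of undefined] refl]
    by (intro mixture_const) auto
  finally show ?thesis .
qed

text \<open>The cost is affine in the plan and the marginals are preserved, so averaging plans of
  minimal cost gives minimal cost again.\<close>

lemma optimal_plan_mixture:
  assumes "\<And>i. optimal_plan mu nu (K i)"
  shows "optimal_plan mu nu (mixture p K)"
proof -
  have K: "K i \<in> transport_plans mu nu" for i using assms by (simp add: optimal_plan_def)
  note KD = transport_plansD[OF K]
  have "mixture p K \<in> transport_plans mu nu"
    unfolding transport_plans_def
    using sets_mixture[of K p] prob_space_mixture[of K p] distr_mixture_const[of K fst mu p]
      distr_mixture_const[of K snd nu p] KD by simp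
  moreover have "quadratic_cost (mixture p K) \<le> quadratic_cost gam'" if "gam' \<in> transport_plans mu nu" for gam'
  proof -
    have "quadratic_cost (mixture p K) = (\<integral>\<^sup>+i. quadratic_cost (K i) \<partial>measure_pmf p)"
      unfolding quadratic_cost_eq by (rule nn_integral_mixture) (use KD in "auto intro: measurable_compose")
    also have "\<dots> \<le> (\<integral>\<^sup>+i. quadratic_cost gam' \<partial>measure_pmf p)"
      using assms that by (intro nn_integral_mono) (auto simp: optimal_plan_def)
    also have "\<dots> = quadratic_cost gam'" by (simp add: measure_pmf.emeasure_space_1[simplified])
    finally show ?thesis .
  qed
  ultimately show ?thesis by (auto simp: optimal_plan_def)
qed

text \<open>The translates of N by e / (k + 1) are pairwise disjoint, since a common point would
  give two points of N that differ by a positive multiple of e. They have equal measure and all lie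
  in one ball of radius m + 1, so this measure is 0.\<close>

lemma compact_null_of_disjoint_translates:
  fixes N :: "'a::euclidean_space set"
  assumes "compact N" and e: "norm e \<le> 1"
    and dis: "\<And>x s. x \<in> N \<Longrightarrow> 0 < s \<Longrightarrow> x + s *\<^sub>R e \<notin> N"
  shows "N \<in> null_sets lborel"
proof -
  obtain m where m: "N \<subseteq> cball 0 m" using compact_imp_bounded[OF assms(1)] by (auto simp: bounded_iff subset_iff)
  define T where "T k = (+) ((1 / Suc k) *\<^sub>R e) ` N" for k :: nat
  have cT: "compact (T k)" for k unfolding T_def using assms(1) by (rule compact_translation)
  have mT: "measure lebesgue (T k) = measure lebesgue N" for k unfolding T_def by (rule measure_translation)
  have lm: "T k \<in> lmeasurable" for k using cT by (rule lmeasurable_compact)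
  have disj: "disjoint_family T"
    unfolding disjoint_family_on_def
  proof (intro ballI impI)
    have *: False if xT: "x \<in> T k" "x \<in> T l" and kl: "k < l" for x and k l :: nat
    proof -
      obtain a b where ab: "a \<in> N" "b \<in> N" "x = (1 / Suc k) *\<^sub>R e + a" "x = (1 / Suc l) *\<^sub>R e + b"
        using xT unfolding T_def image_def by blast
      have "b = a + (1 / Suc k - 1 / Suc l) *\<^sub>R e" using ab(3,4) by (simp add: algebra_simps)
      moreover have "1 / Suc k - 1 / Suc l > (0::real)" using kl by (simp add: frac_less2)
      ultimately show False using dis[OF ab(1)] ab(2) by auto
    qed
    fix k l :: nat assume "k \<noteq> l"
    then show "T k \<inter> T l = {}" using * by (metis disjoint_iff linorder_neqE_nat)
  qed
  have "real n * measure lebesgue N \<le> measure lebesgue (cball (0::'a) (m + 1))" for n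
  proof -
    have "real n * measure lebesgue N = (\<Sum>k<n. measure lebesgue (T k))" by (simp add: mT)
    also have "\<dots> = measure lebesgue (\<Union>k<n. T k)"
      using fmeasurableD[OF lm] fmeasurableD2[OF lm] disj by (intro measure_finite_Union[symmetric])
        (auto simp: disjoint_family_on_def simp del: emeasure_completion)
    also have "\<dots> \<le> measure lebesgue (cball (0::'a) (m + 1))"
    proof (rule measure_mono_fmeasurable)
      show "(\<Union>k<n. T k) \<subseteq> cball 0 (m + 1)"
      proof (intro UN_least subsetI)
        fix k z assume "z \<in> T k"
        then obtain a where a: "a \<in> N" and z: "z = (1 / Suc k) *\<^sub>R e + a" unfolding T_def by blast
        have "norm z \<le> norm ((1 / Suc k) *\<^sub>R e) + norm a" unfolding z by (rule norm_triangle_ineq)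
        also have "norm ((1 / Suc k) *\<^sub>R e) \<le> 1 * 1"
          using e unfolding norm_scaleR by (intro mult_mono) auto
        also have "norm a \<le> m" using a m by auto
        finally show "z \<in> cball 0 (m + 1)" by simp
      qed
    qed (use lm in "auto intro!: sets.finite_UN simp: fmeasurableD")
    finally show ?thesis .
  qed
  then have "measure lebesgue N = 0"
    by (metis less_le_not_le measure_nonneg order_le_less reals_Archimedean3)
  moreover have "emeasure lborel N = ennreal (measure lebesgue N)"
    using emeasure_eq_measure2[OF lmeasurable_compact[OF assms(1)]] assms(1)
    by (simp add: borel_compact)
  ultimately show ?thesis using assms(1) by (auto simp: null_sets_def borel_compact)
qed

text \<open>Fix a coordinate direction e and rationals a < b, and collect the x with two values
  whose e-components are separated by a and b. A line parallel to e meets this set at most once: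
  moving forward along e, monotonicity forbids passing from a value above b to one below a. The
  radius m makes the set the projection of a compact one, and the countably many choices of e, a, b,
  m exhaust all multivalued points.\<close>

lemma monotone_multivalued_null:
  fixes S :: "('a::euclidean_space \<times> 'a) set"
  assumes S: "closed S" and mono: "\<And>x y x' y'. (x, y) \<in> S \<Longrightarrow> (x', y') \<in> S \<Longrightarrow> 0 \<le> (x - x') \<bullet> (y - y')"
  obtains D where "D \<in> null_sets lborel" "\<And>x y y'. (x, y) \<in> S \<Longrightarrow> (x, y') \<in> S \<Longrightarrow> x \<notin> D \<Longrightarrow> y = y'"
proof -
  define N where "N e a b m = fst ` {z \<in> cball 0 (real m). (fst z, fst (snd z)) \<in> S \<and> (fst z, snd (snd z)) \<in> S \<and>
      fst (snd z) \<bullet> e \<le> of_rat a \<and> of_rat b \<le> snd (snd z) \<bullet> e}" for e :: 'a and a b :: rat and m :: nat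
  have comp: "compact (N e a b m)" for e a b m
  proof -
    have "closed {z. (fst z, fst (snd z)) \<in> S}" "closed {z. (fst z, snd (snd z)) \<in> S}"
      using S by (auto intro!: closed_vimage[of S, unfolded vimage_def] continuous_intros)
    moreover have "closed {z :: 'a \<times> 'a \<times> 'a. fst (snd z) \<bullet> e \<le> of_rat a}" "closed {z :: 'a \<times> 'a \<times> 'a. of_rat b \<le> snd (snd z) \<bullet> e}"
      by (auto intro!: closed_Collect_le continuous_intros)
    ultimately have "compact (cball 0 (real m) \<inter> ({z. (fst z, fst (snd z)) \<in> S} \<inter> {z. (fst z, snd (snd z)) \<in> S}
       \<inter> {z. fst (snd z) \<bullet> e \<le> of_rat a} \<inter> {z. of_rat b \<le> snd (snd z) \<bullet> e}))"
      by (intro compact_Int_closed compact_cball closed_Int)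
    then have "compact (fst ` (cball 0 (real m) \<inter> ({z. (fst z, fst (snd z)) \<in> S} \<inter> {z. (fst z, snd (snd z)) \<in> S}
       \<inter> {z. fst (snd z) \<bullet> e \<le> of_rat a} \<inter> {z. of_rat b \<le> snd (snd z) \<bullet> e})))"
      by (intro compact_continuous_image continuous_intros)
    also have "fst ` (cball 0 (real m) \<inter> ({z. (fst z, fst (snd z)) \<in> S} \<inter> {z. (fst z, snd (snd z)) \<in> S}
       \<inter> {z. fst (snd z) \<bullet> e \<le> of_rat a} \<inter> {z. of_rat b \<le> snd (snd z) \<bullet> e})) = N e a b m"
      unfolding N_def by (intro arg_cong[where f="image fst"]) auto
    finally show ?thesis .
  qed
  have null: "N e a b m \<in> null_sets lborel" if e: "e \<in> Basis" and ab: "a < b" for e a b m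
  proof (rule compact_null_of_disjoint_translates[OF comp])
    show "norm e \<le> 1" using e by simp
    fix x s assume x: "x \<in> N e a b m" and s: "(0::real) < s"
    show "x + s *\<^sub>R e \<notin> N e a b m"
    proof
      assume "x + s *\<^sub>R e \<in> N e a b m"
      then obtain y where y: "(x + s *\<^sub>R e, y) \<in> S" "y \<bullet> e \<le> of_rat a" unfolding N_def by auto
      obtain y' where y': "(x, y') \<in> S" "of_rat b \<le> y' \<bullet> e" using x unfolding N_def by auto
      have "0 \<le> (s *\<^sub>R e) \<bullet> (y - y')" using mono[OF y(1) y'(1)] by simp
      then have "0 \<le> e \<bullet> (y - y')" using s by (simp add: zero_le_mult_iff)
      moreover have "(of_rat a :: real) < of_rat b" using ab by (simp add: of_rat_less)
      ultimately show False using y(2) y'(2) by (simp add: inner_diff_right inner_commute)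
    qed
  qed
  define D where "D = (\<Union>e\<in>Basis. \<Union>a. \<Union>b\<in>{a<..}. \<Union>m. N e a b m)"
  have "D \<in> null_sets lborel"
    unfolding D_def by (intro null_sets_UN') (auto intro: null countable_finite)
  moreover have "y = y'" if y: "(x, y) \<in> S" "(x, y') \<in> S" "x \<notin> D" for x y y'
  proof (rule ccontr)
    assume "y \<noteq> y'"
    then obtain e where e: "e \<in> Basis" "y \<bullet> e \<noteq> y' \<bullet> e" using euclidean_eqI by blast
    have *: False if y: "(x, y) \<in> S" "(x, y') \<in> S" and less: "y \<bullet> e < y' \<bullet> e" for y y'
    proof -
      obtain a where a: "y \<bullet> e < of_rat a" "of_rat a < y' \<bullet> e" using of_rat_dense[OF less] by auto
      obtain b where  b: "(of_rat a :: real) < of_rat b" "of_rat b < y' \<bullet> e" using of_rat_dense[OF a(2)] by auto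
      obtain m :: nat where "norm (x, y, y') < m" using reals_Archimedean2 by blast
      then have "x \<in> N e a b m" unfolding N_def using y a b by (intro image_eqI[of _ _ "(x, y, y')"]) auto
      moreover have "a < b" using b(1) by (simp add: of_rat_less)
      ultimately show False using e(1) \<open>x \<notin> D\<close> unfolding D_def by blast
    qed
    show False using *[of y y'] *[of y' y] y e by linarith
  qed
  ultimately show ?thesis using that by blast
qed

lemma gen_geodesic_plansD:
  assumes "Ga \<in> gen_geodesic_plans mu nu rho"
  shows "Ga \<in> P2" "optimal_plan mu nu (distr Ga borel (\<lambda>t. (fst t, fst (snd t))))"
    "optimal_plan mu rho (distr Ga borel (\<lambda>t. (fst t, snd (snd t))))"
  using assms by (auto simp: gen_geodesic_plans_def case_prod_unfold)

lemma AE_first_marginal: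
  assumes "Ga \<in> P2" "distr Ga borel (\<lambda>t :: 'a::euclidean_space \<times> 'a \<times> 'a. (fst t, g t)) \<in> transport_plans mu nu"
    "absolutely_continuous lborel mu" "D \<in> null_sets lborel" and [measurable]: "g \<in> borel_measurable borel"
  shows "AE t in Ga. fst t \<notin> D"
proof -
  note [measurable_cong] = P2_sets[OF assms(1)]
  have "D \<in> null_sets mu" using assms by (auto simp: absolutely_continuous_def)
  moreover have "distr Ga borel fst = mu"
    using transport_plansD(3)[OF assms(2)] by (simp add: distr_distr comp_def)
  ultimately have "AE x in distr Ga borel fst. x \<notin> D" by (auto intro: AE_not_in)
  then show ?thesis using assms(4) by (subst (asm) AE_distr_iff) (auto simp: null_sets_def)
qed

lemma distr_fst_gen_geodesic_plan:
  assumes "Ga \<in> gen_geodesic_plans mu nu rho"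
  shows "distr Ga borel fst = mu"
proof -
  note G = gen_geodesic_plansD[OF assms]
  note [measurable_cong] = P2_sets[OF G(1)]
  have "distr (distr Ga borel (\<lambda>t. (fst t, fst (snd t)))) borel fst = mu"
    using G(2) transport_plansD(3) by (auto simp: optimal_plan_def)
  then show ?thesis by (simp add: distr_distr comp_def)
qed

text \<open>The average of two admissible plans is admissible, so both are carried by one set on which the
  first coordinate determines the other two.\<close>

lemma gen_geodesic_plan_unique:
  fixes mu nu rho :: "'a::euclidean_space measure"
  assumes mu: "mu \<in> P2" and nu: "nu \<in> P2" and rho: "rho \<in> P2" and ac: "absolutely_continuous lborel mu"
    and Ga1: "Ga1 \<in> gen_geodesic_plans mu nu rho" and Ga2: "Ga2 \<in> gen_geodesic_plans mu nu rho"
  shows "Ga1 = Ga2"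
proof -
  define K where "K b = (if b then Ga1 else Ga2)" for b
  have KG: "K b \<in> gen_geodesic_plans mu nu rho" for b using Ga1 Ga2 by (simp add: K_def)
  note KP = gen_geodesic_plansD(1)[OF KG]
  have Kp: "prob_space (K b)" and Ks: "sets (K b) = sets borel" for b using KP P2_prob P2_sets by auto
  define p where "p = bernoulli_pmf (1/2)"
  define gam12 where "gam12 = mixture p (\<lambda>b. distr (K b) borel (\<lambda>t. (fst t, fst (snd t))))"
  define gam13 where "gam13 = mixture p (\<lambda>b. distr (K b) borel (\<lambda>t. (fst t, snd (snd t))))"
  have o12: "optimal_plan mu nu gam12" unfolding gam12_def
    using gen_geodesic_plansD(2)[OF KG] by (rule optimal_plan_mixture)
  have o13: "optimal_plan mu rho gam13" unfolding gam13_def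
    using gen_geodesic_plansD(3)[OF KG] by (rule optimal_plan_mixture)
  define S where "S = measure_support gam12"
  define R where "R = measure_support gam13"
  have cl: "closed S" "closed R" unfolding S_def R_def by (rule closed_measure_support)+
  obtain D where D: "D \<in> null_sets lborel" "\<And>x y y'. (x, y) \<in> S \<Longrightarrow> (x, y') \<in> S \<Longrightarrow> x \<notin> D \<Longrightarrow> y = y'"
    using monotone_multivalued_null[OF cl(1)] optimal_plan_support_monotone[OF o12 mu nu] unfolding S_def by blast
  obtain E where E: "E \<in> null_sets lborel" "\<And>x y y'. (x, y) \<in> R \<Longrightarrow> (x, y') \<in> R \<Longrightarrow> x \<notin> E \<Longrightarrow> y = y'"
    using monotone_multivalued_null[OF cl(2)] optimal_plan_support_monotone[OF o13 mu rho] unfolding R_def by blast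
  define G where "G = {t. (fst t, fst (snd t)) \<in> S \<and> (fst t, snd (snd t)) \<in> R \<and> fst t \<notin> D \<and> fst t \<notin> E}"
  have [measurable]: "S \<in> sets borel" "R \<in> sets borel" "D \<in> sets borel" "E \<in> sets borel"
    using cl D(1) E(1) by (auto simp: null_sets_def)
  have m1[measurable]: "(\<lambda>t::'a\<times>'a\<times>'a. (fst t, fst (snd t))) \<in> borel_measurable borel"
    "(\<lambda>t::'a\<times>'a\<times>'a. (fst t, snd (snd t))) \<in> borel_measurable borel"
    by (auto intro!: borel_measurable_continuous_onI continuous_intros)
  have Gm[measurable]: "G \<in> sets borel" unfolding G_def by measurable
  have pair: "AE t in K b. (fst t, h t) \<in> measure_support gam"
    if gam: "gam = mixture p (\<lambda>b. distr (K b) borel (\<lambda>t. (fst t, h t)))" and [measurable]: "(\<lambda>t. (fst t, h t)) \<in> borel_measurable borel"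
    for gam and h :: "'a\<times>'a\<times>'a \<Rightarrow> 'a" and b
  proof -
    note [measurable_cong] = Ks
    have pr: "prob_space (distr (K b) borel (\<lambda>t. (fst t, h t)))" for b
      using Kp[of b] by (rule prob_space.prob_space_distr) simp
    have [measurable]: "measure_support gam \<in> sets borel" using closed_measure_support by (rule borel_closed)
    have "AE z in gam. z \<in> measure_support gam"
      by (rule AE_measure_support) (simp add: gam sets_mixture pr)
    then have "AE z in gam. z \<notin> - measure_support gam" by simp
    moreover have "- measure_support gam \<in> sets gam" by (subst gam) (simp add: sets_mixture pr)
    ultimately have "emeasure gam (- measure_support gam) = 0" using AE_iff_null_sets by blast
    then have "emeasure (distr (K b) borel (\<lambda>t. (fst t, h t))) (- measure_support gam) = 0"
      unfolding gam[symmetric] by (subst (asm) gam) (cases b; simp add: emeasure_mixture pr p_def)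
    then have "AE z in distr (K b) borel (\<lambda>t. (fst t, h t)). z \<in> measure_support gam"
      by (intro AE_I[of _ _ "- measure_support gam"]) auto
    then show ?thesis by (subst (asm) AE_distr_iff) auto
  qed
  have AEG: "AE t in K b. t \<in> G" for b
  proof -
    have 1: "AE t in K b. (fst t, fst (snd t)) \<in> S" unfolding S_def by (rule pair) (auto simp: gam12_def)
    have 2: "AE t in K b. (fst t, snd (snd t)) \<in> R" unfolding R_def by (rule pair) (auto simp: gam13_def)
    have pl: "distr (K b) borel (\<lambda>t. (fst t, fst (snd t))) \<in> transport_plans mu nu"
      using gen_geodesic_plansD(2)[OF KG[of b]] by (simp add: optimal_plan_def)
    have 3: "AE t in K b. fst t \<notin> D" by (rule AE_first_marginal[OF KP pl ac D(1)]) measurable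
    have 4: "AE t in K b. fst t \<notin> E" by (rule AE_first_marginal[OF KP pl ac E(1)]) measurable
    show ?thesis using 1 2 3 4 by eventually_elim (auto simp: G_def)
  qed
  have inj: "t = t'" if "t \<in> G" "t' \<in> G" "fst t = fst t'" for t t'
  proof -
    have "fst (snd t) = fst (snd t')" "snd (snd t) = snd (snd t')"
      using that D(2)[of "fst t" "fst (snd t)" "fst (snd t')"] E(2)[of "fst t" "snd (snd t)" "snd (snd t')"]
      unfolding G_def by auto
    with that show ?thesis by (simp add: prod_eq_iff)
  qed
  \<comment> \<open>On \<open>G\<close> the first coordinate is injective, so a compact part of
    \<open>G\<close> is recovered up to a null set from its projection, which is compact and hence
    measurable. Its mass thus depends on \<open>mu\<close> alone; inner regularity extends this to
    all Borel sets.\<close>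
  have compK: "emeasure (K b) C = emeasure mu (fst ` C)" if C: "compact C" "C \<subseteq> G" for b C
  proof -
    note [measurable_cong] = Ks
    have cf: "compact (fst ` C)" using C(1) by (intro compact_continuous_image continuous_intros)
    have [measurable]: "C \<in> sets borel" "fst ` C \<in> sets borel" using C(1) cf by (auto simp: borel_compact)
    have "emeasure mu (fst ` C) = emeasure (K b) (fst -` (fst ` C) \<inter> space (K b))"
      unfolding distr_fst_gen_geodesic_plan[OF KG[of b], symmetric] by (simp add: emeasure_distr)
    also have "\<dots> = emeasure (K b) C"
    proof (rule emeasure_eq_AE)
      show "AE t in K b. t \<in> fst -` fst ` C \<inter> space (K b) \<longleftrightarrow> t \<in> C"
        using AEG[of b]
      proof eventually_elim
        fix t assume t: "t \<in> G"
        show "t \<in> fst -` fst ` C \<inter> space (K b) \<longleftrightarrow> t \<in> C"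
          using inj[OF t] C(2) sets_eq_imp_space_eq[OF Ks[of b]] by (auto simp: image_iff dest: subsetD)
      qed
    qed (auto intro: measurable_sets)
    finally show ?thesis by simp
  qed
  have "K True = K False"
  proof (rule measure_eqI)
    fix A assume "A \<in> sets (K True)"
    then have [measurable]: "A \<in> sets borel" by (simp add: Ks)
    have *: "emeasure (K b) A = (SUP C\<in>{C. C \<subseteq> A \<inter> G \<and> compact C}. emeasure mu (fst ` C))" for b
    proof -
      note [measurable_cong] = Ks
      interpret prob_space "K b" by (rule Kp)
      have "emeasure (K b) A = emeasure (K b) (A \<inter> G)"
        by (rule emeasure_eq_AE) (use AEG[of b] in "auto elim: AE_mp simp: Ks")
      also have "\<dots> = (SUP C\<in>{C. C \<subseteq> A \<inter> G \<and> compact C}. emeasure (K b) C)"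
        by (rule inner_regular) (auto simp: Ks)
      also have "\<dots> = (SUP C\<in>{C. C \<subseteq> A \<inter> G \<and> compact C}. emeasure mu (fst ` C))"
        by (rule SUP_cong) (auto simp: compK)
      finally show ?thesis .
    qed
    show "emeasure (K True) A = emeasure (K False) A" unfolding * ..
  qed (simp add: Ks)
  then show ?thesis by (simp add: K_def)
qed

subsection \<open>Lower semicontinuity of the internal energy\<close>

text \<open>The l1 norm is chosen because exp (- norm1 x) is a product of functions of one
  coordinate, so its integral factorizes. As a function of linear growth, \<open>norm1\<close> has
  convergent integrals along almost surely convergent variables with bounded second moments.\<close>

definition norm1 :: "'a::euclidean_space \<Rightarrow> real" where
  "norm1 x = (\<Sum>b\<in>Basis. \<bar>x \<bullet> b\<bar>)"

lemma norm1_nonneg [simp]: "0 \<le> norm1 x" by (simp add: norm1_def sum_nonneg)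

lemma continuous_on_norm1 [continuous_intros]: "continuous_on S g \<Longrightarrow> continuous_on S (\<lambda>x. norm1 (g x))"
  unfolding norm1_def by (intro continuous_intros)

lemma norm1_measurable [measurable]: "norm1 \<in> borel_measurable borel"
  by (intro borel_measurable_continuous_onI continuous_on_norm1 continuous_on_id)

lemma norm1_le_norm: "norm1 (x :: 'a::euclidean_space) \<le> DIM('a) * norm x"
  unfolding norm1_def using sum_bounded_above[of Basis "\<lambda>b. \<bar>x \<bullet> b\<bar>" "norm x"] Basis_le_norm by auto

lemma norm1_triangle: "norm1 (x + y) \<le> norm1 x + norm1 y"
  unfolding norm1_def sum.distrib[symmetric] by (intro sum_mono) (simp add: inner_add_left abs_triangle_ineq)

lemma P2_norm1_integrable:
  assumes "mu \<in> P2" shows "integrable mu norm1"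
proof -
  interpret prob_space mu using assms by (rule P2_prob)
  have [measurable]: "norm1 \<in> borel_measurable mu"
    by (rule borel_measurable_sets_eq[OF P2_sets[OF assms]]) measurable
  have [measurable]: "norm \<in> borel_measurable mu"
    by (rule borel_measurable_sets_eq[OF P2_sets[OF assms]]) measurable
  have n: "integrable mu norm"
    by (rule square_integrable_imp_integrable) (use P2_integrable[OF assms] in auto)
  show ?thesis
  proof (rule Bochner_Integration.integrable_bound)
    show "integrable mu (\<lambda>x. DIM('a) * norm x)" using n by simp
  qed (use norm1_le_norm in auto)
qed

lemma exp_abs_nn_integral_finite: "(\<integral>\<^sup>+(x::real). ennreal (exp (- \<bar>x\<bar>)) \<partial>lborel) < \<infinity>"
proof -
  have 1: "(\<integral>\<^sup>+x. ennreal (exp (- x)) * indicator {0..} x \<partial>lborel) = 1"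
    using nn_intergal_power_times_exp_Ici[of 0] by (simp add: mult.commute)
  have "(\<integral>\<^sup>+(x::real). ennreal (exp (- \<bar>x\<bar>)) \<partial>lborel)
      \<le> (\<integral>\<^sup>+x. ennreal (exp (- x)) * indicator {0..} x + ennreal (exp (- (-x))) * indicator {0..} (-x) \<partial>lborel)"
    by (intro nn_integral_mono) (auto simp: indicator_def)
  also have "\<dots> = (\<integral>\<^sup>+x. ennreal (exp (- x)) * indicator {0..} x \<partial>lborel)
     + (\<integral>\<^sup>+x. ennreal (exp (- (-x))) * indicator {0..} (-x) \<partial>lborel)"
    by (rule nn_integral_add) auto
  also have "(\<integral>\<^sup>+x. ennreal (exp (- (-x))) * indicator {0..} (-x) \<partial>lborel) = (\<integral>\<^sup>+x. ennreal (exp (- x)) * indicator {0..} x \<partial>lborel)"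
    using nn_integral_real_affine[of "\<lambda>x. ennreal (exp (- x)) * indicator {0..} x" "-1" 0] by simp
  finally show ?thesis unfolding 1 by (rule le_less_trans) simp
qed

lemma exp_norm1_integrable: "integrable lborel (\<lambda>x :: 'a::euclidean_space. exp (- norm1 x - 1))"
proof (subst integrable_iff_bounded, intro conjI)
  have "(\<integral>\<^sup>+(x::'a). ennreal (norm (exp (- norm1 x - 1))) \<partial>lborel) \<le> (\<integral>\<^sup>+(x::'a). (\<Prod>b\<in>Basis. ennreal (exp (- \<bar>x \<bullet> b\<bar>))) \<partial>lborel)"
  proof (intro nn_integral_mono)
    fix x :: 'a
    have "exp (- norm1 x - 1) \<le> exp (- norm1 x)" by simp
    also have "\<dots> = (\<Prod>b\<in>Basis. exp (- \<bar>x \<bullet> b\<bar>))" by (simp add: norm1_def exp_sum flip: sum_negf)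
    finally show "ennreal (norm (exp (- norm1 x - 1))) \<le> (\<Prod>b\<in>Basis. ennreal (exp (- \<bar>x \<bullet> b\<bar>)))"
      by (simp add: prod_ennreal ennreal_leI)
  qed
  also have "\<dots> = (\<Prod>b\<in>(Basis::'a set). (\<integral>\<^sup>+x. ennreal (exp (- \<bar>x\<bar>)) \<partial>lborel))"
    by (rule nn_integral_lborel_prod) auto
  also have "\<dots> < \<infinity>" using exp_abs_nn_integral_finite by (simp add: power_less_top_ennreal)
  finally show "(\<integral>\<^sup>+(x::'a). ennreal (norm (exp (- norm1 x - 1))) \<partial>lborel) < \<infinity>" .
qed measurable

text \<open>The constant \<open>c\<close> is \<open>0\<close> for a nonnegative \<open>f\<close>. For \<open>f s = c * (s * ln s)\<close>, the minimum of
  \<open>s ln s + a s\<close> over \<open>s\<close> is \<open>- exp (- a - 1)\<close>; with \<open>a = norm1 x\<close> it is integrable in \<open>x\<close>.\<close>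

locale internal_energy =
  fixes f :: "real \<Rightarrow> real" and c :: real
  assumes convex: "convex_on {0..} f" and cont: "continuous_on {0..} f" and f0: "f 0 = 0"
    and superlinear: "filterlim (\<lambda>s. f s / s) at_top at_top"
    and c0: "0 \<le> c" and lower: "\<And>a s. 0 \<le> a \<Longrightarrow> 0 \<le> s \<Longrightarrow> 0 \<le> f s + c * (a * s + exp (- a - 1))"
begin

definition fstar :: "real \<Rightarrow> real" where
  "fstar p = (SUP s\<in>{0..}. p * s - f s)"

text \<open>The right derivative of the convex function f, as the infimum of the slopes to the
  right. The facts about it are for s > 0: at 0 these slopes may be unbounded below, as for s ln
  s.\<close>

definition subgrad :: "real \<Rightarrow> real" where
  "subgrad s = Inf ((\<lambda>t. (f s - f t) / (s - t)) ` ({s<..} \<inter> {0..}))"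

text \<open>A nonnegative version of f (r x). The added terms integrate to c times a first moment
  plus a constant, and these converge on their own, so lower semicontinuity can be proved for
  \<open>shifted\<close> and transferred to f.\<close>

definition shifted :: "'a::euclidean_space \<Rightarrow> real \<Rightarrow> real" where
  "shifted x s = f s + c * (norm1 x * s + exp (- norm1 x - 1))"

lemma shifted_nonneg: "0 \<le> s \<Longrightarrow> 0 \<le> shifted x s"
  unfolding shifted_def by (rule lower) auto

lemma f_measurable [measurable (raw)]:
  assumes "r \<in> borel_measurable M" "\<And>x. 0 \<le> r x"
  shows "(\<lambda>x. f (r x)) \<in> borel_measurable M"
proof -
  have "continuous_on UNIV (\<lambda>s. f (max 0 s))"
    by (rule continuous_on_compose2[OF cont]) (auto intro!: continuous_intros)
  then have "(\<lambda>s. f (max 0 s)) \<in> borel_measurable borel" by (rule borel_measurable_continuous_onI)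
  from measurable_compose[OF assms(1) this] show ?thesis using assms(2) by (simp add: max_absorb2)
qed

lemma shifted_measurable [measurable (raw)]:
  assumes "r \<in> borel_measurable borel" "\<And>x. 0 \<le> r x"
  shows "(\<lambda>x. shifted x (r x)) \<in> borel_measurable borel"
  unfolding shifted_def using assms by measurable

text \<open>Superlinear growth makes p s - f s nonpositive for large s, and continuity bounds it on
  the remaining compact interval. Hence the conjugate \<open>fstar\<close> is finite at every
  p.\<close>

lemma fstar_bdd: "bdd_above ((\<lambda>s. p * s - f s) ` {0..})"
proof -
  obtain S where S: "\<And>s. s \<ge> S \<Longrightarrow> p \<le> f s / s"
    using superlinear unfolding filterlim_at_top eventually_at_top_linorder by blast
  define T where "T = max S 1"
  have "compact ((\<lambda>s. p * s - f s) ` {0..T})"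
    by (intro compact_continuous_image continuous_intros continuous_on_subset[OF cont]) auto
  then have "bdd_above ((\<lambda>s. p * s - f s) ` {0..T})" by (intro bounded_imp_bdd_above compact_imp_bounded)
  then obtain B where B: "\<And>s. s \<in> {0..T} \<Longrightarrow> p * s - f s \<le> B"
    unfolding bdd_above_def by blast
  have "p * s - f s \<le> max B 0" if "0 \<le> s" for s
  proof (cases "s \<le> T")
    case True then show ?thesis using B[of s] that by auto
  next
    case False
    then have "s \<ge> S" "s > 0" by (auto simp: T_def)
    then show ?thesis using S[of s] by (simp add: field_simps)
  qed
  then show ?thesis by (intro bdd_aboveI[of _ "max B 0"]) auto
qed

lemma fenchel: "0 \<le> s \<Longrightarrow> p * s - fstar p \<le> f s"
  unfolding fstar_def using cSUP_upper[OF _ fstar_bdd, of s p] by auto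

lemma fstar_nonneg: "0 \<le> fstar p"
  using fenchel[of 0 p] by (simp add: f0)

lemma fstar_continuous: "continuous_on UNIV fstar"
proof (rule convex_on_continuous)
  show "convex_on UNIV fstar"
  proof (rule convex_onI)
    fix t x y :: real assume t: "0 < t" "t < 1"
    have "((1 - t) *\<^sub>R x + t *\<^sub>R y) * s - f s \<le> (1 - t) * fstar x + t * fstar y" if "s \<in> {0..}" for s
    proof -
      have "((1 - t) *\<^sub>R x + t *\<^sub>R y) * s - f s = (1 - t) * (x * s - f s) + t * (y * s - f s)"
        by (simp add: algebra_simps)
      also have "\<dots> \<le> (1 - t) * fstar x + t * fstar y"
        using t fenchel[of s x] fenchel[of s y] that by (intro add_mono mult_left_mono) auto
      finally show ?thesis .
    qed
    then show "fstar ((1 - t) *\<^sub>R x + t *\<^sub>R y) \<le> (1 - t) * fstar x + t * fstar y"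
      unfolding fstar_def[of "(1 - t) *\<^sub>R x + t *\<^sub>R y"] by (intro cSUP_least) auto
  qed simp
qed simp

lemma fstar_measurable [measurable]: "fstar \<in> borel_measurable borel"
  using fstar_continuous by (rule borel_measurable_continuous_onI)

lemma subgrad: "0 < s \<Longrightarrow> 0 \<le> t \<Longrightarrow> f s + subgrad s * (t - s) \<le> f t"
  unfolding subgrad_def by (rule convex_le_Inf_differential[OF convex]) auto

lemma fstar_subgrad: assumes "0 < s" shows "fstar (subgrad s) = subgrad s * s - f s"
proof (rule antisym)
  show "fstar (subgrad s) \<le> subgrad s * s - f s"
    unfolding fstar_def using subgrad[OF assms] by (intro cSUP_least) (auto simp: algebra_simps)
  show "subgrad s * s - f s \<le> fstar (subgrad s)" using fenchel[of s "subgrad s"] assms by simp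
qed

lemma subgrad_mono: assumes "0 < s" "s \<le> t" shows "subgrad s \<le> subgrad t"
proof (cases "s = t")
  case False
  then have "s < t" using assms by simp
  have "f s + subgrad s * (t - s) \<le> f t" "f t + subgrad t * (s - t) \<le> f s"
    using assms by (auto intro!: subgrad)
  then have "0 \<le> (subgrad t - subgrad s) * (t - s)" by (simp add: algebra_simps)
  with \<open>s < t\<close> show ?thesis by (simp add: zero_le_mult_iff)
qed simp

text \<open>The value at \<open>r\<close> of the tangent at \<open>s\<close>.\<close>

definition tangent :: "real \<Rightarrow> real \<Rightarrow> real" where
  "tangent s r = subgrad s * r - fstar (subgrad s)"

lemma tangent_self: "0 < s \<Longrightarrow> tangent s s = f s"
  by (simp add: tangent_def fstar_subgrad)

lemma tangent_le: "0 \<le> r \<Longrightarrow> tangent s r \<le> f r"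
  unfolding tangent_def by (rule fenchel)

text \<open>Slopes taken at a point of [1 / (n + 1), n + 1] give a bounded dual variable, away from
  0 and from infinity, where the slope of f may be unbounded.\<close>

definition clamp_inv :: "nat \<Rightarrow> real \<Rightarrow> real" where
  "clamp_inv n r = max (1 / real (Suc n)) (min (real (Suc n)) r)"

lemma clamp_inv: "0 < clamp_inv n r" "1 / Suc n \<le> clamp_inv n r" "clamp_inv n r \<le> Suc n"
proof -
  have "1 / real (Suc n) \<le> 1" "1 \<le> real (Suc n)" by (simp_all add: divide_le_eq)
  then have "1 / real (Suc n) \<le> real (Suc n)" by (rule order_trans)
  then show "0 < clamp_inv n r" "1 / Suc n \<le> clamp_inv n r" "clamp_inv n r \<le> Suc n"
    by (auto simp: clamp_inv_def less_max_iff_disj)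
qed

text \<open>The clamped point is r itself or lies between 1 and r. By convexity a tangent taken
  closer to r is higher at r, so the tangent at 1 is a lower bound that does not depend on n; it
  supplies the minorant for Fatou's lemma.\<close>

lemma tangent_clamp_lower:
  assumes "0 \<le> r"
  shows "- (\<bar>subgrad 1\<bar> * r + \<bar>fstar (subgrad 1)\<bar>) \<le> tangent (clamp_inv n r) r"
proof -
  define s where "s = clamp_inv n r"
  have s: "0 < s" unfolding s_def by (rule clamp_inv)
  have eq: "tangent s r = f s + subgrad s * (r - s)" using s by (simp add: tangent_def fstar_subgrad algebra_simps)
  have "tangent 1 r \<le> tangent s r"
  proof -
    consider "s = r" | "s < r" "1 \<le> s" | "r < s" "s \<le> 1"
    proof -
      define a b where "a = 1 / real (Suc n)" and "b = real (Suc n)"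
      have ab: "a \<le> 1" "1 \<le> b" unfolding a_def b_def by (simp_all add: divide_le_eq)
      have s: "s = max a (min b r)" unfolding s_def clamp_inv_def a_def b_def ..
      show ?thesis
      proof (cases "r < a")
        case True then show ?thesis using ab s by (intro that(3)) auto
      next
        case False
        show ?thesis
        proof (cases "b < r")
          case True then show ?thesis using ab s by (intro that(2)) auto
        next
          case F: False
          show ?thesis using ab s False F by (intro that(1)) auto
        qed
      qed
    qed
    then show ?thesis
    proof cases
      case 1 then show ?thesis using tangent_le[OF assms, of 1] tangent_self[OF s] by simp
    next
      case 2
      have "subgrad 1 * (r - s) \<le> subgrad s * (r - s)" using 2 subgrad_mono[of 1 s] by (intro mult_right_mono) auto
      moreover have "tangent 1 s \<le> f s" using s by (intro tangent_le) simp
      ultimately show ?thesis unfolding eq by (simp add: tangent_def algebra_simps)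
    next
      case 3
      have "subgrad 1 * (r - s) \<le> subgrad s * (r - s)" using 3 s subgrad_mono[of s 1] by (intro mult_right_mono_neg) auto
      moreover have "tangent 1 s \<le> f s" using s by (intro tangent_le) simp
      ultimately show ?thesis unfolding eq by (simp add: tangent_def algebra_simps)
    qed
  qed
  moreover have "- (\<bar>subgrad 1\<bar> * r) \<le> subgrad 1 * r" using assms abs_ge_minus_self[of "subgrad 1"] 
    by (metis abs_mult abs_of_nonneg abs_ge_minus_self minus_le_iff)
  ultimately show ?thesis unfolding s_def tangent_def by (simp add: abs_if split: if_splits)
qed

text \<open>For r > 0 the clamp is eventually inactive and the tangent touches f at r. For r = 0 the
  tangent at s = 1 / (n + 1) has the value f s - s * subgrad s; slopes increase, so subgrad s is at
  most |subgrad 1|, and continuity of f at 0 gives the limit.\<close>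

lemma tangent_clamp_tendsto:
  assumes "0 \<le> r"
  shows "(\<lambda>n. tangent (clamp_inv n r) r) \<longlonglongrightarrow> f r"
proof (cases "r = 0")
  case False
  with assms have r: "0 < r" by simp
  obtain N :: nat where N: "1 / Suc N < r" "r < Suc N"
  proof -
    obtain a b :: nat where ab: "inverse (Suc a) < r" "r < real b" using r reals_Archimedean reals_Archimedean2 by metis
    have "1 / Suc (max a b) \<le> inverse (Suc a)" by (simp add: field_simps)
    with ab have "1 / Suc (max a b) < r" "r < Suc (max a b)" by auto
    then show ?thesis by (rule that)
  qed
  have "tangent (clamp_inv n r) r = f r" if "n \<ge> N" for n
  proof -
    have "1 / Suc n \<le> 1 / Suc N" using that by (simp add: frac_le)
    then have "clamp_inv n r = r" using N that by (simp add: clamp_inv_def)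
    with r show ?thesis by (simp add: tangent_self)
  qed
  then show ?thesis by (auto intro!: tendsto_eventually eventually_sequentiallyI)
next
  case True
  have eq: "clamp_inv n r = 1 / Suc n" for n by (simp add: clamp_inv_def True max_def)
  have lim: "(\<lambda>n. 1 / real (Suc n)) \<longlonglongrightarrow> 0" using LIMSEQ_inverse_real_of_nat by (simp add: divide_inverse)
  show ?thesis
  proof (rule tendsto_sandwich)
    show "\<forall>\<^sub>F n in sequentially. f (1 / Suc n) - (1 / Suc n) * \<bar>subgrad 1\<bar> \<le> tangent (clamp_inv n r) r"
    proof (intro always_eventually allI)
      fix n :: nat
      have "subgrad (1 / Suc n) \<le> \<bar>subgrad 1\<bar>" using subgrad_mono[of "1 / Suc n" 1] by (auto simp: divide_le_eq)
      then have "(1 / Suc n) * subgrad (1 / Suc n) \<le> (1 / Suc n) * \<bar>subgrad 1\<bar>" by (intro mult_left_mono) auto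
      then show "f (1 / Suc n) - (1 / Suc n) * \<bar>subgrad 1\<bar> \<le> tangent (clamp_inv n r) r"
        unfolding eq tangent_def by (simp add: fstar_subgrad True mult.commute)
    qed
    show "\<forall>\<^sub>F n in sequentially. tangent (clamp_inv n r) r \<le> f r"
      using tangent_le[OF assms] by simp
    have "(\<lambda>n. f (1 / Suc n)) \<longlonglongrightarrow> f 0"
      by (rule continuous_on_tendsto_compose[OF cont lim]) auto
    then have "(\<lambda>n. f (1 / Suc n) - (1 / Suc n) * \<bar>subgrad 1\<bar>) \<longlonglongrightarrow> f 0 - 0 * \<bar>subgrad 1\<bar>"
      by (intro tendsto_intros lim)
    then show "(\<lambda>n. f (1 / Suc n) - (1 / Suc n) * \<bar>subgrad 1\<bar>) \<longlonglongrightarrow> f r" by (simp add: True)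
  qed simp
qed

lemma subgrad_clamp_measurable [measurable]: "(\<lambda>r. subgrad (clamp_inv n r)) \<in> borel_measurable borel"
  by (rule borel_measurable_mono) (auto simp: mono_def intro!: subgrad_mono clamp_inv, auto simp: clamp_inv_def min_def max_def)

lemma subgrad_clamp_bounded: "\<bar>subgrad (clamp_inv n r)\<bar> \<le> \<bar>subgrad (1 / Suc n)\<bar> + \<bar>subgrad (Suc n)\<bar>"
  using subgrad_mono[OF _ clamp_inv(2), of n r] subgrad_mono[OF clamp_inv(1,3), of n r] by auto

end

section \<open>Lebesgue densities and compactly supported test functions\<close>

abbreviation lebesgue_density :: "('a::euclidean_space \<Rightarrow> real) \<Rightarrow> 'a measure" where
  "lebesgue_density r \<equiv> density lborel (\<lambda>x. ennreal (r x))"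

lemma leb_density_nonneg [simp]: "0 \<le> leb_density mu x" by (simp add: leb_density_def)

lemma leb_density_measurable [measurable]: "leb_density mu \<in> borel_measurable borel"
  unfolding leb_density_def by measurable

lemma density_leb_density:
  fixes mu :: "'a::euclidean_space measure"
  assumes "finite_measure mu" "sets mu = sets borel" "absolutely_continuous lborel mu"
  shows "lebesgue_density (leb_density mu) = mu"
proof -
  interpret finite_measure mu by fact
  have "AE x in lborel. RN_deriv lborel mu x \<noteq> \<infinity>"
    by (rule sigma_finite_measure.RN_deriv_finite[OF sigma_finite_lborel]) (use assms in "auto intro: sigma_finite_measure_axioms")
  then have "lebesgue_density (leb_density mu) = density lborel (RN_deriv lborel mu)"
    by (intro density_cong) (auto simp: leb_density_def less_top[symmetric] elim!: eventually_mono)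
  also have "\<dots> = mu" using assms by (intro sigma_finite_measure.density_RN_deriv[OF sigma_finite_lborel]) auto
  finally show ?thesis .
qed

lemma leb_density_unique:
  fixes r :: "'a::euclidean_space \<Rightarrow> real"
  assumes [measurable]: "r \<in> borel_measurable borel" and nn: "\<And>x. 0 \<le> r x"
    and fin: "finite_measure (lebesgue_density r)"
  shows "AE x in lborel. leb_density (lebesgue_density r) x = r x"
proof -
  have ac: "absolutely_continuous lborel (lebesgue_density r)"
    by (rule absolutely_continuousI_density) simp
  have "density lborel (\<lambda>x. ennreal (leb_density (lebesgue_density r) x)) = lebesgue_density r"
    by (rule density_leb_density[OF fin _ ac]) simp
  then have "AE x in lborel. ennreal (leb_density (lebesgue_density r) x) = ennreal (r x)"
    by (subst (asm) sigma_finite_measure.density_unique_iff[OF sigma_finite_lborel]) auto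
  then show ?thesis by eventually_elim (use nn in auto)
qed

definition compactly_supported :: "('a::euclidean_space \<Rightarrow> real) \<Rightarrow> bool" where
  "compactly_supported g \<longleftrightarrow> continuous_on UNIV g \<and> (\<exists>R. \<forall>x. R < norm x \<longrightarrow> g x = 0)"

lemma compactly_supported_measurable: "compactly_supported g \<Longrightarrow> g \<in> borel_measurable borel"
  unfolding compactly_supported_def by (auto intro: borel_measurable_continuous_onI)

lemma compactly_supported_mult:
  assumes "compactly_supported g" "continuous_on UNIV h"
  shows "compactly_supported (\<lambda>x. g x * h x)"
proof -
  obtain R where R: "\<forall>x. R < norm x \<longrightarrow> g x = 0" using assms by (auto simp: compactly_supported_def)
  have "\<forall>x. R < norm x \<longrightarrow> g x * h x = 0" using R by simp
  then show ?thesis using assms unfolding compactly_supported_def by (blast intro: continuous_on_mult)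
qed

lemma compactly_supported_bounded:
  assumes "compactly_supported g"
  obtains B where "\<And>x. \<bar>g x\<bar> \<le> B" "0 \<le> B"
proof -
  obtain R where R: "\<And>x. R < norm x \<Longrightarrow> g x = 0" and c: "continuous_on UNIV g"
    using assms by (auto simp: compactly_supported_def)
  have "compact (g ` cball 0 R)" by (intro compact_continuous_image continuous_on_subset[OF c]) auto
  then obtain B where B: "\<And>x. x \<in> cball 0 R \<Longrightarrow> \<bar>g x\<bar> \<le> B" using compact_imp_bounded by (force simp: bounded_iff)
  have "\<bar>g x\<bar> \<le> max B 0" for x
  proof (cases "norm x \<le> R")
    case True then show ?thesis using B[of x] by simp
  next
    case False then show ?thesis using R[of x] by simp
  qed
  then show ?thesis by (rule that) simp
qed

lemma compactly_supported_integrable: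
  assumes "compactly_supported g"
  shows "integrable lborel g"
proof -
  obtain B where B: "\<And>x. \<bar>g x\<bar> \<le> B" "0 \<le> B" using compactly_supported_bounded[OF assms] by blast
  obtain R where R: "\<And>x. R < norm x \<Longrightarrow> g x = 0" using assms by (auto simp: compactly_supported_def)
  show ?thesis
  proof (rule Bochner_Integration.integrable_bound)
    show "integrable lborel (\<lambda>x. B * indicator (cball 0 R) x)"
      by (intro integrable_mult_right integrable_real_indicator) (use emeasure_lborel_cball_finite in auto)
    show "AE x in lborel. norm (g x) \<le> norm (B * indicator (cball 0 R) x)"
      using B R by (intro AE_I2) (auto simp: indicator_def not_le[symmetric])
  qed (use assms in "auto intro: compactly_supported_measurable")
qed

lemma compactly_supported_mult_integrable:
  assumes g: "compactly_supported g" and r: "integrable M r" and [measurable_cong]: "sets M = sets borel"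
  shows "integrable M (\<lambda>x. g x * r x)"
proof -
  obtain B where B: "\<And>x. \<bar>g x\<bar> \<le> B" "0 \<le> B" using compactly_supported_bounded[OF g] by blast
  have [measurable]: "g \<in> borel_measurable borel" using g by (rule compactly_supported_measurable)
  show ?thesis
  proof (rule Bochner_Integration.integrable_bound)
    show "integrable M (\<lambda>x. B * r x)" using r by simp
    show "AE x in M. norm (g x * r x) \<le> norm (B * r x)"
      using B by (intro AE_I2) (auto simp: abs_mult intro!: mult_right_mono)
  qed (use r in measurable)
qed

lemma integral_le_of_nn_integral_le:
  assumes "integrable M h" "\<And>x. h x \<le> \<phi> x" "(\<integral>\<^sup>+x. ennreal (\<phi> x) \<partial>M) \<le> ennreal C" "0 \<le> C"
  shows "(LINT x|M. h x) \<le> C"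
proof -
  have i: "integrable M (\<lambda>x. max 0 (h x))" using assms(1) by simp
  have "(LINT x|M. h x) \<le> (LINT x|M. max 0 (h x))" using i assms(1) by (intro integral_mono) auto
  moreover have "ennreal (LINT x|M. max 0 (h x)) \<le> ennreal C"
  proof -
    have "ennreal (LINT x|M. max 0 (h x)) = (\<integral>\<^sup>+x. ennreal (max 0 (h x)) \<partial>M)"
      by (rule nn_integral_eq_integral[symmetric, OF i]) simp
    also have "\<dots> \<le> (\<integral>\<^sup>+x. ennreal (\<phi> x) \<partial>M)"
      using assms(2) by (intro nn_integral_mono) (auto simp: ennreal_leI max_def)
    finally show ?thesis using assms(3) by simp
  qed
  ultimately show ?thesis using assms(4) by (simp add: ennreal_le_iff)
qed

section \<open>Lower semicontinuity by duality with continuous test functions\<close>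

context internal_energy
begin

definition shifted_energy :: "('a::euclidean_space \<Rightarrow> real) \<Rightarrow> ennreal" where
  "shifted_energy r = (\<integral>\<^sup>+x. ennreal (shifted x (r x)) \<partial>lborel)"

context
  fixes r :: "nat \<Rightarrow> 'a::euclidean_space \<Rightarrow> real" and mu :: "'a measure" and C :: "nat \<Rightarrow> real" and C0 :: real
  assumes r_m [measurable]: "\<And>k. r k \<in> borel_measurable borel" and r_n: "\<And>k x. 0 \<le> r k x"
    and r_i: "\<And>k. integrable lborel (r k)"
    and fin: "finite_measure mu" and smu [measurable_cong]: "sets mu = sets borel"
    and vague: "\<And>g. compactly_supported g \<Longrightarrow> (\<lambda>k. LBINT x. g x * r k x) \<longlonglongrightarrow> (LINT x|mu. g x)"
    and energy: "\<And>k. shifted_energy (r k) \<le> ennreal (C k)" and C_nonneg: "\<And>k. 0 \<le> C k" and C_lim: "C \<longlonglongrightarrow> C0"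
begin

text \<open>Fenchel's inequality with a continuous dual variable \<open>psi\<close> survives the limit.\<close>

lemma dual_bound:
  assumes eta: "compactly_supported eta" and eta01: "\<And>x. 0 \<le> eta x" "\<And>x. eta x \<le> 1" and psi: "continuous_on UNIV psi"
  shows "(LINT x|mu. eta x * psi x) - (LBINT x. eta x * fstar (psi x))
    + c * ((LINT x|mu. eta x * norm1 x) + (LBINT x. eta x * exp (- norm1 x - 1))) \<le> C0"
proof -
  have s1: "compactly_supported (\<lambda>x. eta x * psi x)" using eta psi by (rule compactly_supported_mult)
  have s2: "compactly_supported (\<lambda>x. eta x * fstar (psi x))"
    using eta continuous_on_compose2[OF fstar_continuous psi] by (intro compactly_supported_mult) auto
  have s3: "compactly_supported (\<lambda>x. eta x * norm1 x)"
    using eta by (intro compactly_supported_mult continuous_intros)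
  have s4: "compactly_supported (\<lambda>x. eta x * exp (- norm1 x - 1))"
    using eta by (intro compactly_supported_mult continuous_intros)
  note i = compactly_supported_mult_integrable[OF s1 r_i] compactly_supported_integrable[OF s2]
    compactly_supported_mult_integrable[OF s3 r_i] compactly_supported_integrable[OF s4]
  define I where "I k = (LBINT x. eta x * psi x * r k x) - (LBINT x. eta x * fstar (psi x))
    + c * ((LBINT x. eta x * norm1 x * r k x) + (LBINT x. eta x * exp (- norm1 x - 1)))" for k
  have le: "I k \<le> C k" for k
  proof -
    have eq: "I k = (LBINT x. eta x * psi x * r k x - eta x * fstar (psi x)
        + c * (eta x * norm1 x * r k x + eta x * exp (- norm1 x - 1)))"
      unfolding I_def using i by simp
    show ?thesis unfolding eq
    proof (rule integral_le_of_nn_integral_le[where \<phi>="\<lambda>x. shifted x (r k x)"])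
      show "eta x * psi x * r k x - eta x * fstar (psi x) + c * (eta x * norm1 x * r k x + eta x * exp (- norm1 x - 1))
          \<le> shifted x (r k x)" for x
      proof -
        have "eta x * psi x * r k x - eta x * fstar (psi x) + c * (eta x * norm1 x * r k x + eta x * exp (- norm1 x - 1))
            = eta x * (psi x * r k x - fstar (psi x) + c * (norm1 x * r k x + exp (- norm1 x - 1)))"
          by (simp add: algebra_simps)
        also have "\<dots> \<le> eta x * shifted x (r k x)"
          unfolding shifted_def using eta01 r_n by (intro mult_left_mono add_right_mono fenchel) auto
        also have "\<dots> \<le> 1 * shifted x (r k x)"
          using eta01 r_n by (intro mult_right_mono shifted_nonneg) auto
        finally show ?thesis by simp
      qed
    qed (use i energy C_nonneg in "auto simp: shifted_energy_def")
  qed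
  have "I \<longlonglongrightarrow> (LINT x|mu. eta x * psi x) - (LBINT x. eta x * fstar (psi x))
    + c * ((LINT x|mu. eta x * norm1 x) + (LBINT x. eta x * exp (- norm1 x - 1)))"
    unfolding I_def by (intro tendsto_intros vague s1 s3)
  then show ?thesis using C_lim by (rule LIMSEQ_le) (use le in auto)
qed

lemma C0_nonneg: "0 \<le> C0"
  using LIMSEQ_le_const[OF C_lim] C_nonneg by blast

text \<open>A constant dual variable L, localized by cut-offs that tend to the indicator of U. Up to
  C0 / L the limit mass of U is controlled by the volume of U: this is the equi-integrability that
  superlinear growth provides.\<close>

lemma limit_open_bound:
  assumes U: "open U" and Ufin: "emeasure lborel U < \<infinity>" and L: "0 < L"
  shows "L * measure mu U \<le> C0 + fstar L * measure lborel U"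
proof -
  interpret finite_measure mu by (rule fin)
  define eta where "eta n x = min 1 (real n * infdist x (- U)) * max 0 (min 1 (real n - norm x))" for n and x :: 'a
  have cs: "compactly_supported (eta n)" for n
    unfolding compactly_supported_def eta_def
    by (auto intro!: continuous_intros exI[of _ "real n"])
  have b: "0 \<le> eta n x" "eta n x \<le> 1" for n x
    unfolding eta_def by (auto simp: infdist_nonneg intro!: mult_le_one)
  \<comment> \<open>The first branch reflects that \<open>infdist\<close> to the empty set is 0;
    \<open>neU\<close> shows that the complement of a set of finite volume is nonempty.\<close>
  have lim: "(\<lambda>n. eta n x) \<longlonglongrightarrow> (if - U = {} then 0 else indicator U x)" for x
  proof (cases "- U = {} \<or> x \<notin> U")
    case True
    then have "infdist x (- U) = 0"
    proof
      assume "x \<notin> U" then show ?thesis by (intro infdist_zero) simp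
    qed (simp add: infdist_def)
    then show ?thesis using True by (auto simp: eta_def)
  next
    case False
    then have pos: "infdist x (- U) > 0" using infdist_pos_not_in_closed[of "- U" x] U by (auto simp: open_closed)
    obtain N :: nat where N: "real N * infdist x (- U) > 1" using pos reals_Archimedean3 by metis
    obtain M :: nat where M: "real M > norm x + 1" using reals_Archimedean2 by blast
    have "eta n x = 1" if "n \<ge> max N M" for n
    proof -
      have "real N * infdist x (- U) \<le> real n * infdist x (- U)" using that pos by (intro mult_right_mono) auto
      moreover have "real n \<ge> real M" using that by simp
      ultimately show ?thesis unfolding eta_def using N M by simp
    qed
    then have "(\<lambda>n. eta n x) \<longlonglongrightarrow> 1"
      by (intro tendsto_eventually eventually_sequentiallyI[of "max N M"])
    then show ?thesis using False by simp
  qed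
  have neU: "- U \<noteq> {}"
  proof
    assume "- U = {}"
    then have "U = UNIV" by auto
    with Ufin show False by simp
  qed
  have Um[measurable]: "U \<in> sets borel" using U by simp
  have [measurable]: "eta n \<in> borel_measurable borel" for n using cs by (rule compactly_supported_measurable)
  have l1: "(\<lambda>n. LINT x|mu. eta n x) \<longlonglongrightarrow> (LINT x|mu. indicator U x)"
    by (rule integral_dominated_convergence[where w="\<lambda>_. 1"]) (use b lim neU in auto)
  have "eta n x \<le> indicator U x" for n x
    using b(2)[of n x] by (cases "x \<in> U") (auto simp: eta_def)
  then have le: "(LBINT x. eta n x) \<le> (LBINT x. indicator U x)" for n
    using Ufin by (intro integral_mono compactly_supported_integrable[OF cs] integrable_real_indicator) auto
  have "L * (LINT x|mu. eta n x) \<le> C0 + fstar L * measure lborel U" for n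
  proof -
    have "0 \<le> c * ((LINT x|mu. eta n x * norm1 x) + (LBINT x. eta n x * exp (- norm1 x - 1)))"
      using c0 b by (intro mult_nonneg_nonneg add_nonneg_nonneg integral_nonneg_AE) auto
    moreover have "(LINT x|mu. eta n x * L) - (LBINT x. eta n x * fstar L)
       + c * ((LINT x|mu. eta n x * norm1 x) + (LBINT x. eta n x * exp (- norm1 x - 1))) \<le> C0"
      by (rule dual_bound[OF cs b]) auto
    moreover have "fstar L * (LBINT x. eta n x) \<le> fstar L * measure lborel U"
      using le[of n] fstar_nonneg by (intro mult_left_mono) auto
    ultimately show ?thesis by (simp add: mult.commute)
  qed
  then have "L * (LINT x|mu. indicator U x) \<le> C0 + fstar L * measure lborel U"
    by (intro LIMSEQ_le_const2[OF tendsto_mult_left[OF l1]]) auto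
  then show ?thesis by simp
qed

text \<open>For given L the null set N is covered by an open U so small that fstar L times its
  volume is at most 1. Then L times the mass of N is at most C0 + 1, and L is arbitrary.\<close>

lemma limit_absolutely_continuous: "absolutely_continuous lborel mu"
  unfolding absolutely_continuous_def
proof
  interpret finite_measure mu by (rule fin)
  fix N assume N: "N \<in> null_sets (lborel :: 'a measure)"
  then have [measurable]: "N \<in> sets borel" and N0: "emeasure lborel N = 0" by (auto simp: null_sets_def)
  have le: "measure mu N * L \<le> C0 + 1" if L: "0 < L" for L
  proof -
    define e where "e = 1 / (1 + fstar L)"
    have e: "0 < e" "fstar L * e \<le> 1" using fstar_nonneg[of L] by (auto simp: e_def field_simps)
    obtain U where U: "open U" "N \<subseteq> U" "emeasure lborel (U - N) < e"
      using outer_regular_lborel[of N e] e by auto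
    have "emeasure lborel U \<le> emeasure lborel (U - N) + emeasure lborel N"
      using U by (intro order_trans[OF emeasure_mono emeasure_subadditive]) auto
    with U N0 have Ue: "emeasure lborel U < ennreal e" by simp
    then have Uf: "emeasure lborel U < \<infinity>" by (rule less_trans) simp
    have "measure lborel U \<le> e"
      using Ue e Uf by (simp add: emeasure_eq_ennreal_measure ennreal_less_iff less_top[symmetric])
    then have "fstar L * measure lborel U \<le> fstar L * e" using fstar_nonneg by (intro mult_left_mono) auto
    moreover have "measure mu N * L \<le> measure mu U * L" using L U by (intro mult_right_mono finite_measure_mono) auto
    ultimately show ?thesis using limit_open_bound[OF U(1) Uf L] e(2) by (simp add: mult.commute)
  qed
  have "measure mu N = 0"
  proof (rule ccontr)
    assume "measure mu N \<noteq> 0"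
    then have p: "measure mu N > 0" by (simp add: zero_less_measure_iff)
    then have "measure mu N * ((C0 + 2) / measure mu N) \<le> C0 + 1" using C0_nonneg by (intro le) auto
    with p show False by simp
  qed
  then show "N \<in> null_sets mu" by (auto simp: null_sets_def emeasure_eq_measure)
qed

text \<open>The best dual variable is the slope of f at the limit density, which is only measurable.
  Continuous functions tending to psi almost everywhere, clamped to [- B, B], carry the bound over
  by dominated convergence.\<close>

lemma dual_bound_measurable:
  assumes rho: "rho \<in> borel_measurable borel" "\<And>x. 0 \<le> rho x" "mu = lebesgue_density rho"
    and eta: "compactly_supported eta" and eta01: "\<And>x. 0 \<le> eta x" "\<And>x. eta x \<le> 1"
    and psi[measurable]: "psi \<in> borel_measurable borel" and B: "\<And>x. \<bar>psi x\<bar> \<le> B"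
  shows "integrable lborel (\<lambda>x. eta x * (psi x * rho x - fstar (psi x) + c * (norm1 x * rho x + exp (- norm1 x - 1))))"
    "(LBINT x. eta x * (psi x * rho x - fstar (psi x) + c * (norm1 x * rho x + exp (- norm1 x - 1)))) \<le> C0"
proof -
  note [measurable] = rho(1)
  interpret finite_measure mu by (rule fin)
  have [measurable]: "eta \<in> borel_measurable borel" using eta by (rule compactly_supported_measurable)
  have irho: "integrable lborel rho"
  proof -
    have "integrable mu (\<lambda>_. 1::real)" by simp
    then show ?thesis unfolding rho(3) using rho(2) by (subst (asm) integrable_real_density) auto
  qed
  have B0: "0 \<le> B" using order_trans[OF abs_ge_zero B] .
  define clB where "clB s = max (- B) (min B s)" for s
  have clB: "\<bar>clB s\<bar> \<le> B" "\<bar>s\<bar> \<le> B \<Longrightarrow> clB s = s" for s using B0 by (auto simp: clB_def)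
  have "compact (fstar ` {-B..B})"
    by (intro compact_continuous_image continuous_on_subset[OF fstar_continuous]) auto
  then obtain D where D: "\<And>p. p \<in> {-B..B} \<Longrightarrow> \<bar>fstar p\<bar> \<le> D"
    using compact_imp_bounded by (force simp: bounded_iff)
  have s3: "compactly_supported (\<lambda>x. eta x * norm1 x)"
    using eta by (intro compactly_supported_mult continuous_intros)
  have s4: "compactly_supported (\<lambda>x. eta x * exp (- norm1 x - 1))"
    using eta by (intro compactly_supported_mult continuous_intros)
  note i34 = compactly_supported_mult_integrable[OF s3 irho] compactly_supported_integrable[OF s4]
    compactly_supported_mult_integrable[OF eta irho] compactly_supported_integrable[OF eta]
  define H where "H g x = eta x * (g x * rho x - fstar (g x) + c * (norm1 x * rho x + exp (- norm1 x - 1)))" for g :: "'a \<Rightarrow> real" and x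
  define w where "w x = B * (eta x * rho x) + D * eta x + c * (eta x * norm1 x * rho x + eta x * exp (- norm1 x - 1))" for x
  have iw: "integrable lborel w" unfolding w_def using i34 by simp
  have Hw: "norm (H g x) \<le> w x" if "\<bar>g x\<bar> \<le> B" for g x
  proof -
    have "\<bar>g x * rho x - fstar (g x) + c * (norm1 x * rho x + exp (- norm1 x - 1))\<bar>
        \<le> \<bar>g x\<bar> * rho x + \<bar>fstar (g x)\<bar> + c * (norm1 x * rho x + exp (- norm1 x - 1))"
    proof -
      have tri: "\<bar>a - b + e\<bar> \<le> \<bar>a\<bar> + \<bar>b\<bar> + e" if "0 \<le> e" for a b e :: real using that by linarith
      have "\<bar>g x * rho x\<bar> = \<bar>g x\<bar> * rho x" using rho(2)[of x] by (simp add: abs_mult)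
      moreover have "0 \<le> c * (norm1 x * rho x + exp (- norm1 x - 1))" using c0 rho(2)[of x] by simp
      ultimately show ?thesis using tri by metis
    qed
    also have "\<dots> \<le> B * rho x + D + c * (norm1 x * rho x + exp (- norm1 x - 1))"
      using that rho(2)[of x] D[of "g x"] by (intro add_mono mult_right_mono) (auto simp: abs_le_iff)
    finally have "\<bar>H g x\<bar> \<le> eta x * (B * rho x + D + c * (norm1 x * rho x + exp (- norm1 x - 1)))"
      unfolding H_def using eta01(1)[of x] by (auto simp: abs_mult intro!: mult_left_mono)
    then show ?thesis unfolding w_def by (simp add: algebra_simps)
  qed
  have bound: "(LBINT x. H g x) \<le> C0" if g: "continuous_on UNIV g" "\<And>x. \<bar>g x\<bar> \<le> B" for g
  proof -
    have s1: "compactly_supported (\<lambda>x. eta x * g x)" using eta g by (intro compactly_supported_mult)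
    have s2: "compactly_supported (\<lambda>x. eta x * fstar (g x))"
      using eta continuous_on_compose2[OF fstar_continuous g(1)] by (intro compactly_supported_mult) auto
    have [measurable]: "g \<in> borel_measurable borel" using g by (intro borel_measurable_continuous_onI)
    note i12 = compactly_supported_mult_integrable[OF s1 irho] compactly_supported_integrable[OF s2]
    have "(LBINT x. H g x) = (LBINT x. eta x * g x * rho x - eta x * fstar (g x) + c * (eta x * norm1 x * rho x + eta x * exp (- norm1 x - 1)))"
      unfolding H_def by (intro Bochner_Integration.integral_cong) (auto simp: algebra_simps)
    also have "\<dots> = (LBINT x. eta x * g x * rho x) - (LBINT x. eta x * fstar (g x))
       + c * ((LBINT x. eta x * norm1 x * rho x) + (LBINT x. eta x * exp (- norm1 x - 1)))"
      using i12 i34 by simp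
    also have "\<dots> = (LINT x|mu. eta x * g x) - (LBINT x. eta x * fstar (g x))
       + c * ((LINT x|mu. eta x * norm1 x) + (LBINT x. eta x * exp (- norm1 x - 1)))"
      unfolding rho(3) using rho(2) by (simp add: integral_real_density mult.commute)
    also have "\<dots> \<le> C0" by (rule dual_bound[OF eta eta01 g(1)])
    finally show ?thesis .
  qed
  have "psi \<in> borel_measurable lebesgue" using psi by (simp add: measurable_completion)
  then have "psi measurable_on UNIV" by (intro lebesgue_measurable_imp_measurable_on) auto
  then obtain N g where N: "negligible N" and g: "\<And>n. continuous_on UNIV (g n)" and
    glim: "\<And>x. x \<notin> N \<Longrightarrow> (\<lambda>n. g n x) \<longlonglongrightarrow> psi x"
    unfolding measurable_on_def by auto
  have AEN: "AE x in lborel. x \<notin> N"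
    using N unfolding negligible_iff_null_sets by (metis AE_completion_iff AE_not_in)
  define G where "G n x = clB (g n x)" for n x
  have cG: "continuous_on UNIV (G n)" for n unfolding G_def clB_def by (intro continuous_intros g)
  have [measurable]: "G n \<in> borel_measurable borel" for n using cG by (rule borel_measurable_continuous_onI)
  have [measurable]: "H psi \<in> borel_measurable borel" "H (G n) \<in> borel_measurable borel" for n unfolding H_def by measurable
  have Glim: "(\<lambda>n. H (G n) x) \<longlonglongrightarrow> H psi x" if "x \<notin> N" for x
  proof -
    have "(\<lambda>n. G n x) \<longlonglongrightarrow> clB (psi x)" unfolding G_def clB_def by (intro tendsto_intros glim that)
    then have l: "(\<lambda>n. G n x) \<longlonglongrightarrow> psi x" using clB(2)[OF B] by simp
    have "(\<lambda>n. fstar (G n x)) \<longlonglongrightarrow> fstar (psi x)" by (rule continuous_on_tendsto_compose[OF fstar_continuous l]) auto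
    then show ?thesis unfolding H_def by (intro tendsto_intros l)
  qed
  have "integrable lborel (H psi)"
    by (rule Bochner_Integration.integrable_bound[OF iw]) (use order_trans[OF Hw[of psi, OF B] abs_ge_self] in auto)
  then show "integrable lborel (\<lambda>x. eta x * (psi x * rho x - fstar (psi x) + c * (norm1 x * rho x + exp (- norm1 x - 1))))"
    unfolding H_def .
  have "(\<lambda>n. LBINT x. H (G n) x) \<longlonglongrightarrow> (LBINT x. H psi x)"
  proof (rule integral_dominated_convergence[where w=w])
    show "AE x in lborel. (\<lambda>n. H (G n) x) \<longlonglongrightarrow> H psi x" using AEN by eventually_elim (rule Glim)
    show "AE x in lborel. norm (H (G n) x) \<le> w x" for n using Hw clB(1) unfolding G_def by auto
  qed (use iw in auto)
  then have "(LBINT x. H psi x) \<le> C0"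
    by (rule LIMSEQ_le_const2) (use bound[OF cG] clB(1) in "auto simp: G_def")
  then show "(LBINT x. eta x * (psi x * rho x - fstar (psi x) + c * (norm1 x * rho x + exp (- norm1 x - 1)))) \<le> C0"
    unfolding H_def .
qed

text \<open>When psi is the slope at the clamped density, psi * rho - fstar psi is the value at rho
  of a tangent, and these values tend to f rho. They may be negative; adding the integrable function
  \<open>w\<close> makes Fatou's lemma applicable, and the integral of \<open>w\<close> cancels at
  the end.\<close>

lemma shifted_energy_local_bound:
  assumes rho: "rho \<in> borel_measurable borel" "\<And>x. 0 \<le> rho x" "mu = lebesgue_density rho"
    and eta: "compactly_supported eta" and eta01: "\<And>x. 0 \<le> eta x" "\<And>x. eta x \<le> 1"
  shows "(\<integral>\<^sup>+x. ennreal (eta x * shifted x (rho x)) \<partial>lborel) \<le> ennreal C0"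
proof -
  note [measurable] = rho(1)
  interpret finite_measure mu by (rule fin)
  have [measurable]: "eta \<in> borel_measurable borel" using eta by (rule compactly_supported_measurable)
  have irho: "integrable lborel rho"
  proof -
    have "integrable mu (\<lambda>_. 1::real)" by simp
    then show ?thesis unfolding rho(3) using rho(2) by (subst (asm) integrable_real_density) auto
  qed
  define w where "w x = eta x * (\<bar>subgrad 1\<bar> * rho x + \<bar>fstar (subgrad 1)\<bar>)" for x
  have iw: "integrable lborel w"
  proof -
    have "integrable lborel (\<lambda>x. \<bar>subgrad 1\<bar> * (eta x * rho x) + \<bar>fstar (subgrad 1)\<bar> * eta x)"
      using compactly_supported_mult_integrable[OF eta irho] compactly_supported_integrable[OF eta] by simp
    then show ?thesis unfolding w_def by (simp add: algebra_simps)
  qed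
  have w0: "0 \<le> w x" for x unfolding w_def using eta01 rho(2) by simp
  define E where "E x = c * (norm1 x * rho x + exp (- norm1 x - 1))" for x
  have E0: "0 \<le> E x" for x unfolding E_def using c0 rho(2)[of x] by simp
  define u where "u n x = eta x * (tangent (clamp_inv n (rho x)) (rho x) + E x) + w x" for n x
  have u_eq: "eta x * (tangent (clamp_inv n (rho x)) (rho x) + E x) =
      eta x * (subgrad (clamp_inv n (rho x)) * rho x - fstar (subgrad (clamp_inv n (rho x))) + c * (norm1 x * rho x + exp (- norm1 x - 1)))" for n x
    by (simp add: tangent_def E_def)
  have u0: "0 \<le> u n x" for n x
  proof -
    have "eta x * (- (\<bar>subgrad 1\<bar> * rho x + \<bar>fstar (subgrad 1)\<bar>)) \<le> eta x * (tangent (clamp_inv n (rho x)) (rho x) + E x)"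
      using eta01 tangent_clamp_lower[OF rho(2), of x n] E0[of x] by (intro mult_left_mono) auto
    then show ?thesis unfolding u_def w_def by (simp add: algebra_simps)
  qed
  have [measurable]: "(\<lambda>x. subgrad (clamp_inv n (rho x))) \<in> borel_measurable borel" for n by measurable
  have iu: "integrable lborel (u n)" "(LBINT x. u n x) \<le> C0 + (LBINT x. w x)" for n
    using dual_bound_measurable[OF rho eta eta01, of "\<lambda>x. subgrad (clamp_inv n (rho x))", OF _ subgrad_clamp_bounded] iw
    unfolding u_def u_eq by auto
  have [measurable]: "u n \<in> borel_measurable borel" for n using iu(1)[of n] by simp
  have "(\<integral>\<^sup>+x. ennreal (eta x * shifted x (rho x) + w x) \<partial>lborel) \<le> ennreal (C0 + (LBINT x. w x))"
  proof (rule nn_integral_le_of_limit_bounded[where u=u])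
    show "AE x in lborel. (\<lambda>n. u n x) \<longlonglongrightarrow> eta x * shifted x (rho x) + w x"
      unfolding u_def shifted_def E_def[symmetric] by (intro AE_I2 tendsto_intros tangent_clamp_tendsto rho(2))
    show "(\<integral>\<^sup>+x. ennreal (u n x) \<partial>lborel) \<le> ennreal (C0 + (LBINT x. w x))" for n
      using iu u0 by (subst nn_integral_eq_integral) (auto intro: ennreal_leI)
  qed (use rho iw in auto)
  also have "(\<integral>\<^sup>+x. ennreal (eta x * shifted x (rho x) + w x) \<partial>lborel)
      = (\<integral>\<^sup>+x. ennreal (eta x * shifted x (rho x)) \<partial>lborel) + (\<integral>\<^sup>+x. ennreal (w x) \<partial>lborel)"
    using eta01 rho w0 iw by (subst nn_integral_add[symmetric]) (auto simp: shifted_nonneg intro!: nn_integral_cong)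
  also have "(\<integral>\<^sup>+x. ennreal (w x) \<partial>lborel) = ennreal (LBINT x. w x)"
    using iw w0 by (intro nn_integral_eq_integral) auto
  also have "ennreal (C0 + (LBINT x. w x)) = ennreal C0 + ennreal (LBINT x. w x)"
    using C0_nonneg w0 by (intro ennreal_plus integral_nonneg_AE) auto
  finally show ?thesis by (simp add: ennreal_add_left_cancel_le add.commute)
qed

lemma shifted_energy_limit:
  assumes rho: "rho \<in> borel_measurable borel" "\<And>x. 0 \<le> rho x" "mu = lebesgue_density rho"
  shows "shifted_energy rho \<le> ennreal C0"
  unfolding shifted_energy_def
proof (rule nn_integral_le_of_limit_bounded)
  define eta where "eta n x = max 0 (min 1 (real n - norm x))" for n and x :: 'a
  have cs: "compactly_supported (eta n)" for n
    unfolding compactly_supported_def eta_def by (auto intro!: continuous_intros exI[of _ "real n"])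
  note [measurable] = rho(1) compactly_supported_measurable[OF cs]
  show "(\<integral>\<^sup>+x. ennreal (eta n x * shifted x (rho x)) \<partial>lborel) \<le> ennreal C0" for n
    by (rule shifted_energy_local_bound[OF rho cs]) (auto simp: eta_def)
  show "(\<lambda>x. eta n x * shifted x (rho x)) \<in> borel_measurable lborel" for n using rho(2) by simp
  show "(\<lambda>x. shifted x (rho x)) \<in> borel_measurable lborel" using rho by simp
  show "AE x in lborel. (\<lambda>n. eta n x * shifted x (rho x)) \<longlonglongrightarrow> shifted x (rho x)"
  proof (intro AE_I2)
    fix x :: 'a
    obtain M :: nat where M: "real M > norm x + 1" using reals_Archimedean2 by blast
    have "eta n x * shifted x (rho x) = shifted x (rho x)" if "n \<ge> M" for n
    proof -
      have "real n \<ge> real M" using that by simp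
      then show ?thesis using M unfolding eta_def by simp
    qed
    then show "(\<lambda>n. eta n x * shifted x (rho x)) \<longlonglongrightarrow> shifted x (rho x)"
      by (intro tendsto_eventually eventually_sequentiallyI)
  qed
qed

end

end

context internal_energy
begin

text \<open>The internal energy is encoded by its upper bounds: if the energy is infinite or a
  density is missing, no real u qualifies. Limits and mixtures then become statements about real
  numbers.\<close>

definition energy_le :: "'a::euclidean_space measure \<Rightarrow> real \<Rightarrow> bool" where
  "energy_le M u \<longleftrightarrow> (\<exists>r\<in>borel_measurable borel. (\<forall>x. 0 \<le> r x) \<and> M = lebesgue_density r \<and>
     integrable lborel (\<lambda>x. f (r x)) \<and> (LBINT x. f (r x)) \<le> u)"

lemma shifted_energy_eq:
  fixes r :: "'a::euclidean_space \<Rightarrow> real"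
  assumes r: "r \<in> borel_measurable borel" "\<And>x. 0 \<le> r x" and i: "integrable lborel (\<lambda>x. norm1 x * r x)"
    and fi: "integrable lborel (\<lambda>x. f (r x))"
  defines "T \<equiv> (LBINT x. f (r x)) + c * ((LBINT x. norm1 x * r x) + (LBINT (x::'a). exp (- norm1 x - 1)))"
  shows "shifted_energy r = ennreal T" "0 \<le> T"
proof -
  have int: "integrable lborel (\<lambda>x. shifted x (r x))"
    unfolding shifted_def
    by (intro Bochner_Integration.integrable_add integrable_mult_right i fi exp_norm1_integrable)
  have T: "(LBINT x. shifted x (r x)) = T"
    unfolding shifted_def T_def
    by (simp add: i fi exp_norm1_integrable[where 'a='a] Bochner_Integration.integrable_add integrable_mult_right)
  show "shifted_energy r = ennreal T"
    unfolding shifted_energy_def T[symmetric] by (rule nn_integral_eq_integral[OF int]) (simp add: shifted_nonneg r)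
  show "0 \<le> T" unfolding T[symmetric] by (intro integral_nonneg_AE AE_I2 shifted_nonneg r)
qed

lemma integrable_of_shifted_energy:
  fixes r :: "'a::euclidean_space \<Rightarrow> real"
  assumes r: "r \<in> borel_measurable borel" "\<And>x. 0 \<le> r x" and i: "integrable lborel (\<lambda>x. norm1 x * r x)"
    and fin: "shifted_energy r < \<infinity>"
  shows "integrable lborel (\<lambda>x. f (r x))"
proof -
  have "integrable lborel (\<lambda>x. shifted x (r x))"
    using fin r unfolding shifted_energy_def by (intro integrableI_nonneg) (auto simp: shifted_nonneg)
  then have "integrable lborel (\<lambda>x. shifted x (r x) - c * (norm1 x * r x + exp (- norm1 x - 1)))"
    by (intro Bochner_Integration.integrable_diff Bochner_Integration.integrable_add integrable_mult_right i exp_norm1_integrable)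
  then show ?thesis by (simp add: shifted_def)
qed

text \<open>Adding c times the first moment and a constant makes the integrand nonnegative; the
  bounds a k for the added moments converge to the moment of mu, which is subtracted again in the
  limit. The total mass of r k is left free, to fit the box densities constructed later, which lose
  the mass of the bad cells.\<close>

lemma energy_le_limit:
  fixes r :: "nat \<Rightarrow> 'a::euclidean_space \<Rightarrow> real"
  assumes r: "\<And>k. r k \<in> borel_measurable borel" "\<And>k x. 0 \<le> r k x" "\<And>k. integrable lborel (r k)"
    and mu: "mu \<in> P2"
    and vague: "\<And>g. compactly_supported g \<Longrightarrow> (\<lambda>k. LBINT x. g x * r k x) \<longlonglongrightarrow> (LINT x|mu. g x)"
    and n1: "\<And>k. integrable lborel (\<lambda>x. norm1 x * r k x)" "\<And>k. (LBINT x. norm1 x * r k x) \<le> a k"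
    and a: "a \<longlonglongrightarrow> (LINT x|mu. norm1 x)"
    and fi: "\<And>k. integrable lborel (\<lambda>x. f (r k x))" "\<And>k. (LBINT x. f (r k x)) \<le> u k"
    and u: "u \<longlonglongrightarrow> v"
  shows "energy_le mu v"
proof -
  define E where "E = (LBINT (x::'a). exp (- norm1 x - 1))"
  define C where "C k = u k + c * (a k + E)" for k
  interpret prob_space mu using mu by (rule P2_prob)
  note sq = shifted_energy_eq[OF r(1,2) n1(1) fi(1), folded E_def]
  have le: "(LBINT x. f (r k x)) + c * ((LBINT x. norm1 x * r k x) + E) \<le> C k" for k
    unfolding C_def using c0 fi(2) n1(2) by (intro add_mono mult_left_mono) auto
  have C0: "0 \<le> C k" for k using order_trans[OF sq(2) le] .
  have en: "shifted_energy (r k) \<le> ennreal (C k)" for k unfolding sq(1) using le by (rule ennreal_leI)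
  have Cl: "C \<longlonglongrightarrow> v + c * ((LINT x|mu. norm1 x) + E)" unfolding C_def by (intro tendsto_intros u a)
  define rho where "rho = leb_density mu"
  have ac: "absolutely_continuous lborel mu"
    by (rule limit_absolutely_continuous[OF r finite_measure_axioms P2_sets[OF mu] vague en C0 Cl])
  have rho: "rho \<in> borel_measurable borel" "\<And>x. 0 \<le> rho x" "mu = lebesgue_density rho"
    unfolding rho_def using density_leb_density[OF finite_measure_axioms P2_sets[OF mu] ac] by auto
  have sh: "shifted_energy rho \<le> ennreal (v + c * ((LINT x|mu. norm1 x) + E))"
    by (rule shifted_energy_limit[OF r finite_measure_axioms P2_sets[OF mu] vague en C0 Cl rho])
  have irho: "integrable lborel (\<lambda>x. norm1 x * rho x)"
    using P2_norm1_integrable[OF mu] rho(1,2) unfolding rho(3) by (simp add: integrable_real_density mult.commute)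
  have erho: "(LBINT x. norm1 x * rho x) = (LINT x|mu. norm1 x)"
    using rho(1,2) unfolding rho(3) by (simp add: integral_real_density mult.commute)
  have ifrho: "integrable lborel (\<lambda>x. f (rho x))"
    by (rule integrable_of_shifted_energy[OF rho(1,2) irho]) (use sh in "auto intro: le_less_trans")
  have "ennreal ((LBINT x. f (rho x)) + c * ((LINT x|mu. norm1 x) + E)) \<le> ennreal (v + c * ((LINT x|mu. norm1 x) + E))"
    using sh shifted_energy_eq(1)[OF rho(1,2) irho ifrho] unfolding erho E_def by simp
  moreover have "0 \<le> v + c * ((LINT x|mu. norm1 x) + E)" using LIMSEQ_le_const[OF Cl] C0 by blast
  ultimately have "(LBINT x. f (rho x)) \<le> v" by (simp add: ennreal_le_iff)
  then show ?thesis unfolding energy_le_def using rho ifrho by blast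
qed

lemma energy_le_limit_distr:
  fixes X :: "nat \<Rightarrow> 'w \<Rightarrow> 'a::euclidean_space"
  assumes "prob_space Om" and [measurable]: "\<And>k. X k \<in> borel_measurable Om" "Y \<in> borel_measurable Om"
    and lim: "converges_AE Om X Y"
    and X: "\<And>k. moment2 Om (X k) \<le> ennreal C"
    and en: "\<And>k. energy_le (distr Om borel (X k)) (u k)" and u: "u \<longlonglongrightarrow> v"
  shows "energy_le (distr Om borel Y) v"
proof -
  interpret prob_space Om by fact
  have XP: "distr Om borel (X k) \<in> P2" for k
    using X[of k] by (auto simp: distr_in_P2_iff intro: le_less_trans)
  have "moment2 Om Y \<le> ennreal C"
  proof (rule nn_integral_le_of_limit_bounded[where u="\<lambda>k w. norm (X k w) ^ 2"])
    show "AE w in Om. (\<lambda>k. norm (X k w) ^ 2) \<longlonglongrightarrow> norm (Y w) ^ 2"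
      using lim by eventually_elim (intro tendsto_intros)
  qed (use X in auto)
  then have YP: "distr Om borel Y \<in> P2" by (auto simp: distr_in_P2_iff intro: le_less_trans)
  have "\<forall>k. \<exists>r. r \<in> borel_measurable borel \<and> (\<forall>x. 0 \<le> r x) \<and> distr Om borel (X k) = lebesgue_density r \<and>
     integrable lborel (\<lambda>x. f (r x)) \<and> (LBINT x. f (r x)) \<le> u k"
    using en unfolding energy_le_def by blast
  then obtain r where r: "\<And>k. r k \<in> borel_measurable borel" "\<And>k x. 0 \<le> r k x"
    "\<And>k. distr Om borel (X k) = lebesgue_density (r k)"
    "\<And>k. integrable lborel (\<lambda>x. f (r k x))" "\<And>k. (LBINT x. f (r k x)) \<le> u k"
    by metis
  note [measurable] = r(1)
  have dens: "(LBINT x. g x * r k x) = (LINT w|Om. g (X k w))" if [measurable]: "g \<in> borel_measurable borel" for g k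
  proof -
    have "(LBINT x. g x * r k x) = (\<integral>x. g x \<partial>lebesgue_density (r k))"
      using r(2) by (simp add: integral_real_density mult.commute)
    also have "\<dots> = (LINT w|Om. g (X k w))" unfolding r(3)[symmetric] by (simp add: integral_distr)
    finally show ?thesis .
  qed
  have densi: "integrable lborel (\<lambda>x. g x * r k x)" if "integrable (distr Om borel (X k)) g" for g k
    using that r(2) borel_measurable_integrable[OF that] unfolding r(3)
    by (subst (asm) integrable_real_density) (auto simp: mult.commute)
  show ?thesis
  proof (rule energy_le_limit[OF r(1,2) _ YP _ _ _ _ r(4,5) u, where a="\<lambda>k. LBINT x. norm1 x * r k x"])
    show "integrable lborel (r k)" for k
      using densi[of k "\<lambda>_. 1"] prob_space.finite_measure[OF P2_prob[OF XP[of k]]]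
      by (simp add: finite_measure.integrable_const)
    show "(\<lambda>k. LBINT x. g x * r k x) \<longlonglongrightarrow> (\<integral>x. g x \<partial>distr Om borel Y)" if g: "compactly_supported g" for g
    proof -
      have [measurable]: "g \<in> borel_measurable borel" using g by (rule compactly_supported_measurable)
      obtain B where "\<And>x. \<bar>g x\<bar> \<le> B" using compactly_supported_bounded[OF g] by blast
      then have "continuous_on UNIV g" "bounded (range g)"
        using g by (auto simp: compactly_supported_def bounded_iff)
      then have "(\<lambda>k. \<integral>x. g x \<partial>distr Om borel (X k)) \<longlonglongrightarrow> (\<integral>x. g x \<partial>distr Om borel Y)"
        using narrowly_converges_distr[OF _ _ lim] unfolding narrowly_converges_def by simp
      then show ?thesis by (simp add: dens integral_distr)
    qed
    show "integrable lborel (\<lambda>x. norm1 x * r k x)" for k using P2_norm1_integrable[OF XP] by (rule densi)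
    show "(\<lambda>k. LBINT x. norm1 x * r k x) \<longlonglongrightarrow> (\<integral>x. norm1 x \<partial>distr Om borel Y)"
    proof -
      have "\<bar>norm1 (x::'a)\<bar> \<le> DIM('a) * (1 + norm x)" for x
        using norm1_le_norm[of x] by (simp add: algebra_simps)
      then have "(\<lambda>k. LINT w|Om. norm1 (X k w)) \<longlonglongrightarrow> (LINT w|Om. norm1 (Y w))"
        by (intro expectation_tendsto_linear_growth[OF _ _ lim X]) (auto intro: continuous_on_norm1 continuous_on_id)
      then show ?thesis by (simp add: dens integral_distr)
    qed
  qed auto
qed

end

subsection \<open>Matching quantile cells\<close>

definition wide :: "real \<Rightarrow> real set \<Rightarrow> bool" where
  "wide de S \<longleftrightarrow> (\<exists>s\<in>S. \<exists>s'\<in>S. de < s' - s)"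

text \<open>Without atoms the distribution function is continuous and takes the value v at some q.
  The sublevel set contains the half line up to q and ends at a point where the distribution
  function is still at most v.\<close>

lemma (in finite_borel_measure) measure_cdf_le:
  assumes atoms: "\<And>x. measure M {x} = 0" and v: "0 < v" "v \<le> measure M UNIV"
  shows "measure M {s. cdf M s \<le> v} = v"
proof (cases "v = measure M UNIV")
  case True
  then have "{s. cdf M s \<le> v} = UNIV" using cdf_bounded by (auto simp: borel_UNIV)
  with True show ?thesis by simp
next
  case False
  with v have v: "0 < v" "v < measure M UNIV" by auto
  have cont: "continuous_on UNIV (cdf M)"
    using isCont_cdf atoms by (simp add: continuous_at_imp_continuous_on)
  define S where "S = {s. cdf M s \<le> v}"
  have clS: "closed S" unfolding S_def using cont by (intro closed_Collect_le) auto
  obtain s0 where s0: "cdf M s0 < v"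
    using order_tendstoD(2)[OF cdf_lim_at_bot v(1)] by (auto simp: eventually_at_bot_linorder)
  obtain s1 where s1: "v < cdf M s1"
    using order_tendstoD(1)[OF cdf_lim_at_top, of v] v(2) by (auto simp: eventually_at_top_linorder borel_UNIV)
  have s01: "s0 \<le> s1" using cdf_nondecreasing[of s1 s0] s0 s1 by linarith
  obtain q where q: "cdf M q = v"
    using IVT'[of "cdf M" s0 v s1] s0 s1 s01 continuous_on_subset[OF cont] by auto
  have bdd: "bdd_above S"
  proof (rule bdd_aboveI[of _ s1])
    fix s assume "s \<in> S"
    then show "s \<le> s1" using cdf_nondecreasing[of s1 s] s1 unfolding S_def by fastforce
  qed
  have "Sup S \<in> S" using s0 by (intro closed_contains_Sup bdd clS) (auto simp: S_def intro: less_imp_le)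
  then have le: "cdf M (Sup S) \<le> v" by (simp add: S_def)
  have "measure M S \<le> cdf M (Sup S)"
    unfolding cdf_def2 using bdd clS by (intro finite_measure_mono) (auto intro: cSup_upper)
  moreover have "cdf M q \<le> measure M S"
    unfolding cdf_def2 using clS cdf_nondecreasing[of _ q] q
    by (intro finite_measure_mono) (auto simp: S_def borel_closed)
  ultimately show ?thesis using le q unfolding S_def by simp
qed

lemma (in finite_borel_measure) quantile_index:
  assumes atoms: "\<And>x. measure M {x} = 0" and m: "0 < measure M UNIV" and n: "0 < (n::nat)"
  obtains idx :: "real \<Rightarrow> nat" where "mono idx" "\<And>s. idx s < n"
    "\<And>k. k < n \<Longrightarrow> measure M (idx -` {k}) = measure M UNIV / n" "\<And>k. idx -` {k} \<in> sets borel"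
proof -
  define m where "m = measure M UNIV"
  have m0: "0 < m" using m by (simp add: m_def)
  define x where "x s = n * cdf M s / m" for s
  \<comment> \<open>Level k is where n * cdf / m lies in (k, k + 1]; truncated subtraction adds the
    points with value 0 to level 0.\<close>
  define idx where "idx s = nat \<lceil>x s\<rceil> - 1" for s
  have xmono: "x s \<le> x t" if "s \<le> t" for s t
    unfolding x_def using m0 cdf_nondecreasing[OF that] by (intro divide_right_mono mult_left_mono) auto
  have mono: "mono idx"
    unfolding mono_def idx_def using xmono by (auto intro!: diff_le_mono nat_mono ceiling_mono)
  have xn: "x s \<le> n" for s
    unfolding x_def using m0 cdf_bounded[of s] by (simp add: m_def borel_UNIV field_simps mult_left_mono)
  then have "\<lceil>x s\<rceil> \<le> int n" for s by (simp add: ceiling_le_iff)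
  then have nx: "nat \<lceil>x s\<rceil> \<le> n" for s by (simp add: nat_le_iff)
  have less: "idx s < n" for s unfolding idx_def using n nx[of s] by linarith
  have le_iff: "idx s \<le> k \<longleftrightarrow> cdf M s \<le> real (k + 1) * m / n" for s k
  proof -
    have "idx s \<le> k \<longleftrightarrow> nat \<lceil>x s\<rceil> \<le> k + 1" unfolding idx_def by linarith
    also have "\<dots> \<longleftrightarrow> x s \<le> real (k + 1)" by (simp add: nat_le_iff ceiling_le_iff)
    also have "\<dots> \<longleftrightarrow> cdf M s \<le> real (k + 1) * m / n" unfolding x_def using m0 n by (simp add: field_simps)
    finally show ?thesis .
  qed
  have meas: "{s. idx s \<le> k} \<in> sets borel" for k
  proof -
    have "is_interval {s. idx s \<le> k}"
      unfolding is_interval_1 using monoD[OF mono] by (auto intro: order_trans)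
    then show ?thesis by (rule real_interval_borel_measurable)
  qed
  have le: "measure M {s. idx s \<le> k} = real (k + 1) * m / n" if "k < n" for k
    unfolding le_iff
  proof (rule measure_cdf_le[OF atoms])
    show "0 < real (k + 1) * m / n" using m0 n by simp
    have "real (k + 1) * m \<le> n * m" using that m0 by (intro mult_right_mono) auto
    then show "real (k + 1) * m / n \<le> measure M UNIV" using n by (simp add: m_def field_simps)
  qed
  have pre: "idx -` {k} = {s. idx s \<le> k} - (if k = 0 then {} else {s. idx s \<le> k - 1})" for k by auto
  have "measure M (idx -` {k}) = m / n" if "k < n" for k
  proof (cases "k = 0")
    case True then show ?thesis unfolding pre using le[of 0] that by simp
  next
    case False
    have "measure M (idx -` {k}) = measure M {s. idx s \<le> k} - measure M {s. idx s \<le> k - 1}"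
      unfolding pre using False meas by (simp, intro finite_measure_Diff) auto
    also have "\<dots> = m / n" using le[of k] le[of "k - 1"] that False by (simp add: field_simps)
    finally show ?thesis .
  qed
  moreover have "idx -` {k} \<in> sets borel" for k
    unfolding pre by (intro sets.Diff meas) (use meas[of "k - 1"] in auto)
  ultimately show ?thesis using that[OF mono less] unfolding m_def by blast
qed

text \<open>A level set of a monotone map that is longer than \<open>de\<close> and meets \<open>{- L..L}\<close> contains a point of a
  fixed finite grid of mesh \<open>de / 2\<close>.\<close>

lemma card_wide_levels:
  fixes de L :: real assumes "0 < de"
  obtains z :: nat where "\<And>idx :: real \<Rightarrow> nat. mono idx \<Longrightarrow>
    finite {k. wide de (idx -` {k}) \<and> idx -` {k} \<inter> {- L..L} \<noteq> {}} \<and>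
    card {k. wide de (idx -` {k}) \<and> idx -` {k} \<inter> {- L..L} \<noteq> {}} \<le> z"
proof -
  define h where "h = de / 2"
  have h: "0 < h" using assms by (simp add: h_def)
  define Mz where "Mz = \<lceil>L / h\<rceil> + 2"
  define Z where "Z = (\<lambda>j::int. j * h) ` {- Mz..Mz}"
  have "{k. wide de (idx -` {k}) \<and> idx -` {k} \<inter> {- L..L} \<noteq> {}} \<subseteq> idx ` Z" if mono: "mono idx" for idx :: "real \<Rightarrow> nat"
  proof
    fix k assume k: "k \<in> {k. wide de (idx -` {k}) \<and> idx -` {k} \<inter> {- L..L} \<noteq> {}}"
    then obtain s s' where "s \<in> idx -` {k}" "s' \<in> idx -` {k}" and s3: "de < s' - s" unfolding wide_def by blast
    then have s: "idx s = k" "idx s' = k" "de < s' - s" by auto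
    from k obtain p where "p \<in> idx -` {k}" "p \<in> {- L..L}" by blast
    then have p: "idx p = k" "- L \<le> p" "p \<le> L" by auto
    have conv: "idx u = k" if "a \<le> u" "u \<le> b" "idx a = k" "idx b = k" for a u b
      using monoD[OF mono that(1)] monoD[OF mono that(2)] that(3,4) by simp
    define u where "u = p / h"
    have pu: "p = u * h" using h by (simp add: u_def)
    have Lh: "u \<le> L / h" "- (L / h) \<le> u" unfolding u_def using p h by (auto simp: field_simps)
    have up: "p \<le> \<lceil>u\<rceil> * h" "\<lceil>u\<rceil> * h \<le> (u + 1) * h" unfolding pu using h by (intro mult_right_mono; linarith)+
    have dn: "\<lfloor>u\<rfloor> * h \<le> p" "(u - 1) * h \<le> \<lfloor>u\<rfloor> * h" unfolding pu using h by (intro mult_right_mono; linarith)+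
    show "k \<in> idx ` Z"
    \<comment> \<open>One of s, s' is at least h = de / 2 away from p. Rounding p / h up or down
      gives a grid point between p and that point, and monotonicity keeps it in the level.\<close>
    proof (cases "s' - p \<ge> h")
      case True
      have "idx (\<lceil>u\<rceil> * h) = k"
      proof (rule conv[OF up(1) _ p(1) s(2)])
        have "(u + 1) * h = p + h" unfolding pu by (simp add: distrib_right)
        then show "\<lceil>u\<rceil> * h \<le> s'" using up(2) True by linarith
      qed
      moreover have "\<lceil>u\<rceil> \<in> {- Mz..Mz}"
        unfolding Mz_def atLeastAtMost_iff using Lh by linarith
      ultimately show ?thesis unfolding Z_def by blast
    next
      case False
      then have "p - s \<ge> h" using s(3) by (simp add: h_def)
      then have "idx (\<lfloor>u\<rfloor> * h) = k"
      proof (intro conv[OF _ dn(1) s(1) p(1)])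
        assume "p - s \<ge> h"
        moreover have "(u - 1) * h = p - h" unfolding pu by (simp add: left_diff_distrib)
        ultimately show "s \<le> \<lfloor>u\<rfloor> * h" using dn(2) by linarith
      qed
      moreover have "\<lfloor>u\<rfloor> \<in> {- Mz..Mz}"
        unfolding Mz_def atLeastAtMost_iff using Lh by linarith
      ultimately show ?thesis unfolding Z_def by blast
    qed
  qed
  moreover have "finite Z" unfolding Z_def by simp
  ultimately have "finite {k. wide de (idx -` {k}) \<and> idx -` {k} \<inter> {- L..L} \<noteq> {}} \<and>
    card {k. wide de (idx -` {k}) \<and> idx -` {k} \<inter> {- L..L} \<noteq> {}} \<le> card Z" if "mono idx" for idx :: "real \<Rightarrow> nat"
    using that by (meson card_image_le card_mono finite_imageI finite_subset order_trans)
  then show ?thesis by (rule that)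
qed

text \<open>Wide levels meeting [- l, l] are at most z in number, whatever n is, and each has mass m
  / n; the other wide levels lie in the tail. Each contribution is at most ep / 2 for all large n,
  and not just for one n, because the two marginals of a cell pair must be cut into the same number
  of pieces.\<close>

lemma (in finite_borel_measure) quantile_split:
  assumes atoms: "\<And>x. measure M {x} = 0" and m: "0 < measure M UNIV" and de: "0 < de" and ep: "0 < ep"
  obtains n0 :: nat where "0 < n0" "\<And>n. n0 \<le> n \<Longrightarrow> \<exists>idx :: real \<Rightarrow> nat. mono idx \<and> (\<forall>s. idx s < n) \<and>
    (\<forall>k<n. measure M (idx -` {k}) = measure M UNIV / n) \<and> (\<forall>k. idx -` {k} \<in> sets borel) \<and>
    (\<Sum>k | k < n \<and> wide de (idx -` {k}). measure M UNIV / n) \<le> ep"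
proof -
  have "(\<lambda>l. measure M (- {- real l..real l})) \<longlonglongrightarrow> measure M (\<Inter>l::nat. - {- real l..real l})"
    by (intro finite_Lim_measure_decseq) (auto simp: decseq_def)
  also have "(\<Inter>l::nat. - {- real l..real l}) = {}"
  proof -
    have "\<exists>l::nat. s \<in> {- real l..real l}" for s
    proof -
      obtain l :: nat where "\<bar>s\<bar> < real l" using reals_Archimedean2 by blast
      then have "s \<in> {- real l..real l}" by auto
      then show ?thesis ..
    qed
    then show ?thesis by blast
  qed
  finally have "(\<lambda>l. measure M (- {- real l..real l})) \<longlonglongrightarrow> 0" by simp
  from order_tendstoD(2)[OF this, of "ep / 2"] ep obtain l :: nat where l: "measure M (- {- real l..real l}) < ep / 2"
    by (auto simp: eventually_sequentially)
  define L where "L = real l"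
  obtain z :: nat where z: "\<And>idx :: real \<Rightarrow> nat. mono idx \<Longrightarrow>
    finite {k. wide de (idx -` {k}) \<and> idx -` {k} \<inter> {- L..L} \<noteq> {}} \<and>
    card {k. wide de (idx -` {k}) \<and> idx -` {k} \<inter> {- L..L} \<noteq> {}} \<le> z"
    using card_wide_levels[OF de, of L] by blast
  define m where "m = measure M UNIV"
  obtain n1 :: nat where n1: "2 * real z * m / ep < n1" using reals_Archimedean2 by blast
  show ?thesis
  proof (rule that[of "Suc n1"])
    fix n assume n: "Suc n1 \<le> n"
    then have n0: "0 < n" by simp
    obtain idx :: "real \<Rightarrow> nat" where idx: "mono idx" "\<And>s. idx s < n"
      "\<And>k. k < n \<Longrightarrow> measure M (idx -` {k}) = m / n" "\<And>k. idx -` {k} \<in> sets borel"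
      using quantile_index[OF atoms m n0] unfolding m_def by blast
    define W where "W = {k. k < n \<and> wide de (idx -` {k})}"
    define W1 where "W1 = {k\<in>W. idx -` {k} \<inter> {- L..L} \<noteq> {}}"
    define W2 where "W2 = {k\<in>W. idx -` {k} \<inter> {- L..L} = {}}"
    have fW: "finite W" unfolding W_def by simp
    have "(\<Sum>k\<in>W. m / n) = (\<Sum>k\<in>W1. m / n) + (\<Sum>k\<in>W2. m / n)"
    proof -
      have "W = W1 \<union> W2" by (auto simp: W1_def W2_def)
      then show ?thesis using fW by (simp only:) (rule sum.union_disjoint; auto simp: W1_def W2_def)
    qed
    also have "(\<Sum>k\<in>W1. m / n) \<le> ep / 2"
    proof -
      have "card W1 \<le> card {k. wide de (idx -` {k}) \<and> idx -` {k} \<inter> {- L..L} \<noteq> {}}"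
        using z[OF idx(1)] by (intro card_mono) (auto simp: W1_def W_def)
      then have "card W1 \<le> z" using z[OF idx(1)] by simp
      then have "card W1 * m \<le> z * m" using m by (intro mult_right_mono) (auto simp: m_def)
      moreover have "2 * real z * m \<le> n * ep"
      proof -
        have "2 * real z * m / ep \<le> n" using n1 n by simp
        then show ?thesis using ep by (simp add: field_simps)
      qed
      ultimately show ?thesis using n0 by (simp add: field_simps)
    qed
    also have "(\<Sum>k\<in>W2. m / n) \<le> ep / 2"
    proof -
      have "(\<Sum>k\<in>W2. m / n) = (\<Sum>k\<in>W2. measure M (idx -` {k}))"
        using idx(3) by (intro sum.cong) (auto simp: W2_def W_def)
      also have "\<dots> = measure M (\<Union>k\<in>W2. idx -` {k})"
        using idx(4) fW by (intro finite_measure_finite_Union[symmetric]) (auto simp: W2_def disjoint_family_on_def)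
      also have "\<dots> \<le> measure M (- {- L..L})"
        by (intro finite_measure_mono) (auto simp: W2_def)
      finally show ?thesis using l unfolding L_def by linarith
    qed
    finally have "(\<Sum>k\<in>W. m / n) \<le> ep" by simp
    then show "\<exists>idx :: real \<Rightarrow> nat. mono idx \<and> (\<forall>s. idx s < n) \<and>
      (\<forall>k<n. measure M (idx -` {k}) = measure M UNIV / n) \<and> (\<forall>k. idx -` {k} \<in> sets borel) \<and>
      (\<Sum>k | k < n \<and> wide de (idx -` {k}). measure M UNIV / n) \<le> ep"
      using idx unfolding W_def m_def by blast
  qed simp
qed

section \<open>Recursive splitting into matched cells\<close>

definition cell :: "('a::euclidean_space \<Rightarrow> real set) \<Rightarrow> 'a set" where
  "cell A = {x. \<forall>e\<in>Basis. x \<bullet> e \<in> A e}"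

definition interval_family :: "('a::euclidean_space \<Rightarrow> real set) \<Rightarrow> bool" where
  "interval_family A \<longleftrightarrow> (\<forall>e\<in>Basis. is_interval (A e))"

type_synonym 'a cell_pair = "('a \<Rightarrow> real set) \<times> ('a \<Rightarrow> real set)"

definition narrow_pair :: "real \<Rightarrow> 'a set \<Rightarrow> 'a cell_pair \<Rightarrow> bool" where
  "narrow_pair de J P \<longleftrightarrow> (\<forall>e\<in>J. \<not> wide de (fst P e) \<and> \<not> wide de (snd P e))"

text \<open>Asking for one coordinate and one direction common to both marginals is what keeps the
  interpolated boxes disjoint: convex combinations preserve an order shared by both ends.\<close>

definition separated :: "'a::euclidean_space cell_pair \<Rightarrow> 'a cell_pair \<Rightarrow> bool" where
  "separated P Q \<longleftrightarrow> (\<exists>e\<in>Basis.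
     ((\<forall>s\<in>fst P e. \<forall>s'\<in>fst Q e. s < s') \<and> (\<forall>s\<in>snd P e. \<forall>s'\<in>snd Q e. s < s')) \<or>
     ((\<forall>s\<in>fst P e. \<forall>s'\<in>fst Q e. s' < s) \<and> (\<forall>s\<in>snd P e. \<forall>s'\<in>snd Q e. s' < s)))"

lemma cell_measurable:
  assumes "interval_family A" shows "cell A \<in> sets borel"
proof -
  have eq: "cell A = (\<Inter>e\<in>Basis. (\<lambda>x. x \<bullet> e) -` A e \<inter> space borel)" by (auto simp: cell_def)
  have "A e \<in> sets borel" if "e \<in> Basis" for e
    using assms that by (auto simp: interval_family_def intro: real_interval_borel_measurable)
  then have "(\<lambda>x. x \<bullet> e) -` A e \<inter> space borel \<in> sets (borel :: 'a measure)" if "e \<in> Basis" for e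
    using that by (intro measurable_sets[of _ borel borel]) auto
  then have "(\<Inter>e\<in>Basis. (\<lambda>x. x \<bullet> e) -` A e \<inter> space borel) \<in> sets (borel :: 'a measure)"
    by (intro sets.finite_INT) auto
  then show ?thesis unfolding eq .
qed

lemma cell_update:
  assumes "e \<in> Basis" "A e = UNIV"
  shows "cell (A(e := S)) = cell A \<inter> {x. x \<bullet> e \<in> S}"
  using assms by (auto simp: cell_def)

lemma separated_not_refl:
  assumes "separated P P" shows "cell (fst P) = {}"
proof (rule ccontr)
  assume "cell (fst P) \<noteq> {}"
  then obtain x where "\<And>e. e \<in> Basis \<Longrightarrow> x \<bullet> e \<in> fst P e" by (auto simp: cell_def)
  with assms show False unfolding separated_def by (meson less_irrefl)
qed

definition marginal_on :: "'a::euclidean_space measure \<Rightarrow> 'a set \<Rightarrow> 'a \<Rightarrow> real measure" where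
  "marginal_on al R e = distr (density al (indicator R)) borel (\<lambda>x. x \<bullet> e)"

lemma
  fixes al :: "'a::euclidean_space measure"
  assumes "prob_space al" and sal: "sets al = sets borel" and R: "R \<in> sets borel"
  shows finite_borel_measure_marginal_on: "finite_borel_measure (marginal_on al R e)"
    and measure_marginal_on: "S \<in> sets borel \<Longrightarrow> measure (marginal_on al R e) S = measure al (R \<inter> {x. x \<bullet> e \<in> S})"
proof -
  interpret prob_space al by fact
  note [measurable_cong] = sal
  note [measurable] = R
  have sp: "space al = UNIV" using sets_eq_imp_space_eq[OF sal] by simp
  have em: "emeasure (marginal_on al R e) S = emeasure al (R \<inter> {x. x \<bullet> e \<in> S})" if [measurable]: "S \<in> sets borel" for S
  proof -
    have "emeasure (marginal_on al R e) S = emeasure (density al (indicator R)) {x. x \<bullet> e \<in> S}"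
      unfolding marginal_on_def by (subst emeasure_distr) (auto simp: sp vimage_def)
    also have "\<dots> = (\<integral>\<^sup>+x. indicator R x * indicator {x. x \<bullet> e \<in> S} x \<partial>al)"
      by (rule emeasure_density) measurable
    also have "\<dots> = (\<integral>\<^sup>+x. indicator (R \<inter> {x. x \<bullet> e \<in> S}) x \<partial>al)"
      by (intro nn_integral_cong) (auto simp: indicator_def)
    finally show ?thesis by simp
  qed
  show "finite_borel_measure (marginal_on al R e)"
  proof (intro finite_borel_measure.intro finite_borel_measure_axioms.intro finite_measureI)
    show "emeasure (marginal_on al R e) (space (marginal_on al R e)) \<noteq> \<infinity>"
      using em[of UNIV] by (simp add: marginal_on_def)
  qed (simp add: marginal_on_def)
  show "measure (marginal_on al R e) S = measure al (R \<inter> {x. x \<bullet> e \<in> S})" if "S \<in> sets borel"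
    using em[OF that] by (simp add: measure_def)
qed

text \<open>The invariant of the recursion: J holds the coordinates already cut, and cells are still
  unrestricted in the others. Positive mass keeps cells nonempty, so that no pair is separated from
  itself and distinct pieces are distinct pairs.\<close>

definition good_pairs :: "'a::euclidean_space measure \<Rightarrow> 'a measure \<Rightarrow> 'a set \<Rightarrow> 'a cell_pair set \<Rightarrow> bool" where
  "good_pairs al be J C \<longleftrightarrow> finite C \<and>
    (\<forall>P\<in>C. interval_family (fst P) \<and> interval_family (snd P) \<and>
      (\<forall>e\<in>Basis - J. fst P e = UNIV \<and> snd P e = UNIV) \<and>
      measure al (cell (fst P)) = measure be (cell (snd P)) \<and> 0 < measure al (cell (fst P))) \<and>
    (\<forall>P\<in>C. \<forall>Q\<in>C. P \<noteq> Q \<longrightarrow> separated P Q) \<and> (\<Sum>P\<in>C. measure al (cell (fst P))) = 1"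

context
  fixes al be :: "'a::euclidean_space measure"
  assumes pal: "prob_space al" and pbe: "prob_space be" and sal: "sets al = sets borel" and sbe: "sets be = sets borel"
    and hal: "\<And>e s. e \<in> Basis \<Longrightarrow> measure al {x. x \<bullet> e = s} = 0"
    and hbe: "\<And>e s. e \<in> Basis \<Longrightarrow> measure be {x. x \<bullet> e = s} = 0"
begin

lemma atoms_marginal_on:
  assumes "R \<in> sets borel" "e \<in> Basis"
  shows "measure (marginal_on al R e) {s} = 0" "measure (marginal_on be R e) {s} = 0"
proof -
  interpret a: prob_space al by (rule pal)
  interpret b: prob_space be by (rule pbe)
  have [measurable]: "{x. x \<bullet> e = s} \<in> sets (borel :: 'a measure)" by measurable
  have "measure al (R \<inter> {x. x \<bullet> e \<in> {s}}) \<le> measure al {x. x \<bullet> e = s}"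
    using assms by (intro a.finite_measure_mono) (auto simp: sal)
  then show "measure (marginal_on al R e) {s} = 0"
    using hal[OF assms(2)] measure_marginal_on[OF pal sal assms(1), of "{s}" e] by (simp add: measure_le_0_iff)
  have "measure be (R \<inter> {x. x \<bullet> e \<in> {s}}) \<le> measure be {x. x \<bullet> e = s}"
    using assms by (intro b.finite_measure_mono) (auto simp: sbe)
  then show "measure (marginal_on be R e) {s} = 0"
    using hbe[OF assms(2)] measure_marginal_on[OF pbe sbe assms(1), of "{s}" e] by (simp add: measure_le_0_iff)
qed

lemma split_pair:
  assumes P: "interval_family (fst P)" "interval_family (snd P)" "measure al (cell (fst P)) = measure be (cell (snd P))"
      "0 < measure al (cell (fst P))"
    and e: "e \<in> Basis" "fst P e = UNIV" "snd P e = UNIV" and de: "0 < de" and ep: "0 < ep"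
  obtains n :: nat and i1 i2 :: "real \<Rightarrow> nat" where "0 < n" "mono i1" "mono i2" "\<And>s. i1 s < n" "\<And>s. i2 s < n"
    "\<And>k. k < n \<Longrightarrow> measure al (cell ((fst P)(e := i1 -` {k}))) = measure al (cell (fst P)) / n"
    "\<And>k. k < n \<Longrightarrow> measure be (cell ((snd P)(e := i2 -` {k}))) = measure al (cell (fst P)) / n"
    "(\<Sum>k | k < n \<and> wide de (i1 -` {k}). measure al (cell (fst P)) / n) \<le> ep"
    "(\<Sum>k | k < n \<and> wide de (i2 -` {k}). measure al (cell (fst P)) / n) \<le> ep"
proof -
  define m where "m = measure al (cell (fst P))"
  have cm: "cell (fst P) \<in> sets borel" "cell (snd P) \<in> sets borel" using P by (auto intro: cell_measurable)
  define N1 where "N1 = marginal_on al (cell (fst P)) e"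
  define N2 where "N2 = marginal_on be (cell (snd P)) e"
  interpret N1: finite_borel_measure N1 unfolding N1_def by (rule finite_borel_measure_marginal_on[OF pal sal cm(1)])
  interpret N2: finite_borel_measure N2 unfolding N2_def by (rule finite_borel_measure_marginal_on[OF pbe sbe cm(2)])
  note mm = measure_marginal_on[OF pal sal cm(1), of _ e, folded N1_def] measure_marginal_on[OF pbe sbe cm(2), of _ e, folded N2_def]
  have u: "measure N1 UNIV = m" "measure N2 UNIV = m" using mm[of UNIV] P(3) by (simp_all add: m_def)
  have at: "measure N1 {s} = 0" "measure N2 {s} = 0" for s
    unfolding N1_def N2_def using atoms_marginal_on[OF _ e(1)] cm by auto
  have m0: "0 < measure N1 UNIV" "0 < measure N2 UNIV" unfolding u using P(4) by (simp_all add: m_def)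
  obtain n1 :: nat where n1: "0 < n1" "\<And>n. n1 \<le> n \<Longrightarrow> \<exists>idx :: real \<Rightarrow> nat. mono idx \<and> (\<forall>s. idx s < n) \<and>
    (\<forall>k<n. measure N1 (idx -` {k}) = measure N1 UNIV / n) \<and> (\<forall>k. idx -` {k} \<in> sets borel) \<and>
    (\<Sum>k | k < n \<and> wide de (idx -` {k}). measure N1 UNIV / n) \<le> ep"
    using N1.quantile_split[OF at(1) m0(1) de ep] by blast
  obtain n2 :: nat where n2: "0 < n2" "\<And>n. n2 \<le> n \<Longrightarrow> \<exists>idx :: real \<Rightarrow> nat. mono idx \<and> (\<forall>s. idx s < n) \<and>
    (\<forall>k<n. measure N2 (idx -` {k}) = measure N2 UNIV / n) \<and> (\<forall>k. idx -` {k} \<in> sets borel) \<and>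
    (\<Sum>k | k < n \<and> wide de (idx -` {k}). measure N2 UNIV / n) \<le> ep"
    using N2.quantile_split[OF at(2) m0(2) de ep] by blast
  define n where "n = max n1 n2"
  obtain i1 :: "real \<Rightarrow> nat" where i1: "mono i1" "\<forall>s. i1 s < n" "\<forall>k<n. measure N1 (i1 -` {k}) = m / n"
    "\<forall>k. i1 -` {k} \<in> sets borel" "(\<Sum>k | k < n \<and> wide de (i1 -` {k}). m / n) \<le> ep"
    using n1(2)[of n] unfolding u n_def by auto
  obtain i2 :: "real \<Rightarrow> nat" where i2: "mono i2" "\<forall>s. i2 s < n" "\<forall>k<n. measure N2 (i2 -` {k}) = m / n"
    "\<forall>k. i2 -` {k} \<in> sets borel" "(\<Sum>k | k < n \<and> wide de (i2 -` {k}). m / n) \<le> ep"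
    using n2(2)[of n] unfolding u n_def by auto
  show ?thesis
  proof (rule that[of n i1 i2])
    show "0 < n" using n1(1) by (simp add: n_def)
    show "measure al (cell ((fst P)(e := i1 -` {k}))) = measure al (cell (fst P)) / n" if "k < n" for k
      using i1(3,4) mm(1)[of "i1 -` {k}"] that unfolding cell_update[of e "fst P", OF e(1,2)] m_def by simp
    show "measure be (cell ((snd P)(e := i2 -` {k}))) = measure al (cell (fst P)) / n" if "k < n" for k
      using i2(3,4) mm(2)[of "i2 -` {k}"] that unfolding cell_update[of e "snd P", OF e(1,3)] m_def by simp
  qed (use i1 i2 in "auto simp: m_def")
qed

lemma is_interval_level: "mono (idx :: real \<Rightarrow> nat) \<Longrightarrow> is_interval (idx -` {k})"
  unfolding is_interval_1
proof (intro ballI allI impI, elim conjE)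
  fix a b x assume "mono idx" "a \<in> idx -` {k}" "b \<in> idx -` {k}" "a \<le> x" "x \<le> b"
  then show "x \<in> idx -` {k}" using monoD[of idx a x] monoD[of idx x b] by simp
qed

text \<open>Every pair is cut along e at quantiles of its own restricted marginals, as in the Knothe
  rearrangement, into a number of pieces that depends on the pair. A child fails to be narrow only
  if its parent did or if one of its two new intervals is wide.\<close>

lemma good_pairs_refine:
  assumes C: "good_pairs al be J C" and bad: "(\<Sum>P | P \<in> C \<and> \<not> narrow_pair de J P. measure al (cell (fst P))) \<le> ep"
    and e: "e \<in> Basis" "e \<notin> J" and de: "0 < de" and ep: "0 < ep"
  obtains C' where "good_pairs al be (insert e J) C'"
    "(\<Sum>P | P \<in> C' \<and> \<not> narrow_pair de (insert e J) P. measure al (cell (fst P))) \<le> 2 * ep"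
proof -
  \<comment> \<open>Each pair loses at most eta on either side, in total at most 2 * card C * eta <=
    ep, which with the inherited ep makes 2 * ep. The + 1 keeps the denominator positive.\<close>
  define eta where "eta = ep / (2 * (real (card C) + 1))"
  have eta: "0 < eta" using ep by (simp add: eta_def)
  have fC: "finite C" using C by (simp add: good_pairs_def)
  let ?m = "\<lambda>P :: 'a cell_pair. measure al (cell (fst P))"
  let ?w = "\<lambda>(n::nat) (i :: real \<Rightarrow> nat) m. \<Sum>k | k < n \<and> wide de (i -` {k}). m / real n"
  define Rel where "Rel P n i1 i2 \<longleftrightarrow> 0 < n \<and> mono i1 \<and> mono i2 \<and> (\<forall>s. i1 s < n) \<and> (\<forall>s. i2 s < n) \<and>
    (\<forall>k<n. measure al (cell ((fst P)(e := i1 -` {k}))) = ?m P / real n) \<and>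
    (\<forall>k<n. measure be (cell ((snd P)(e := i2 -` {k}))) = ?m P / real n) \<and>
    ?w n i1 (?m P) \<le> eta \<and> ?w n i2 (?m P) \<le> eta" for P :: "'a cell_pair" and n and i1 i2 :: "real \<Rightarrow> nat"
  have "\<forall>P\<in>C. \<exists>n i1 i2. Rel P n i1 i2"
  proof
    fix P assume P: "P \<in> C"
    have Pf: "interval_family (fst P)" "interval_family (snd P)" "?m P = measure be (cell (snd P))" "0 < ?m P"
      "fst P e = UNIV" "snd P e = UNIV" using C P e by (auto simp: good_pairs_def)
    show "\<exists>n i1 i2. Rel P n i1 i2"
      unfolding Rel_def by (rule split_pair[OF Pf(1-4) e(1) Pf(5,6) de eta]) blast
  qed
  then obtain n i1 i2 where ni': "\<And>P. P \<in> C \<Longrightarrow> Rel P (n P) (i1 P) (i2 P)" by metis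
  note ni = ni'[unfolded Rel_def]
  have Cpos: "0 < ?m P" if "P \<in> C" for P using C that unfolding good_pairs_def by blast
  have npos: "0 < n P" if "P \<in> C" for P using ni[OF that] by simp
  define ch where "ch z = ((fst (fst z))(e := i1 (fst z) -` {snd z}), (snd (fst z))(e := i2 (fst z) -` {snd z}))" for z :: "'a cell_pair \<times> nat"
  define S where "S = Sigma C (\<lambda>P. {..<n P})"
  have fS: "finite S" unfolding S_def using fC by simp
  define C' where "C' = ch ` S"
  have m_ch: "?m (ch z) = ?m (fst z) / n (fst z)" "measure be (cell (snd (ch z))) = ?m (fst z) / n (fst z)" if "z \<in> S" for z
    using that ni[of "fst z"] by (auto simp: S_def ch_def)
  have pos: "0 < ?m (ch z)" if "z \<in> S" for z
  proof -
    have "fst z \<in> C" using that by (auto simp: S_def)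
    then show ?thesis using npos[of "fst z"] Cpos[of "fst z"] unfolding m_ch[OF that] by simp
  qed
  have sep: "separated (ch z) (ch z')" if z: "z \<in> S" "z' \<in> S" "z \<noteq> z'" for z z'
  proof (cases "fst z = fst z'")
    case False
    then have "separated (fst z) (fst z')" using C z by (auto simp: good_pairs_def S_def)
    then obtain e' where e': "e' \<in> Basis" and alt: "((\<forall>s\<in>fst (fst z) e'. \<forall>s'\<in>fst (fst z') e'. s < s') \<and> (\<forall>s\<in>snd (fst z) e'. \<forall>s'\<in>snd (fst z') e'. s < s')) \<or>
     ((\<forall>s\<in>fst (fst z) e'. \<forall>s'\<in>fst (fst z') e'. s' < s) \<and> (\<forall>s\<in>snd (fst z) e'. \<forall>s'\<in>snd (fst z') e'. s' < s))"
      unfolding separated_def by blast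
    \<comment> \<open>No parent restricts the coordinate e, so the coordinate that separates two
      parents was cut earlier and is inherited unchanged by their children.\<close>
    have "e' \<noteq> e"
    proof
      assume "e' = e"
      moreover have "fst (fst z) e = UNIV" "fst (fst z') e = UNIV" using C z e by (auto simp: good_pairs_def S_def)
      ultimately show False using alt by (auto dest: spec[of _ "0::real"])
    qed
    then show ?thesis unfolding separated_def using e' alt by (intro bexI[of _ e']) (auto simp: ch_def)
  next
    case True
    then have ne: "snd z \<noteq> snd z'" using z(3) by (simp add: prod_eq_iff)
    have mono: "mono (i1 (fst z))" "mono (i2 (fst z))" using ni[of "fst z"] z by (auto simp: S_def)
    have lt: "s < s'" if "mono i" "i s < i s'" for s s' :: real and i :: "real \<Rightarrow> nat"
      using that by (metis leD le_less_linear monoD)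
    consider "snd z < snd z'" | "snd z' < snd z" using ne by linarith
    then show ?thesis
    proof cases
      case 1
      then have "(\<forall>s\<in>fst (ch z) e. \<forall>s'\<in>fst (ch z') e. s < s') \<and> (\<forall>s\<in>snd (ch z) e. \<forall>s'\<in>snd (ch z') e. s < s')"
        using True lt[OF mono(1)] lt[OF mono(2)] by (auto simp: ch_def)
      then show ?thesis unfolding separated_def using e(1) by blast
    next
      case 2
      then have "(\<forall>s\<in>fst (ch z) e. \<forall>s'\<in>fst (ch z') e. s' < s) \<and> (\<forall>s\<in>snd (ch z) e. \<forall>s'\<in>snd (ch z') e. s' < s)"
        using True lt[OF mono(1)] lt[OF mono(2)] by (auto simp: ch_def)
      then show ?thesis unfolding separated_def using e(1) by blast
    qed
  qed
  have inj: "inj_on ch S"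
  proof (rule inj_onI, rule ccontr)
    fix z z' assume z: "z \<in> S" "z' \<in> S" "ch z = ch z'" "z \<noteq> z'"
    then have "cell (fst (ch z)) = {}" using sep[OF z(1,2,4)] separated_not_refl by metis
    then show False using pos[OF z(1)] by simp
  qed
  have sum_ch: "(\<Sum>P\<in>ch ` T. ?m P) = (\<Sum>z\<in>T. ?m (fst z) / n (fst z))" if "T \<subseteq> S" for T
    using inj that m_ch by (subst sum.reindex) (auto intro!: sum.cong intro: inj_on_subset)
  have one: "(\<Sum>P\<in>C'. ?m P) = 1"
  proof -
    have "(\<Sum>P\<in>C'. ?m P) = (\<Sum>P\<in>C. \<Sum>k<n P. ?m P / n P)"
      unfolding C'_def sum_ch[OF subset_refl] unfolding S_def using fC by (subst sum.Sigma) (auto intro!: sum.cong)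
    also have "\<dots> = (\<Sum>P\<in>C. ?m P)" using npos by (intro sum.cong) auto
    also have "\<dots> = 1" using C unfolding good_pairs_def by blast
    finally show ?thesis .
  qed
  have good: "good_pairs al be (insert e J) C'"
    unfolding good_pairs_def
  proof (intro conjI ballI impI one)
    show "finite C'" unfolding C'_def using fS by simp
  next
    fix P assume "P \<in> C'"
    then obtain z where z: "z \<in> S" "P = ch z" by (auto simp: C'_def)
    have fz: "fst z \<in> C" using z by (auto simp: S_def)
    have iv: "is_interval (i1 (fst z) -` {snd z})" "is_interval (i2 (fst z) -` {snd z})"
      using ni[OF fz] by (auto intro: is_interval_level)
    show "interval_family (fst P)" "interval_family (snd P)"
      using C fz iv unfolding z(2) by (auto simp: good_pairs_def interval_family_def ch_def)
    show "fst P e' = UNIV" "snd P e' = UNIV" if "e' \<in> Basis - insert e J" for e'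
      using C fz that unfolding z(2) by (auto simp: good_pairs_def ch_def)
    show "?m P = measure be (cell (snd P))" unfolding z(2) using m_ch[OF z(1)] by simp
    show "0 < ?m P" unfolding z(2) by (rule pos[OF z(1)])
  next
    fix P Q assume "P \<in> C'" "Q \<in> C'" "P \<noteq> Q"
    then obtain z z' where "z \<in> S" "P = ch z" "z' \<in> S" "Q = ch z'" unfolding C'_def by blast
    with \<open>P \<noteq> Q\<close> show "separated P Q" using sep[of z z'] by auto
  qed
  have fX: "finite (Sigma {P\<in>C. \<not> narrow_pair de J P} (\<lambda>P. {..<n P}))"
    using fC by (intro finite_SigmaI) auto
  have fY: "finite (Sigma C (\<lambda>P. {k. k < n P \<and> wide de (i P -` {k})}))" for i :: "'a cell_pair \<Rightarrow> real \<Rightarrow> nat"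
    using fC by (intro finite_SigmaI) auto
  define B where "B = {z\<in>S. \<not> narrow_pair de (insert e J) (ch z)}"
  have "{P\<in>C'. \<not> narrow_pair de (insert e J) P} = ch ` B" unfolding C'_def B_def by auto
  then have "(\<Sum>P | P \<in> C' \<and> \<not> narrow_pair de (insert e J) P. ?m P) = (\<Sum>z\<in>B. ?m (fst z) / n (fst z))"
    by (simp add: sum_ch B_def)
  also have "\<dots> \<le> (\<Sum>z\<in>Sigma {P\<in>C. \<not> narrow_pair de J P} (\<lambda>P. {..<n P}) \<union>
      (Sigma C (\<lambda>P. {k. k < n P \<and> wide de (i1 P -` {k})}) \<union> Sigma C (\<lambda>P. {k. k < n P \<and> wide de (i2 P -` {k})})). ?m (fst z) / n (fst z))"
  proof (rule sum_mono2)
    show "B \<subseteq> Sigma {P\<in>C. \<not> narrow_pair de J P} (\<lambda>P. {..<n P}) \<union>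
      (Sigma C (\<lambda>P. {k. k < n P \<and> wide de (i1 P -` {k})}) \<union> Sigma C (\<lambda>P. {k. k < n P \<and> wide de (i2 P -` {k})}))"
    proof
      fix z assume "z \<in> B"
      then have zS: "fst z \<in> C" "snd z < n (fst z)" and nn: "\<not> narrow_pair de (insert e J) (ch z)" by (auto simp: B_def S_def)
      have "\<not> narrow_pair de J (fst z) \<or> wide de (i1 (fst z) -` {snd z}) \<or> wide de (i2 (fst z) -` {snd z})"
      proof (rule ccontr)
        assume "\<not> ?thesis"
        then have "narrow_pair de (insert e J) (ch z)" using e(2) unfolding narrow_pair_def ch_def by simp
        with nn show False ..
      qed
      with zS show "z \<in> Sigma {P\<in>C. \<not> narrow_pair de J P} (\<lambda>P. {..<n P}) \<union>
        (Sigma C (\<lambda>P. {k. k < n P \<and> wide de (i1 P -` {k})}) \<union> Sigma C (\<lambda>P. {k. k < n P \<and> wide de (i2 P -` {k})}))"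
        by (cases z) simp
    qed
  qed (simp_all add: fX fY)
  also have "\<dots> \<le> (\<Sum>z\<in>Sigma {P\<in>C. \<not> narrow_pair de J P} (\<lambda>P. {..<n P}). ?m (fst z) / n (fst z))
     + ((\<Sum>z\<in>Sigma C (\<lambda>P. {k. k < n P \<and> wide de (i1 P -` {k})}). ?m (fst z) / n (fst z))
      + (\<Sum>z\<in>Sigma C (\<lambda>P. {k. k < n P \<and> wide de (i2 P -` {k})}). ?m (fst z) / n (fst z)))"
  proof -
    have un: "sum g (X \<union> Y) \<le> sum g X + sum g Y" if "finite X" "finite Y" "\<And>z. 0 \<le> g z" for g :: "'a cell_pair \<times> nat \<Rightarrow> real" and X Y
      using sum.union_inter[of X Y g] sum_nonneg[of "X \<inter> Y" g] that by simp
    show ?thesis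
    proof (rule order_trans[OF un add_left_mono[OF un]])
    qed (simp_all add: fX fY)
  qed
  also have "(\<Sum>z\<in>Sigma {P\<in>C. \<not> narrow_pair de J P} (\<lambda>P. {..<n P}). ?m (fst z) / n (fst z)) = (\<Sum>P | P \<in> C \<and> \<not> narrow_pair de J P. ?m P)"
    using fC npos by (subst sum.Sigma[symmetric, where g="\<lambda>P k. ?m P / n P", unfolded case_prod_beta]) (auto intro!: sum.cong)
  also have "(\<Sum>z\<in>Sigma C (\<lambda>P. {k. k < n P \<and> wide de (i1 P -` {k})}). ?m (fst z) / n (fst z)) = (\<Sum>P\<in>C. ?w (n P) (i1 P) (?m P))"
    using fC by (subst sum.Sigma[symmetric, where g="\<lambda>P k. ?m P / n P", unfolded case_prod_beta]) auto
  also have "(\<Sum>z\<in>Sigma C (\<lambda>P. {k. k < n P \<and> wide de (i2 P -` {k})}). ?m (fst z) / n (fst z)) = (\<Sum>P\<in>C. ?w (n P) (i2 P) (?m P))"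
    using fC by (subst sum.Sigma[symmetric, where g="\<lambda>P k. ?m P / n P", unfolded case_prod_beta]) auto
  finally have le: "(\<Sum>P | P \<in> C' \<and> \<not> narrow_pair de (insert e J) P. ?m P) \<le>
     (\<Sum>P | P \<in> C \<and> \<not> narrow_pair de J P. ?m P) + ((\<Sum>P\<in>C. ?w (n P) (i1 P) (?m P)) + (\<Sum>P\<in>C. ?w (n P) (i2 P) (?m P)))" .
  have "(\<Sum>P\<in>C. ?w (n P) (i1 P) (?m P)) \<le> (\<Sum>P\<in>C. eta)" by (intro sum_mono) (use ni in blast)
  moreover have "(\<Sum>P\<in>C. ?w (n P) (i2 P) (?m P)) \<le> (\<Sum>P\<in>C. eta)" by (intro sum_mono) (use ni in blast)
  moreover have "(\<Sum>P\<in>C. eta) \<le> ep / 2" using ep by (simp add: eta_def field_simps)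
  ultimately have "(\<Sum>P | P \<in> C' \<and> \<not> narrow_pair de (insert e J) P. ?m P) \<le> 2 * ep"
    using le bad by linarith
  with good show ?thesis by (rule that)
qed

lemma exists_good_pairs:
  assumes "finite J" "J \<subseteq> Basis" "0 < de" "0 < ep"
  shows "\<exists>C. good_pairs al be J C \<and> (\<Sum>P | P \<in> C \<and> \<not> narrow_pair de J P. measure al (cell (fst P))) \<le> ep"
  using assms
proof (induction J arbitrary: ep rule: finite_induct)
  case empty
  interpret a: prob_space al by (rule pal)
  interpret b: prob_space be by (rule pbe)
  have sp: "space al = UNIV" "space be = UNIV" using sets_eq_imp_space_eq[OF sal] sets_eq_imp_space_eq[OF sbe] by auto
  have "good_pairs al be {} {(\<lambda>_. UNIV, \<lambda>_. UNIV)}"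
    using a.prob_space b.prob_space by (auto simp: good_pairs_def interval_family_def cell_def sp)
  moreover have "narrow_pair de {} P" for P :: "'a cell_pair" by (simp add: narrow_pair_def)
  ultimately show ?case
    using empty.prems(3) by (intro exI[of _ "{(\<lambda>_. UNIV, \<lambda>_. UNIV)}"] conjI) simp_all
next
  case (insert e J)
  have "\<exists>C. good_pairs al be J C \<and> (\<Sum>P | P \<in> C \<and> \<not> narrow_pair de J P. measure al (cell (fst P))) \<le> ep / 2"
    by (rule insert.IH) (use insert.prems in simp_all)
  then obtain C where C: "good_pairs al be J C" "(\<Sum>P | P \<in> C \<and> \<not> narrow_pair de J P. measure al (cell (fst P))) \<le> ep / 2"
    by blast
  have e: "e \<in> Basis" and ep: "0 < ep / 2" using insert.prems by simp_all
  obtain C' where "good_pairs al be (insert e J) C'"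
    "(\<Sum>P | P \<in> C' \<and> \<not> narrow_pair de (insert e J) P. measure al (cell (fst P))) \<le> 2 * (ep / 2)"
    using good_pairs_refine[OF C e insert.hyps(2) insert.prems(2) ep] by blast
  then show ?case by (intro exI[of _ C'] conjI) simp_all
qed

end

subsection \<open>Couplings along cells\<close>

text \<open>Brunn-Minkowski for boxes, from the arithmetic-geometric mean inequality: after division
  by the interpolated sides z, the geometric means of x / z and y / z are at most their arithmetic
  means, and the convex combination of these arithmetic means is 1.\<close>

lemma geometric_mean_superadditive:
  fixes x y :: "'i \<Rightarrow> real"
  assumes I: "finite I" "I \<noteq> {}" and x: "\<And>i. i \<in> I \<Longrightarrow> 0 < x i" and y: "\<And>i. i \<in> I \<Longrightarrow> 0 < y i" and t: "0 \<le> t" "t \<le> 1"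
  shows "(1 - t) * (\<Prod>i\<in>I. x i) powr (1 / card I) + t * (\<Prod>i\<in>I. y i) powr (1 / card I)
    \<le> (\<Prod>i\<in>I. (1 - t) * x i + t * y i) powr (1 / card I)"
proof -
  define z where "z i = (1 - t) * x i + t * y i" for i
  have z: "0 < z i" if "i \<in> I" for i
  proof (cases "t = 0")
    case False
    then show ?thesis unfolding z_def using t x[OF that] y[OF that] by (intro add_nonneg_pos) auto
  qed (simp add: z_def x that)
  have n: "0 < card I" using I by (simp add: card_gt_0_iff)
  have am: "(\<Prod>i\<in>I. w i) powr (1 / card I) \<le> (\<Prod>i\<in>I. z i) powr (1 / card I) * (\<Sum>i\<in>I. (w i / z i) / card I)"
    if w: "\<And>i. i \<in> I \<Longrightarrow> 0 < w i" for w
  proof -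
    have "(\<Prod>i\<in>I. w i) = (\<Prod>i\<in>I. z i) * (\<Prod>i\<in>I. w i / z i)"
      unfolding prod.distrib[symmetric] using z by (intro prod.cong) (auto simp: less_imp_neq[symmetric])
    then have "(\<Prod>i\<in>I. w i) powr (1 / card I) = (\<Prod>i\<in>I. z i) powr (1 / card I) * (\<Prod>i\<in>I. w i / z i) powr (1 / card I)"
      using z w by (simp add: powr_mult prod_nonneg less_imp_le)
    also have "\<dots> \<le> (\<Prod>i\<in>I. z i) powr (1 / card I) * (\<Sum>i\<in>I. (w i / z i) / card I)"
      using I z w by (intro mult_left_mono arith_geom_mean) (auto simp: less_imp_le)
    finally show ?thesis .
  qed
  have "(1 - t) * (\<Prod>i\<in>I. x i) powr (1 / card I) + t * (\<Prod>i\<in>I. y i) powr (1 / card I)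
     \<le> (1 - t) * ((\<Prod>i\<in>I. z i) powr (1 / card I) * (\<Sum>i\<in>I. (x i / z i) / card I))
      + t * ((\<Prod>i\<in>I. z i) powr (1 / card I) * (\<Sum>i\<in>I. (y i / z i) / card I))"
    using t am[of x] am[of y] x y by (intro add_mono mult_left_mono) auto
  also have "\<dots> = (\<Prod>i\<in>I. z i) powr (1 / card I) * (\<Sum>i\<in>I. ((1 - t) * x i + t * y i) / z i / card I)"
  proof -
    have eq: "(\<Sum>i\<in>I. ((1 - t) * x i + t * y i) / z i / card I)
        = (1 - t) * (\<Sum>i\<in>I. (x i / z i) / card I) + t * (\<Sum>i\<in>I. (y i / z i) / card I)"
      unfolding sum_distrib_left sum.distrib[symmetric] by (simp add: add_divide_distrib)
    show ?thesis unfolding eq by (simp only: distrib_left mult.left_commute)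
  qed
  also have "(\<Sum>i\<in>I. ((1 - t) * x i + t * y i) / z i / card I) = (\<Sum>i\<in>I. 1 / card I)"
    using z unfolding z_def[symmetric] by (intro sum.cong) (auto simp: less_imp_neq[symmetric])
  also have "\<dots> = 1" using n by simp
  finally show ?thesis by (simp add: z_def)
qed

definition cell_lower :: "('a::euclidean_space \<Rightarrow> real set) \<Rightarrow> 'a" where
  "cell_lower A = (\<Sum>e\<in>Basis. Inf (A e) *\<^sub>R e)"

definition cell_upper :: "('a::euclidean_space \<Rightarrow> real set) \<Rightarrow> 'a" where
  "cell_upper A = (\<Sum>e\<in>Basis. Sup (A e) *\<^sub>R e)"

lemma cell_lower_inner: "e \<in> Basis \<Longrightarrow> cell_lower A \<bullet> e = Inf (A e)"
  and cell_upper_inner: "e \<in> Basis \<Longrightarrow> cell_upper A \<bullet> e = Sup (A e)"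
  by (simp_all add: cell_lower_def cell_upper_def)

lemma not_wide_bdd:
  assumes "\<not> wide de S" "S \<noteq> {}"
  shows "bdd_above S" "bdd_below S" "Inf S \<le> Sup S" "Sup S - Inf S \<le> de"
proof -
  obtain s where s: "s \<in> S" using assms by auto
  have le: "s' - s'' \<le> de" if "s' \<in> S" "s'' \<in> S" for s' s''
    using assms(1) that by (auto simp: wide_def not_less)
  show bd: "bdd_above S" "bdd_below S"
    using le[OF _ s] le[OF s] by (auto intro!: bdd_aboveI[of _ "s + de"] bdd_belowI[of _ "s - de"] simp: algebra_simps)
  show "Inf S \<le> Sup S" using cInf_lower[OF s bd(2)] cSup_upper[OF s bd(1)] by simp
  have "Sup S \<le> Inf S + de"
  proof (rule cSup_least[OF assms(2)])
    fix s' assume s': "s' \<in> S"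
    have "s' - de \<le> Inf S" using le[OF s'] by (intro cInf_greatest[OF assms(2)]) (simp add: algebra_simps)
    then show "s' \<le> Inf S + de" by simp
  qed
  then show "Sup S - Inf S \<le> de" by simp
qed

context
  fixes A :: "'a::euclidean_space \<Rightarrow> real set" and de
  assumes A: "interval_family A" and narrow: "\<And>e. e \<in> Basis \<Longrightarrow> \<not> wide de (A e)" and ne: "cell A \<noteq> {}"
begin

lemma cell_coords_nonempty: "e \<in> Basis \<Longrightarrow> A e \<noteq> {}"
  using ne by (auto simp: cell_def)

lemma cell_lower_le_upper: "e \<in> Basis \<Longrightarrow> cell_lower A \<bullet> e \<le> cell_upper A \<bullet> e"
  and cell_width: "e \<in> Basis \<Longrightarrow> cell_upper A \<bullet> e - cell_lower A \<bullet> e \<le> de"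
  using not_wide_bdd[OF narrow cell_coords_nonempty] by (auto simp: cell_lower_inner cell_upper_inner)

lemma cell_subset_cbox: "cell A \<subseteq> cbox (cell_lower A) (cell_upper A)"
  using not_wide_bdd[OF narrow cell_coords_nonempty]
  by (auto simp: cell_def mem_box cell_lower_inner cell_upper_inner intro!: cInf_lower cSup_upper)

lemma box_subset_cell: "box (cell_lower A) (cell_upper A) \<subseteq> cell A"
proof
  fix x assume x: "x \<in> box (cell_lower A) (cell_upper A)"
  have "x \<bullet> e \<in> A e" if e: "e \<in> Basis" for e
  proof -
    have lu: "Inf (A e) < x \<bullet> e" "x \<bullet> e < Sup (A e)"
      using x e by (auto simp: mem_box cell_lower_inner cell_upper_inner)
    obtain s where s: "s \<in> A e" "s < x \<bullet> e"
      using cInf_lessD[OF cell_coords_nonempty[OF e] lu(1)] by blast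
    obtain s' where s': "s' \<in> A e" "x \<bullet> e < s'"
      using less_cSupD[OF cell_coords_nonempty[OF e] lu(2)] by blast
    show ?thesis using A e s s' unfolding interval_family_def is_interval_1 by (meson less_imp_le)
  qed
  then show "x \<in> cell A" by (simp add: cell_def)
qed

lemma emeasure_cell:
  "emeasure lborel (cell A) = ennreal (\<Prod>e\<in>Basis. cell_upper A \<bullet> e - cell_lower A \<bullet> e)"
proof (rule antisym)
  show "emeasure lborel (cell A) \<le> ennreal (\<Prod>e\<in>Basis. cell_upper A \<bullet> e - cell_lower A \<bullet> e)"
    using emeasure_mono[OF cell_subset_cbox, of lborel] cell_lower_le_upper
    by (simp add: emeasure_lborel_cbox_eq inner_diff_left)
  show "ennreal (\<Prod>e\<in>Basis. cell_upper A \<bullet> e - cell_lower A \<bullet> e) \<le> emeasure lborel (cell A)"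
    using emeasure_mono[OF box_subset_cell, of lborel] cell_lower_le_upper cell_measurable[OF A]
    by (simp add: emeasure_lborel_box_eq inner_diff_left)
qed

end

context internal_energy
begin

text \<open>The supporting line of f at the average density m / v, integrated over R.\<close>

lemma jensen_cell:
  fixes a :: "'a::euclidean_space \<Rightarrow> real"
  assumes [measurable]: "a \<in> borel_measurable borel" and a: "\<And>x. 0 \<le> a x" and i: "integrable lborel a" "integrable lborel (\<lambda>x. f (a x))"
    and [measurable]: "R \<in> sets borel" and R: "emeasure lborel R = ennreal v" "0 < v"
    and m: "m = (LBINT x. indicator R x * a x)" "0 < m"
  shows "v * f (m / v) \<le> (LBINT x. indicator R x * f (a x))"
proof -
  define p where "p = subgrad (m / v)"
  have iR: "integrable lborel (\<lambda>x. indicator R x * a x)" "integrable lborel (\<lambda>x. indicator R x * f (a x))"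
    "integrable lborel (indicator R :: 'a \<Rightarrow> real)"
    using integrable_mult_indicator[OF _ i(1), of R] integrable_mult_indicator[OF _ i(2), of R] R
    by (auto intro!: integrable_real_indicator)
  have mR: "measure lborel R = v" using R by (simp add: measure_def)
  have "v * f (m / v) = v * (f (m / v) - p * (m / v)) + p * m" using R(2) by (simp add: field_simps)
  also have "\<dots> = (LBINT x. indicator R x * (f (m / v) - p * (m / v)) + p * (indicator R x * a x))"
    using iR by (simp add: m(1)[symmetric] mR)
  also have "\<dots> \<le> (LBINT x. indicator R x * f (a x))"
  proof (rule integral_mono)
    show "indicator R x * (f (m / v) - p * (m / v)) + p * (indicator R x * a x) \<le> indicator R x * f (a x)" for x
      using subgrad[of "m / v" "a x"] a[of x] R m by (auto simp: indicator_def p_def algebra_simps)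
  qed (use iR in auto)
  finally show ?thesis .
qed

end

locale mccann_energy = internal_energy f c for f c +
  fixes dim :: nat
  assumes dim: "0 < dim" and mccann_convex: "convex_on {0<..} (\<lambda>s. s ^ dim * f (1 / s ^ dim))"
    and mccann_mono: "antimono_on {0<..} (\<lambda>s. s ^ dim * f (1 / s ^ dim))"
begin

text \<open>A mass m spread evenly over a volume w has energy w * f (m / w) = m * h ((w / m) powr (1
  / dim)), where h is McCann's function. For fixed m the argument is proportional to the side of a
  cube of volume w. That h is nonincreasing absorbs the inequality between the volumes; its
  convexity does the rest.\<close>

lemma volume_energy_convex:
  assumes x: "0 < x" and y: "0 < y" and v: "0 < v" and m: "0 < m" and t: "0 \<le> t" "t \<le> 1"
    and le: "(1 - t) * x powr (1 / dim) + t * y powr (1 / dim) \<le> v powr (1 / dim)"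
  shows "v * f (m / v) \<le> (1 - t) * (x * f (m / x)) + t * (y * f (m / y))"
proof -
  define h where "h s = s ^ dim * f (1 / s ^ dim)" for s
  define si where "si w = (w / m) powr (1 / dim)" for w
  have s0: "0 < si w" if "0 < w" for w using that m by (simp add: si_def)
  have hs: "m * h (si w) = w * f (m / w)" if "0 < w" for w
  proof -
    have "si w ^ dim = si w powr dim" using s0[OF that] by (simp add: powr_realpow)
    also have "\<dots> = w / m" using dim that m by (simp add: si_def powr_powr)
    finally show ?thesis using m by (simp add: h_def)
  qed
  have "si w = w powr (1 / dim) / m powr (1 / dim)" if "0 < w" for w
    using that m by (simp add: si_def powr_divide)
  then have "(1 - t) * si x + t * si y = ((1 - t) * x powr (1 / dim) + t * y powr (1 / dim)) / m powr (1 / dim)"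
    using x y by (simp add: add_divide_distrib)
  also have "\<dots> \<le> v powr (1 / dim) / m powr (1 / dim)" using le by (intro divide_right_mono) auto
  also have "\<dots> = si v" using v m by (simp add: si_def powr_divide)
  finally have le': "(1 - t) * si x + t * si y \<le> si v" .
  have pos: "0 < (1 - t) * si x + t * si y"
  proof (cases "t = 0")
    case False
    then show ?thesis using t s0[OF x] s0[OF y] by (intro add_nonneg_pos) auto
  qed (use s0[OF x] in simp)
  have "h (si v) \<le> h ((1 - t) * si x + t * si y)"
    using mccann_mono le' pos s0[OF v] unfolding h_def monotone_on_def by auto
  also have "\<dots> \<le> (1 - t) * h (si x) + t * h (si y)"
    using convex_onD[OF mccann_convex, of t "si x" "si y"] t s0[OF x] s0[OF y] unfolding h_def by simp
  finally have "m * h (si v) \<le> m * ((1 - t) * h (si x) + t * h (si y))" using m by (intro mult_left_mono) auto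
  also have "\<dots> = (1 - t) * (m * h (si x)) + t * (m * h (si y))" by (simp add: algebra_simps)
  finally show ?thesis using hs x y v by simp
qed

end

lemma Sup_le_Inf:
  fixes S T :: "real set"
  assumes "S \<noteq> {}" "T \<noteq> {}" "\<forall>s\<in>S. \<forall>t\<in>T. s < t"
  shows "Sup S \<le> Inf T"
  by (intro cSup_least cInf_greatest assms(1,2)) (use assms(3) in "blast intro: less_imp_le")

definition interpolate :: "real \<Rightarrow> 'a::euclidean_space \<times> 'a \<Rightarrow> 'a" where
  "interpolate t p = (1 - t) *\<^sub>R fst p + t *\<^sub>R snd p"

lemma continuous_on_interpolate: "continuous_on UNIV (interpolate t)"
  unfolding interpolate_def by (intro continuous_intros)

lemma interpolate_measurable [measurable]: "interpolate t \<in> borel_measurable borel"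
  using continuous_on_interpolate by (rule borel_measurable_continuous_onI)

lemma norm_interpolate_le:
  assumes "t \<in> {0..1}" shows "(norm (interpolate t p))\<^sup>2 \<le> 2 * norm p ^ 2"
proof -
  have "norm (interpolate t p) \<le> (1 - t) * norm p + t * norm p"
    unfolding interpolate_def using assms norm_fst_le[of "fst p" "snd p"] norm_snd_le[of "snd p" "fst p"]
    by (intro order_trans[OF norm_triangle_ineq] add_mono) (auto intro!: mult_left_mono)
  then have "(norm (interpolate t p))\<^sup>2 \<le> norm p ^ 2" by (intro power_mono) (auto simp: algebra_simps)
  then show ?thesis using zero_le_power2[of "norm p"] by linarith
qed

lemma distr_interpolate_P2:
  assumes "gam \<in> P2" "t \<in> {0..1}" shows "distr gam borel (interpolate t) \<in> P2"
proof -
  interpret prob_space gam using assms by (simp add: P2_prob)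
  note [measurable_cong] = P2_sets[OF assms(1)]
  have "(\<integral>\<^sup>+p. ennreal (norm (interpolate t p) ^ 2) \<partial>gam) \<le> (\<integral>\<^sup>+p. ennreal (2 * norm p ^ 2) \<partial>gam)"
    using norm_interpolate_le[OF assms(2)] by (intro nn_integral_mono ennreal_leI)
  also have "\<dots> < \<infinity>"
    using P2_integrable[OF assms(1)] nn_integral_cmult[of "\<lambda>p. ennreal (norm p ^ 2)" gam 2]
    by (simp add: integrable_iff_bounded ennreal_mult ennreal_mult_less_top)
  finally show ?thesis by (subst distr_in_P2_iff) auto
qed

lemma norm1_diff_le: "\<bar>norm1 (p :: 'a::euclidean_space) - norm1 q\<bar> \<le> DIM('a) * norm (p - q)"
  using norm1_triangle[of "p - q" q] norm1_triangle[of "q - p" p] norm1_le_norm[of "p - q"] norm1_le_norm[of "q - p"]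
  by (simp add: norm_minus_commute abs_le_iff)

lemma density_prob_integrable:
  fixes a :: "'a::euclidean_space \<Rightarrow> real"
  assumes [measurable]: "a \<in> borel_measurable borel" and a: "\<And>x. 0 \<le> a x"
    and al: "al = lebesgue_density a" and "prob_space al"
  shows "integrable lborel a" "R \<in> sets borel \<Longrightarrow> (LBINT x. indicator R x * a x) = measure al R"
    "sets al = sets borel" "e \<in> Basis \<Longrightarrow> measure al {x. x \<bullet> e = s} = 0"
    "N \<in> null_sets lborel \<Longrightarrow> measure al N = 0"
proof -
  interpret prob_space al by fact
  have "integrable al (\<lambda>_. 1::real)" by simp
  then show "integrable lborel a" unfolding al using a by (subst (asm) integrable_real_density) auto
  show "(LBINT x. indicator R x * a x) = measure al R" if [measurable]: "R \<in> sets borel"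
  proof -
    have "measure al R = (LINT x|al. indicator R x)" using that by (simp add: al)
    also have "\<dots> = (LBINT x. a x * indicator R x)" unfolding al using a by (subst integral_real_density) auto
    finally show ?thesis by (simp add: mult.commute)
  qed
  show "sets al = sets borel" by (simp add: al)
  show null: "measure al N = 0" if "N \<in> null_sets lborel" for N
  proof -
    have "absolutely_continuous lborel al" unfolding al by (rule absolutely_continuousI_density) simp
    with that have "N \<in> null_sets al" by (auto simp: absolutely_continuous_def)
    then show ?thesis by (auto simp: null_sets_def measure_def)
  qed
  show "measure al {x. x \<bullet> e = s} = 0" if "e \<in> Basis"
  proof (rule null)
    have "negligible {x. x \<bullet> e = s}" using negligible_standard_hyperplane[OF that] .
    then show "{x. x \<bullet> e = s} \<in> null_sets lborel"
      by (auto simp: negligible_iff_null_sets null_sets_completion_iff)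
  qed
qed

lemma (in finite_measure) sum_measure_disjoint:
  assumes "finite D" "disjoint_family_on F D" "\<And>P. P \<in> D \<Longrightarrow> F P \<in> sets M" "R \<in> sets M"
  shows "(\<Sum>P\<in>D. measure M (R \<inter> F P)) = measure M (R \<inter> (\<Union>P\<in>D. F P))"
proof -
  have "(\<Sum>P\<in>D. measure M (R \<inter> F P)) = measure M (\<Union>P\<in>D. R \<inter> F P)"
    using assms by (intro finite_measure_finite_Union[symmetric]) (auto simp: disjoint_family_on_def)
  then show ?thesis by simp
qed

lemma cell_sides_pos:
  fixes A :: "'a::euclidean_space \<Rightarrow> real set"
  assumes E: "interval_family A" "\<And>e. e \<in> Basis \<Longrightarrow> \<not> wide d (A e)" "cell A \<noteq> {}" and null: "cell A \<notin> null_sets lborel"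
  shows "emeasure lborel (cell A) = ennreal (\<Prod>e\<in>Basis. cell_upper A \<bullet> e - cell_lower A \<bullet> e)"
    "0 < (\<Prod>e\<in>Basis. cell_upper A \<bullet> e - cell_lower A \<bullet> e)"
    "\<And>e. e \<in> Basis \<Longrightarrow> 0 < cell_upper A \<bullet> e - cell_lower A \<bullet> e"
proof -
  let ?x = "\<Prod>e\<in>Basis. cell_upper A \<bullet> e - cell_lower A \<bullet> e"
  show x: "emeasure lborel (cell A) = ennreal ?x" by (rule emeasure_cell[OF E])
  have x0: "?x \<noteq> 0"
  proof
    assume z: "?x = 0"
    have "emeasure lborel (cell A) = 0" unfolding x z by simp
    then show False using null cell_measurable[OF E(1)] by (simp add: null_sets_def)
  qed
  have "0 \<le> ?x" using cell_lower_le_upper[OF E] by (intro prod_nonneg) auto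
  with x0[symmetric] show "0 < ?x" by (rule order_neq_le_trans)
  show "0 < cell_upper A \<bullet> e - cell_lower A \<bullet> e" if e: "e \<in> Basis" for e
  proof -
    have "cell_upper A \<bullet> e - cell_lower A \<bullet> e \<noteq> 0" using x0 e prod_zero[OF finite_Basis] by metis
    then show ?thesis using cell_lower_le_upper[OF E e] by simp
  qed
qed

text \<open>Density, with respect to the product of the marginals, of the plan that couples each
  pair of matched cells by their normalized product.\<close>

definition coupling_weight :: "'a::euclidean_space measure \<Rightarrow> 'a cell_pair set \<Rightarrow> 'a \<times> 'a \<Rightarrow> real" where
  "coupling_weight al C z =
     (\<Sum>P\<in>C. indicator (cell (fst P)) (fst z) * indicator (cell (snd P)) (snd z) / measure al (cell (fst P)))"

definition cell_coupling :: "'a::euclidean_space measure \<Rightarrow> 'a measure \<Rightarrow> 'a cell_pair set \<Rightarrow> ('a \<times> 'a) measure" where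
  "cell_coupling al be C = density (al \<Otimes>\<^sub>M be) (\<lambda>z. ennreal (coupling_weight al C z))"

definition cell_box :: "real \<Rightarrow> 'a::euclidean_space cell_pair \<Rightarrow> 'a set" where
  "cell_box t P = box ((1 - t) *\<^sub>R cell_lower (fst P) + t *\<^sub>R cell_lower (snd P))
     ((1 - t) *\<^sub>R cell_upper (fst P) + t *\<^sub>R cell_upper (snd P))"

definition cell_volume :: "real \<Rightarrow> 'a::euclidean_space cell_pair \<Rightarrow> real" where
  "cell_volume t P = (\<Prod>e\<in>Basis. (1 - t) * (cell_upper (fst P) \<bullet> e - cell_lower (fst P) \<bullet> e)
     + t * (cell_upper (snd P) \<bullet> e - cell_lower (snd P) \<bullet> e))"

text \<open>A surrogate for the interpolated plan: over a pair of cells the law of (1 - t) y + t z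
  has no explicit density, so its mass is spread evenly over the interpolated box. The energy can
  then be computed exactly, while positions change by at most the size of the box.\<close>

definition box_density :: "'a::euclidean_space measure \<Rightarrow> 'a cell_pair set \<Rightarrow> real \<Rightarrow> 'a \<Rightarrow> real" where
  "box_density al G t x = (\<Sum>P\<in>G. measure al (cell (fst P)) / cell_volume t P * indicator (cell_box t P) x)"

section \<open>Estimates for one family of matched cells\<close>

context mccann_energy
begin

context
  fixes a b :: "'a::euclidean_space \<Rightarrow> real" and al be :: "'a measure" and C :: "'a cell_pair set" and de ep :: real
  assumes dim_eq: "dim = DIM('a)"
    and a_m [measurable]: "a \<in> borel_measurable borel" and a0: "\<And>x. 0 \<le> a x" and al: "al = lebesgue_density a"
    and b_m [measurable]: "b \<in> borel_measurable borel" and b0: "\<And>x. 0 \<le> b x" and be: "be = lebesgue_density b"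
    and alP: "al \<in> P2" and beP: "be \<in> P2"
    and fa: "integrable lborel (\<lambda>x. f (a x))" and fb: "integrable lborel (\<lambda>x. f (b x))"
    and de: "0 < de" and ep: "0 < ep"
    and C: "good_pairs al be Basis C"
    and bad: "(\<Sum>P | P \<in> C \<and> \<not> narrow_pair (de / DIM('a)) Basis P. measure al (cell (fst P))) \<le> ep"
begin

interpretation al: prob_space al using alP by (rule P2_prob)
interpretation be: prob_space be using beP by (rule P2_prob)
interpretation ab: pair_prob_space al be ..

lemmas alD = density_prob_integrable[OF a_m a0 al P2_prob[OF alP]]
lemmas beD = density_prob_integrable[OF b_m b0 be P2_prob[OF beP]]

lemma sal [measurable_cong]: "sets al = sets borel" and sbe [measurable_cong]: "sets be = sets borel"
  using alD(3) beD(3) .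

lemma salbe [measurable_cong]: "sets (al \<Otimes>\<^sub>M be) = sets borel"
  using sets_pair_measure_cong[OF sal sbe] unfolding borel_prod .

abbreviation mass :: "'a cell_pair \<Rightarrow> real" where "mass P \<equiv> measure al (cell (fst P))"
abbreviation lc :: "'a cell_pair \<Rightarrow> 'a set" where "lc P \<equiv> cell (fst P)"
abbreviation rc :: "'a cell_pair \<Rightarrow> 'a set" where "rc P \<equiv> cell (snd P)"
abbreviation AB :: "('a \<times> 'a) measure" where "AB \<equiv> al \<Otimes>\<^sub>M be"
abbreviation coupling :: "('a \<times> 'a) measure" where "coupling \<equiv> cell_coupling al be C"
abbreviation side :: "('a \<Rightarrow> real set) \<Rightarrow> 'a \<Rightarrow> real" where "side A e \<equiv> cell_upper A \<bullet> e - cell_lower A \<bullet> e"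
abbreviation closed_box :: "real \<Rightarrow> 'a cell_pair \<Rightarrow> 'a set" where
  "closed_box t P \<equiv> cbox ((1 - t) *\<^sub>R cell_lower (fst P) + t *\<^sub>R cell_lower (snd P)) ((1 - t) *\<^sub>R cell_upper (fst P) + t *\<^sub>R cell_upper (snd P))"

lemma finC: "finite C" using C unfolding good_pairs_def by blast

lemma CD:
  assumes "P \<in> C"
  shows "interval_family (fst P)" "interval_family (snd P)" "measure be (rc P) = mass P" "0 < mass P"
  using C assms unfolding good_pairs_def by metis+

lemma mass_sum: "(\<Sum>P\<in>C. mass P) = 1" using C unfolding good_pairs_def by blast

lemma cells_disjoint:
  assumes "P \<in> C" "Q \<in> C" "P \<noteq> Q"
  shows "lc P \<inter> lc Q = {}" "rc P \<inter> rc Q = {}"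
proof -
  have "separated P Q" using C assms unfolding good_pairs_def by blast
  then show "lc P \<inter> lc Q = {}" "rc P \<inter> rc Q = {}"
    unfolding separated_def cell_def by fastforce+
qed

lemma cell_meas: "P \<in> C \<Longrightarrow> lc P \<in> sets borel" "P \<in> C \<Longrightarrow> rc P \<in> sets borel"
  by (blast intro: cell_measurable CD)+

lemma weight_measurable: "coupling_weight al C \<in> borel_measurable borel"
  unfolding coupling_weight_def using cell_meas
  by (intro borel_measurable_sum borel_measurable_divide borel_measurable_times borel_measurable_indicator'
      measurable_compose[OF fst_snd_borel(1)] measurable_compose[OF fst_snd_borel(2)] borel_measurable_indicator) auto

lemma weight_nonneg: "0 \<le> coupling_weight al C z"
  unfolding coupling_weight_def by (intro sum_nonneg) auto

lemma cells_disjoint_family: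
  "D \<subseteq> C \<Longrightarrow> disjoint_family_on (\<lambda>P. lc P) D" "D \<subseteq> C \<Longrightarrow> disjoint_family_on (\<lambda>P. rc P) D"
  unfolding disjoint_family_on_def using cells_disjoint by blast+

lemma sum_measure_cells:
  assumes D: "D \<subseteq> C" and R: "R \<in> sets borel"
  shows "(\<Sum>P\<in>D. measure al (R \<inter> lc P)) = measure al (R \<inter> (\<Union>P\<in>D. lc P))"
    "(\<Sum>P\<in>D. measure be (R \<inter> rc P)) = measure be (R \<inter> (\<Union>P\<in>D. rc P))"
proof -
  have fD: "finite D" by (rule finite_subset[OF D finC])
  show "(\<Sum>P\<in>D. measure al (R \<inter> lc P)) = measure al (R \<inter> (\<Union>P\<in>D. lc P))"
    by (rule al.sum_measure_disjoint[OF fD cells_disjoint_family(1)[OF D]]) (use R D cell_meas in "auto simp: sal")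
  show "(\<Sum>P\<in>D. measure be (R \<inter> rc P)) = measure be (R \<inter> (\<Union>P\<in>D. rc P))"
    by (rule be.sum_measure_disjoint[OF fD cells_disjoint_family(2)[OF D]]) (use R D cell_meas in "auto simp: sbe")
qed

lemma union_cells_measurable:
  assumes "D \<subseteq> C"
  shows "(\<Union>P\<in>D. lc P) \<in> sets borel" "(\<Union>P\<in>D. rc P) \<in> sets borel"
  using assms finite_subset[OF assms finC] cell_meas by (auto intro!: sets.finite_UN)

lemma measure_union_cells:
  assumes "D \<subseteq> C"
  shows "measure al (\<Union>P\<in>D. lc P) = (\<Sum>P\<in>D. mass P)" "measure be (\<Union>P\<in>D. rc P) = (\<Sum>P\<in>D. mass P)"
proof -
  show "measure al (\<Union>P\<in>D. lc P) = (\<Sum>P\<in>D. mass P)" using sum_measure_cells(1)[OF assms, of UNIV] by simp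
  have "(\<Sum>P\<in>D. measure be (rc P)) = (\<Sum>P\<in>D. mass P)" using CD(3) assms by (intro sum.cong) auto
  then show "measure be (\<Union>P\<in>D. rc P) = (\<Sum>P\<in>D. mass P)" using sum_measure_cells(2)[OF assms, of UNIV] by simp
qed

text \<open>The masses of the disjoint cells add up to 1, so the cells cover everything but a null
  set.\<close>

lemma full_cells:
  assumes [measurable]: "R \<in> sets borel"
  shows "(\<Sum>P\<in>C. measure al (R \<inter> lc P)) = measure al R" "(\<Sum>P\<in>C. measure be (R \<inter> rc P)) = measure be R"
proof -
  note [measurable] = union_cells_measurable[OF subset_refl]
  have a: "AE x in al. x \<in> (\<Union>P\<in>C. lc P)"
    by (subst al.AE_in_set_eq_1) (auto simp: measure_union_cells(1) mass_sum)
  have "measure al (R \<inter> (\<Union>P\<in>C. lc P)) = measure al R"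
    by (rule al.finite_measure_eq_AE) (use a in "auto elim: eventually_mono")
  then show "(\<Sum>P\<in>C. measure al (R \<inter> lc P)) = measure al R" by (simp add: sum_measure_cells)
  have b: "AE x in be. x \<in> (\<Union>P\<in>C. rc P)"
    by (subst be.AE_in_set_eq_1) (auto simp: measure_union_cells(2) mass_sum)
  have "measure be (R \<inter> (\<Union>P\<in>C. rc P)) = measure be R"
    by (rule be.finite_measure_eq_AE) (use b in "auto elim: eventually_mono")
  then show "(\<Sum>P\<in>C. measure be (R \<inter> rc P)) = measure be R" by (simp add: sum_measure_cells)
qed

lemma emeasure_coupling_Times:
  assumes [measurable]: "R \<in> sets borel" "S \<in> sets borel"
  shows "emeasure coupling (R \<times> S)
    = ennreal (\<Sum>P\<in>C. measure al (R \<inter> lc P) * measure be (S \<inter> rc P) / mass P)"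
proof -
  note [measurable] = weight_measurable
  have RS: "R \<times> S \<in> sets AB" by (rule pair_measureI) (auto simp: sal sbe)
  have "emeasure coupling (R \<times> S) = (\<integral>\<^sup>+z. ennreal (coupling_weight al C z) * indicator (R \<times> S) z \<partial>AB)"
    unfolding cell_coupling_def using RS by (subst emeasure_density) auto
  also have "\<dots> = (\<integral>\<^sup>+z. (\<Sum>P\<in>C. ennreal (1 / mass P) * indicator ((R \<inter> lc P) \<times> (S \<inter> rc P)) z) \<partial>AB)"
  proof (intro nn_integral_cong)
    fix z :: "'a \<times> 'a"
    have "ennreal (coupling_weight al C z) * indicator (R \<times> S) z = ennreal (coupling_weight al C z * indicator (R \<times> S) z)"
      by (simp add: indicator_def)
    also have "coupling_weight al C z * indicator (R \<times> S) z = (\<Sum>P\<in>C. (1 / mass P) * indicator ((R \<inter> lc P) \<times> (S \<inter> rc P)) z)"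
      unfolding coupling_weight_def sum_distrib_right by (intro sum.cong) (auto simp: indicator_def mem_Times_iff)
    also have "ennreal \<dots> = (\<Sum>P\<in>C. ennreal ((1 / mass P) * indicator ((R \<inter> lc P) \<times> (S \<inter> rc P)) z))"
      by (intro sum_ennreal[symmetric]) auto
    also have "\<dots> = (\<Sum>P\<in>C. ennreal (1 / mass P) * indicator ((R \<inter> lc P) \<times> (S \<inter> rc P)) z)"
      by (intro sum.cong) (auto simp: indicator_def)
    finally show "ennreal (coupling_weight al C z) * indicator (R \<times> S) z
        = (\<Sum>P\<in>C. ennreal (1 / mass P) * indicator ((R \<inter> lc P) \<times> (S \<inter> rc P)) z)" .
  qed
  also have "\<dots> = (\<Sum>P\<in>C. ennreal (1 / mass P) * emeasure AB ((R \<inter> lc P) \<times> (S \<inter> rc P)))"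
  proof -
    have m: "(R \<inter> lc P) \<times> (S \<inter> rc P) \<in> sets AB" if "P \<in> C" for P
      using cell_meas[OF that] by (intro pair_measureI) (auto simp: sal sbe)
    show ?thesis using m by (subst nn_integral_sum) (auto simp: nn_integral_cmult_indicator intro!: sum.cong borel_measurable_times)
  qed
  also have "\<dots> = (\<Sum>P\<in>C. ennreal (measure al (R \<inter> lc P) * measure be (S \<inter> rc P) / mass P))"
  proof (intro sum.cong refl)
    fix P assume P: "P \<in> C"
    show "ennreal (1 / mass P) * emeasure AB ((R \<inter> lc P) \<times> (S \<inter> rc P))
        = ennreal (measure al (R \<inter> lc P) * measure be (S \<inter> rc P) / mass P)"
      using cell_meas[OF P] CD(4)[OF P]
      by (subst be.emeasure_pair_measure_Times)
        (auto simp: sal sbe al.emeasure_eq_measure be.emeasure_eq_measure simp flip: ennreal_mult')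
  qed
  also have "\<dots> = ennreal (\<Sum>P\<in>C. measure al (R \<inter> lc P) * measure be (S \<inter> rc P) / mass P)"
    by (intro sum_ennreal) auto
  finally show ?thesis .
qed

lemma coupling_plan: "coupling \<in> transport_plans al be"
proof -
  have s: "sets coupling = sets borel" by (simp add: cell_coupling_def salbe)
  note [measurable_cong] = s
  have sp: "space coupling = UNIV" using sets_eq_imp_space_eq[OF s] by simp
  have 1: "distr coupling borel fst = al"
  proof (rule measure_eqI)
    fix R assume "R \<in> sets (distr coupling borel fst)"
    then have [measurable]: "R \<in> sets borel" by simp
    have "emeasure (distr coupling borel fst) R = emeasure coupling (R \<times> UNIV)"
      by (subst emeasure_distr) (auto simp: sp intro!: arg_cong[where f="emeasure _"])
    also have "\<dots> = ennreal (\<Sum>P\<in>C. measure al (R \<inter> lc P))"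
      unfolding emeasure_coupling_Times[OF \<open>R \<in> sets borel\<close> sets.top[of borel, unfolded space_borel]]
      using CD by (intro arg_cong[where f=ennreal] sum.cong) (auto simp: less_imp_neq[symmetric])
    also have "\<dots> = emeasure al R" by (simp add: full_cells al.emeasure_eq_measure)
    finally show "emeasure (distr coupling borel fst) R = emeasure al R" .
  qed (simp add: sal)
  have 2: "distr coupling borel snd = be"
  proof (rule measure_eqI)
    fix R assume "R \<in> sets (distr coupling borel snd)"
    then have [measurable]: "R \<in> sets borel" by simp
    have "emeasure (distr coupling borel snd) R = emeasure coupling (UNIV \<times> R)"
      by (subst emeasure_distr) (auto simp: sp intro!: arg_cong[where f="emeasure _"])
    also have "\<dots> = ennreal (\<Sum>P\<in>C. measure be (R \<inter> rc P))"
      unfolding emeasure_coupling_Times[OF sets.top[of borel, unfolded space_borel] \<open>R \<in> sets borel\<close>]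
      using CD by (intro arg_cong[where f=ennreal] sum.cong) (auto simp: less_imp_neq[symmetric])
    also have "\<dots> = emeasure be R" by (simp add: full_cells be.emeasure_eq_measure)
    finally show "emeasure (distr coupling borel snd) R = emeasure be R" .
  qed (simp add: sbe)
  have "emeasure coupling UNIV = emeasure (distr coupling borel fst) UNIV"
    by (subst emeasure_distr) (auto simp: sp)
  also have "\<dots> = 1" unfolding 1 using al.emeasure_space_1 sets_eq_imp_space_eq[OF sal] by simp
  finally have "prob_space coupling" by (intro prob_spaceI) (simp add: sp)
  with s 1 2 show ?thesis by (simp add: transport_plans_def)
qed

lemma integral_coupling:
  assumes [measurable]: "h \<in> borel_measurable borel" and i: "\<And>P. P \<in> C \<Longrightarrow> integrable AB (\<lambda>z. indicator (lc P \<times> rc P) z * h z)"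
  shows "(LINT z|coupling. h z) = (\<Sum>P\<in>C. (1 / mass P) * (LINT z|AB. indicator (lc P \<times> rc P) z * h z))"
proof -
  note [measurable] = weight_measurable
  have "(LINT z|coupling. h z) = (LINT z|AB. coupling_weight al C z * h z)"
    unfolding cell_coupling_def using weight_nonneg by (subst integral_real_density) auto
  also have "\<dots> = (LINT z|AB. (\<Sum>P\<in>C. (1 / mass P) * (indicator (lc P \<times> rc P) z * h z)))"
    unfolding coupling_weight_def sum_distrib_right
    by (intro Bochner_Integration.integral_cong refl sum.cong) (auto simp: indicator_def mem_Times_iff)
  also have "\<dots> = (\<Sum>P\<in>C. (1 / mass P) * (LINT z|AB. indicator (lc P \<times> rc P) z * h z))"
    using i by (subst Bochner_Integration.integral_sum) auto
  finally show ?thesis .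
qed

abbreviation good :: "'a cell_pair set" where "good \<equiv> {P\<in>C. narrow_pair (de / DIM('a)) Basis P}"

abbreviation bd :: "real \<Rightarrow> 'a \<Rightarrow> real" where "bd \<equiv> box_density al good"

lemma good_subset: "good \<subseteq> C" by auto

lemma finite_good: "finite good" using finC by simp

lemma good_narrow:
  assumes "P \<in> good" "e \<in> Basis"
  shows "\<not> wide (de / DIM('a)) (fst P e)" "\<not> wide (de / DIM('a)) (snd P e)"
  using assms by (auto simp: narrow_pair_def)

lemma good_nonempty:
  assumes "P \<in> C" shows "lc P \<noteq> {}" "rc P \<noteq> {}"
  using CD(3,4)[OF assms] by auto

lemma good_volumes:
  assumes P: "P \<in> good"
  defines "x \<equiv> (\<Prod>e\<in>Basis. side (fst P) e)" and "y \<equiv> (\<Prod>e\<in>Basis. side (snd P) e)"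
  shows "emeasure lborel (lc P) = ennreal x" "0 < x" "emeasure lborel (rc P) = ennreal y" "0 < y"
    "\<And>e. e \<in> Basis \<Longrightarrow> 0 < side (fst P) e" "\<And>e. e \<in> Basis \<Longrightarrow> 0 < side (snd P) e"
proof -
  have PC: "P \<in> C" using P by simp
  have "lc P \<notin> null_sets lborel" "rc P \<notin> null_sets lborel" using alD(5) beD(5) CD(3,4)[OF PC] by auto
  note V = cell_sides_pos[OF CD(1)[OF PC] good_narrow(1)[OF P] good_nonempty(1)[OF PC] this(1)]
    cell_sides_pos[OF CD(2)[OF PC] good_narrow(2)[OF P] good_nonempty(2)[OF PC] this(2)]
  show "emeasure lborel (lc P) = ennreal x" "0 < x" "emeasure lborel (rc P) = ennreal y" "0 < y"
    unfolding x_def y_def by (simp_all only: V(1,2,4,5))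
  show "0 < side (fst P) e" if "e \<in> Basis" for e by (rule V(3)) (use that in simp_all)
  show "0 < side (snd P) e" if "e \<in> Basis" for e by (rule V(6)) (use that in simp_all)
qed

context
  fixes t :: real
  assumes t: "t \<in> {0..1}"
begin

lemma box_side_pos:
  assumes "P \<in> good" "e \<in> Basis"
  shows "0 < (1 - t) * (side (fst P) e) + t * (side (snd P) e)"
proof (cases "t = 0")
  case False
  then show ?thesis using t good_volumes(5,6)[OF assms] by (intro add_nonneg_pos) auto
qed (use good_volumes(5)[OF assms] in simp)

lemma cell_volume_pos: "P \<in> good \<Longrightarrow> 0 < cell_volume t P"
  unfolding cell_volume_def using box_side_pos by (intro prod_pos) auto

lemma emeasure_cell_box:
  assumes "P \<in> good" shows "emeasure lborel (cell_box t P) = ennreal (cell_volume t P)"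
proof -
  have eq: "((1 - t) *\<^sub>R cell_upper (fst P) + t *\<^sub>R cell_upper (snd P)) \<bullet> e - ((1 - t) *\<^sub>R cell_lower (fst P) + t *\<^sub>R cell_lower (snd P)) \<bullet> e
    = (1 - t) * (side (fst P) e) + t * (side (snd P) e)" for e
    by (simp add: inner_simps algebra_simps)
  have le: "((1 - t) *\<^sub>R cell_lower (fst P) + t *\<^sub>R cell_lower (snd P)) \<bullet> e \<le> ((1 - t) *\<^sub>R cell_upper (fst P) + t *\<^sub>R cell_upper (snd P)) \<bullet> e"
    if "e \<in> Basis" for e
    using box_side_pos[OF assms that] eq[of e] by simp
  show ?thesis unfolding cell_box_def cell_volume_def eq[symmetric]
    by (subst emeasure_lborel_box) (use le in "auto simp: inner_diff_left")
qed

lemma norm_diff_box_le: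
  assumes P: "P \<in> good"
    and p: "p \<in> closed_box t P"
    and q: "q \<in> closed_box t P"
  shows "norm (p - q) \<le> de"
proof -
  have PC: "P \<in> C" using P by simp
  note E1 = CD(1)[OF PC] good_narrow(1)[OF P] good_nonempty(1)[OF PC]
  note E2 = CD(2)[OF PC] good_narrow(2)[OF P] good_nonempty(2)[OF PC]
  have "\<bar>(p - q) \<bullet> e\<bar> \<le> de / DIM('a)" if e: "e \<in> Basis" for e
  proof -
    have w: "(1 - t) * (side (fst P) e) + t * (side (snd P) e)
        \<le> (1 - t) * (de / DIM('a)) + t * (de / DIM('a))"
      using t cell_width[OF E1 e] cell_width[OF E2 e] by (intro add_mono mult_left_mono) auto
    have eqD: "(1 - t) * (de / DIM('a)) + t * (de / DIM('a)) = de / DIM('a)" by (simp only: left_diff_distrib mult_1 diff_add_cancel)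
    note w[unfolded eqD]
    moreover have "(1 - t) * (cell_lower (fst P) \<bullet> e) + t * (cell_lower (snd P) \<bullet> e) \<le> p \<bullet> e"
      "p \<bullet> e \<le> (1 - t) * (cell_upper (fst P) \<bullet> e) + t * (cell_upper (snd P) \<bullet> e)"
      "(1 - t) * (cell_lower (fst P) \<bullet> e) + t * (cell_lower (snd P) \<bullet> e) \<le> q \<bullet> e"
      "q \<bullet> e \<le> (1 - t) * (cell_upper (fst P) \<bullet> e) + t * (cell_upper (snd P) \<bullet> e)"
      using p q e by (auto simp: mem_box inner_simps)
    ultimately show ?thesis by (simp add: inner_diff_left abs_le_iff right_diff_distrib)
  qed
  then have "(\<Sum>e\<in>Basis. \<bar>(p - q) \<bullet> e\<bar>) \<le> of_nat (card (Basis :: 'a set)) * (de / DIM('a))" by (intro sum_bounded_above)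
  then show ?thesis using norm_le_l1[of "p - q"] by simp
qed

lemma interpolate_mem_cbox:
  assumes P: "P \<in> good" and z: "z \<in> lc P \<times> rc P"
  shows "interpolate t z \<in> closed_box t P"
proof -
  have PC: "P \<in> C" using P by simp
  note E1 = CD(1)[OF PC] good_narrow(1)[OF P] good_nonempty(1)[OF PC]
  note E2 = CD(2)[OF PC] good_narrow(2)[OF P] good_nonempty(2)[OF PC]
  have "fst z \<in> cbox (cell_lower (fst P)) (cell_upper (fst P))" "snd z \<in> cbox (cell_lower (snd P)) (cell_upper (snd P))"
    using z cell_subset_cbox[OF E1] cell_subset_cbox[OF E2] by auto
  then show ?thesis using t by (auto simp: mem_box interpolate_def inner_simps intro!: add_mono mult_left_mono)
qed

text \<open>The order along e common to both marginals gives Sup <= Inf at both ends, and convex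
  combinations keep it. The boxes are open because closed ones may share a face.\<close>

lemma cell_boxes_disjoint:
  assumes P: "P \<in> good" and Q: "Q \<in> good" and ne: "P \<noteq> Q"
  shows "cell_box t P \<inter> cell_box t Q = {}"
proof -
  have sepd: False if PQ: "P \<in> good" "Q \<in> good" "e \<in> Basis" "x \<in> cell_box t P" "x \<in> cell_box t Q"
      and lt: "\<forall>s\<in>fst P e. \<forall>s'\<in>fst Q e. s < s'" "\<forall>s\<in>snd P e. \<forall>s'\<in>snd Q e. s < s'" for P Q x e
  proof -
    have PC: "P \<in> C" "Q \<in> C" using PQ by auto
    have ne: "fst P e \<noteq> {}" "fst Q e \<noteq> {}" "snd P e \<noteq> {}" "snd Q e \<noteq> {}"
      using good_nonempty PC PQ(3) cell_coords_nonempty[OF CD(1) good_narrow(1)] cell_coords_nonempty[OF CD(2) good_narrow(2)] PQ(1,2)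
      by auto
    have "Sup (fst P e) \<le> Inf (fst Q e)" "Sup (snd P e) \<le> Inf (snd Q e)"
      using Sup_le_Inf[OF ne(1,2) lt(1)] Sup_le_Inf[OF ne(3,4) lt(2)] .
    then have "(1 - t) * Sup (fst P e) + t * Sup (snd P e) \<le> (1 - t) * Inf (fst Q e) + t * Inf (snd Q e)"
      using t by (intro add_mono mult_left_mono) auto
    moreover have "x \<bullet> e < (1 - t) * Sup (fst P e) + t * Sup (snd P e)" "(1 - t) * Inf (fst Q e) + t * Inf (snd Q e) < x \<bullet> e"
      using PQ(3-5) by (auto simp: cell_box_def mem_box inner_simps cell_lower_inner cell_upper_inner)
    ultimately show False by linarith
  qed
  have "separated P Q" using C P Q ne unfolding good_pairs_def by blast
  then obtain e where e: "e \<in> Basis" and alt: "((\<forall>s\<in>fst P e. \<forall>s'\<in>fst Q e. s < s') \<and> (\<forall>s\<in>snd P e. \<forall>s'\<in>snd Q e. s < s')) \<or>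
     ((\<forall>s\<in>fst P e. \<forall>s'\<in>fst Q e. s' < s) \<and> (\<forall>s\<in>snd P e. \<forall>s'\<in>snd Q e. s' < s))"
    unfolding separated_def by blast
  show ?thesis
  proof (rule ccontr)
    assume "cell_box t P \<inter> cell_box t Q \<noteq> {}"
    then obtain x where x: "x \<in> cell_box t P" "x \<in> cell_box t Q" by blast
    from alt show False
      using sepd[OF P Q e x] sepd[OF Q P e x(2,1)] by blast
  qed
qed

text \<open>Both averages of \<open>g\<close> are within \<open>w\<close> of the value of \<open>g\<close> at one point of the box.\<close>

lemma cell_average_close:
  assumes P: "P \<in> good" and [measurable]: "g \<in> borel_measurable borel" and w: "\<And>p q. norm (p - q) \<le> de \<Longrightarrow> \<bar>g p - g q\<bar> \<le> w"
  shows "integrable lborel (\<lambda>x. indicator (cell_box t P) x * g x)"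
    "integrable AB (\<lambda>z. indicator (lc P \<times> rc P) z * g (interpolate t z))"
    "\<bar>mass P / cell_volume t P * (LBINT x. indicator (cell_box t P) x * g x)
      - (1 / mass P) * (LINT z|AB. indicator (lc P \<times> rc P) z * g (interpolate t z))\<bar> \<le> 2 * w * mass P"
proof -
  have PC: "P \<in> C" using P by simp
  have m: "0 < mass P" by (rule CD(4)[OF PC])
  have v: "0 < cell_volume t P" by (rule cell_volume_pos[OF P])
  have vB: "measure lborel (cell_box t P) = cell_volume t P"
    using emeasure_cell_box[OF P] v by (simp add: measure_def)
  have Bm[measurable]: "cell_box t P \<in> sets borel" by (simp add: cell_box_def)
  have "cell_box t P \<noteq> {}" using vB v by auto
  then obtain p0 where p0: "p0 \<in> cell_box t P" by blast
  have sub: "cell_box t P \<subseteq> closed_box t P"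
    unfolding cell_box_def by (rule box_subset_cbox)
  have c1: "\<bar>g x - g p0\<bar> \<le> w" if "x \<in> cell_box t P" for x
    using that p0 sub by (intro w norm_diff_box_le[OF P]) auto
  have c2: "\<bar>g (interpolate t z) - g p0\<bar> \<le> w" if "z \<in> lc P \<times> rc P" for z
    using p0 sub by (intro w norm_diff_box_le[OF P] interpolate_mem_cbox[OF P that]) auto
  have w0: "0 \<le> w" using c1[OF p0] by simp
  have gen: "integrable M (\<lambda>z. indicator S z * k z) \<and> \<bar>(LINT z|M. indicator S z * k z) - measure M S * g p0\<bar> \<le> w * measure M S"
    if [measurable]: "S \<in> sets M" "k \<in> borel_measurable M" and fin: "emeasure M S < \<infinity>"
      and close: "\<And>z. z \<in> S \<Longrightarrow> \<bar>k z - g p0\<bar> \<le> w" for M :: "'m measure" and S k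
  proof
    have iS: "integrable M (indicator S :: 'm \<Rightarrow> real)" using fin by (intro integrable_real_indicator) auto
    show i: "integrable M (\<lambda>z. indicator S z * k z)"
    proof (rule Bochner_Integration.integrable_bound)
      show "integrable M (\<lambda>z. indicator S z * (\<bar>g p0\<bar> + w))" using iS by simp
      show "AE z in M. norm (indicator S z * k z) \<le> norm (indicator S z * (\<bar>g p0\<bar> + w))"
        using close w0 by (intro AE_I2) (fastforce simp: indicator_def abs_le_iff)
    qed simp
    have "\<bar>(LINT z|M. indicator S z * k z) - measure M S * g p0\<bar> = \<bar>LINT z|M. indicator S z * k z - indicator S z * g p0\<bar>"
      using i iS by simp
    also have "\<dots> \<le> (LINT z|M. indicator S z * w)"
    proof (rule order_trans[OF integral_abs_bound], rule integral_mono)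
      show "\<bar>indicator S z * k z - indicator S z * g p0\<bar> \<le> indicator S z * w" for z
        using close[of z] by (simp add: indicator_def)
    qed (use i iS in auto)
    also have "\<dots> = w * measure M S" using iS by simp
    finally show "\<bar>(LINT z|M. indicator S z * k z) - measure M S * g p0\<bar> \<le> w * measure M S" .
  qed
  have r1: "integrable lborel (\<lambda>x. indicator (cell_box t P) x * g x) \<and>
     \<bar>(LBINT x. indicator (cell_box t P) x * g x) - measure lborel (cell_box t P) * g p0\<bar> \<le> w * measure lborel (cell_box t P)"
    by (rule gen) (use c1 emeasure_cell_box[OF P] in auto)
  have cS: "lc P \<times> rc P \<in> sets AB"
    using cell_meas[OF PC] by (intro pair_measureI) (auto simp: sal sbe)
  have mS: "measure AB (lc P \<times> rc P) = mass P * mass P"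
    using cell_meas[OF PC] CD(3)[OF PC]
    by (subst measure_def, subst be.emeasure_pair_measure_Times) (auto simp: sal sbe al.emeasure_eq_measure be.emeasure_eq_measure simp flip: ennreal_mult')
  have r2: "integrable AB (\<lambda>z. indicator (lc P \<times> rc P) z * g (interpolate t z)) \<and>
     \<bar>(LINT z|AB. indicator (lc P \<times> rc P) z * g (interpolate t z)) - measure AB (lc P \<times> rc P) * g p0\<bar>
     \<le> w * measure AB (lc P \<times> rc P)"
  proof (rule gen)
    show "emeasure AB (lc P \<times> rc P) < \<infinity>"
      using ab.emeasure_finite[of "lc P \<times> rc P"] by (simp only: infinity_ennreal_def less_top)
  qed (use c2 cS in auto)
  show "integrable lborel (\<lambda>x. indicator (cell_box t P) x * g x)"
    "integrable AB (\<lambda>z. indicator (lc P \<times> rc P) z * g (interpolate t z))"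
    using r1 r2 by auto
  define I1 where "I1 = (LBINT x. indicator (cell_box t P) x * g x)"
  define I2 where "I2 = (LINT z|AB. indicator (lc P \<times> rc P) z * g (interpolate t z))"
  have "\<bar>mass P / cell_volume t P * I1 - mass P * g p0\<bar> = mass P / cell_volume t P * \<bar>I1 - cell_volume t P * g p0\<bar>"
  proof -
    have "mass P / cell_volume t P * I1 - mass P * g p0 = mass P / cell_volume t P * (I1 - cell_volume t P * g p0)"
      using v by (simp add: right_diff_distrib)
    then show ?thesis using m v by (simp only: abs_mult abs_of_pos[OF divide_pos_pos])
  qed
  also have "\<dots> \<le> mass P / cell_volume t P * (w * cell_volume t P)"
    using r1 m v unfolding I1_def vB by (intro mult_left_mono) auto
  finally have A1: "\<bar>mass P / cell_volume t P * I1 - mass P * g p0\<bar> \<le> w * mass P" using v by (simp add: mult.commute)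
  have "\<bar>(1 / mass P) * I2 - mass P * g p0\<bar> = (1 / mass P) * \<bar>I2 - mass P * mass P * g p0\<bar>"
  proof -
    have "(1 / mass P) * I2 - mass P * g p0 = (1 / mass P) * (I2 - mass P * mass P * g p0)"
      using m by (simp add: right_diff_distrib)
    then show ?thesis using m by (simp only: abs_mult abs_of_pos[OF divide_pos_pos] zero_less_one)
  qed
  also have "\<dots> \<le> (1 / mass P) * (w * (mass P * mass P))"
    using r2 m unfolding I2_def mS by (intro mult_left_mono) auto
  finally have A2: "\<bar>(1 / mass P) * I2 - mass P * g p0\<bar> \<le> w * mass P" using m by simp
  show "\<bar>mass P / cell_volume t P * (LBINT x. indicator (cell_box t P) x * g x)
      - (1 / mass P) * (LINT z|AB. indicator (lc P \<times> rc P) z * g (interpolate t z))\<bar> \<le> 2 * w * mass P"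
  proof -
    have tri: "\<bar>x - z\<bar> \<le> w \<Longrightarrow> \<bar>y - z\<bar> \<le> w \<Longrightarrow> \<bar>x - y\<bar> \<le> 2 * w" for x y z w :: real by linarith
    show ?thesis using tri[OF A1 A2] unfolding I1_def I2_def by (simp only: mult.assoc)
  qed
qed

lemma box_density_measurable: "bd t \<in> borel_measurable borel"
  unfolding box_density_def
  by (intro borel_measurable_sum borel_measurable_times borel_measurable_const borel_measurable_indicator) (simp add: cell_box_def)

lemma box_density_nonneg: "0 \<le> bd t x"
  unfolding box_density_def using cell_volume_pos by (intro sum_nonneg mult_nonneg_nonneg divide_nonneg_pos) auto

lemma integral_box_density:
  assumes i: "\<And>P. P \<in> good \<Longrightarrow> integrable lborel (\<lambda>x. indicator (cell_box t P) x * g x)"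
  shows "integrable lborel (\<lambda>x. g x * bd t x)"
    "(LBINT x. g x * bd t x)
      = (\<Sum>P\<in>good. mass P / cell_volume t P * (LBINT x. indicator (cell_box t P) x * g x))"
proof -
  have eq: "g x * bd t x = (\<Sum>P\<in>good. mass P / cell_volume t P * (indicator (cell_box t P) x * g x))" for x
    unfolding box_density_def sum_distrib_left by (intro sum.cong) (auto simp: mult_ac)
  show "integrable lborel (\<lambda>x. g x * bd t x)"
    unfolding eq by (intro Bochner_Integration.integrable_sum integrable_mult_right i)
  have "(LBINT x. g x * bd t x) = (\<Sum>P\<in>good. LBINT x. mass P / cell_volume t P * (indicator (cell_box t P) x * g x))"
    unfolding eq by (intro Bochner_Integration.integral_sum integrable_mult_right i)
  also have "\<dots> = (\<Sum>P\<in>good. mass P / cell_volume t P * (LBINT x. indicator (cell_box t P) x * g x))"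
    by (intro sum.cong integral_mult_right_zero refl)
  finally show "(LBINT x. g x * bd t x)
      = (\<Sum>P\<in>good. mass P / cell_volume t P * (LBINT x. indicator (cell_box t P) x * g x))" .
qed

lemma box_density_integrable: "integrable lborel (bd t)"
proof -
  have "integrable lborel (\<lambda>x. indicator (cell_box t P) x * (1::real))" if "P \<in> good" for P
    using cell_average_close(1)[OF that, of "\<lambda>_. 1" 0] by simp
  from integral_box_density(1)[OF this] show ?thesis by simp
qed

lemma sum_good_bad: "(\<Sum>P\<in>C. (h P :: real)) = (\<Sum>P\<in>good. h P) + (\<Sum>P | P \<in> C \<and> \<not> narrow_pair (de / DIM('a)) Basis P. h P)"
proof -
  have "C = good \<union> {P\<in>C. \<not> narrow_pair (de / DIM('a)) Basis P}" by auto
  then have "(\<Sum>P\<in>C. h P) = (\<Sum>P\<in>good \<union> {P\<in>C. \<not> narrow_pair (de / DIM('a)) Basis P}. h P)" by simp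
  also have "\<dots> = (\<Sum>P\<in>good. h P) + (\<Sum>P\<in>{P\<in>C. \<not> narrow_pair (de / DIM('a)) Basis P}. h P)"
    by (rule sum.union_disjoint) (use finC in auto)
  finally show ?thesis .
qed

lemma mass_good_le: "(\<Sum>P\<in>good. mass P) \<le> 1"
  using sum_mono2[OF finC good_subset, of mass] mass_sum by simp

text \<open>On a good pair both integrals average g over the same small box. Bad pairs are absent
  from the box density and contribute at most G times their mass to the other side.\<close>

lemma coupling_close:
  assumes [measurable]: "g \<in> borel_measurable borel" and w: "\<And>p q. norm (p - q) \<le> de \<Longrightarrow> \<bar>g p - g q\<bar> \<le> w"
    and G: "\<And>x. \<bar>g x\<bar> \<le> G"
  shows "\<bar>(LBINT x. g x * bd t x) - (LINT z|coupling. g (interpolate t z))\<bar> \<le> 2 * w + G * ep"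
proof -
  let ?I1 = "\<lambda>P. LBINT x. indicator (cell_box t P) x * g x"
  let ?I2 = "\<lambda>P. LINT z|AB. indicator (lc P \<times> rc P) z * g (interpolate t z)"
  let ?bad = "{P. P \<in> C \<and> \<not> narrow_pair (de / DIM('a)) Basis P}"
  have cS: "lc P \<times> rc P \<in> sets AB" if "P \<in> C" for P
    using cell_meas[OF that] by (intro pair_measureI) (auto simp: sal sbe)
  have mS: "measure AB (lc P \<times> rc P) = mass P * mass P" if "P \<in> C" for P
    using cell_meas[OF that] CD(3)[OF that]
    by (subst measure_def, subst be.emeasure_pair_measure_Times) (auto simp: sal sbe al.emeasure_eq_measure be.emeasure_eq_measure simp flip: ennreal_mult')
  have G0: "0 \<le> G" using order_trans[OF abs_ge_zero G] .
  have w0: "0 \<le> w" using w[of 0 0] de by simp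
  have i: "integrable AB (\<lambda>z. indicator (lc P \<times> rc P) z * g (interpolate t z))" if "P \<in> C" for P
    using cS[OF that] G G0 by (intro ab.integrable_const_bound[where B=G]) (auto simp: indicator_def)
  have I2: "\<bar>(1 / mass P) * ?I2 P\<bar> \<le> G * mass P" if P: "P \<in> C" for P
  proof -
    have "\<bar>?I2 P\<bar> \<le> (LINT z|AB. indicator (lc P \<times> rc P) z * G)"
    proof (rule order_trans[OF integral_abs_bound], rule integral_mono)
      show "integrable AB (\<lambda>z. \<bar>indicator (lc P \<times> rc P) z * g (interpolate t z)\<bar>)"
        using i[OF P] by (rule integrable_abs)
      show "integrable AB (\<lambda>z. indicator (lc P \<times> rc P) z * G)"
        using cS[OF P] G0 by (intro ab.integrable_const_bound[where B=G]) (auto simp: indicator_def)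
      show "\<bar>indicator (lc P \<times> rc P) z * g (interpolate t z)\<bar> \<le> indicator (lc P \<times> rc P) z * G" for z
        using G by (auto simp: indicator_def)
    qed
    also have "\<dots> = mass P * mass P * G" using cS[OF P] mS[OF P] by simp
    finally have "(1 / mass P) * \<bar>?I2 P\<bar> \<le> (1 / mass P) * (mass P * mass P * G)" by (rule mult_left_mono) simp
    also have "\<dots> = G * mass P" using CD(4)[OF P] by simp
    finally show ?thesis by (simp add: abs_mult)
  qed
  have e1: "(LBINT x. g x * bd t x) = (\<Sum>P\<in>good. mass P / cell_volume t P * ?I1 P)"
    by (rule integral_box_density(2)) (rule cell_average_close(1)[OF _ assms(1) w])
  have e2: "(LINT z|coupling. g (interpolate t z)) = (\<Sum>P\<in>good. (1 / mass P) * ?I2 P) + (\<Sum>P\<in>?bad. (1 / mass P) * ?I2 P)"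
    unfolding sum_good_bad[symmetric] by (rule integral_coupling[OF _ i]) auto
  have "\<bar>(\<Sum>P\<in>good. mass P / cell_volume t P * ?I1 P) - (\<Sum>P\<in>good. (1 / mass P) * ?I2 P)\<bar> \<le> (\<Sum>P\<in>good. 2 * w * mass P)"
    unfolding sum_subtractf[symmetric]
    by (rule order_trans[OF sum_abs], rule sum_mono) (rule cell_average_close(3)[OF _ assms(1) w])
  also have "\<dots> = 2 * w * (\<Sum>P\<in>good. mass P)" by (simp add: sum_distrib_left)
  also have "\<dots> \<le> 2 * w * 1" using w0 mass_good_le by (intro mult_left_mono) auto
  finally have d1: "\<bar>(\<Sum>P\<in>good. mass P / cell_volume t P * ?I1 P) - (\<Sum>P\<in>good. (1 / mass P) * ?I2 P)\<bar> \<le> 2 * w" by simp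
  have "\<bar>\<Sum>P\<in>?bad. (1 / mass P) * ?I2 P\<bar> \<le> (\<Sum>P\<in>?bad. G * mass P)"
    by (rule order_trans[OF sum_abs], rule sum_mono) (rule I2, simp)
  also have "\<dots> = G * (\<Sum>P\<in>?bad. mass P)" by (simp add: sum_distrib_left)
  also have "\<dots> \<le> G * ep" using G0 bad by (intro mult_left_mono) auto
  finally have d2: "\<bar>\<Sum>P\<in>?bad. (1 / mass P) * ?I2 P\<bar> \<le> G * ep" .
  have tri: "\<bar>x - y\<bar> \<le> u \<Longrightarrow> \<bar>z\<bar> \<le> w \<Longrightarrow> \<bar>x - (y + z)\<bar> \<le> u + w" for x y z u w :: real by linarith
  show ?thesis unfolding e1 e2 by (rule tri[OF d1 d2])
qed

text \<open>\<open>norm1\<close> is unbounded, so the contribution of bad pairs is not controlled by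
  their mass. It is nonnegative and gets dropped, which leaves an upper bound.\<close>

lemma norm1_coupling_close:
  "integrable lborel (\<lambda>x. norm1 x * bd t x)"
  "(LBINT x. norm1 x * bd t x) \<le> (LINT z|coupling. norm1 (interpolate t z)) + 2 * (DIM('a) * de)"
proof -
  let ?I1 = "\<lambda>P. LBINT x. indicator (cell_box t P) x * norm1 x"
  let ?I2 = "\<lambda>P. LINT z|AB. indicator (lc P \<times> rc P) z * norm1 (interpolate t z)"
  let ?bad = "{P. P \<in> C \<and> \<not> narrow_pair (de / DIM('a)) Basis P}"
  have w: "\<bar>norm1 (p :: 'a) - norm1 q\<bar> \<le> DIM('a) * de" if "norm (p - q) \<le> de" for p q
    using norm1_diff_le[of p q] that by (rule order_trans[OF _ mult_left_mono]) simp
  have cS: "lc P \<times> rc P \<in> sets AB" if "P \<in> C" for P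
    using cell_meas[OF that] by (intro pair_measureI) (auto simp: sal sbe)
  have PP: "AB \<in> P2" using transport_plan_second_moment(1)[OF pair_measure_plan[OF alP beP] alP beP] .
  have iall: "integrable AB (\<lambda>z. norm1 (interpolate t z))"
    using P2_norm1_integrable[OF distr_interpolate_P2[OF PP t]] by (subst (asm) integrable_distr_eq) auto
  have i: "integrable AB (\<lambda>z. indicator (lc P \<times> rc P) z * norm1 (interpolate t z))" if "P \<in> C" for P
    using integrable_mult_indicator[OF cS[OF that] iall] by simp
  have iB: "integrable lborel (\<lambda>x. indicator (cell_box t P) x * norm1 x)" if "P \<in> good" for P
    by (rule cell_average_close(1)[OF that norm1_measurable w])
  show "integrable lborel (\<lambda>x. norm1 x * bd t x)" by (rule integral_box_density(1)[OF iB])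
  have e1: "(LBINT x. norm1 x * bd t x) = (\<Sum>P\<in>good. mass P / cell_volume t P * ?I1 P)"
    by (rule integral_box_density(2)[OF iB])
  have e2: "(LINT z|coupling. norm1 (interpolate t z)) = (\<Sum>P\<in>good. (1 / mass P) * ?I2 P) + (\<Sum>P\<in>?bad. (1 / mass P) * ?I2 P)"
    unfolding sum_good_bad[symmetric] by (rule integral_coupling[OF _ i]) auto
  have bad0: "0 \<le> (\<Sum>P\<in>?bad. (1 / mass P) * ?I2 P)" by (intro sum_nonneg mult_nonneg_nonneg integral_nonneg_AE) auto
  have "(\<Sum>P\<in>good. mass P / cell_volume t P * ?I1 P) \<le> (\<Sum>P\<in>good. (1 / mass P) * ?I2 P + 2 * (DIM('a) * de) * mass P)"
  proof (rule sum_mono)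
    fix P assume P: "P \<in> good"
    have tri: "\<bar>x - y\<bar> \<le> w \<Longrightarrow> x \<le> y + w" for x y w :: real by linarith
    show "mass P / cell_volume t P * ?I1 P \<le> (1 / mass P) * ?I2 P + 2 * (DIM('a) * de) * mass P"
      by (rule tri[OF cell_average_close(3)[OF P norm1_measurable w]])
  qed
  also have "\<dots> = (\<Sum>P\<in>good. (1 / mass P) * ?I2 P) + 2 * (DIM('a) * de) * (\<Sum>P\<in>good. mass P)"
    by (simp add: sum.distrib sum_distrib_left)
  also have "\<dots> \<le> (\<Sum>P\<in>good. (1 / mass P) * ?I2 P) + 2 * (DIM('a) * de) * 1"
    using de mass_good_le by (intro add_left_mono mult_left_mono) auto
  finally show "(LBINT x. norm1 x * bd t x) \<le> (LINT z|coupling. norm1 (interpolate t z)) + 2 * (DIM('a) * de)"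
    unfolding e1 e2 using bad0 by simp
qed

text \<open>The boxes are disjoint and f 0 = 0, so the energy is a sum over the good pairs; for each
  of them the volume inequality is followed by Jensen's inequality on both cells. The right side
  integrates over the good cells only, since f may be negative on the remainders E and E'.\<close>

lemma box_energy:
  defines "E \<equiv> - (\<Union>P\<in>good. lc P)" and "E' \<equiv> - (\<Union>P\<in>good. rc P)"
  shows "integrable lborel (\<lambda>x. f (bd t x))" "E \<in> sets borel" "E' \<in> sets borel"
    "measure al E \<le> ep" "measure be E' \<le> ep"
    "(LBINT x. f (bd t x))
      \<le> (1 - t) * (LBINT x. indicator (- E) x * f (a x)) + t * (LBINT x. indicator (- E') x * f (b x))"
proof -
  let ?v = "\<lambda>P. cell_volume t P * f (mass P / cell_volume t P)"
  have eq: "f (bd t x) = (\<Sum>P\<in>good. indicator (cell_box t P) x * f (mass P / cell_volume t P))" for x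
  proof (cases "\<exists>P\<in>good. x \<in> cell_box t P")
    case True
    then obtain P where P: "P \<in> good" "x \<in> cell_box t P" by blast
    have Q: "x \<notin> cell_box t Q" if "Q \<in> good - {P}" for Q
    proof -
      have "cell_box t P \<inter> cell_box t Q = {}" using that P by (intro cell_boxes_disjoint) auto
      then show ?thesis using P(2) by blast
    qed
    have "bd t x = mass P / cell_volume t P"
      unfolding box_density_def using Q P by (subst sum.remove[OF finite_good P(1)]) auto
    moreover have "(\<Sum>P\<in>good. indicator (cell_box t P) x * f (mass P / cell_volume t P)) = f (mass P / cell_volume t P)"
      using Q P by (subst sum.remove[OF finite_good P(1)]) auto
    ultimately show ?thesis by simp
  next
    case False
    then have "bd t x = 0" unfolding box_density_def by (intro sum.neutral) auto
    moreover have "(\<Sum>P\<in>good. indicator (cell_box t P) x * f (mass P / cell_volume t P)) = 0" using False by (intro sum.neutral) auto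
    ultimately show ?thesis by (simp add: f0)
  qed
  have iB: "integrable lborel (indicator (cell_box t P) :: 'a \<Rightarrow> real)" if "P \<in> good" for P
    using emeasure_cell_box[OF that] by (intro integrable_real_indicator) (auto simp: cell_box_def)
  show "integrable lborel (\<lambda>x. f (bd t x))" unfolding eq
    by (intro Bochner_Integration.integrable_sum integrable_mult_left iB)
  have int: "(LBINT x. f (bd t x)) = (\<Sum>P\<in>good. ?v P)"
  proof -
    have "(LBINT x. f (bd t x)) = (\<Sum>P\<in>good. LBINT x. indicator (cell_box t P) x * f (mass P / cell_volume t P))"
      unfolding eq using iB by (intro Bochner_Integration.integral_sum) simp
    also have "\<dots> = (\<Sum>P\<in>good. ?v P)"
    proof (rule sum.cong[OF refl])
      fix P assume P: "P \<in> good"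
      have "measure lborel (cell_box t P) = cell_volume t P"
        using emeasure_cell_box[OF P] cell_volume_pos[OF P] by (simp add: measure_def)
      then show "(LBINT x. indicator (cell_box t P) x * f (mass P / cell_volume t P)) = ?v P" using iB[OF P] by simp
    qed
    finally show ?thesis .
  qed
  note [measurable] = union_cells_measurable[OF good_subset]
  show "E \<in> sets borel" "E' \<in> sets borel"
    unfolding E_def E'_def using union_cells_measurable[OF good_subset] by (simp_all only: borel_comp)
  have badm: "1 - (\<Sum>P\<in>good. mass P) \<le> ep" using sum_good_bad[of mass] mass_sum bad by simp
  have "measure al E = 1 - (\<Sum>P\<in>good. mass P)"
    unfolding E_def measure_union_cells(1)[OF good_subset, symmetric]
    using al.prob_compl[of "\<Union>P\<in>good. lc P"] sets_eq_imp_space_eq[OF sal] by (simp add: Compl_eq_Diff_UNIV)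
  then show "measure al E \<le> ep" using badm by simp
  have "measure be E' = 1 - (\<Sum>P\<in>good. mass P)"
    unfolding E'_def measure_union_cells(2)[OF good_subset, symmetric]
    using be.prob_compl[of "\<Union>P\<in>good. rc P"] sets_eq_imp_space_eq[OF sbe] by (simp add: Compl_eq_Diff_UNIV)
  then show "measure be E' \<le> ep" using badm by simp
  have le: "?v P \<le> (1 - t) * (LBINT x. indicator (lc P) x * f (a x)) + t * (LBINT x. indicator (rc P) x * f (b x))"
    if P: "P \<in> good" for P
  proof -
    have PC: "P \<in> C" using P by simp
    let ?x = "\<Prod>e\<in>Basis. side (fst P) e"
    let ?y = "\<Prod>e\<in>Basis. side (snd P) e"
    note V = good_volumes[OF P]
    have gm: "(1 - t) * ?x powr (1 / dim) + t * ?y powr (1 / dim) \<le> cell_volume t P powr (1 / dim)"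
      unfolding cell_volume_def dim_eq using t V by (intro geometric_mean_superadditive) auto
    have "?v P \<le> (1 - t) * (?x * f (mass P / ?x)) + t * (?y * f (mass P / ?y))"
      using t V cell_volume_pos[OF P] CD(4)[OF PC] gm by (intro volume_energy_convex) auto
    also have "\<dots> \<le> (1 - t) * (LBINT x. indicator (lc P) x * f (a x)) + t * (LBINT x. indicator (rc P) x * f (b x))"
    proof (intro add_mono mult_left_mono)
      show "?x * f (mass P / ?x) \<le> (LBINT x. indicator (lc P) x * f (a x))"
        by (rule jensen_cell[OF a_m a0 alD(1) fa cell_meas(1)[OF PC] V(1,2) _ CD(4)[OF PC]]) (simp add: alD(2) cell_meas(1)[OF PC])
      show "?y * f (mass P / ?y) \<le> (LBINT x. indicator (rc P) x * f (b x))"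
        by (rule jensen_cell[OF b_m b0 beD(1) fb cell_meas(2)[OF PC] V(3,4) _ CD(4)[OF PC]]) (simp add: beD(2) cell_meas(2)[OF PC] CD(3)[OF PC])
    qed (use t in auto)
    finally show ?thesis .
  qed
  have ind: "(\<Sum>P\<in>good. LBINT x. indicator (F P) x * g x) = (LBINT x. indicator (\<Union>P\<in>good. F P) x * g x)"
    if dj: "disjoint_family_on F good" and m: "\<And>P. P \<in> good \<Longrightarrow> F P \<in> sets borel" and g: "integrable lborel g" for F :: "_ \<Rightarrow> 'a set" and g :: "'a \<Rightarrow> real"
  proof -
    have "(LBINT x. indicator (\<Union>P\<in>good. F P) x * g x) = (LBINT x. (\<Sum>P\<in>good. indicator (F P) x * g x))"
      unfolding sum_distrib_right[symmetric] indicator_UN_disjoint[OF finite_good dj] ..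
    also have "\<dots> = (\<Sum>P\<in>good. LBINT x. indicator (F P) x * g x)"
    proof (rule Bochner_Integration.integral_sum)
      fix P assume "P \<in> good"
      then show "integrable lborel (\<lambda>x. indicator (F P) x * g x)"
        using integrable_mult_indicator[OF _ g, of "F P"] m by simp
    qed
    finally show ?thesis by simp
  qed
  note dj = cells_disjoint_family[OF good_subset]
  have "(\<Sum>P\<in>good. ?v P) \<le> (1 - t) * (\<Sum>P\<in>good. LBINT x. indicator (lc P) x * f (a x))
      + t * (\<Sum>P\<in>good. LBINT x. indicator (rc P) x * f (b x))"
    unfolding sum_distrib_left sum.distrib[symmetric] by (rule sum_mono) (rule le)
  then show "(LBINT x. f (bd t x))
      \<le> (1 - t) * (LBINT x. indicator (- E) x * f (a x)) + t * (LBINT x. indicator (- E') x * f (b x))"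
    unfolding int E_def E'_def double_complement
    using ind[OF dj(1) _ fa] ind[OF dj(2) _ fb] cell_meas by simp
qed

end

end

end

section \<open>The limit of small cells\<close>

lemma transport_plan_limit:
  assumes "prob_space Om" and [measurable]: "\<And>k. X k \<in> borel_measurable Om" "Y \<in> borel_measurable Om"
    and lim: "converges_AE Om X Y"
    and pl: "\<And>k. distr Om borel (X k) \<in> transport_plans mu nu" and "mu \<in> P2" "nu \<in> P2"
  shows "distr Om borel Y \<in> transport_plans mu nu"
proof -
  interpret prob_space Om by fact
  have fstX: "distr Om borel (\<lambda>w. fst (X k w)) = mu" "distr Om borel (\<lambda>w. snd (X k w)) = nu" for k
    using transport_plansD(3,4)[OF pl[of k]] by (simp_all add: distr_distr comp_def)
  have m1: "distr Om borel (\<lambda>w. fst (Y w)) = mu"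
  proof (rule distr_limit_eq[where X="\<lambda>k w. fst (X k w)"])
    show "AE w in Om. (\<lambda>k. fst (X k w)) \<longlonglongrightarrow> fst (Y w)" using lim by eventually_elim (rule tendsto_fst)
  qed (auto simp: fstX narrowly_converges_const P2_prob P2_sets assms)
  have m2: "distr Om borel (\<lambda>w. snd (Y w)) = nu"
  proof (rule distr_limit_eq[where X="\<lambda>k w. snd (X k w)"])
    show "AE w in Om. (\<lambda>k. snd (X k w)) \<longlonglongrightarrow> snd (Y w)" using lim by eventually_elim (rule tendsto_snd)
  qed (auto simp: fstX narrowly_converges_const P2_prob P2_sets assms)
  show ?thesis
    unfolding transport_plans_def using m1 m2 by (simp add: prob_space_distr distr_distr comp_def)
qed

text \<open>|g| is at most M a plus the positive part of |g| - M a. The latter has small integral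
  for large M because g vanishes where a does; the former yields M times the al-mass of E n. The
  remainders of the cells are small in al-mass, not in volume.\<close>

lemma integral_small_sets_tendsto_0:
  fixes a g :: "'a::euclidean_space \<Rightarrow> real"
  assumes [measurable]: "a \<in> borel_measurable borel" and a0: "\<And>x. 0 \<le> a x" and al: "al = lebesgue_density a"
    and "prob_space al" and g: "integrable lborel g" and ga: "\<And>x. a x = 0 \<Longrightarrow> g x = 0"
    and E[measurable]: "\<And>n. E n \<in> sets borel" and lim: "(\<lambda>n. measure al (E n)) \<longlonglongrightarrow> 0"
  shows "(\<lambda>n. LBINT x. indicator (E n) x * g x) \<longlonglongrightarrow> 0"
proof -
  note D = density_prob_integrable[OF assms(1) a0 al assms(4)]
  have [measurable]: "g \<in> borel_measurable borel" using g by simp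
  define h where "h M x = max 0 (\<bar>g x\<bar> - real M * a x)" for M :: nat and x
  have hi: "integrable lborel (h M)" for M
    unfolding h_def using g D(1) by simp
  have "(\<lambda>M. LBINT x. h M x) \<longlonglongrightarrow> (LINT x|(lborel :: 'a measure). 0)"
  proof (rule integral_dominated_convergence[where w="\<lambda>x. \<bar>g x\<bar>"])
    show "AE x in lborel. (\<lambda>M. h M x) \<longlonglongrightarrow> 0"
    proof (intro AE_I2)
      fix x :: 'a
      show "(\<lambda>M. h M x) \<longlonglongrightarrow> 0"
      proof (cases "a x = 0")
        case True then show ?thesis using ga[OF True] by (simp add: h_def)
      next
        case False
        then have "0 < a x" using a0[of x] by simp
        then obtain M0 :: nat where M0: "\<bar>g x\<bar> < real M0 * a x" using reals_Archimedean3 by blast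
        have "h M x = 0" if "M \<ge> M0" for M
        proof -
          have "real M0 * a x \<le> real M * a x" using that a0 by (intro mult_right_mono) auto
          with M0 show ?thesis by (simp add: h_def)
        qed
        then show ?thesis by (intro tendsto_eventually eventually_sequentiallyI)
      qed
    qed
    show "AE x in lborel. norm (h M x) \<le> \<bar>g x\<bar>" for M using a0 by (intro AE_I2) (auto simp: h_def)
  qed (use g in "auto simp: h_def")
  then have hlim: "(\<lambda>M. LBINT x. h M x) \<longlonglongrightarrow> 0" by simp
  have bound: "\<bar>LBINT x. indicator (E n) x * g x\<bar> \<le> (LBINT x. h M x) + real M * measure al (E n)" for n M
  proof -
    have i1: "integrable lborel (\<lambda>x. indicator (E n) x * g x)" "integrable lborel (\<lambda>x. indicator (E n) x * a x)"
      using integrable_mult_indicator[OF _ g, of "E n"] integrable_mult_indicator[OF _ D(1), of "E n"] by auto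
    have "\<bar>LBINT x. indicator (E n) x * g x\<bar> \<le> (LBINT x. h M x + real M * (indicator (E n) x * a x))"
    proof (rule order_trans[OF integral_abs_bound], rule integral_mono)
      show "\<bar>indicator (E n) x * g x\<bar> \<le> h M x + real M * (indicator (E n) x * a x)" for x
        by (auto simp: h_def indicator_def)
    qed (use i1 hi in auto)
    also have "\<dots> = (LBINT x. h M x) + real M * measure al (E n)" using i1 hi D(2)[OF E] by simp
    finally show ?thesis .
  qed
  show ?thesis
  proof (rule LIMSEQ_I)
    fix e :: real assume e: "0 < e"
    obtain M where M: "(LBINT x. h M x) < e / 2"
      using order_tendstoD(2)[OF hlim, of "e / 2"] e by (auto simp: eventually_sequentially)
    have "(\<lambda>n. real M * measure al (E n)) \<longlonglongrightarrow> real M * 0" by (intro tendsto_intros lim)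
    then obtain n0 where n0: "\<And>n. n \<ge> n0 \<Longrightarrow> real M * measure al (E n) < e / 2"
      using order_tendstoD(2)[of "\<lambda>n. real M * measure al (E n)" 0 sequentially "e / 2"] e by (auto simp: eventually_sequentially)
    show "\<exists>n0. \<forall>n\<ge>n0. norm ((LBINT x. indicator (E n) x * g x) - 0) < e"
    proof (intro exI allI impI)
      fix n assume "n \<ge> n0"
      from n0[OF this] M bound[of n M] show "norm ((LBINT x. indicator (E n) x * g x) - 0) < e" by simp
    qed
  qed
qed

context mccann_energy
begin

text \<open>What the cells of one mesh provide at time t, with a single parameter \<open>de\<close>
  for the mesh and for the lost mass.\<close>

definition approximates :: "'a::euclidean_space measure \<Rightarrow> 'a measure \<Rightarrow> ('a \<Rightarrow> real) \<Rightarrow> ('a \<Rightarrow> real) \<Rightarrow>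
    real \<Rightarrow> 'a cell_pair set \<Rightarrow> real \<Rightarrow> ('a \<Rightarrow> real) \<Rightarrow> 'a set \<Rightarrow> 'a set \<Rightarrow> bool" where
  "approximates al be a b de C t r E E' \<longleftrightarrow> r \<in> borel_measurable borel \<and> (\<forall>x. 0 \<le> r x) \<and> integrable lborel r \<and>
      (\<forall>g w G. g \<in> borel_measurable borel \<longrightarrow> (\<forall>p q. norm (p - q) \<le> de \<longrightarrow> \<bar>g p - g q\<bar> \<le> w) \<longrightarrow> (\<forall>x. \<bar>g x\<bar> \<le> G) \<longrightarrow>
         \<bar>(LBINT x. g x * r x) - (\<integral>z. g (interpolate t z) \<partial>cell_coupling al be C)\<bar> \<le> 2 * w + G * de) \<and>
      integrable lborel (\<lambda>x. norm1 x * r x) \<and>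
      (LBINT x. norm1 x * r x) \<le> (\<integral>z. norm1 (interpolate t z) \<partial>cell_coupling al be C) + 2 * (DIM('a) * de) \<and>
      integrable lborel (\<lambda>x. f (r x)) \<and> E \<in> sets borel \<and> E' \<in> sets borel \<and> measure al E \<le> de \<and> measure be E' \<le> de \<and>
      (LBINT x. f (r x))
        \<le> (1 - t) * (LBINT x. indicator (- E) x * f (a x)) + t * (LBINT x. indicator (- E') x * f (b x))"
  for de :: real

lemma approximate_coupling:
  fixes a b :: "'a::euclidean_space \<Rightarrow> real" and de :: real
  assumes dim_eq: "dim = DIM('a)"
    and a: "a \<in> borel_measurable borel" "\<And>x. 0 \<le> a x" "al = lebesgue_density a"
    and b: "b \<in> borel_measurable borel" "\<And>x. 0 \<le> b x" "be = lebesgue_density b"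
    and P: "al \<in> P2" "be \<in> P2"
    and fab: "integrable lborel (\<lambda>x. f (a x))" "integrable lborel (\<lambda>x. f (b x))"
    and de: "0 < de"
  obtains C where "cell_coupling al be C \<in> transport_plans al be"
    "\<And>t. t \<in> {0..1} \<Longrightarrow> \<exists>r E E'. approximates al be a b de C t r E E'"
proof -
  note Dal = density_prob_integrable[OF a P2_prob[OF P(1)]]
  note Dbe = density_prob_integrable[OF b P2_prob[OF P(2)]]
  have "\<exists>C. good_pairs al be Basis C \<and> (\<Sum>P | P \<in> C \<and> \<not> narrow_pair (de / DIM('a)) Basis P. measure al (cell (fst P))) \<le> de"
    by (rule exists_good_pairs[OF P2_prob[OF P(1)] P2_prob[OF P(2)] Dal(3) Dbe(3) Dal(4) Dbe(4)])
      (use de in auto)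
  then obtain C where C: "good_pairs al be Basis C"
    "(\<Sum>P | P \<in> C \<and> \<not> narrow_pair (de / DIM('a)) Basis P. measure al (cell (fst P))) \<le> de" by blast
  note prems = dim_eq a b P fab de de C
  let ?G = "{P\<in>C. narrow_pair (de / DIM('a)) Basis P}"
  show ?thesis
  proof (rule that)
    show "cell_coupling al be C \<in> transport_plans al be" by (rule coupling_plan[OF prems])
    fix t :: real assume t: "t \<in> {0..1}"
    have close: "\<forall>g w G. g \<in> borel_measurable borel \<longrightarrow> (\<forall>p q. norm (p - q) \<le> de \<longrightarrow> \<bar>g p - g q\<bar> \<le> w) \<longrightarrow> (\<forall>x. \<bar>g x\<bar> \<le> G) \<longrightarrow>
         \<bar>(LBINT x. g x * box_density al ?G t x) - (\<integral>z. g (interpolate t z) \<partial>cell_coupling al be C)\<bar> \<le> 2 * w + G * de"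
      by (intro allI impI) (rule coupling_close[OF prems t]; blast)
    have nn: "\<forall>x. 0 \<le> box_density al ?G t x" using box_density_nonneg[OF prems t] by blast
    show "\<exists>r E E'. approximates al be a b de C t r E E'"
      unfolding approximates_def
      by (rule exI[of _ "box_density al ?G t"], rule exI[of _ "- (\<Union>P\<in>?G. cell (fst P))"], rule exI[of _ "- (\<Union>P\<in>?G. cell (snd P))"],
          intro conjI nn box_density_measurable[OF prems t] box_density_integrable[OF prems t]
            close norm1_coupling_close[OF prems t] box_energy[OF prems t])
  qed
qed

text \<open>The subsequence of plans is extracted before t is fixed, so one limit plan serves all t.
  The box densities are not laws of the variables \<open>X k\<close>; they are compared with the
  interpolated plans through uniformly continuous test functions, and this yields the vague
  convergence that \<open>energy_le_limit\<close> takes.\<close>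

theorem box_coupling:
  fixes a b :: "'a::euclidean_space \<Rightarrow> real"
  assumes dim_eq: "dim = DIM('a)"
    and a: "a \<in> borel_measurable borel" "\<And>x. 0 \<le> a x" "al = lebesgue_density a"
    and b: "b \<in> borel_measurable borel" "\<And>x. 0 \<le> b x" "be = lebesgue_density b"
    and P: "al \<in> P2" "be \<in> P2"
    and fab: "integrable lborel (\<lambda>x. f (a x))" "integrable lborel (\<lambda>x. f (b x))"
  obtains ka where "ka \<in> transport_plans al be"
    "\<And>t. t \<in> {0..1} \<Longrightarrow> energy_le (distr ka borel (interpolate t))
       ((1 - t) * (LBINT x. f (a x)) + t * (LBINT x. f (b x)))"
proof -
  define de where "de n = 1 / real (Suc n)" for n
  have de0: "0 < de n" for n by (simp add: de_def)
  have delim: "de \<longlonglongrightarrow> 0" unfolding de_def using LIMSEQ_inverse_real_of_nat by (simp add: divide_inverse)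
  have "\<exists>C. cell_coupling al be C \<in> transport_plans al be \<and> (\<forall>t\<in>{0..1}. \<exists>r E E'. approximates al be a b (de n) C t r E E')" for n
    by (rule approximate_coupling[OF dim_eq a b P fab de0[of n]]) blast
  then obtain C where C: "\<And>n. cell_coupling al be (C n) \<in> transport_plans al be"
    "\<And>n t. t \<in> {0..1} \<Longrightarrow> \<exists>r E E'. approximates al be a b (de n) (C n) t r E E'" by metis
  define M where "M = (LINT x|al. norm x ^ 2) + (LINT y|be. norm y ^ 2)"
  have KP: "cell_coupling al be (C n) \<in> P2" and KM: "(\<integral>p. norm p ^ 2 \<partial>cell_coupling al be (C n)) \<le> M" for n
    using transport_plan_second_moment[OF C(1)[of n] P] unfolding M_def by simp_all
  obtain s :: "nat \<Rightarrow> nat" and Om :: "real measure" and X Y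
    where s: "strict_mono s" and Om: "prob_space Om" and [measurable]: "\<And>k. X k \<in> borel_measurable Om" "Y \<in> borel_measurable Om"
      and X: "\<And>k. distr Om borel (X k) = cell_coupling al be (C (s k))" and lim: "converges_AE Om X Y"
      and YP: "distr Om borel Y \<in> P2" and XM: "\<And>k. moment2 Om (X k) \<le> ennreal M"
    by (rule skorohod_P2[of "\<lambda>n. cell_coupling al be (C n)" M, OF KP KM]) blast
  interpret prob_space Om by fact
  have plan: "distr Om borel Y \<in> transport_plans al be"
    by (rule transport_plan_limit[OF Om _ _ lim _ P]) (simp_all add: X C)
  have des: "(\<lambda>k. de (s k)) \<longlonglongrightarrow> 0" using LIMSEQ_subseq_LIMSEQ[OF delim s] by (simp add: comp_def)
  have en: "energy_le (distr (distr Om borel Y) borel (interpolate t))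
       ((1 - t) * (LBINT x. f (a x)) + t * (LBINT x. f (b x)))" if t: "t \<in> {0..1}" for t
  proof -
    have "\<forall>k. \<exists>r E E'. approximates al be a b (de (s k)) (C (s k)) t r E E'" using C(2)[OF t] by blast
    then obtain r E E' where "\<And>k. approximates al be a b (de (s k)) (C (s k)) t (r k) (E k) (E' k)" by metis
    note R = this[unfolded approximates_def]
    have r: "r k \<in> borel_measurable borel" "0 \<le> r k x" "integrable lborel (r k)" for k x using R[of k] by blast+
    have rclose: "\<bar>(LBINT x. g x * r k x) - (\<integral>z. g (interpolate t z) \<partial>cell_coupling al be (C (s k)))\<bar> \<le> 2 * w + G * de (s k)"
      if "g \<in> borel_measurable borel" "\<And>p q. norm (p - q) \<le> de (s k) \<Longrightarrow> \<bar>g p - g q\<bar> \<le> w" "\<And>x. \<bar>g x\<bar> \<le> G" for g w G k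
      using R[of k] that by blast
    have rn: "integrable lborel (\<lambda>x. norm1 x * r k x)"
      "(LBINT x. norm1 x * r k x) \<le> (\<integral>z. norm1 (interpolate t z) \<partial>cell_coupling al be (C (s k))) + 2 * (DIM('a) * de (s k))" for k
      using R[of k] by blast+
    have rE: "integrable lborel (\<lambda>x. f (r k x))" "E k \<in> sets borel" "E' k \<in> sets borel" "measure al (E k) \<le> de (s k)" "measure be (E' k) \<le> de (s k)"
      "(LBINT x. f (r k x))
        \<le> (1 - t) * (LBINT x. indicator (- E k) x * f (a x)) + t * (LBINT x. indicator (- E' k) x * f (b x))" for k
      using R[of k] by blast+
    have Kint: "(\<integral>z. g (interpolate t z) \<partial>cell_coupling al be (C (s k))) = (LINT w|Om. g (interpolate t (X k w)))"
      if [measurable]: "g \<in> borel_measurable borel" for g :: "'a \<Rightarrow> real" and k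
      unfolding X[symmetric] by (subst integral_distr) auto
    define Z where "Z k w = interpolate t (X k w)" for k w
    define Z0 where "Z0 w = interpolate t (Y w)" for w
    have [measurable]: "Z k \<in> borel_measurable Om" "Z0 \<in> borel_measurable Om" for k unfolding Z_def Z0_def by measurable
    have Zlim: "converges_AE Om Z Z0"
      using lim unfolding Z_def Z0_def
      by eventually_elim (rule continuous_on_tendsto_compose[OF continuous_on_interpolate], auto)
    have ZM: "moment2 Om (Z k) \<le> ennreal (2 * M)" for k
    proof -
      have "moment2 Om (Z k) \<le> (\<integral>\<^sup>+w. 2 * ennreal (norm (X k w) ^ 2) \<partial>Om)"
        using norm_interpolate_le[OF t] unfolding Z_def
        by (intro nn_integral_mono) (simp add: ennreal_mult'[symmetric] ennreal_leI flip: ennreal_numeral)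
      also have "\<dots> = 2 * moment2 Om (X k)" by (rule nn_integral_cmult) measurable
      also have "\<dots> \<le> 2 * ennreal M" using XM by (intro mult_left_mono) auto
      also have "\<dots> = ennreal (2 * M)" by (simp add: ennreal_mult')
      finally show ?thesis .
    qed
    have D0: "distr (distr Om borel Y) borel (interpolate t) = distr Om borel Z0"
      unfolding Z0_def by (subst distr_distr) (auto simp: comp_def)
    have vague: "(\<lambda>k. LBINT x. g x * r k x) \<longlonglongrightarrow> (\<integral>x. g x \<partial>distr Om borel Z0)" if g: "compactly_supported g" for g
    proof -
      have gm[measurable]: "g \<in> borel_measurable borel" using g by (rule compactly_supported_measurable)
      obtain B where B: "\<And>x. \<bar>g x\<bar> \<le> B" "0 \<le> B" using compactly_supported_bounded[OF g] by blast
      have cg: "continuous_on UNIV g" and supp: "\<exists>R. \<forall>x. R < norm x \<longrightarrow> g x = 0" using g by (auto simp: compactly_supported_def)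
      have uc: "uniformly_continuous_on UNIV g"
      proof -
        obtain R where R: "\<And>x. R < norm x \<Longrightarrow> g x = 0" using supp by blast
        have ucR: "uniformly_continuous_on (cball 0 (R + 1)) g"
          by (rule compact_uniformly_continuous[OF continuous_on_subset[OF cg]]) auto
        show ?thesis unfolding uniformly_continuous_on_def
        proof (intro allI impI)
          fix e :: real assume "0 < e"
          then obtain d where d: "0 < d" "\<And>x x'. x \<in> cball 0 (R + 1) \<Longrightarrow> x' \<in> cball 0 (R + 1) \<Longrightarrow> dist x' x < d \<Longrightarrow> dist (g x') (g x) < e"
            using ucR unfolding uniformly_continuous_on_def by metis
          show "\<exists>d>0. \<forall>x\<in>UNIV. \<forall>x'\<in>UNIV. dist x' x < d \<longrightarrow> dist (g x') (g x) < e"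
          proof (intro exI[of _ "min d 1"] conjI ballI impI)
            fix x x' :: 'a assume dx: "dist x' x < min d 1"
            have tr: "norm x \<le> norm x' + dist x' x" "norm x' \<le> norm x + dist x' x"
              using norm_triangle_ineq[of x' "x - x'"] norm_triangle_ineq[of x "x' - x"] by (auto simp: dist_norm norm_minus_commute)
            show "dist (g x') (g x) < e"
            proof (cases "norm x \<le> R \<or> norm x' \<le> R")
              case True then show ?thesis using tr dx by (intro d(2)) auto
            next
              case False then show ?thesis using R \<open>0 < e\<close> by simp
            qed
          qed (use d in auto)
        qed
      qed
      have "narrowly_converges (\<lambda>k. distr Om borel (Z k)) (distr Om borel Z0)"
        by (rule narrowly_converges_distr[OF _ _ Zlim]) auto
      moreover have "bounded (range g)" using B by (auto simp: bounded_iff)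
      ultimately have "(\<lambda>k. \<integral>x. g x \<partial>distr Om borel (Z k)) \<longlonglongrightarrow> (\<integral>x. g x \<partial>distr Om borel Z0)"
        using cg unfolding narrowly_converges_def by blast
      then have l1: "(\<lambda>k. LINT w|Om. g (Z k w)) \<longlonglongrightarrow> (\<integral>x. g x \<partial>distr Om borel Z0)"
        by (simp add: integral_distr)
      have "(\<lambda>k. (LBINT x. g x * r k x) - (LINT w|Om. g (Z k w))) \<longlonglongrightarrow> 0"
      proof (rule LIMSEQ_I)
        fix e :: real assume e: "0 < e"
        obtain d where d: "0 < d" "\<And>p q. norm (p - q) < d \<Longrightarrow> \<bar>g p - g q\<bar> < e / 6"
          using uc e unfolding uniformly_continuous_on_def dist_norm
          by (metis UNIV_I divide_pos_pos real_norm_def zero_less_numeral)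
        have "(\<lambda>k. B * de (s k)) \<longlonglongrightarrow> B * 0" by (intro tendsto_intros des)
        then have "\<forall>\<^sub>F k in sequentially. B * de (s k) < e / 2" using e by (intro order_tendstoD) auto
        moreover have "\<forall>\<^sub>F k in sequentially. de (s k) < d" using order_tendstoD(2)[OF des d(1)] .
        ultimately have "\<forall>\<^sub>F k in sequentially. norm ((LBINT x. g x * r k x) - (LINT w|Om. g (Z k w)) - 0) < e"
        proof eventually_elim
          fix k assume k: "B * de (s k) < e / 2" "de (s k) < d"
          have "\<bar>(LBINT x. g x * r k x) - (\<integral>z. g (interpolate t z) \<partial>cell_coupling al be (C (s k)))\<bar> \<le> 2 * (e / 6) + B * de (s k)"
            using d(2) k(2) by (intro rclose gm B less_imp_le) auto
          then show "norm ((LBINT x. g x * r k x) - (LINT w|Om. g (Z k w)) - 0) < e"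
            using k(1) e unfolding Kint[OF gm] Z_def by simp
        qed
        then show "\<exists>n0. \<forall>k\<ge>n0. norm ((LBINT x. g x * r k x) - (LINT w|Om. g (Z k w)) - 0) < e"
          by (simp add: eventually_sequentially)
      qed
      from tendsto_add[OF this l1] show ?thesis by simp
    qed
    have nlim: "(\<lambda>k. (\<integral>z. norm1 (interpolate t z) \<partial>cell_coupling al be (C (s k))) + 2 * (DIM('a) * de (s k))) \<longlonglongrightarrow> (\<integral>x. norm1 x \<partial>distr Om borel Z0)"
    proof -
      have "\<bar>norm1 (x::'a)\<bar> \<le> DIM('a) * (1 + norm x)" for x
        using norm1_le_norm[of x] by (simp add: algebra_simps)
      then have "(\<lambda>k. LINT w|Om. norm1 (Z k w)) \<longlonglongrightarrow> (LINT w|Om. norm1 (Z0 w))"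
        by (intro expectation_tendsto_linear_growth[OF _ _ Zlim ZM]) (auto intro: continuous_on_norm1 continuous_on_id)
      then have "(\<lambda>k. (LINT w|Om. norm1 (Z k w)) + 2 * (DIM('a) * de (s k))) \<longlonglongrightarrow> (LINT w|Om. norm1 (Z0 w)) + 2 * (real DIM('a) * 0)"
        by (intro tendsto_intros des)
      then show ?thesis unfolding Kint[OF norm1_measurable] Z_def[symmetric] by (simp add: integral_distr)
    qed
    \<comment> \<open>The remainders have vanishing mass, so integrals over the good cells tend to
      the full integrals.\<close>
    have small: "(\<lambda>k. LBINT x. indicator (- F k) x * g x) \<longlonglongrightarrow> (LBINT x. g x)"
      if h: "h \<in> borel_measurable borel" "\<And>x. 0 \<le> h x" "eta = lebesgue_density h" "prob_space eta" "integrable lborel g"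
        "\<And>x. h x = 0 \<Longrightarrow> g x = 0" and F: "\<And>k. F k \<in> sets borel" "\<And>k. measure eta (F k) \<le> de (s k)" for h g :: "'a \<Rightarrow> real" and eta F
    proof -
      have "(\<lambda>k. measure eta (F k)) \<longlonglongrightarrow> 0"
        by (rule tendsto_sandwich[OF _ _ tendsto_const des]) (use F in auto)
      from integral_small_sets_tendsto_0[OF h F(1) this]
      have "(\<lambda>k. (LBINT x. g x) - (LBINT x. indicator (F k) x * g x)) \<longlonglongrightarrow> (LBINT x. g x) - 0" by (intro tendsto_intros)
      moreover have "(LBINT x. g x) - (LBINT x. indicator (F k) x * g x) = (LBINT x. indicator (- F k) x * g x)" for k
      proof -
        have "integrable lborel (\<lambda>x. indicator (F k) x * g x)" using integrable_mult_indicator[OF _ h(5), of "F k"] F(1) by simp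
        then have "(LBINT x. g x) - (LBINT x. indicator (F k) x * g x) = (LBINT x. g x - indicator (F k) x * g x)"
          using h(5) by simp
        also have "\<dots> = (LBINT x. indicator (- F k) x * g x)"
          by (intro Bochner_Integration.integral_cong) (auto simp: indicator_def)
        finally show ?thesis .
      qed
      ultimately show ?thesis by simp
    qed
    have sa: "(\<lambda>k. LBINT x. indicator (- E k) x * f (a x)) \<longlonglongrightarrow> (LBINT x. f (a x))"
      by (rule small[OF a P2_prob[OF P(1)] fab(1) _ rE(2) rE(4)]) (simp add: f0)
    have sb: "(\<lambda>k. LBINT x. indicator (- E' k) x * f (b x)) \<longlonglongrightarrow> (LBINT x. f (b x))"
      by (rule small[OF b P2_prob[OF P(2)] fab(2) _ rE(3) rE(5)]) (simp add: f0)
    have P0: "distr Om borel Z0 \<in> P2" using distr_interpolate_P2[OF YP t] unfolding D0 .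
    show ?thesis unfolding D0
      by (rule energy_le_limit[OF r P0 vague rn nlim rE(1,6) tendsto_add[OF tendsto_mult_left[OF sa] tendsto_mult_left[OF sb]]])
  qed
  show ?thesis by (rule that[OF plan en])
qed

end

subsection \<open>Base points with finite support\<close>

context mccann_energy
begin

text \<open>A piece of mass m with normalized density k contributes the integral of f (m k), so the
  box coupling is wanted for the rescaled function. With r the dim-th root of m, McCann's function h
  becomes m * h (s / r), again convex and nonincreasing; the lower bound survives because m <=
  1.\<close>

lemma scaled:
  assumes m: "0 < m" "m \<le> 1"
  shows "mccann_energy (\<lambda>s. f (m * s)) c dim"
proof
  let ?h = "\<lambda>s. s ^ dim * f (1 / s ^ dim)"
  define r where "r = root dim m"
  have r: "0 < r" "r ^ dim = m" using dim m by (auto simp: r_def)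
  have h: "s ^ dim * f (m * (1 / s ^ dim)) = m * ?h (s / r)" if "0 < s" for s
    using that m r by (simp add: power_divide)
  show "convex_on {0..} (\<lambda>s. f (m * s))"
  proof (rule convex_onI)
    fix t x y :: real assume *: "0 < t" "t < 1" "x \<in> {0..}" "y \<in> {0..}"
    then show "f (m * ((1 - t) *\<^sub>R x + t *\<^sub>R y)) \<le> (1 - t) * f (m * x) + t * f (m * y)"
      using convex_onD[OF convex, of t "m * x" "m * y"] m by (simp add: algebra_simps)
  qed simp
  show "continuous_on {0..} (\<lambda>s. f (m * s))"
    using m by (intro continuous_on_compose2[OF cont] continuous_intros) auto
  show "f (m * 0) = 0" by (simp add: f0)
  have "filterlim (\<lambda>s. m * s) at_top at_top"
    using m by (intro filterlim_tendsto_pos_mult_at_top[OF tendsto_const _ filterlim_ident])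
  from filterlim_compose[OF superlinear this]
  have "filterlim (\<lambda>s. m * (f (m * s) / (m * s))) at_top at_top"
    using m by (intro filterlim_tendsto_pos_mult_at_top[OF tendsto_const])
  then show "filterlim (\<lambda>s. f (m * s) / s) at_top at_top" using m by simp
  show "0 \<le> c" "0 < dim" by (fact c0, fact dim)
  show "0 \<le> f (m * s) + c * (a * s + exp (- a - 1))" if "0 \<le> a" "0 \<le> s" for a s
  proof -
    have "m * s \<le> s" using that m by (simp add: mult_left_le_one_le)
    then have "c * (a * (m * s) + exp (- a - 1)) \<le> c * (a * s + exp (- a - 1))"
      using that c0 by (intro mult_left_mono add_right_mono) auto
    then show ?thesis using lower[of a "m * s"] that m by simp
  qed
  show "convex_on {0<..} (\<lambda>s. s ^ dim * f (m * (1 / s ^ dim)))"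
  proof (rule convex_onI)
    fix t x y :: real assume *: "0 < t" "t < 1" "x \<in> {0<..}" "y \<in> {0<..}"
    let ?w = "(1 - t) * x + t * y"
    have "0 < ?w" using * by (intro add_pos_pos) auto
    moreover have "m * ?h ((1 - t) * (x / r) + t * (y / r)) \<le> m * ((1 - t) * ?h (x / r) + t * ?h (y / r))"
      using convex_onD[OF mccann_convex, of t "x / r" "y / r"] * r m by (intro mult_left_mono) auto
    moreover have "(1 - t) * (x / r) + t * (y / r) = ?w / r" by (simp add: add_divide_distrib)
    moreover have "m * ((1 - t) * ?h (x / r) + t * ?h (y / r)) = (1 - t) * (m * ?h (x / r)) + t * (m * ?h (y / r))"
      by (simp only: algebra_simps)
    ultimately show "((1 - t) *\<^sub>R x + t *\<^sub>R y) ^ dim * f (m * (1 / ((1 - t) *\<^sub>R x + t *\<^sub>R y) ^ dim)) \<le>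
        (1 - t) * (x ^ dim * f (m * (1 / x ^ dim))) + t * (y ^ dim * f (m * (1 / y ^ dim)))"
      using * h[of ?w] h[of x] h[of y] by simp
  qed simp
  show "antimono_on {0<..} (\<lambda>s. s ^ dim * f (m * (1 / s ^ dim)))"
  proof (rule monotone_onI)
    fix x y :: real assume *: "x \<in> {0<..}" "y \<in> {0<..}" "x \<le> y"
    have "m * ?h (y / r) \<le> m * ?h (x / r)"
      using monotone_onD[OF mccann_mono, of "x / r" "y / r"] divide_right_mono[of x y r] * r m by (intro mult_left_mono) auto
    then show "y ^ dim * f (m * (1 / y ^ dim)) \<le> x ^ dim * f (m * (1 / x ^ dim))"
      using * h[of x] h[of y] by simp
  qed
qed

end

section \<open>Finite mixtures of separated pieces\<close>

lemma nn_integral_mixture_finite: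
  assumes "\<And>i. prob_space (K i)" "\<And>i. sets (K i) = sets borel" "finite (set_pmf p)" "g \<in> borel_measurable borel"
  shows "(\<integral>\<^sup>+x. g x \<partial>mixture p K) = (\<Sum>i\<in>set_pmf p. ennreal (pmf p i) * (\<integral>\<^sup>+x. g x \<partial>K i))"
  by (simp add: nn_integral_mixture assms nn_integral_measure_pmf_finite mult.commute)

lemma emeasure_mixture_finite:
  assumes "\<And>i. prob_space (K i)" "\<And>i. sets (K i) = sets borel" "finite (set_pmf p)" "A \<in> sets borel"
  shows "emeasure (mixture p K) A = (\<Sum>i\<in>set_pmf p. ennreal (pmf p i) * emeasure (K i) A)"
  by (simp add: emeasure_mixture assms nn_integral_measure_pmf_finite mult.commute)

lemma mixture_null_sets:
  assumes K: "\<And>i. prob_space (K i)" "\<And>i. sets (K i) = sets borel" "finite (set_pmf p)"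
    and A: "A \<in> null_sets (mixture p K)" "i \<in> set_pmf p"
  shows "A \<in> null_sets (K i)"
proof -
  have [simp]: "A \<in> sets borel" using A sets_mixture[OF K(1,2), of p] by auto
  have "(\<Sum>i\<in>set_pmf p. ennreal (pmf p i) * emeasure (K i) A) = 0"
    using A emeasure_mixture_finite[OF K, of A] by (simp add: null_sets_def)
  then have "ennreal (pmf p i) * emeasure (K i) A = 0" using A K(3) by (subst (asm) sum_nonneg_eq_0_iff) auto
  moreover have "0 < pmf p i" using A by (simp add: pmf_positive)
  ultimately show ?thesis using K(2) by (auto simp: null_sets_def)
qed

lemma AE_mixtureD:
  assumes K: "\<And>i. prob_space (K i)" "\<And>i. sets (K i) = sets borel" "finite (set_pmf p)"
    and "AE x in mixture p K. Q x" "i \<in> set_pmf p"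
  shows "AE x in K i. Q x"
proof -
  obtain N where N: "N \<in> null_sets (mixture p K)" "{x \<in> space (mixture p K). \<not> Q x} \<subseteq> N"
    using assms(4) by (auto simp: eventually_ae_filter)
  have "space (K i) = UNIV" "space (mixture p K) = UNIV"
    using sets_eq_imp_space_eq[OF K(2), of i] sets_eq_imp_space_eq[OF sets_mixture[of K p, OF K(1,2)]] by auto
  with N mixture_null_sets[OF K N(1) assms(5)] show ?thesis by (auto simp: eventually_ae_filter)
qed

lemma mixture_density:
  fixes k :: "'i \<Rightarrow> 'a::euclidean_space \<Rightarrow> real"
  assumes K: "\<And>i. prob_space (K i)" "\<And>i. sets (K i) = sets borel" and p: "finite (set_pmf p)"
    and k[measurable]: "\<And>i. k i \<in> borel_measurable borel" and k0: "\<And>i x. 0 \<le> k i x"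
    and Kk: "\<And>i. i \<in> set_pmf p \<Longrightarrow> K i = lebesgue_density (k i)"
  shows "mixture p K = density lborel (\<lambda>x. ennreal (\<Sum>i\<in>set_pmf p. pmf p i * k i x))"
proof (rule measure_eqI)
  show "sets (mixture p K) = sets (density lborel (\<lambda>x. ennreal (\<Sum>i\<in>set_pmf p. pmf p i * k i x)))"
    by (simp add: sets_mixture K)
  fix A assume "A \<in> sets (mixture p K)"
  then have A[measurable]: "A \<in> sets borel" by (simp add: sets_mixture K)
  have "emeasure (mixture p K) A = (\<Sum>i\<in>set_pmf p. ennreal (pmf p i) * (\<integral>\<^sup>+x. ennreal (k i x) * indicator A x \<partial>lborel))"
    unfolding emeasure_mixture_finite[OF K p A] by (intro sum.cong refl) (simp add: Kk emeasure_density)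
  also have "\<dots> = (\<integral>\<^sup>+x. (\<Sum>i\<in>set_pmf p. ennreal (pmf p i) * (ennreal (k i x) * indicator A x)) \<partial>lborel)"
    by (subst nn_integral_sum) (auto simp: nn_integral_cmult)
  also have "\<dots> = (\<integral>\<^sup>+x. ennreal (\<Sum>i\<in>set_pmf p. pmf p i * k i x) * indicator A x \<partial>lborel)"
    using k0 by (intro nn_integral_cong) (simp add: sum_distrib_right ennreal_mult mult.assoc flip: sum_ennreal)
  also have "\<dots> = emeasure (density lborel (\<lambda>x. ennreal (\<Sum>i\<in>set_pmf p. pmf p i * k i x))) A"
    by (simp add: emeasure_density)
  finally show "emeasure (mixture p K) A = emeasure (density lborel (\<lambda>x. ennreal (\<Sum>i\<in>set_pmf p. pmf p i * k i x))) A" .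
qed

definition weakly_separated :: "'a::euclidean_space measure \<Rightarrow> 'a measure \<Rightarrow> bool" where
  "weakly_separated M N \<longleftrightarrow> (\<exists>a c. a \<noteq> 0 \<and> (AE y in M. c \<le> a \<bullet> y) \<and> (AE y in N. a \<bullet> y \<le> c))"

text \<open>Apart from a null set, both densities can be positive only on the separating hyperplane,
  which is itself Lebesgue null.\<close>

lemma weakly_separated_densities:
  fixes k l :: "'a::euclidean_space \<Rightarrow> real"
  assumes "weakly_separated (lebesgue_density k) (lebesgue_density l)"
    and [measurable]: "k \<in> borel_measurable borel" "l \<in> borel_measurable borel"
    and "\<And>x. 0 \<le> k x" "\<And>x. 0 \<le> l x"
  shows "AE x in lborel. k x = 0 \<or> l x = 0"
proof -
  obtain a c where a: "a \<noteq> 0" and M: "AE y in lebesgue_density k. c \<le> a \<bullet> y"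
    "AE y in lebesgue_density l. a \<bullet> y \<le> c" using assms(1) unfolding weakly_separated_def by blast
  have "negligible {x. a \<bullet> x = c}" using a by (intro negligible_hyperplane) auto
  then have "{x. a \<bullet> x = c} \<in> null_sets lborel"
    by (auto simp: negligible_iff_null_sets null_sets_completion_iff)
  then have "AE x in lborel. a \<bullet> x \<noteq> c" by (intro AE_I') auto
  with M show ?thesis
    by (simp add: AE_density) (elim AE_mp, intro AE_I2, use assms(4,5) in "force simp: less_le")
qed

lemma apply_disjoint_sum:
  fixes g :: "'i \<Rightarrow> real"
  assumes "finite S" "\<And>i j. i \<in> S \<Longrightarrow> j \<in> S \<Longrightarrow> i \<noteq> j \<Longrightarrow> g i = 0 \<or> g j = 0" "h 0 = (0::real)"
  shows "h (\<Sum>i\<in>S. g i) = (\<Sum>i\<in>S. h (g i))"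
proof (cases "\<exists>i\<in>S. g i \<noteq> 0")
  case True
  then obtain i where i: "i \<in> S" "g i \<noteq> 0" by blast
  then have z: "\<And>j. j \<in> S - {i} \<Longrightarrow> g j = 0" using assms(2)[of i] by blast
  show ?thesis using i assms(1,3) z by (simp add: sum.remove[of S i])
qed (simp add: assms)

lemma AE_finite_pairs:
  assumes "finite S" "\<And>i j. i \<in> S \<Longrightarrow> j \<in> S \<Longrightarrow> i \<noteq> j \<Longrightarrow> AE x in M. Q i j x"
  shows "AE x in M. \<forall>i\<in>S. \<forall>j\<in>S. i \<noteq> j \<longrightarrow> Q i j x"
proof (intro AE_finite_allI assms(1))
  fix i j assume "i \<in> S" "j \<in> S"
  then show "AE x in M. i \<noteq> j \<longrightarrow> Q i j x" using assms(2)[of i j] by (cases "i = j") auto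
qed

context mccann_energy
begin

text \<open>\<open>energy_le\<close> speaks of some density; two densities of the same measure agree
  almost everywhere, so the bound passes to the given one.\<close>

lemma energy_le_densityD:
  fixes r :: "'a::euclidean_space \<Rightarrow> real"
  assumes [measurable]: "r \<in> borel_measurable borel" and r0: "\<And>x. 0 \<le> r x"
    and P: "prob_space (lebesgue_density r)" and en: "energy_le (lebesgue_density r) u"
  shows "integrable lborel (\<lambda>x. f (r x))" "(LBINT x. f (r x)) \<le> u"
proof -
  obtain s where [measurable]: "s \<in> borel_measurable borel" and s0: "\<And>x. 0 \<le> s x"
    and eq: "lebesgue_density r = lebesgue_density s"
    and s: "integrable lborel (\<lambda>x. f (s x))" "(LBINT x. f (s x)) \<le> u"
    using en unfolding energy_le_def by blast
  have fin: "finite_measure (lebesgue_density r)" using P by (simp add: prob_space_def)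
  have "AE x in lborel. r x = s x"
    using leb_density_unique[OF _ r0 fin] leb_density_unique[OF _ s0 fin[unfolded eq]]
    unfolding eq[symmetric] by (auto elim!: AE_mp)
  then have ae: "AE x in lborel. f (s x) = f (r x)" by eventually_elim simp
  have m: "(\<lambda>x. f (r x)) \<in> borel_measurable lborel" "(\<lambda>x. f (s x)) \<in> borel_measurable lborel"
    by (rule f_measurable; use r0 s0 in simp)+
  show "integrable lborel (\<lambda>x. f (r x))" by (rule integrable_cong_AE_imp[OF s(1) m(1) ae])
  have "(LBINT x. f (s x)) = (LBINT x. f (r x))" by (rule integral_cong_AE[OF m(2,1) ae])
  with s(2) show "(LBINT x. f (r x)) \<le> u" by simp
qed

context
  fixes p :: "'i pmf" and K :: "'i \<Rightarrow> 'a::euclidean_space measure" and k :: "'i \<Rightarrow> 'a \<Rightarrow> real"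
  assumes K: "\<And>i. prob_space (K i)" "\<And>i. sets (K i) = sets borel" and p: "finite (set_pmf p)"
    and k[measurable]: "\<And>i. k i \<in> borel_measurable borel" and k0: "\<And>i x. 0 \<le> k i x"
    and Kk: "\<And>i. i \<in> set_pmf p \<Longrightarrow> K i = lebesgue_density (k i)"
    and sep: "\<And>i j. i \<in> set_pmf p \<Longrightarrow> j \<in> set_pmf p \<Longrightarrow> i \<noteq> j \<Longrightarrow> weakly_separated (K i) (K j)"
begin

lemma disjoint_densities:
  "AE x in lborel. \<forall>i\<in>set_pmf p. \<forall>j\<in>set_pmf p. i \<noteq> j \<longrightarrow> pmf p i * k i x = 0 \<or> pmf p j * k j x = 0"
proof (rule AE_finite_pairs[OF p])
  fix i j assume ij: "i \<in> set_pmf p" "j \<in> set_pmf p" "i \<noteq> j"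
  from weakly_separated_densities[OF sep[OF ij, unfolded Kk[OF ij(1)] Kk[OF ij(2)]] k k k0 k0]
  show "AE x in lborel. pmf p i * k i x = 0 \<or> pmf p j * k j x = 0" by eventually_elim auto
qed

lemma f_disjoint_sum:
  "AE x in lborel. f (\<Sum>i\<in>set_pmf p. pmf p i * k i x) = (\<Sum>i\<in>set_pmf p. f (pmf p i * k i x))"
  using disjoint_densities by eventually_elim (rule apply_disjoint_sum[where h=f, OF p _ f0], auto)

lemma sum_density_measurable:
  "(\<lambda>x. f (pmf p i * k i x)) \<in> borel_measurable lborel"
  "(\<lambda>x. f (\<Sum>i\<in>set_pmf p. pmf p i * k i x)) \<in> borel_measurable lborel"
proof -
  have 1: "(\<lambda>x. pmf p i * k i x) \<in> borel_measurable lborel" "(\<lambda>x. \<Sum>i\<in>set_pmf p. pmf p i * k i x) \<in> borel_measurable lborel"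
    using k by simp_all
  show "(\<lambda>x. f (pmf p i * k i x)) \<in> borel_measurable lborel"
    "(\<lambda>x. f (\<Sum>i\<in>set_pmf p. pmf p i * k i x)) \<in> borel_measurable lborel"
    by (rule f_measurable[OF 1(1)], simp add: k0) (rule f_measurable[OF 1(2)], simp add: k0 sum_nonneg)
qed

lemma energy_le_mixtureI:
  assumes i: "\<And>i. i \<in> set_pmf p \<Longrightarrow> integrable lborel (\<lambda>x. f (pmf p i * k i x))"
    and u: "(\<Sum>i\<in>set_pmf p. LBINT x. f (pmf p i * k i x)) \<le> u"
  shows "energy_le (mixture p K) u"
  unfolding energy_le_def
proof (intro bexI[of _ "\<lambda>x. \<Sum>i\<in>set_pmf p. pmf p i * k i x"] conjI allI)
  have ae: "AE x in lborel. (\<Sum>i\<in>set_pmf p. f (pmf p i * k i x)) = f (\<Sum>i\<in>set_pmf p. pmf p i * k i x)"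
    using f_disjoint_sum by eventually_elim simp
  have int: "integrable lborel (\<lambda>x. \<Sum>i\<in>set_pmf p. f (pmf p i * k i x))"
    using i by (intro Bochner_Integration.integrable_sum)
  note [measurable] = sum_density_measurable
  show "integrable lborel (\<lambda>x. f (\<Sum>i\<in>set_pmf p. pmf p i * k i x))"
    by (rule integrable_cong_AE_imp[OF int _ ae]) measurable
  have "(LBINT x. f (\<Sum>i\<in>set_pmf p. pmf p i * k i x)) = (LBINT x. (\<Sum>i\<in>set_pmf p. f (pmf p i * k i x)))"
    by (rule integral_cong_AE[OF _ _ f_disjoint_sum]) measurable
  also have "\<dots> = (\<Sum>i\<in>set_pmf p. LBINT x. f (pmf p i * k i x))"
    using i by (rule Bochner_Integration.integral_sum)
  finally show "(LBINT x. f (\<Sum>i\<in>set_pmf p. pmf p i * k i x)) \<le> u" using u by simp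
qed (auto intro!: sum_nonneg k0 mult_nonneg_nonneg mixture_density[OF K p k k0 Kk])

text \<open>At almost every point at most one weighted piece is nonzero and f 0 = 0, so f of the sum
  is the sum of the f. A nonzero piece is then the whole sum, hence f of each piece is dominated by
  f of the sum, which gives integrability piece by piece.\<close>

lemma energy_le_mixtureD:
  assumes en: "energy_le (mixture p K) u"
  shows "i \<in> set_pmf p \<Longrightarrow> integrable lborel (\<lambda>x. f (pmf p i * k i x))"
    "(\<Sum>i\<in>set_pmf p. LBINT x. f (pmf p i * k i x)) \<le> u"
proof -
  note [measurable] = sum_density_measurable
  have mix: "mixture p K = density lborel (\<lambda>x. ennreal (\<Sum>i\<in>set_pmf p. pmf p i * k i x))"
    by (rule mixture_density[OF K p k k0 Kk])
  have mp: "prob_space (mixture p K)" by (rule prob_space_mixture[OF K])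
  have *: "integrable lborel (\<lambda>x. f (\<Sum>i\<in>set_pmf p. pmf p i * k i x))"
    "(LBINT x. f (\<Sum>i\<in>set_pmf p. pmf p i * k i x)) \<le> u"
    by (rule energy_le_densityD[OF _ _ mp[unfolded mix] en[unfolded mix]];
        auto intro!: sum_nonneg k0 mult_nonneg_nonneg)+
  show int: "integrable lborel (\<lambda>x. f (pmf p i * k i x))" if i: "i \<in> set_pmf p" for i
  proof (rule Bochner_Integration.integrable_bound[OF *(1)])
    show "AE x in lborel. norm (f (pmf p i * k i x)) \<le> norm (f (\<Sum>i\<in>set_pmf p. pmf p i * k i x))"
      using disjoint_densities
    proof eventually_elim
      fix x assume d: "\<forall>i\<in>set_pmf p. \<forall>j\<in>set_pmf p. i \<noteq> j \<longrightarrow> pmf p i * k i x = 0 \<or> pmf p j * k j x = 0"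
      show "norm (f (pmf p i * k i x)) \<le> norm (f (\<Sum>i\<in>set_pmf p. pmf p i * k i x))"
      proof (cases "pmf p i * k i x = 0")
        case True then show ?thesis by (simp only: f0 norm_zero norm_ge_zero)
      next
        case False
        have "(\<Sum>j\<in>set_pmf p - {i}. pmf p j * k j x) = 0"
        proof (intro sum.neutral ballI)
          fix j assume "j \<in> set_pmf p - {i}"
          then show "pmf p j * k j x = 0" using d[rule_format, of i j] i False by auto
        qed
        then have "(\<Sum>j\<in>set_pmf p. pmf p j * k j x) = pmf p i * k i x"
          unfolding sum.remove[OF p i] by simp
        then show ?thesis by simp
      qed
    qed
  qed (rule sum_density_measurable)
  have "(\<Sum>i\<in>set_pmf p. LBINT x. f (pmf p i * k i x)) = (LBINT x. (\<Sum>i\<in>set_pmf p. f (pmf p i * k i x)))"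
    using int by (rule Bochner_Integration.integral_sum[symmetric])
  also have "\<dots> = (LBINT x. f (\<Sum>i\<in>set_pmf p. pmf p i * k i x))"
    by (rule integral_cong_AE[OF _ _ f_disjoint_sum, symmetric])
      (rule sum_density_measurable borel_measurable_sum)+
  finally show "(\<Sum>i\<in>set_pmf p. LBINT x. f (pmf p i * k i x)) \<le> u" using *(2) by simp
qed

end

lemma mixture_component_density:
  fixes K :: "'i \<Rightarrow> 'a::euclidean_space measure"
  assumes K: "\<And>i. prob_space (K i)" "\<And>i. sets (K i) = sets borel" and p: "finite (set_pmf p)"
    and en: "energy_le (mixture p K) u" and i: "i \<in> set_pmf p"
  shows "K i = density lborel (\<lambda>x. ennreal (leb_density (K i) x))"
proof -
  have "absolutely_continuous lborel (K i)"
    unfolding absolutely_continuous_def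
  proof
    fix A assume A: "A \<in> null_sets (lborel :: 'a measure)"
    have "absolutely_continuous lborel (mixture p K)"
      using en unfolding energy_le_def by (auto intro!: absolutely_continuousI_density)
    with A have "A \<in> null_sets (mixture p K)" by (auto simp: absolutely_continuous_def)
    then show "A \<in> null_sets (K i)" by (rule mixture_null_sets[OF K p _ i])
  qed
  with K(1)[of i] show ?thesis by (intro density_leb_density[symmetric] K) (simp add: prob_space_def)
qed

lemma scaled_box_coupling:
  fixes al be :: "'a::euclidean_space measure"
  assumes dim_eq: "dim = DIM('a)" and m: "0 < m" "m \<le> 1"
    and a: "a \<in> borel_measurable borel" "\<And>x. 0 \<le> a x" "al = lebesgue_density a"
    and b: "b \<in> borel_measurable borel" "\<And>x. 0 \<le> b x" "be = lebesgue_density b"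
    and P: "al \<in> P2" "be \<in> P2"
    and fab: "integrable lborel (\<lambda>x. f (m * a x))" "integrable lborel (\<lambda>x. f (m * b x))"
  shows "\<exists>ka\<in>transport_plans al be. \<forall>t\<in>{0..1}. \<exists>r\<in>borel_measurable borel. (\<forall>x. 0 \<le> r x) \<and>
    distr ka borel (interpolate t) = lebesgue_density r \<and> integrable lborel (\<lambda>x. f (m * r x)) \<and>
    (LBINT x. f (m * r x)) \<le> (1 - t) * (LBINT x. f (m * a x)) + t * (LBINT x. f (m * b x))"
proof -
  obtain ka where ka: "ka \<in> transport_plans al be"
    "\<And>t. t \<in> {0..1} \<Longrightarrow> internal_energy.energy_le (\<lambda>s. f (m * s)) (distr ka borel (interpolate t))
       ((1 - t) * (LBINT x. f (m * a x)) + t * (LBINT x. f (m * b x)))"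
    by (rule mccann_energy.box_coupling[OF scaled[OF m] dim_eq a b P fab]) blast
  have sc: "internal_energy (\<lambda>s. f (m * s)) c" by (rule mccann_energy.axioms(1)[OF scaled[OF m]])
  have "\<exists>r\<in>borel_measurable borel. (\<forall>x. 0 \<le> r x) \<and>
    distr ka borel (interpolate t) = lebesgue_density r \<and> integrable lborel (\<lambda>x. f (m * r x)) \<and>
    (LBINT x. f (m * r x)) \<le> (1 - t) * (LBINT x. f (m * a x)) + t * (LBINT x. f (m * b x))"
    if t: "t \<in> {0..1}" for t
    by (rule iffD1[OF internal_energy.energy_le_def[OF sc]]) (rule ka(2)[OF t])
  then show ?thesis by (intro bexI[OF _ ka(1)] ballI)
qed

end

text \<open>One normal a for both ends, with offsets c and d of their own: at time t the hyperplane
  of offset (1 - t) c + t d separates the interpolants.\<close>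

definition co_separated :: "'a::euclidean_space measure \<Rightarrow> 'a measure \<Rightarrow> 'a measure \<Rightarrow> 'a measure \<Rightarrow> bool" where
  "co_separated M N M' N' \<longleftrightarrow> (\<exists>a c d. a \<noteq> 0 \<and> (AE y in M. c \<le> a \<bullet> y) \<and> (AE y in N. a \<bullet> y \<le> c) \<and>
     (AE y in M'. d \<le> a \<bullet> y) \<and> (AE y in N'. a \<bullet> y \<le> d))"

lemma AE_transport_plan:
  assumes ka: "ka \<in> transport_plans M N" and "AE y in M. P y" "AE z in N. Q z"
  shows "AE q in ka. P (fst q) \<and> Q (snd q)"
proof -
  note [measurable_cong] = transport_plansD(1)[OF ka]
  have "AE q in ka. P (fst q)"
    by (rule AE_distrD[of fst ka borel]) (use assms(2) transport_plansD(3)[OF ka] in auto)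
  moreover have "AE q in ka. Q (snd q)"
    by (rule AE_distrD[of snd ka borel]) (use assms(3) transport_plansD(4)[OF ka] in auto)
  ultimately show ?thesis by eventually_elim simp
qed

lemma weakly_separated_interpolate:
  assumes "co_separated M N M' N'" "ka \<in> transport_plans M M'" "ka' \<in> transport_plans N N'" and t: "t \<in> {0..1}"
  shows "weakly_separated (distr ka borel (interpolate t)) (distr ka' borel (interpolate t))"
proof -
  obtain a c d where a: "a \<noteq> 0" and h: "AE y in M. c \<le> a \<bullet> y" "AE y in N. a \<bullet> y \<le> c"
    "AE y in M'. d \<le> a \<bullet> y" "AE y in N'. a \<bullet> y \<le> d" using assms(1) unfolding co_separated_def by blast
  note [measurable_cong] = transport_plansD(1)[OF assms(2)] transport_plansD(1)[OF assms(3)]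
  have "AE q in ka. (1 - t) * c + t * d \<le> a \<bullet> interpolate t q"
    using AE_transport_plan[OF assms(2) h(1,3)]
    by eventually_elim (use t in "auto simp: interpolate_def inner_add_right intro!: add_mono mult_left_mono")
  moreover have "AE q in ka'. a \<bullet> interpolate t q \<le> (1 - t) * c + t * d"
    using AE_transport_plan[OF assms(3) h(2,4)]
    by eventually_elim (use t in "auto simp: interpolate_def inner_add_right intro!: add_mono mult_left_mono")
  ultimately show ?thesis
    unfolding weakly_separated_def using a by (intro exI[of _ a] exI[of _ "(1 - t) * c + t * d"]) (simp add: AE_distr_iff)
qed

context mccann_energy
begin

text \<open>Each pair of pieces is coupled on its own, for f rescaled by the weight of the piece.
  The interpolated pieces stay separated, so their energies add up, and summing the inequalities of
  the pieces gives that of the mixture.\<close>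

lemma mixture_coupling:
  fixes N R :: "'i \<Rightarrow> 'a::euclidean_space measure"
  assumes dim_eq: "dim = DIM('a)" and p: "finite (set_pmf p)" and NP: "\<And>i. N i \<in> P2" and RP: "\<And>i. R i \<in> P2"
    and sep: "\<And>i j. i \<in> set_pmf p \<Longrightarrow> j \<in> set_pmf p \<Longrightarrow> i \<noteq> j \<Longrightarrow> co_separated (N i) (N j) (R i) (R j)"
    and u: "energy_le (mixture p N) u" and v: "energy_le (mixture p R) v"
  shows "\<exists>ka. (\<forall>i. ka i \<in> transport_plans (N i) (R i)) \<and>
    (\<forall>t\<in>{0..1}. energy_le (mixture p (\<lambda>i. distr (ka i) borel (interpolate t))) ((1 - t) * u + t * v))"
proof -
  note NK = P2_prob[OF NP] P2_sets[OF NP]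
  note RK = P2_prob[OF RP] P2_sets[OF RP]
  define n where "n i = leb_density (N i)" for i
  define r where "r i = leb_density (R i)" for i
  have n[measurable]: "n i \<in> borel_measurable borel" "0 \<le> n i x"
    and r[measurable]: "r i \<in> borel_measurable borel" "0 \<le> r i x" for i x
    by (simp_all add: n_def r_def)
  have Nn: "N i = lebesgue_density (n i)" and Rr: "R i = lebesgue_density (r i)"
    if "i \<in> set_pmf p" for i
    unfolding n_def r_def
    by (rule mixture_component_density[OF NK p u that] mixture_component_density[OF RK p v that])+
  have sN: "weakly_separated (N i) (N j)" and sR: "weakly_separated (R i) (R j)"
    if "i \<in> set_pmf p" "j \<in> set_pmf p" "i \<noteq> j" for i j
    using sep[OF that] unfolding co_separated_def weakly_separated_def by blast+
  have eN: "\<And>i. i \<in> set_pmf p \<Longrightarrow> integrable lborel (\<lambda>x. f (pmf p i * n i x))"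
    "(\<Sum>i\<in>set_pmf p. LBINT x. f (pmf p i * n i x)) \<le> u"
    by (rule energy_le_mixtureD[OF NK p n Nn sN u]; assumption)+
  have eR: "\<And>i. i \<in> set_pmf p \<Longrightarrow> integrable lborel (\<lambda>x. f (pmf p i * r i x))"
    "(\<Sum>i\<in>set_pmf p. LBINT x. f (pmf p i * r i x)) \<le> v"
    by (rule energy_le_mixtureD[OF RK p r Rr sR v]; assumption)+
  define good where "good i ka \<longleftrightarrow> (\<forall>t\<in>{0..1}. \<exists>k\<in>borel_measurable borel. (\<forall>x. 0 \<le> k x) \<and>
    distr ka borel (interpolate t) = lebesgue_density k \<and> integrable lborel (\<lambda>x. f (pmf p i * k x)) \<and>
    (LBINT x. f (pmf p i * k x)) \<le> (1 - t) * (LBINT x. f (pmf p i * n i x)) + t * (LBINT x. f (pmf p i * r i x)))"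
    for i and ka :: "('a \<times> 'a) measure"
  have "\<exists>ka\<in>transport_plans (N i) (R i). i \<in> set_pmf p \<longrightarrow> good i ka" for i
  proof (cases "i \<in> set_pmf p")
    case True
    have "\<exists>ka\<in>transport_plans (N i) (R i). good i ka"
      unfolding good_def
      by (rule scaled_box_coupling[OF dim_eq pmf_positive[OF True] pmf_le_1 n Nn[OF True] r Rr[OF True] NP RP eN(1)[OF True] eR(1)[OF True]])
    then show ?thesis by blast
  next
    \<comment> \<open>Indices off the support carry no weight, but the family of plans is indexed by
      the whole type; the product plan fills the gap.\<close>
    case False
    then show ?thesis using pair_measure_plan[OF NP RP] by blast
  qed
  then obtain ka where ka: "\<And>i. ka i \<in> transport_plans (N i) (R i)" "\<And>i. i \<in> set_pmf p \<Longrightarrow> good i (ka i)" by metis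
  have "energy_le (mixture p (\<lambda>i. distr (ka i) borel (interpolate t))) ((1 - t) * u + t * v)" if t: "t \<in> {0..1}" for t
  proof -
    define isk where "isk i k \<longleftrightarrow> k \<in> borel_measurable borel \<and> (\<forall>x. 0 \<le> k x) \<and> (i \<in> set_pmf p \<longrightarrow>
      distr (ka i) borel (interpolate t) = lebesgue_density k \<and> integrable lborel (\<lambda>x. f (pmf p i * k x)) \<and>
      (LBINT x. f (pmf p i * k x)) \<le> (1 - t) * (LBINT x. f (pmf p i * n i x)) + t * (LBINT x. f (pmf p i * r i x)))"
      for i and k :: "'a \<Rightarrow> real"
    have "\<exists>k. isk i k" for i
    proof (cases "i \<in> set_pmf p")
      case True
      then show ?thesis using ka(2)[OF True] t unfolding good_def isk_def by blast
    qed (auto simp: isk_def intro: exI[of _ "\<lambda>_. 0"])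
    then obtain k where "\<And>i. isk i (k i)" by metis
    note k = this[unfolded isk_def]
    have kk: "k i \<in> borel_measurable borel" "0 \<le> k i x"
      "i \<in> set_pmf p \<Longrightarrow> distr (ka i) borel (interpolate t) = lebesgue_density (k i)"
      "i \<in> set_pmf p \<Longrightarrow> integrable lborel (\<lambda>x. f (pmf p i * k i x))" for i x
      using k[of i] by blast+
    have K: "prob_space (distr (ka i) borel (interpolate t))" for i
      using transport_plansD[OF ka(1)[of i]] by (intro prob_space.prob_space_distr) (auto intro: borel_measurable_sets_eq)
    show ?thesis
    proof (rule energy_le_mixtureI[where k=k])
      have "(\<Sum>i\<in>set_pmf p. LBINT x. f (pmf p i * k i x))
          \<le> (\<Sum>i\<in>set_pmf p. (1 - t) * (LBINT x. f (pmf p i * n i x)) + t * (LBINT x. f (pmf p i * r i x)))"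
        using k by (intro sum_mono) blast
      also have "\<dots> = (1 - t) * (\<Sum>i\<in>set_pmf p. LBINT x. f (pmf p i * n i x)) + t * (\<Sum>i\<in>set_pmf p. LBINT x. f (pmf p i * r i x))"
        by (simp add: sum.distrib sum_distrib_left)
      also have "\<dots> \<le> (1 - t) * u + t * v"
        using t eN(2) eR(2) by (intro add_mono mult_left_mono) auto
      finally show "(\<Sum>i\<in>set_pmf p. LBINT x. f (pmf p i * k i x)) \<le> (1 - t) * u + t * v" .
      show "weakly_separated (distr (ka i) borel (interpolate t)) (distr (ka j) borel (interpolate t))"
        if "i \<in> set_pmf p" "j \<in> set_pmf p" "i \<noteq> j" for i j
        using weakly_separated_interpolate[OF sep[OF that] ka(1) ka(1) t] .
    qed (rule K p kk sets_distr | assumption)+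
  qed
  with ka(1) show ?thesis by blast
qed

end

section \<open>Disintegration and gluing over a finitely supported base point\<close>

lemma Pair_measurable_borel [measurable]:
  "Pair x \<in> borel_measurable (borel :: 'b::euclidean_space measure)" for x :: "'a::euclidean_space"
  by (intro borel_measurable_continuous_onI continuous_intros)

lemma prob_space_distr_borel:
  "prob_space M \<Longrightarrow> sets M = sets borel \<Longrightarrow> g \<in> borel_measurable borel \<Longrightarrow> prob_space (distr M borel g)"
  by (rule prob_space.prob_space_distr[OF _ borel_measurable_sets_eq])

context
  fixes p :: "'a::euclidean_space pmf" and gam :: "('a \<times> 'a) measure" and nu :: "'a measure"
  assumes p: "finite (set_pmf p)" and gam: "gam \<in> transport_plans (distr (measure_pmf p) borel id) nu" and nu: "nu \<in> P2"
begin

text \<open>The conditional law of y given x. Off the support \<open>nu\<close> is the default, so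
  that every index carries a probability measure with finite second moment.\<close>

definition component :: "'a \<Rightarrow> 'a measure" where
  "component x = (if x \<in> set_pmf p then distr (uniform_measure gam ({x} \<times> UNIV)) borel snd else nu)"

lemma emeasure_fibre: "emeasure gam ({x} \<times> UNIV) = ennreal (pmf p x)"
proof -
  note [measurable_cong] = transport_plansD(1)[OF gam]
  have "ennreal (pmf p x) = emeasure (distr (measure_pmf p) borel id) {x}"
    by (simp add: emeasure_distr emeasure_pmf_single)
  also have "\<dots> = emeasure gam (fst -` {x} \<inter> space gam)"
    unfolding transport_plansD(3)[OF gam, symmetric] by (subst emeasure_distr) auto
  also have "fst -` {x} \<inter> space gam = {x} \<times> UNIV"
    using sets_eq_imp_space_eq[OF transport_plansD(1)[OF gam]] by auto
  finally show ?thesis by simp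
qed

lemma component_prob: "prob_space (component x)" "sets (component x) = sets borel"
proof -
  note [measurable_cong] = transport_plansD(1)[OF gam]
  interpret g: prob_space gam using transport_plansD(2)[OF gam] .
  show "prob_space (component x)"
  proof (cases "x \<in> set_pmf p")
    case True
    then have "prob_space (uniform_measure gam ({x} \<times> UNIV))"
      using pmf_positive[OF True] by (intro prob_space_uniform_measure) (simp_all add: emeasure_fibre)
    then show ?thesis using True unfolding component_def by (auto intro!: prob_space.prob_space_distr)
  qed (simp add: component_def P2_prob nu)
qed (simp add: component_def P2_sets[OF nu])

lemma plan_eq_mixture: "gam = mixture p (\<lambda>x. distr (component x) borel (Pair x))"
proof (rule measure_eqI)
  note [measurable_cong] = transport_plansD(1)[OF gam]
  have K: "prob_space (distr (component x) borel (Pair x))" "sets (distr (component x) borel (Pair x)) = sets borel" for x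
    using component_prob[of x] by (simp_all add: prob_space_distr_borel)
  show "sets gam = sets (mixture p (\<lambda>x. distr (component x) borel (Pair x)))"
    unfolding transport_plansD(1)[OF gam] by (rule sets_mixture[OF K, symmetric])
  fix A assume "A \<in> sets gam"
  then have A[measurable]: "A \<in> sets borel" by (simp add: transport_plansD(1)[OF gam])
  have sp: "space gam = UNIV" using sets_eq_imp_space_eq[OF transport_plansD(1)[OF gam]] by simp
  have B[measurable]: "{x} \<times> UNIV \<in> sets (borel :: ('a \<times> 'a) measure)" for x :: 'a by (intro borel_closed closed_Times) auto
  have c: "ennreal (pmf p x) * emeasure (distr (component x) borel (Pair x)) A = emeasure gam ({x} \<times> UNIV \<inter> A)"
    if x: "x \<in> set_pmf p" for x
  proof -
    note [measurable_cong] = component_prob(2)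
    have [measurable]: "Pair x -` A \<in> sets borel" using measurable_sets[OF Pair_measurable_borel A] by simp
    have S: "snd -` Pair x -` A \<in> sets gam"
      using measurable_sets[of snd gam borel "Pair x -` A"] sp by simp
    have "emeasure (distr (component x) borel (Pair x)) A = emeasure (component x) (Pair x -` A)"
      using component_prob[of x] sets_eq_imp_space_eq[OF component_prob(2)] by (subst emeasure_distr) auto
    also have "\<dots> = emeasure (uniform_measure gam ({x} \<times> UNIV)) (snd -` Pair x -` A)"
      using x sp unfolding component_def by (simp add: emeasure_distr)
    also have "\<dots> = emeasure gam ({x} \<times> UNIV \<inter> snd -` Pair x -` A) / ennreal (pmf p x)"
      using S by (subst emeasure_uniform_measure) (auto simp: emeasure_fibre transport_plansD(1)[OF gam])
    also have "{x} \<times> UNIV \<inter> snd -` Pair x -` A = {x} \<times> UNIV \<inter> A" by auto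
    finally show ?thesis using x pmf_positive[OF x] 
      by (simp add: ennreal_times_divide mult.commute[of "ennreal (pmf p x)"] ennreal_mult_divide_eq)
  qed
  have "AE q in gam. fst q \<in> set_pmf p"
  proof (rule AE_distrD[of fst gam borel])
    have "AE x in measure_pmf p. x \<in> set_pmf p" by (rule AE_pmfI)
    moreover have "{x. x \<in> set_pmf p} \<in> sets borel" using p by (simp add: borel_closed finite_imp_closed)
    ultimately show "AE x in distr gam borel fst. x \<in> set_pmf p"
      unfolding transport_plansD(3)[OF gam] by (subst AE_distr_iff) auto
  qed auto
  moreover have "(\<Union>x\<in>set_pmf p. {x} \<times> UNIV \<inter> A) \<in> sets gam"
    using p by (intro sets.finite_UN) (auto simp: transport_plansD(1)[OF gam] intro!: sets.Int B A)
  ultimately have "emeasure gam A = emeasure gam (\<Union>x\<in>set_pmf p. {x} \<times> UNIV \<inter> A)"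
    using \<open>A \<in> sets gam\<close> by (intro emeasure_eq_AE) (auto elim!: eventually_mono)
  also have "\<dots> = (\<Sum>x\<in>set_pmf p. emeasure gam ({x} \<times> UNIV \<inter> A))"
    using p by (intro sum_emeasure[symmetric]) (auto simp: disjoint_family_on_def transport_plansD(1)[OF gam] intro!: sets.Int B A)
  also have "\<dots> = emeasure (mixture p (\<lambda>x. distr (component x) borel (Pair x))) A"
    unfolding emeasure_mixture_finite[OF K p A] by (intro sum.cong refl c[symmetric])
  finally show "emeasure gam A = emeasure (mixture p (\<lambda>x. distr (component x) borel (Pair x))) A" .
qed

lemma marginal_eq_mixture: "nu = mixture p component"
proof -
  have K: "prob_space (distr (component x) borel (Pair x))" "sets (distr (component x) borel (Pair x)) = sets borel" for x
    using component_prob[of x] by (simp_all add: prob_space_distr_borel)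
  have eq: "distr (distr (component x) borel (Pair x)) borel snd = component x" for x
    using distr_distr[OF fst_snd_borel(2) borel_measurable_sets_eq[OF component_prob(2) Pair_measurable_borel[of x]]]
    distr_id2[OF component_prob(2)[symmetric]] by (simp add: comp_def)
  have "nu = distr (mixture p (\<lambda>x. distr (component x) borel (Pair x))) borel snd"
    unfolding plan_eq_mixture[symmetric] by (rule transport_plansD(4)[OF gam, symmetric])
  also have "\<dots> = mixture p (\<lambda>x. distr (distr (component x) borel (Pair x)) borel snd)"
    by (rule distr_mixture[OF K fst_snd_borel(2)])
  also have "\<dots> = mixture p component" by (simp add: eq)
  finally show ?thesis .
qed

lemma component_P2: "component x \<in> P2"
proof (cases "x \<in> set_pmf p")
  case True
  have "(\<integral>\<^sup>+y. ennreal (norm y ^ 2) \<partial>nu) < \<infinity>" using nu by (simp add: P2_iff_nn_integral)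
  then have "(\<Sum>x\<in>set_pmf p. ennreal (pmf p x) * (\<integral>\<^sup>+y. ennreal (norm y ^ 2) \<partial>component x)) < \<infinity>"
    by (subst (asm) marginal_eq_mixture) (simp add: nn_integral_mixture_finite[OF component_prob p])
  then have "ennreal (pmf p x) * (\<integral>\<^sup>+y. ennreal (norm y ^ 2) \<partial>component x) < \<infinity>"
    using True p by (simp add: sum.remove[of _ x])
  then show ?thesis
    using pmf_positive[OF True] component_prob[of x] by (auto simp: P2_iff_nn_integral ennreal_mult_less_top)
qed (simp add: component_def nu)

end

text \<open>Monotonicity of the support says (x - x') . y' <= (x - x') . y for y over x and y' over
  x', and an infimum supplies the offset. The normal x - x' depends only on the atoms, hence is the
  same for the plans towards two different targets.\<close>

lemma optimal_components_separated:
  fixes p :: "'a::euclidean_space pmf"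
  assumes p: "finite (set_pmf p)" and opt: "optimal_plan (distr (measure_pmf p) borel id) nu gam"
    and mu: "distr (measure_pmf p) borel id \<in> P2" and nu: "nu \<in> P2" and x: "x \<in> set_pmf p" "x' \<in> set_pmf p"
  shows "\<exists>c. (AE y in component p gam nu x. c \<le> (x - x') \<bullet> y) \<and> (AE y in component p gam nu x'. (x - x') \<bullet> y \<le> c)"
proof -
  have gam: "gam \<in> transport_plans (distr (measure_pmf p) borel id) nu" using opt by (simp add: optimal_plan_def)
  note cp = component_prob[OF p gam nu]
  have K: "prob_space (distr (component p gam nu x) borel (Pair x))" "sets (distr (component p gam nu x) borel (Pair x)) = sets borel" for x
    using cp[of x] by (simp_all add: prob_space_distr_borel)
  have "AE q in gam. q \<in> measure_support gam" by (rule AE_measure_support[OF transport_plansD(1)[OF gam]])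
  then have AEmix: "AE q in mixture p (\<lambda>x. distr (component p gam nu x) borel (Pair x)). q \<in> measure_support gam"
    unfolding plan_eq_mixture[OF p gam nu, symmetric] .
  have supp: "AE y in component p gam nu x. (x, y) \<in> measure_support gam" if "x \<in> set_pmf p" for x
    by (rule AE_distrD[OF borel_measurable_sets_eq[OF cp(2) Pair_measurable_borel] AE_mixtureD[OF K p AEmix that]])
  have ne: "\<exists>y. (x, y) \<in> measure_support gam" if "x \<in> set_pmf p" for x
  proof (rule ccontr)
    assume "\<not> ?thesis"
    then have "AE y in component p gam nu x. False" using supp[OF that] by simp
    then show False using prob_space.not_empty[OF cp(1)] prob_space.AE_False[OF cp(1)] by simp
  qed
  define c where "c = Inf ((\<bullet>) (x - x') ` {y. (x, y) \<in> measure_support gam})"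
  have mono: "(x - x') \<bullet> y' \<le> (x - x') \<bullet> y" if "(x, y) \<in> measure_support gam" "(x', y') \<in> measure_support gam" for y y'
    using optimal_plan_support_monotone[OF opt mu nu that] by (simp add: inner_diff_right)
  obtain y0 where y0: "(x', y0) \<in> measure_support gam" using ne[OF x(2)] by blast
  have "c \<le> (x - x') \<bullet> y" if "(x, y) \<in> measure_support gam" for y
    unfolding c_def using that mono[OF _ y0] by (intro cInf_lower bdd_belowI2[of _ "(x - x') \<bullet> y0"]) auto
  moreover have "(x - x') \<bullet> y' \<le> c" if "(x', y') \<in> measure_support gam" for y'
    unfolding c_def using that ne[OF x(1)] mono by (intro cInf_greatest) auto
  ultimately show ?thesis
    using supp[OF x(1)] supp[OF x(2)] by (intro exI[of _ c] conjI) (auto elim!: eventually_mono)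
qed

text \<open>The squared norm of (x, y, z) is at most that of (x, y) plus that of (x, z); x counts
  twice, whence the factor 2.\<close>

lemma gen_geodesic_plansI:
  fixes mu nu rho :: "'a::euclidean_space measure"
  assumes "prob_space Ga" and s[measurable_cong]: "sets Ga = sets borel"
    and o: "optimal_plan mu nu (distr Ga borel (\<lambda>t. (fst t, fst (snd t))))"
      "optimal_plan mu rho (distr Ga borel (\<lambda>t. (fst t, snd (snd t))))"
    and P: "mu \<in> P2" "nu \<in> P2" "rho \<in> P2"
  shows "Ga \<in> gen_geodesic_plans mu nu rho"
    "(LINT t|Ga. norm t ^ 2) \<le> 2 * (LINT x|mu. norm x ^ 2) + (LINT x|nu. norm x ^ 2) + (LINT x|rho. norm x ^ 2)"
proof -
  let ?M = "\<lambda>mu. LINT x|mu. norm x ^ 2" and ?C = "2 * (LINT x|mu. norm x ^ 2) + (LINT x|nu. norm x ^ 2) + (LINT x|rho. norm x ^ 2)"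
  interpret prob_space Ga by fact
  have nn: "0 \<le> ?M eta" for eta :: "'a measure" by simp
  have pl: "distr Ga borel (\<lambda>t. (fst t, fst (snd t))) \<in> transport_plans mu nu"
    "distr Ga borel (\<lambda>t. (fst t, snd (snd t))) \<in> transport_plans mu rho" using o by (simp_all add: optimal_plan_def)
  have m1: "(\<integral>\<^sup>+q. ennreal (norm q ^ 2) \<partial>distr Ga borel (\<lambda>t. (fst t, fst (snd t)))) \<le> ennreal (?M mu + ?M nu)"
    using transport_plan_second_moment[OF pl(1) P(1,2)] nn by (subst second_moment_le_iff) auto
  have m2: "(\<integral>\<^sup>+q. ennreal (norm q ^ 2) \<partial>distr Ga borel (\<lambda>t. (fst t, snd (snd t)))) \<le> ennreal (?M mu + ?M rho)"
    using transport_plan_second_moment[OF pl(2) P(1,3)] nn by (subst second_moment_le_iff) auto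
  have "(\<integral>\<^sup>+t. ennreal (norm t ^ 2) \<partial>Ga)
      \<le> (\<integral>\<^sup>+t. ennreal (norm (fst t, fst (snd t)) ^ 2) + ennreal (norm (fst t, snd (snd t)) ^ 2) \<partial>Ga)"
    by (intro nn_integral_mono) (simp add: norm_prod_sq flip: ennreal_plus)
  also have "\<dots> = (\<integral>\<^sup>+t. ennreal (norm (fst t, fst (snd t)) ^ 2) \<partial>Ga) + (\<integral>\<^sup>+t. ennreal (norm (fst t, snd (snd t)) ^ 2) \<partial>Ga)"
    by (rule nn_integral_add) measurable
  also have "\<dots> = (\<integral>\<^sup>+q. ennreal (norm q ^ 2) \<partial>distr Ga borel (\<lambda>t. (fst t, fst (snd t)))) + (\<integral>\<^sup>+q. ennreal (norm q ^ 2) \<partial>distr Ga borel (\<lambda>t. (fst t, snd (snd t))))"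
    by (simp add: nn_integral_distr)
  also have "\<dots> \<le> ennreal (?M mu + ?M nu) + ennreal (?M mu + ?M rho)" by (intro add_mono m1 m2)
  also have "\<dots> = ennreal ?C" using nn by (subst ennreal_plus[symmetric]) (auto simp: algebra_simps)
  finally have le: "(\<integral>\<^sup>+t. ennreal (norm t ^ 2) \<partial>Ga) \<le> ennreal ?C" .
  then have GP: "Ga \<in> P2" using assms(1) s by (auto simp: P2_iff_nn_integral intro: le_less_trans)
  then show "Ga \<in> gen_geodesic_plans mu nu rho"
    using o by (simp add: gen_geodesic_plans_def case_prod_unfold)
  have "0 \<le> ?C" by (intro add_nonneg_nonneg mult_nonneg_nonneg nn) simp
  from le second_moment_le_iff[OF GP this] show "(LINT t|Ga. norm t ^ 2) \<le> ?C" by blast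
qed

text \<open>Whatever couplings \<open>ka x\<close> of the two conditional laws are chosen over the
  points x, both pair marginals come out as prescribed. This is the freedom that the choice of
  couplings exploits.\<close>

lemma gluing_marginals:
  fixes p :: "'a::euclidean_space pmf" and N R :: "'a::euclidean_space \<Rightarrow> 'a measure"
  assumes ka: "\<And>x. ka x \<in> transport_plans (N x) (R x)"
  defines "Ga \<equiv> mixture p (\<lambda>x. distr (ka x) borel (Pair x))"
  shows "prob_space Ga" "sets Ga = sets borel"
    "distr Ga borel (\<lambda>t. (fst t, fst (snd t))) = mixture p (\<lambda>x. distr (N x) borel (Pair x))"
    "distr Ga borel (\<lambda>t. (fst t, snd (snd t))) = mixture p (\<lambda>x. distr (R x) borel (Pair x))"
    "distr Ga borel (\<lambda>q. interpolate s (snd q)) = mixture p (\<lambda>x. distr (ka x) borel (interpolate s))"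
proof -
  note KD = transport_plansD[OF ka]
  have K: "prob_space (distr (ka x) borel (Pair x))" "sets (distr (ka x) borel (Pair x)) = sets borel" for x
    using KD(1,2)[of x] by (simp_all add: prob_space_distr_borel)
  show "prob_space Ga" "sets Ga = sets borel"
    unfolding Ga_def by (rule prob_space_mixture[OF K] sets_mixture[OF K])+
  have D: "distr (distr (ka x) borel (Pair x)) borel g = distr (ka x) borel (\<lambda>q. g (x, q))"
    if "g \<in> borel_measurable borel" for x and g :: "'a \<times> 'a \<times> 'a \<Rightarrow> 'b::topological_space"
    using distr_distr[OF that borel_measurable_sets_eq[OF KD(1) Pair_measurable_borel[of x]]] by (simp add: comp_def)
  have E: "distr Ga borel g = mixture p (\<lambda>x. distr (ka x) borel (\<lambda>q. g (x, q)))"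
    if "g \<in> borel_measurable borel" for g :: "'a \<times> 'a \<times> 'a \<Rightarrow> 'b::topological_space"
    unfolding Ga_def distr_mixture[OF K that] D[OF that] ..
  have m1: "distr (N x) borel (Pair x) = distr (ka x) borel (\<lambda>q. (x, fst q))" for x
    unfolding KD(3)[of x, symmetric]
    using distr_distr[OF Pair_measurable_borel[of x] borel_measurable_sets_eq[OF KD(1) fst_snd_borel(1)]] by (simp add: comp_def)
  have m2: "distr (R x) borel (Pair x) = distr (ka x) borel (\<lambda>q. (x, snd q))" for x
    unfolding KD(4)[of x, symmetric]
    using distr_distr[OF Pair_measurable_borel[of x] borel_measurable_sets_eq[OF KD(1) fst_snd_borel(2)]] by (simp add: comp_def)
  show "distr Ga borel (\<lambda>t. (fst t, fst (snd t))) = mixture p (\<lambda>x. distr (N x) borel (Pair x))"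
    unfolding m1 by (subst E) simp_all
  show "distr Ga borel (\<lambda>t. (fst t, snd (snd t))) = mixture p (\<lambda>x. distr (R x) borel (Pair x))"
    unfolding m2 by (subst E) simp_all
  show "distr Ga borel (\<lambda>q. interpolate s (snd q)) = mixture p (\<lambda>x. distr (ka x) borel (interpolate s))"
    by (subst E) simp_all
qed

context mccann_energy
begin

text \<open>Any two optimal plans may be taken; the couplings over the atoms are those of
  \<open>mixture_coupling\<close>. The energy bounds stand inside the conclusion so that an
  admissible plan is also obtained when they fail, from product couplings.\<close>

lemma semidiscrete_plan:
  fixes p :: "'a::euclidean_space pmf"
  assumes dim_eq: "dim = DIM('a)" and p: "finite (set_pmf p)" and mu: "distr (measure_pmf p) borel id \<in> P2"
    and nu: "nu \<in> P2" and rho: "rho \<in> P2"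
  shows "\<exists>Ga\<in>gen_geodesic_plans (distr (measure_pmf p) borel id) nu rho.
    energy_le nu u \<and> energy_le rho v \<longrightarrow> (\<forall>t\<in>{0..1}. energy_le (distr Ga borel (\<lambda>q. interpolate t (snd q))) ((1 - t) * u + t * v))"
proof -
  obtain gam gam' where o: "optimal_plan (distr (measure_pmf p) borel id) nu gam" "optimal_plan (distr (measure_pmf p) borel id) rho gam'"
    using exists_optimal_plan[OF mu nu] exists_optimal_plan[OF mu rho] by blast
  then have gam: "gam \<in> transport_plans (distr (measure_pmf p) borel id) nu"
    and gam': "gam' \<in> transport_plans (distr (measure_pmf p) borel id) rho" by (simp_all add: optimal_plan_def)
  define N where "N = component p gam nu"
  define R where "R = component p gam' rho"
  have NP: "N x \<in> P2" and RP: "R x \<in> P2" for x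
    unfolding N_def R_def by (rule component_P2[OF p gam nu] component_P2[OF p gam' rho])+
  have mix: "mixture p N = nu" "mixture p R = rho"
    "mixture p (\<lambda>x. distr (N x) borel (Pair x)) = gam" "mixture p (\<lambda>x. distr (R x) borel (Pair x)) = gam'"
    unfolding N_def R_def
    by (rule marginal_eq_mixture[OF p gam nu, symmetric] marginal_eq_mixture[OF p gam' rho, symmetric]
      plan_eq_mixture[OF p gam nu, symmetric] plan_eq_mixture[OF p gam' rho, symmetric])+
  have sep: "co_separated (N i) (N j) (R i) (R j)" if ij: "i \<in> set_pmf p" "j \<in> set_pmf p" "i \<noteq> j" for i j
    using optimal_components_separated[OF p o(1) mu nu ij(1,2)] optimal_components_separated[OF p o(2) mu rho ij(1,2)] ij(3)
    unfolding co_separated_def N_def R_def by (intro exI[of _ "i - j"]) auto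
  have "\<exists>ka. (\<forall>i. ka i \<in> transport_plans (N i) (R i)) \<and> (energy_le nu u \<and> energy_le rho v \<longrightarrow>
    (\<forall>t\<in>{0..1}. energy_le (mixture p (\<lambda>i. distr (ka i) borel (interpolate t))) ((1 - t) * u + t * v)))"
  proof (cases "energy_le nu u \<and> energy_le rho v")
    case True
    then have uv: "energy_le (mixture p N) u" "energy_le (mixture p R) v" by (simp_all add: mix)
    from mixture_coupling[OF dim_eq p NP RP sep uv] show ?thesis by blast
  next
    case False
    then show ?thesis using pair_measure_plan[OF NP RP] by (intro exI[of _ "\<lambda>i. N i \<Otimes>\<^sub>M R i"]) auto
  qed
  then obtain ka where ka: "\<And>i. ka i \<in> transport_plans (N i) (R i)"
    and en: "energy_le nu u \<and> energy_le rho v \<longrightarrow>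
      (\<forall>t\<in>{0..1}. energy_le (mixture p (\<lambda>i. distr (ka i) borel (interpolate t))) ((1 - t) * u + t * v))" by blast
  note G = gluing_marginals[where p=p, OF ka]
  show ?thesis
  proof (rule bexI)
    show "mixture p (\<lambda>x. distr (ka x) borel (Pair x)) \<in> gen_geodesic_plans (distr (measure_pmf p) borel id) nu rho"
      by (rule gen_geodesic_plansI(1)[OF G(1,2) _ _ mu nu rho]) (simp_all only: G(3,4) mix o)
  qed (simp only: G(5), rule en)
qed

text \<open>Simple functions tending to the identity, of norm at most 2 |x|, discretize the base
  point with bounded second moments. Optimality towards both targets and the energy bound pass to
  the limit of the discrete plans.\<close>

lemma generalized_geodesic_energy:
  fixes mu nu rho :: "'a::euclidean_space measure"
  assumes dim_eq: "dim = DIM('a)" and mu: "mu \<in> P2" and nu: "nu \<in> P2" and rho: "rho \<in> P2"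
  shows "\<exists>Ga\<in>gen_geodesic_plans mu nu rho.
    energy_le nu u \<and> energy_le rho v \<longrightarrow> (\<forall>t\<in>{0..1}. energy_le (distr Ga borel (\<lambda>q. interpolate t (snd q))) ((1 - t) * u + t * v))"
proof -
  note [measurable_cong] = P2_sets[OF mu]
  interpret m: prob_space mu using mu by (rule P2_prob)
  obtain F :: "nat \<Rightarrow> 'a \<Rightarrow> 'a" where F: "\<And>i. simple_function borel (F i)" and Flim: "\<And>x. (\<lambda>i. F i x) \<longlonglongrightarrow> x"
    and Fb: "\<And>i x. norm (F i x) \<le> 2 * norm x"
    using borel_measurable_implies_sequence_metric[of id "borel :: 'a measure" 0] by (auto simp: dist_norm)
  have Fm[measurable]: "F i \<in> borel_measurable borel" for i using F by (rule borel_measurable_simple_function)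
  have Fmu: "F i \<in> borel_measurable mu" for i by (rule borel_measurable_sets_eq[OF P2_sets[OF mu] Fm])
  have Ffin: "finite (range (F i))" for i using F[of i] by (simp add: simple_function_def)
  have FP: "distr mu borel (F i) \<in> P2" and FM: "(\<integral>x. norm x ^ 2 \<partial>distr mu borel (F i)) \<le> 4 * (LINT x|mu. norm x ^ 2)" for i
  proof -
    have "norm (F i x) ^ 2 \<le> 4 * norm x ^ 2" for x using power_mono[OF Fb, of i x 2] by (simp add: power_mult_distrib)
    then have "(\<integral>\<^sup>+x. ennreal (norm (F i x) ^ 2) \<partial>mu) \<le> (\<integral>\<^sup>+x. ennreal (4 * norm x ^ 2) \<partial>mu)"
      by (intro nn_integral_mono ennreal_leI)
    also have "\<dots> = ennreal (4 * (LINT x|mu. norm x ^ 2))"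
      using P2_integrable[OF mu] by (subst nn_integral_eq_integral) auto
    finally have le: "(\<integral>\<^sup>+x. ennreal (norm (F i x) ^ 2) \<partial>mu) \<le> ennreal (4 * (LINT x|mu. norm x ^ 2))" .
    then show "distr mu borel (F i) \<in> P2" by (subst m.distr_in_P2_iff[OF Fmu]) (auto intro: le_less_trans)
    from second_moment_le_iff[OF this, of "4 * (LINT x|mu. norm x ^ 2)"] le
    show "(\<integral>x. norm x ^ 2 \<partial>distr mu borel (F i)) \<le> 4 * (LINT x|mu. norm x ^ 2)" by (simp add: nn_integral_distr Fmu)
  qed
  have pmf: "\<exists>p. finite (set_pmf p) \<and> distr (measure_pmf p) borel id = distr mu borel (F i)" for i
  proof -
    let ?M = "distr mu (count_space UNIV) (F i)"
    have Fc[measurable]: "F i \<in> measurable mu (count_space UNIV)"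
      using measurable_simple_function[OF F[of i]] by (simp add: measurable_cong_sets[OF P2_sets[OF mu] refl])
    interpret M: prob_space ?M by (rule m.prob_space_distr) simp
    have ae: "AE x in ?M. x \<in> range (F i)" by (subst AE_distr_iff) auto
    then have "AE x in ?M. measure ?M {x} \<noteq> 0"
      using Ffin[of i] by (subst M.AE_support_countable) (auto intro!: exI[of _ "range (F i)"] countable_finite)
    then have p: "measure_pmf (Abs_pmf ?M) = ?M" using M.prob_space_axioms by (intro Abs_pmf_inverse) auto
    have "set_pmf (Abs_pmf ?M) \<subseteq> range (F i)" using ae by (subst (asm) p[symmetric]) (auto simp: AE_measure_pmf_iff)
    moreover have "distr (measure_pmf (Abs_pmf ?M)) borel id = distr mu borel (F i)"
      unfolding p by (subst distr_distr) auto
    ultimately show ?thesis using Ffin finite_subset by blast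
  qed
  have "\<exists>Ga\<in>gen_geodesic_plans (distr mu borel (F i)) nu rho. energy_le nu u \<and> energy_le rho v \<longrightarrow>
      (\<forall>t\<in>{0..1}. energy_le (distr Ga borel (\<lambda>q. interpolate t (snd q))) ((1 - t) * u + t * v))" for i
  proof -
    obtain p where p: "finite (set_pmf p)" "distr (measure_pmf p) borel id = distr mu borel (F i)" using pmf[of i] by blast
    from semidiscrete_plan[OF dim_eq p(1) _ nu rho] show ?thesis unfolding p(2) using FP by blast
  qed
  then obtain G where G: "\<And>i. G i \<in> gen_geodesic_plans (distr mu borel (F i)) nu rho"
    and Ge: "\<And>i t. energy_le nu u \<Longrightarrow> energy_le rho v \<Longrightarrow> t \<in> {0..1} \<Longrightarrow>
      energy_le (distr (G i) borel (\<lambda>q. interpolate t (snd q))) ((1 - t) * u + t * v)" by metis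
  note GD = gen_geodesic_plansD[OF G]
  \<comment> \<open>8 = 2 * 4: the base point counts twice in the moment of a plan on triples, and
    the discretization multiplies its second moment by at most 4.\<close>
  let ?C = "8 * (LINT x|mu. norm x ^ 2) + (LINT x|nu. norm x ^ 2) + (LINT x|rho. norm x ^ 2)"
  have GM: "(\<integral>t. norm t ^ 2 \<partial>G i) \<le> ?C" for i
    using gen_geodesic_plansI(2)[OF P2_prob[OF GD(1)] P2_sets[OF GD(1)] GD(2,3) FP nu rho, of i] FM[of i] by linarith
  obtain s :: "nat \<Rightarrow> nat" and Om :: "real measure" and X Y
    where s: "strict_mono s" and Om: "prob_space Om" and XY[measurable]: "\<And>k. X k \<in> borel_measurable Om" "Y \<in> borel_measurable Om"
      and X: "\<And>k. distr Om borel (X k) = G (s k)" and lim: "converges_AE Om X Y"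
      and XM: "\<And>k. moment2 Om (X k) \<le> ennreal ?C"
    by (rule skorohod_P2[of G ?C, OF GD(1) GM]) blast
  interpret prob_space Om by fact
  have Plim: "(\<lambda>k. F (s k) x) \<longlonglongrightarrow> x" for x using LIMSEQ_subseq_LIMSEQ[OF Flim s] by (simp add: comp_def)
  have opt: "optimal_plan mu nu (distr Om borel (\<lambda>w. (fst (Y w), fst (snd (Y w)))))"
  proof (rule optimal_plan_limit[OF mu nu Om _ _ _ Fm Plim Fb, where X="\<lambda>k w. (fst (X k w), fst (snd (X k w)))"])
    show "AE w in Om. (\<lambda>k. (fst (X k w), fst (snd (X k w)))) \<longlonglongrightarrow> (fst (Y w), fst (snd (Y w)))"
      using lim by eventually_elim (intro tendsto_intros)
    show "optimal_plan (distr mu borel (F (s k))) nu (distr Om borel (\<lambda>w. (fst (X k w), fst (snd (X k w)))))" for k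
      using GD(2)[of "s k"] unfolding X[symmetric] by (simp add: distr_distr comp_def)
  qed measurable
  have opt': "optimal_plan mu rho (distr Om borel (\<lambda>w. (fst (Y w), snd (snd (Y w)))))"
  proof (rule optimal_plan_limit[OF mu rho Om _ _ _ Fm Plim Fb, where X="\<lambda>k w. (fst (X k w), snd (snd (X k w)))"])
    show "AE w in Om. (\<lambda>k. (fst (X k w), snd (snd (X k w)))) \<longlonglongrightarrow> (fst (Y w), snd (snd (Y w)))"
      using lim by eventually_elim (intro tendsto_intros)
    show "optimal_plan (distr mu borel (F (s k))) rho (distr Om borel (\<lambda>w. (fst (X k w), snd (snd (X k w)))))" for k
      using GD(3)[of "s k"] unfolding X[symmetric] by (simp add: distr_distr comp_def)
  qed measurable
  have "distr Om borel Y \<in> gen_geodesic_plans mu nu rho"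
    by (rule gen_geodesic_plansI(1)[OF _ _ _ _ mu nu rho]) (use opt opt' in "simp_all add: distr_distr comp_def prob_space_distr")
  moreover have "energy_le (distr (distr Om borel Y) borel (\<lambda>q. interpolate t (snd q))) ((1 - t) * u + t * v)"
    if uv: "energy_le nu u" "energy_le rho v" and t: "t \<in> {0..1}" for t
  proof -
    have "energy_le (distr Om borel (\<lambda>w. interpolate t (snd (Y w)))) ((1 - t) * u + t * v)"
    proof (rule energy_le_limit_distr[OF Om, where X="\<lambda>k w. interpolate t (snd (X k w))" and C="2 * ?C" and u="\<lambda>_. (1 - t) * u + t * v"])
      show "AE w in Om. (\<lambda>k. interpolate t (snd (X k w))) \<longlonglongrightarrow> interpolate t (snd (Y w))"
        using lim unfolding interpolate_def by eventually_elim (intro tendsto_intros)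
      show "energy_le (distr Om borel (\<lambda>w. interpolate t (snd (X k w)))) ((1 - t) * u + t * v)" for k
        using Ge[OF uv t, of "s k"] unfolding X[symmetric] by (simp add: distr_distr comp_def)
      show "(\<integral>\<^sup>+w. ennreal (norm (interpolate t (snd (X k w))) ^ 2) \<partial>Om) \<le> ennreal (2 * ?C)" for k
      proof -
        have "norm (interpolate t (snd q)) ^ 2 \<le> 2 * norm q ^ 2" for q :: "'a \<times> 'a \<times> 'a"
          using norm_interpolate_le[OF t, of "snd q"] norm_prod_sq[of q] zero_le_power2[of "norm (fst q)"] by linarith
        then have "(\<integral>\<^sup>+w. ennreal (norm (interpolate t (snd (X k w))) ^ 2) \<partial>Om) \<le> (\<integral>\<^sup>+w. 2 * ennreal (norm (X k w) ^ 2) \<partial>Om)"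
          by (intro nn_integral_mono) (simp add: ennreal_mult'[symmetric] ennreal_leI flip: ennreal_numeral)
        also have "\<dots> = 2 * moment2 Om (X k)" by (rule nn_integral_cmult) measurable
        also have "\<dots> \<le> 2 * ennreal ?C" using XM by (intro mult_left_mono) auto
        also have "\<dots> = ennreal (2 * ?C)" by (simp add: ennreal_mult')
        finally show ?thesis .
      qed
    qed simp_all
    then show ?thesis by (simp add: distr_distr comp_def)
  qed
  ultimately show ?thesis by (intro bexI[of _ "distr Om borel Y"]) blast+
qed

end

subsection \<open>Potential and interaction energy\<close>

text \<open>What is kept of a C1 function with Lipschitz gradient. The bound passes to the pair
  potential on the product space, so that V and W can be treated as one function.\<close>

definition quad_bound :: "('b::euclidean_space \<Rightarrow> real) \<Rightarrow> real \<Rightarrow> bool" where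
  "quad_bound Phi L \<longleftrightarrow> (\<forall>p. \<exists>g. \<forall>h. \<bar>Phi (p + h) - Phi p - g \<bullet> h\<bar> \<le> L * norm h ^ 2)"

lemma C1_Lipschitz_deriv_quad_bound:
  assumes "C1_Lipschitz_deriv U"
  shows "\<exists>L\<ge>0. quad_bound U L"
proof -
  obtain G L where G: "\<And>x. GDERIV U x :> G x" and L: "L-lipschitz_on UNIV G"
    using assms unfolding C1_Lipschitz_deriv_def by blast
  have "\<bar>U (x + h) - U x - G x \<bullet> h\<bar> \<le> L * norm h ^ 2" for x h
  proof -
    have der: "((\<lambda>s. U (x + s *\<^sub>R h)) has_derivative (\<lambda>u. (u *\<^sub>R h) \<bullet> G (x + s *\<^sub>R h))) (at s within {0..1})" for s :: real
    proof -
      have "((\<lambda>s. x + s *\<^sub>R h) has_derivative (\<lambda>u. u *\<^sub>R h)) (at s within {0..1})"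
        by (auto intro!: derivative_eq_intros)
      from has_derivative_compose[OF this G[of "x + s *\<^sub>R h", unfolded gderiv_def]] show ?thesis by simp
    qed
    from mvt_very_simple[OF zero_le_one der] obtain s where s: "s \<in> {0..1}" "U (x + h) - U x = h \<bullet> G (x + s *\<^sub>R h)" by auto
    have "\<bar>U (x + h) - U x - G x \<bullet> h\<bar> = \<bar>(G (x + s *\<^sub>R h) - G x) \<bullet> h\<bar>"
      unfolding s(2) by (simp add: inner_diff_left inner_commute[of h])
    also have "\<dots> \<le> norm (G (x + s *\<^sub>R h) - G x) * norm h" by (rule Cauchy_Schwarz_ineq2)
    also have "\<dots> \<le> (L * norm (s *\<^sub>R h)) * norm h"
      using lipschitz_onD[OF L, of "x + s *\<^sub>R h" x] by (intro mult_right_mono) (auto simp: dist_norm)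
    also have "\<dots> \<le> (L * norm h) * norm h"
      using s(1) lipschitz_on_nonneg[OF L] by (intro mult_right_mono mult_left_mono) (auto simp: mult_left_le_one_le)
    finally show ?thesis by (simp add: power2_eq_square mult.assoc)
  qed
  then show ?thesis using lipschitz_on_nonneg[OF L] unfolding quad_bound_def by blast
qed

text \<open>W is evaluated at a difference, and |h1 - h2|^2 <= 2 |h|^2; this factor 2 is cancelled
  by the 1/2 in front of W.\<close>

lemma quad_bound_interaction:
  fixes V W :: "'a::euclidean_space \<Rightarrow> real"
  assumes V: "quad_bound V L" and W: "quad_bound W M" and "0 \<le> L" "0 \<le> M"
  shows "quad_bound (\<lambda>p. V (fst p) + W (fst p - snd p) / 2) (L + M)"
  unfolding quad_bound_def
proof
  fix p :: "'a \<times> 'a"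
  obtain g where g: "\<And>h. \<bar>V (fst p + h) - V (fst p) - g \<bullet> h\<bar> \<le> L * norm h ^ 2" using V unfolding quad_bound_def by blast
  obtain k where k: "\<And>h. \<bar>W (fst p - snd p + h) - W (fst p - snd p) - k \<bullet> h\<bar> \<le> M * norm h ^ 2" using W unfolding quad_bound_def by blast
  show "\<exists>g. \<forall>h. \<bar>V (fst (p + h)) + W (fst (p + h) - snd (p + h)) / 2 - (V (fst p) + W (fst p - snd p) / 2) - g \<bullet> h\<bar> \<le> (L + M) * norm h ^ 2"
  proof (intro exI[of _ "(g + k /\<^sub>R 2, - (k /\<^sub>R 2))"] allI)
    fix h :: "'a \<times> 'a"
    have a: "fst p + fst h - (snd p + snd h) = fst p - snd p + (fst h - snd h)" by simp
    have e: "V (fst (p + h)) + W (fst (p + h) - snd (p + h)) / 2 - (V (fst p) + W (fst p - snd p) / 2) - (g + k /\<^sub>R 2, - (k /\<^sub>R 2)) \<bullet> h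
      = (V (fst p + fst h) - V (fst p) - g \<bullet> fst h) + (W (fst p - snd p + (fst h - snd h)) - W (fst p - snd p) - k \<bullet> (fst h - snd h)) / 2"
      unfolding inner_prod_def by (simp add: a inner_add_left inner_diff_right field_simps)
    have bound: "\<bar>A + B / 2\<bar> \<le> d + e" if "b \<le> 2 * e" "a \<le> d" "\<bar>A\<bar> \<le> a" "\<bar>B\<bar> \<le> b" for A B a b d e :: real
      using that by linarith
    have M2: "M * norm (fst h - snd h) ^ 2 \<le> 2 * (M * norm h ^ 2)"
      using mult_left_mono[OF norm_diff_sq_le[of "fst h" "snd h"] \<open>0 \<le> M\<close>] unfolding norm_prod_sq[of h] by (simp add: algebra_simps)
    have L2: "L * norm (fst h) ^ 2 \<le> L * norm h ^ 2"
      using \<open>0 \<le> L\<close> unfolding norm_prod_sq[of h] by (intro mult_left_mono) auto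
    show "\<bar>V (fst (p + h)) + W (fst (p + h) - snd (p + h)) / 2 - (V (fst p) + W (fst p - snd p) / 2) - (g + k /\<^sub>R 2, - (k /\<^sub>R 2)) \<bullet> h\<bar> \<le> (L + M) * norm h ^ 2"
      unfolding e distrib_right by (rule bound[OF M2 L2 g[of "fst h"] k[of "fst h - snd h"]])
  qed
qed

context
  fixes Phi :: "'b::euclidean_space \<Rightarrow> real" and L :: real
  assumes qb: "quad_bound Phi L" and L0: "0 \<le> L"
begin

lemma quad_bound_continuous: "continuous_on UNIV Phi"
proof -
  have "(Phi \<longlongrightarrow> Phi p) (at p)" for p
  proof -
    obtain g where g: "\<And>h. \<bar>Phi (p + h) - Phi p - g \<bullet> h\<bar> \<le> L * norm h ^ 2" using qb unfolding quad_bound_def by blast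
    have b: "norm (Phi x - Phi p) \<le> norm g * norm (x - p) + L * norm (x - p) ^ 2" for x
      using g[of "x - p"] Cauchy_Schwarz_ineq2[of g "x - p"] by (simp add: abs_le_iff)
    have "((\<lambda>x. norm g * norm (x - p) + L * norm (x - p) ^ 2) \<longlongrightarrow> norm g * norm (p - p) + L * norm (p - p) ^ 2) (at p)"
      by (intro tendsto_intros)
    then have "((\<lambda>x. norm g * norm (x - p) + L * norm (x - p) ^ 2) \<longlongrightarrow> 0) (at p)" by simp
    from Lim_null_comparison[OF always_eventually[OF allI[OF b]] this]
    have "((\<lambda>x. Phi x - Phi p) \<longlongrightarrow> 0) (at p)" .
    then show ?thesis by (simp add: LIM_zero_iff)
  qed
  then show ?thesis by (simp add: continuous_on_def continuous_within)
qed

lemma quad_bound_measurable: "Phi \<in> borel_measurable borel"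
  using quad_bound_continuous by (rule borel_measurable_continuous_onI)

lemma quad_bound_growth: "\<exists>A\<ge>0. \<forall>p. \<bar>Phi p\<bar> \<le> A * (1 + norm p ^ 2)"
proof -
  obtain g where g: "\<And>h. \<bar>Phi (0 + h) - Phi 0 - g \<bullet> h\<bar> \<le> L * norm h ^ 2" using qb unfolding quad_bound_def by blast
  have "\<bar>Phi p\<bar> \<le> (\<bar>Phi 0\<bar> + norm g ^ 2 + (L + 1)) * (1 + norm p ^ 2)" for p
  proof -
    have "\<bar>g \<bullet> p\<bar> \<le> norm g * norm p" by (rule Cauchy_Schwarz_ineq2)
    moreover have "norm g * norm p \<le> norm g ^ 2 + norm p ^ 2"
      using sum_squares_bound[of "norm g" "norm p"] mult_nonneg_nonneg[OF norm_ge_zero norm_ge_zero, of g p] by linarith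
    ultimately have gp: "\<bar>g \<bullet> p\<bar> \<le> norm g ^ 2 + norm p ^ 2" by linarith
    have "\<bar>Phi p - Phi 0 - g \<bullet> p\<bar> \<le> L * norm p ^ 2" using g[of p] by simp
    then have "\<bar>Phi p\<bar> \<le> \<bar>Phi 0\<bar> + norm g ^ 2 + (L + 1) * norm p ^ 2"
      using gp unfolding distrib_right by linarith
    also have "\<dots> \<le> (\<bar>Phi 0\<bar> + norm g ^ 2 + (L + 1)) * (1 + norm p ^ 2)"
      using L0 zero_le_power2[of "norm p"] by (simp add: algebra_simps)
    finally show ?thesis .
  qed
  then show ?thesis using L0 by (intro exI[of _ "\<bar>Phi 0\<bar> + norm g ^ 2 + (L + 1)"]) auto
qed

text \<open>Expansion around the interpolated point: the first order terms cancel, and the weights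
  of the remainders add up to (1 - t) t^2 + t (1 - t)^2 = t (1 - t).\<close>

lemma quad_bound_convex:
  assumes t: "t \<in> {0..1}"
  shows "Phi ((1 - t) *\<^sub>R y + t *\<^sub>R z) \<le> (1 - t) * Phi y + t * Phi z + L * (t * (1 - t)) * norm (y - z) ^ 2"
proof -
  define q where "q = (1 - t) *\<^sub>R y + t *\<^sub>R z"
  obtain g where g: "\<And>h. \<bar>Phi (q + h) - Phi q - g \<bullet> h\<bar> \<le> L * norm h ^ 2" using qb unfolding quad_bound_def by blast
  have yz: "q + t *\<^sub>R (y - z) = y" "q + (t - 1) *\<^sub>R (y - z) = z" by (simp_all add: q_def algebra_simps)
  have gy: "\<bar>Phi y - Phi q - t * (g \<bullet> (y - z))\<bar> \<le> L * (t\<^sup>2 * norm (y - z) ^ 2)"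
    using g[of "t *\<^sub>R (y - z)"] unfolding yz by (simp add: power_mult_distrib)
  have gz: "\<bar>Phi z - Phi q - (t - 1) * (g \<bullet> (y - z))\<bar> \<le> L * ((t - 1)\<^sup>2 * norm (y - z) ^ 2)"
    using g[of "(t - 1) *\<^sub>R (y - z)"] unfolding yz by (simp add: power_mult_distrib)
  have 1: "(1 - t) * (Phi q + t * (g \<bullet> (y - z)) - L * (t\<^sup>2 * norm (y - z) ^ 2)) \<le> (1 - t) * Phi y"
    by (rule mult_left_mono) (use gy t in auto)
  have 2: "t * (Phi q + (t - 1) * (g \<bullet> (y - z)) - L * ((t - 1)\<^sup>2 * norm (y - z) ^ 2)) \<le> t * Phi z"
    by (rule mult_left_mono) (use gz t in auto)
  have "(1 - t) * (Phi q + t * G - L * (t\<^sup>2 * N)) + t * (Phi q + (t - 1) * G - L * ((t - 1)\<^sup>2 * N)) = Phi q - L * (t * (1 - t)) * N" for G N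
    by algebra
  from this[of "g \<bullet> (y - z)" "(norm (y - z))\<^sup>2"] 1 2 show ?thesis unfolding q_def[symmetric] by linarith
qed

lemma quad_bound_sym: "Phi (p + h) + Phi (p - h) \<le> 2 * Phi p + 2 * L * norm h ^ 2"
proof -
  obtain g where g: "\<And>h. \<bar>Phi (p + h) - Phi p - g \<bullet> h\<bar> \<le> L * norm h ^ 2" using qb unfolding quad_bound_def by blast
  show ?thesis using g[of h] g[of "- h"] by (simp add: abs_le_iff)
qed

end

text \<open>Applied to the potential V x + W (x - y) / 2, this collects the terms of V and of W in
  one integral.\<close>

definition pair_energy :: "('a::euclidean_space \<times> 'a \<Rightarrow> real) \<Rightarrow> 'a measure \<Rightarrow> real" where
  "pair_energy Phi mu = (LINT p|(mu \<Otimes>\<^sub>M mu). Phi p)"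

lemma pair_P2:
  assumes "mu \<in> P2"
  shows "mu \<Otimes>\<^sub>M mu \<in> P2" "(LINT p|(mu \<Otimes>\<^sub>M mu). norm p ^ 2) = 2 * (LINT x|mu. norm x ^ 2)"
  using transport_plan_second_moment[OF pair_measure_plan[OF assms assms] assms assms] by simp_all

lemma integrable_growth:
  assumes M: "M \<in> P2" and [measurable]: "Phi \<in> borel_measurable borel" and A: "\<And>p. \<bar>Phi p\<bar> \<le> A * (1 + norm p ^ 2)"
  shows "integrable M Phi" "(LINT p|M. Phi p) \<le> A * (1 + (LINT p|M. norm p ^ 2))"
proof -
  interpret prob_space M using M by (rule P2_prob)
  have i: "integrable M (\<lambda>p. A * (1 + norm p ^ 2))" using P2_integrable[OF M] by simp
  show int: "integrable M Phi"
    by (rule Bochner_Integration.integrable_bound[OF i borel_measurable_sets_eq[OF P2_sets[OF M] assms(2)]])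
      (use A in "auto intro!: AE_I2 order_trans[OF A]")
  have "(LINT p|M. Phi p) \<le> (LINT p|M. A * (1 + norm p ^ 2))"
    by (rule integral_mono[OF int i]) (use A in "auto simp: abs_le_iff")
  then show "(LINT p|M. Phi p) \<le> A * (1 + (LINT p|M. norm p ^ 2))" using P2_integrable[OF M] by (simp add: prob_space)
qed

lemma pair_measure_distr_self:
  assumes M: "prob_space M" and g[measurable]: "g \<in> borel_measurable M"
  shows "distr M borel g \<Otimes>\<^sub>M distr M borel g = distr (M \<Otimes>\<^sub>M M) (borel :: ('a::euclidean_space \<times> 'a) measure) (\<lambda>q. (g (fst q), g (snd q)))"
proof -
  have "prob_space (distr M borel g)" using M by (rule prob_space.prob_space_distr) measurable
  then show ?thesis
    using pair_measure_distr[OF g g] by (simp add: prob_space_imp_sigma_finite borel_prod case_prod_unfold)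
qed

lemma pair_energy_distr:
  fixes g :: "'w \<Rightarrow> 'a::euclidean_space"
  assumes "prob_space M" and g[measurable]: "g \<in> borel_measurable M" and [measurable]: "Phi \<in> borel_measurable borel"
  shows "pair_energy Phi (distr M borel g) = (LINT q|(M \<Otimes>\<^sub>M M). Phi (g (fst q), g (snd q)))"
  unfolding pair_energy_def pair_measure_distr_self[OF assms(1,2)] by (subst integral_distr) auto

lemma distr_pair_self_snd:
  assumes "prob_space M" shows "distr (M \<Otimes>\<^sub>M M) M snd = M"
proof -
  interpret prob_space M by fact
  interpret pair_prob_space M M ..
  have "distr (M \<Otimes>\<^sub>M M) M snd = distr (distr (M \<Otimes>\<^sub>M M) (M \<Otimes>\<^sub>M M) (\<lambda>(x, y). (y, x))) M snd"
    by (rule arg_cong[OF distr_pair_swap])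
  also have "\<dots> = distr (M \<Otimes>\<^sub>M M) M fst"
    by (subst distr_distr) (auto simp: comp_def case_prod_unfold)
  also have "\<dots> = M" by (rule prob_space.distr_pair_fst[OF assms])
  finally show ?thesis .
qed

lemma AE_pair_both:
  assumes "prob_space M" "AE x in M. P x"
  shows "AE q in M \<Otimes>\<^sub>M M. P (fst q) \<and> P (snd q)"
proof -
  interpret prob_space M by fact
  interpret pair_prob_space M M ..
  have 1: "AE q in M \<Otimes>\<^sub>M M. P (fst q)"
    by (rule AE_distrD[of fst "M \<Otimes>\<^sub>M M" M]) (measurable, unfold prob_space.distr_pair_fst[OF assms(1)], rule assms(2))
  have "AE q in M \<Otimes>\<^sub>M M. P (snd q)"
    by (rule AE_distrD[of snd "M \<Otimes>\<^sub>M M" M]) (measurable, unfold distr_pair_self_snd[OF assms(1)], rule assms(2))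
  with 1 show ?thesis by eventually_elim simp
qed

lemma pair_energy_limit:
  fixes X :: "nat \<Rightarrow> 'w \<Rightarrow> 'a::euclidean_space"
  assumes Om: "prob_space Om" and [measurable]: "\<And>k. X k \<in> borel_measurable Om" "Y \<in> borel_measurable Om"
    and lim: "converges_AE Om X Y"
    and XP: "\<And>k. distr Om borel (X k) \<in> P2" and YP: "distr Om borel Y \<in> P2"
    and qb: "quad_bound Phi L" "0 \<le> L" and Phi0: "\<And>p. 0 \<le> Phi p"
    and a: "(\<lambda>k. pair_energy Phi (distr Om borel (X k))) \<longlonglongrightarrow> a"
  shows "pair_energy Phi (distr Om borel Y) \<le> a"
proof -
  note [measurable] = quad_bound_measurable[OF qb]
  have nn: "(\<integral>\<^sup>+q. ennreal (Phi (Z (fst q), Z (snd q))) \<partial>(Om \<Otimes>\<^sub>M Om)) = ennreal (pair_energy Phi (distr Om borel Z))"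
    if Z[measurable]: "Z \<in> borel_measurable Om" and ZP: "distr Om borel Z \<in> P2" for Z
  proof -
    obtain A where A: "\<And>p. \<bar>Phi p\<bar> \<le> A * (1 + norm p ^ 2)" using quad_bound_growth[OF qb] by blast
    have "integrable (distr Om borel Z \<Otimes>\<^sub>M distr Om borel Z) Phi"
      by (rule integrable_growth(1)[OF pair_P2(1)[OF ZP] _ A]) measurable
    then have "integrable (Om \<Otimes>\<^sub>M Om) (\<lambda>q. Phi (Z (fst q), Z (snd q)))"
      unfolding pair_measure_distr_self[OF Om Z] by (subst (asm) integrable_distr_eq) auto
    then show ?thesis unfolding pair_energy_distr[OF Om Z quad_bound_measurable[OF qb]]
      by (rule nn_integral_eq_integral) (simp add: Phi0)
  qed
  have a0: "0 \<le> a"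
    by (rule LIMSEQ_le_const[OF a]) (auto simp: pair_energy_def Phi0)
  have "(\<integral>\<^sup>+q. ennreal (Phi (Y (fst q), Y (snd q))) \<partial>(Om \<Otimes>\<^sub>M Om)) \<le> ennreal a"
  proof (rule nn_integral_le_of_limit[where u="\<lambda>k q. Phi (X k (fst q), X k (snd q))"])
    show "AE q in Om \<Otimes>\<^sub>M Om. (\<lambda>k. Phi (X k (fst q), X k (snd q))) \<longlonglongrightarrow> Phi (Y (fst q), Y (snd q))"
      using AE_pair_both[OF Om lim]
      by eventually_elim (rule continuous_on_tendsto_compose[OF quad_bound_continuous[OF qb]], auto intro: tendsto_Pair)
    show "(\<lambda>k. \<integral>\<^sup>+q. ennreal (Phi (X k (fst q), X k (snd q))) \<partial>(Om \<Otimes>\<^sub>M Om)) \<longlonglongrightarrow> ennreal a"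
      unfolding nn[OF assms(2) XP] using a by (intro tendsto_ennrealI)
  qed measurable
  then show ?thesis unfolding nn[OF assms(3) YP] using a0 by simp
qed

text \<open>Two independent copies of the plan move a pair of points along a segment of the product
  space. Each copy contributes the integral of |y - z|^2 once, hence the factor 2.\<close>

lemma pair_energy_interpolate_le:
  fixes gam :: "('a::euclidean_space \<times> 'a) measure"
  assumes gam: "gam \<in> transport_plans nu rho" and P: "nu \<in> P2" "rho \<in> P2" and t: "t \<in> {0..1}"
    and qb: "quad_bound Phi L" "0 \<le> L"
  shows "pair_energy Phi (distr gam borel (interpolate t))
    \<le> (1 - t) * pair_energy Phi nu + t * pair_energy Phi rho + 2 * L * (t * (1 - t)) * (LINT q|gam. norm (fst q - snd q) ^ 2)"
proof -
  note gD = transport_plansD[OF gam]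
  have GP: "gam \<in> P2" using transport_plan_second_moment[OF gam P] by simp
  interpret prob_space gam using gD(2) .
  interpret pair_prob_space gam gam ..
  note [measurable_cong] = gD(1)
  note [measurable] = quad_bound_measurable[OF qb]
  obtain A where A: "\<And>p. \<bar>Phi p\<bar> \<le> A * (1 + norm p ^ 2)" using quad_bound_growth[OF qb] by blast
  have int: "integrable (gam \<Otimes>\<^sub>M gam) (\<lambda>q. Phi (g (fst q), g (snd q)))"
    if g[measurable]: "g \<in> borel_measurable borel" and gP: "distr gam borel g \<in> P2" for g :: "'a \<times> 'a \<Rightarrow> 'a"
  proof -
    have gm: "g \<in> borel_measurable gam" by measurable
    have "integrable (distr gam borel g \<Otimes>\<^sub>M distr gam borel g) Phi"
      by (rule integrable_growth(1)[OF pair_P2(1)[OF gP] _ A]) measurable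
    then show ?thesis
      unfolding pair_measure_distr_self[OF gD(2) gm] by (subst (asm) integrable_distr_eq) auto
  qed
  have eq: "pair_energy Phi (distr gam borel g) = (LINT q|(gam \<Otimes>\<^sub>M gam). Phi (g (fst q), g (snd q)))"
    if g[measurable]: "g \<in> borel_measurable borel" for g :: "'a \<times> 'a \<Rightarrow> 'a"
    by (rule pair_energy_distr[OF gD(2)]) measurable
  let ?c = "\<lambda>q. norm (fst q - snd q) ^ 2 :: real"
  have ci: "integrable gam ?c" by (rule quadratic_cost_finite(2)[OF GP])
  have ci1: "integrable (gam \<Otimes>\<^sub>M gam) (\<lambda>q. ?c (fst q))" "(LINT q|(gam \<Otimes>\<^sub>M gam). ?c (fst q)) = (LINT q|gam. ?c q)"
    using ci prob_space.distr_pair_fst[OF gD(2), of gam] integrable_distr_eq[of fst "gam \<Otimes>\<^sub>M gam" gam ?c] integral_distr[of fst "gam \<Otimes>\<^sub>M gam" gam ?c] by auto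
  note swap = distr_pair_self_snd[OF gD(2)]
  have ci2: "integrable (gam \<Otimes>\<^sub>M gam) (\<lambda>q. ?c (snd q))" "(LINT q|(gam \<Otimes>\<^sub>M gam). ?c (snd q)) = (LINT q|gam. ?c q)"
    using ci swap integrable_distr_eq[of snd "gam \<Otimes>\<^sub>M gam" gam ?c] integral_distr[of snd "gam \<Otimes>\<^sub>M gam" gam ?c] by auto
  have i1: "integrable (gam \<Otimes>\<^sub>M gam) (\<lambda>q. Phi (fst (fst q), fst (snd q)))" and i2: "integrable (gam \<Otimes>\<^sub>M gam) (\<lambda>q. Phi (snd (fst q), snd (snd q)))"
    using int[of fst] int[of snd] by (simp_all add: gD(3,4) P)
  have "pair_energy Phi (distr gam borel (interpolate t)) = (LINT q|(gam \<Otimes>\<^sub>M gam). Phi (interpolate t (fst q), interpolate t (snd q)))"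
    by (rule eq) measurable
  also have "\<dots> \<le> (LINT q|(gam \<Otimes>\<^sub>M gam). (1 - t) * Phi (fst (fst q), fst (snd q)) + t * Phi (snd (fst q), snd (snd q))
      + L * (t * (1 - t)) * (?c (fst q) + ?c (snd q)))"
  proof (rule integral_mono)
    show "Phi (interpolate t (fst q), interpolate t (snd q)) \<le> (1 - t) * Phi (fst (fst q), fst (snd q)) + t * Phi (snd (fst q), snd (snd q))
      + L * (t * (1 - t)) * (?c (fst q) + ?c (snd q))" for q
      using quad_bound_convex[OF qb t, of "(fst (fst q), fst (snd q))" "(snd (fst q), snd (snd q))"]
      by (simp add: interpolate_def norm_prod_sq)
  qed (use int[OF _ distr_interpolate_P2[OF GP t]] i1 i2 ci1(1) ci2(1) in auto)
  also have "\<dots> = (1 - t) * (LINT q|(gam \<Otimes>\<^sub>M gam). Phi (fst (fst q), fst (snd q))) + t * (LINT q|(gam \<Otimes>\<^sub>M gam). Phi (snd (fst q), snd (snd q)))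
      + L * (t * (1 - t)) * ((LINT q|(gam \<Otimes>\<^sub>M gam). ?c (fst q)) + (LINT q|(gam \<Otimes>\<^sub>M gam). ?c (snd q)))"
    using i1 i2 ci1(1) ci2(1) by simp
  also have "\<dots> = (1 - t) * pair_energy Phi nu + t * pair_energy Phi rho + 2 * L * (t * (1 - t)) * (LINT q|gam. ?c q)"
    using eq[of fst] eq[of snd] by (simp add: gD(3,4) ci1(2) ci2(2))
  finally show ?thesis .
qed

lemma ext_integral_eq_integral:
  assumes "integrable M g"
  shows "ext_integral M g = ereal (LINT x|M. g x)"
proof -
  have fin: "(\<integral>\<^sup>+x. ennreal (g x) \<partial>M) \<noteq> \<infinity>" "(\<integral>\<^sup>+x. ennreal (- g x) \<partial>M) \<noteq> \<infinity>"
    using assms by (auto simp: real_integrable_def)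
  then obtain a b where ab: "0 \<le> a" "0 \<le> b" "(\<integral>\<^sup>+x. ennreal (g x) \<partial>M) = ennreal a" "(\<integral>\<^sup>+x. ennreal (- g x) \<partial>M) = ennreal b"
    by (metis ennreal_cases infinity_ennreal_def)
  then show ?thesis
    unfolding ext_integral_def real_lebesgue_integral_def[OF assms] by (simp add: enn2ereal_ennreal)
qed

lemma borel_measurable_sets_eq':
  "sets M = sets borel \<Longrightarrow> g \<in> borel_measurable M \<Longrightarrow> g \<in> borel_measurable borel"
  using measurable_cong_sets[of M borel borel borel] by auto

lemma integrable_leb_density:
  fixes mu :: "'a::euclidean_space measure"
  assumes mu: "mu \<in> P2" and ac: "absolutely_continuous lborel mu" and g: "integrable mu g"
  shows "integrable lborel (\<lambda>x. g x * leb_density mu x)" "(LBINT x. g x * leb_density mu x) = (LINT x|mu. g x)"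
proof -
  have fin: "finite_measure mu" using P2_prob[OF mu] by (simp add: prob_space_def)
  note D = density_leb_density[OF fin P2_sets[OF mu] ac]
  have [measurable]: "g \<in> borel_measurable borel"
    by (rule borel_measurable_sets_eq'[OF P2_sets[OF mu] borel_measurable_integrable[OF g]])
  have "integrable (lebesgue_density (leb_density mu)) g" unfolding D by (rule g)
  then show "integrable lborel (\<lambda>x. g x * leb_density mu x)"
    by (subst (asm) integrable_real_density) (auto simp: mult.commute)
  have "(LINT x|mu. g x) = (\<integral>x. g x \<partial>lebesgue_density (leb_density mu))" unfolding D ..
  also have "\<dots> = (LBINT x. leb_density mu x * g x)" by (subst integral_real_density) auto
  finally show "(LBINT x. g x * leb_density mu x) = (LINT x|mu. g x)" by (simp add: mult.commute)
qed

context mccann_energy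
begin

lemma energy_le_mono: "energy_le M u \<Longrightarrow> u \<le> v \<Longrightarrow> energy_le M v"
  unfolding energy_le_def by (auto intro: order_trans)

lemma energy_le_absolutely_continuous: "energy_le M u \<Longrightarrow> absolutely_continuous lborel M"
  unfolding energy_le_def by (auto intro!: absolutely_continuousI_density)

text \<open>The negative part of f (r x) is at most the integrable function added in
  \<open>shifted\<close>. So the extended integral is a genuine difference, possibly infinite, and
  its real upper bounds are those of \<open>energy_le\<close>.\<close>

lemma internal_term:
  fixes mu :: "'a::euclidean_space measure"
  assumes mu: "mu \<in> P2" and ac: "absolutely_continuous lborel mu"
  shows "ext_integral lborel (\<lambda>x. f (leb_density mu x)) \<noteq> -\<infinity>"
    "ext_integral lborel (\<lambda>x. f (leb_density mu x)) \<le> ereal u \<longleftrightarrow> energy_le mu u"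
proof -
  let ?r = "leb_density mu"
  have fin: "finite_measure mu" using P2_prob[OF mu] by (simp add: prob_space_def)
  note D = density_leb_density[OF fin P2_sets[OF mu] ac]
  have fm: "(\<lambda>x. f (?r x)) \<in> borel_measurable lborel" by (rule f_measurable) simp_all
  have "integrable lborel (\<lambda>x. c * (norm1 x * ?r x + exp (- norm1 x - 1)))"
    by (intro integrable_mult_right Bochner_Integration.integrable_add exp_norm1_integrable
        integrable_leb_density(1)[OF mu ac P2_norm1_integrable[OF mu]])
  then have "(\<integral>\<^sup>+x. ennreal (c * (norm1 x * ?r x + exp (- norm1 x - 1))) \<partial>lborel) \<noteq> \<infinity>"
    unfolding real_integrable_def by blast
  moreover have "(\<integral>\<^sup>+x. ennreal (- f (?r x)) \<partial>lborel) \<le> (\<integral>\<^sup>+x. ennreal (c * (norm1 x * ?r x + exp (- norm1 x - 1))) \<partial>lborel)"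
  proof (intro nn_integral_mono ennreal_leI)
    fix x :: 'a
    show "- f (?r x) \<le> c * (norm1 x * ?r x + exp (- norm1 x - 1))"
      using shifted_nonneg[of "?r x" x] unfolding shifted_def by simp
  qed
  ultimately have neg: "(\<integral>\<^sup>+x. ennreal (- f (?r x)) \<partial>lborel) \<noteq> \<infinity>" by (auto simp: top_unique)
  have both: "ext_integral lborel (\<lambda>x. f (?r x)) \<noteq> -\<infinity> \<and> (ext_integral lborel (\<lambda>x. f (?r x)) \<le> ereal u \<longleftrightarrow> energy_le mu u)"
  proof (cases "integrable lborel (\<lambda>x. f (?r x))")
    case True
    have "(LBINT x. f (?r x)) \<le> u \<longleftrightarrow> energy_le mu u"
    proof
      assume "(LBINT x. f (?r x)) \<le> u"
      then show "energy_le mu u"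
        unfolding energy_le_def using True by (intro bexI[of _ ?r] conjI allI D[symmetric]) auto
    next
      assume "energy_le mu u"
      then show "(LBINT x. f (?r x)) \<le> u"
        using energy_le_densityD(2)[of ?r u] P2_prob[OF mu] by (simp add: D)
    qed
    then show ?thesis by (simp add: ext_integral_eq_integral[OF True])
  next
    case False
    then have "(\<integral>\<^sup>+x. ennreal (f (?r x)) \<partial>lborel) = \<infinity>" using neg fm by (auto simp: real_integrable_def)
    moreover have "enn2ereal (\<integral>\<^sup>+x. ennreal (- f (?r x)) \<partial>lborel) \<noteq> \<infinity>"
      using neg by (metis enn2ereal_eq_top_iff infinity_ennreal_def top_ereal_def)
    ultimately have "ext_integral lborel (\<lambda>x. f (?r x)) = \<infinity>" unfolding ext_integral_def by simp
    moreover have "\<not> energy_le mu u"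
      using energy_le_densityD(1)[of ?r u] P2_prob[OF mu] False by (auto simp: D)
    ultimately show ?thesis by simp
  qed
  then show "ext_integral lborel (\<lambda>x. f (?r x)) \<noteq> -\<infinity>" "ext_integral lborel (\<lambda>x. f (?r x)) \<le> ereal u \<longleftrightarrow> energy_le mu u"
    by blast+
qed

end

locale interaction_energy = mccann_energy f c dim for f c dim +
  fixes V W :: "'a::euclidean_space \<Rightarrow> real" and L M :: real
  assumes dim_eq: "dim = DIM('a)" and V0: "\<And>x. 0 \<le> V x" and W0: "\<And>x. 0 \<le> W x"
    and V: "quad_bound V L" and W: "quad_bound W M" and L0: "0 \<le> L" and M0: "0 \<le> M"
begin

definition Phi :: "'a \<times> 'a \<Rightarrow> real" where
  "Phi p = V (fst p) + W (fst p - snd p) / 2"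

lemma quad_bound_Phi: "quad_bound Phi (L + M)" "0 \<le> L + M"
  using quad_bound_interaction[OF V W L0 M0] L0 M0 unfolding Phi_def[abs_def] by auto

lemma Phi_nonneg: "0 \<le> Phi p"
  unfolding Phi_def using V0 W0 by simp

text \<open>V and W grow at most quadratically, so their terms are finite on \<open>P2\<close> and
  Fubini merges them; only the internal term can be infinite.\<close>

lemma energy_eq:
  assumes mu: "mu \<in> P2" and ac: "absolutely_continuous lborel mu"
  shows "energy V W f mu = ereal (pair_energy Phi mu) + ext_integral lborel (\<lambda>x. f (leb_density mu x))"
proof -
  interpret prob_space mu using mu by (rule P2_prob)
  interpret pair_prob_space mu mu ..
  note [measurable] = quad_bound_measurable[OF V L0] quad_bound_measurable[OF W M0]
  note [measurable_cong] = P2_sets[OF mu]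
  obtain A where A: "\<And>x. \<bar>V x\<bar> \<le> A * (1 + norm x ^ 2)" using quad_bound_growth[OF V L0] by blast
  obtain B where B: "0 \<le> B" "\<And>x. \<bar>W x\<bar> \<le> B * (1 + norm x ^ 2)" using quad_bound_growth[OF W M0] by blast
  have Vi: "integrable mu V" by (rule integrable_growth(1)[OF mu _ A]) measurable
  have V2: "integrable (mu \<Otimes>\<^sub>M mu) (\<lambda>p. V (fst p))" "(LINT p|(mu \<Otimes>\<^sub>M mu). V (fst p)) = (LINT x|mu. V x)"
    using Vi prob_space.distr_pair_fst[OF P2_prob[OF mu], of mu] integrable_distr_eq[of fst "mu \<Otimes>\<^sub>M mu" mu V]
      integral_distr[of fst "mu \<Otimes>\<^sub>M mu" mu V] by auto
  have W2: "integrable (mu \<Otimes>\<^sub>M mu) (\<lambda>p. W (fst p - snd p))"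
  proof (rule integrable_growth(1)[OF pair_P2(1)[OF mu]])
    fix p :: "'a \<times> 'a"
    have "\<bar>W (fst p - snd p)\<bar> \<le> B * (1 + norm (fst p - snd p) ^ 2)" by (rule B(2))
    also have "\<dots> \<le> B * (2 * (1 + norm p ^ 2))"
      using norm_diff_sq_le[of "fst p" "snd p"] B(1) unfolding norm_prod_sq[of p] by (intro mult_left_mono) auto
    finally show "\<bar>W (fst p - snd p)\<bar> \<le> (B * 2) * (1 + norm p ^ 2)" by (simp add: mult.assoc)
  qed measurable
  define w where "w x = (LINT y|mu. W (x - y))" for x
  have wi: "integrable mu w" and wI: "(LINT x|mu. w x) = (LINT p|(mu \<Otimes>\<^sub>M mu). W (fst p - snd p))"
    unfolding w_def using integrable_fst'[OF W2] integral_fst'[OF W2] by simp_all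
  have cw: "conv_fun W (leb_density mu) x = w x" for x
  proof -
    have "\<bar>W (x - y)\<bar> \<le> (B * (2 * (1 + norm x ^ 2))) * (1 + norm y ^ 2)" for y
    proof -
      have "\<bar>W (x - y)\<bar> \<le> B * (1 + norm (x - y) ^ 2)" by (rule B(2))
      also have "1 + norm (x - y) ^ 2 \<le> 2 * (1 + norm x ^ 2) * (1 + norm y ^ 2)"
        using norm_diff_sq_le[of x y] mult_nonneg_nonneg[OF zero_le_power2[of "norm x"] zero_le_power2[of "norm y"]]
        unfolding distrib_left distrib_right by linarith
      finally show ?thesis using B(1) by (simp add: mult_left_mono mult.assoc)
    qed
    then have "integrable mu (\<lambda>y. W (x - y))" by (intro integrable_growth(1)[OF mu]) measurable
    then show ?thesis unfolding conv_fun_def w_def by (rule integrable_leb_density(2)[OF mu ac])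
  qed
  have "pair_energy Phi mu = (LINT x|mu. V x) + (LINT x|mu. w x) / 2"
    unfolding pair_energy_def Phi_def using V2 W2 by (simp add: wI)
  moreover have "ext_integral lborel (\<lambda>x. V x * leb_density mu x) = ereal (LINT x|mu. V x)"
    using ext_integral_eq_integral[OF integrable_leb_density(1)[OF mu ac Vi]] integrable_leb_density(2)[OF mu ac Vi] by simp
  moreover have "ext_integral lborel (\<lambda>x. conv_fun W (leb_density mu) x * leb_density mu x) = ereal (LINT x|mu. w x)"
    using ext_integral_eq_integral[OF integrable_leb_density(1)[OF mu ac wi]] integrable_leb_density(2)[OF mu ac wi] by (simp add: cw)
  ultimately show ?thesis using ac by (simp add: energy_def Let_def)
qed

lemma energy_not_minus_infinity: "mu \<in> P2 \<Longrightarrow> energy V W f mu \<noteq> -\<infinity>"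
  using internal_term(1)[of mu] energy_eq[of mu]
  by (cases "absolutely_continuous lborel mu") (auto simp: energy_def[of V W f mu])

lemma energy_le_iff:
  assumes mu: "mu \<in> P2"
  shows "energy V W f mu \<le> ereal u \<longleftrightarrow> energy_le mu (u - pair_energy Phi mu)"
proof (cases "absolutely_continuous lborel mu")
  case True
  have "ereal a + X \<le> ereal u \<longleftrightarrow> X \<le> ereal (u - a)" for a X by (cases X) (auto simp: algebra_simps)
  then show ?thesis using energy_eq[OF mu True] internal_term(2)[OF mu True] by simp
next
  case False
  then show ?thesis using energy_le_absolutely_continuous by (auto simp: energy_def)
qed

text \<open>Otherwise infinitely many energies lie below some u that is less than the energy of mu.
  Three subsequences are taken in turn: the energies stay below u, the measures get an almost surely
  convergent representation, and the pair energies, bounded by quadratic growth, tend to some a. The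
  internal energies are then bounded by numbers tending to u - a, while the pair energy of mu is at
  most a.\<close>

lemma energy_lower_semicontinuous:
  assumes M: "\<And>k. Ms k \<in> P2" and mu: "mu \<in> P2" and nc: "narrowly_converges Ms mu"
    and C: "\<And>k. (\<integral>x. norm x ^ 2 \<partial>Ms k) \<le> C"
  shows "energy V W f mu \<le> liminf (\<lambda>k. energy V W f (Ms k))"
proof (rule ccontr)
  assume "\<not> ?thesis"
  then obtain u where u: "liminf (\<lambda>k. energy V W f (Ms k)) < ereal u" "ereal u < energy V W f mu"
    using ereal_dense2[of "liminf (\<lambda>k. energy V W f (Ms k))" "energy V W f mu"] by (auto simp: not_le)
  have "infinite {k. energy V W f (Ms k) < ereal u}"
  proof
    assume "finite {k. energy V W f (Ms k) < ereal u}"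
    then have "\<forall>\<^sub>F k in sequentially. ereal u \<le> energy V W f (Ms k)"
      by (simp add: cofinite_eq_sequentially[symmetric] eventually_cofinite not_le)
    from Liminf_bounded[OF this] u(1) show False by simp
  qed
  then obtain s :: "nat \<Rightarrow> nat" where s: "strict_mono s" and su: "\<And>k. energy V W f (Ms (s k)) < ereal u"
    using infinite_enumerate[of "{k. energy V W f (Ms k) < ereal u}"] by blast
  obtain r :: "nat \<Rightarrow> nat" and Om :: "real measure" and X Y
    where r: "strict_mono r" and Om: "prob_space Om" and XY[measurable]: "\<And>k. X k \<in> borel_measurable Om" "Y \<in> borel_measurable Om"
      and X: "\<And>k. distr Om borel (X k) = Ms (s (r k))" and lim: "converges_AE Om X Y"
      and XM: "\<And>k. moment2 Om (X k) \<le> ennreal C"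
    by (rule skorohod_P2[of "\<lambda>k. Ms (s k)" C, OF M C]) blast
  interpret prob_space Om by fact
  have "narrowly_converges (\<lambda>k. distr Om borel (X k)) mu"
    unfolding X using narrowly_converges_subseq[OF narrowly_converges_subseq[OF nc s] r] .
  then have Y: "distr Om borel Y = mu" by (intro distr_limit_eq[OF XY lim P2_prob[OF mu] P2_sets[OF mu]])
  obtain A where A: "0 \<le> A" "\<And>p. \<bar>Phi p\<bar> \<le> A * (1 + norm p ^ 2)" using quad_bound_growth[OF quad_bound_Phi] by blast
  have "pair_energy Phi (Ms (s (r k))) \<in> {0..A * (1 + 2 * C)}" for k
  proof -
    have "pair_energy Phi (Ms (s (r k))) \<le> A * (1 + 2 * (\<integral>x. norm x ^ 2 \<partial>Ms (s (r k))))"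
      using integrable_growth(2)[OF pair_P2(1)[OF M] quad_bound_measurable[OF quad_bound_Phi] A(2)] pair_P2(2)[OF M]
      unfolding pair_energy_def by simp
    also have "\<dots> \<le> A * (1 + 2 * C)" using C A(1) by (intro mult_left_mono) auto
    finally show ?thesis by (auto simp: pair_energy_def Phi_nonneg)
  qed
  then have "\<exists>l\<in>{0..A * (1 + 2 * C)}. \<exists>q. strict_mono q \<and> ((\<lambda>k. pair_energy Phi (Ms (s (r k)))) \<circ> q) \<longlonglongrightarrow> l"
    by (intro compact_imp_seq_compact[OF compact_Icc, unfolded seq_compact_def, rule_format])
  then obtain a q where q: "strict_mono q" and a: "(\<lambda>k. pair_energy Phi (Ms (s (r (q k))))) \<longlonglongrightarrow> a"
    by (auto simp: comp_def)
  have lim': "AE w in Om. (\<lambda>k. X (q k) w) \<longlonglongrightarrow> Y w"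
    using lim by eventually_elim (use LIMSEQ_subseq_LIMSEQ[OF _ q] in "auto simp: comp_def")
  have le: "pair_energy Phi mu \<le> a"
    using pair_energy_limit[where X="\<lambda>k. X (q k)", OF Om XY lim' _ _ quad_bound_Phi Phi_nonneg] a M mu by (simp add: X Y)
  have "energy_le (distr Om borel Y) (u - a)"
  proof (rule energy_le_limit_distr[where X="\<lambda>k. X (q k)", OF Om XY lim' XM])
    show "energy_le (distr Om borel (X (q k))) (u - pair_energy Phi (Ms (s (r (q k)))))" for k
      unfolding X energy_le_iff[OF M, symmetric] using su by (rule less_imp_le)
    show "(\<lambda>k. u - pair_energy Phi (Ms (s (r (q k))))) \<longlonglongrightarrow> u - a" by (intro tendsto_intros a)
  qed
  then have "energy_le mu (u - pair_energy Phi mu)" unfolding Y by (rule energy_le_mono) (use le in simp)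
  then show False using u(2) energy_le_iff[OF mu, of u] by simp
qed

text \<open>The potential part costs 2 (L + M) t (1 - t) times the integral of |y - z|^2; equating 2
  (L + M) with - lam / 2 gives lam = - 4 (L + M). If an end has infinite energy, the right side is
  infinite for 0 < t < 1, and at t = 0 and t = 1 the interpolant is a marginal.\<close>

lemma convex_along_planI:
  fixes mu nu rho :: "'a measure"
  assumes Ga: "Ga \<in> gen_geodesic_plans mu nu rho" and P: "mu \<in> P2" "nu \<in> P2" "rho \<in> P2"
    and en: "\<And>e1 e2. energy V W f nu = ereal e1 \<Longrightarrow> energy V W f rho = ereal e2 \<Longrightarrow>
      (\<forall>t\<in>{0..1}. energy_le (distr Ga borel (\<lambda>q. interpolate t (snd q)))
        ((1 - t) * (e1 - pair_energy Phi nu) + t * (e2 - pair_energy Phi rho)))"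
  shows "convex_along_plan (- 4 * (L + M)) (energy V W f) nu rho Ga"
  unfolding convex_along_plan_def
proof
  fix t :: real assume t: "t \<in> {0..1}"
  note G = gen_geodesic_plansD[OF Ga]
  note sm = borel_measurable_sets_eq[OF P2_sets[OF G(1)]]
  interpret prob_space Ga using G(1) by (rule P2_prob)
  define gam where "gam = distr Ga borel snd"
  have m: "distr gam borel g = distr Ga borel (\<lambda>q. g (snd q))" if [measurable]: "g \<in> borel_measurable borel" for g :: "'a \<times> 'a \<Rightarrow> 'a"
    unfolding gam_def using distr_distr[OF that sm[OF fst_snd_borel(2)]] by (simp add: comp_def)
  have snd_m: "snd \<in> borel_measurable Ga" "(\<lambda>t. (fst t, fst (snd t))) \<in> borel_measurable Ga"
    "(\<lambda>t. (fst t, snd (snd t))) \<in> borel_measurable Ga" by (rule sm, measurable)+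
  have plan: "gam \<in> transport_plans nu rho"
    using G(2,3) transport_plansD(4)[of "distr Ga borel (\<lambda>t. (fst t, fst (snd t)))" mu nu]
      transport_plansD(4)[of "distr Ga borel (\<lambda>t. (fst t, snd (snd t)))" mu rho]
    by (auto simp: transport_plans_def gam_def optimal_plan_def distr_distr comp_def prob_space_distr snd_m)
  have D: "distr Ga borel (\<lambda>(x, y, z). t *\<^sub>R z + (1 - t) *\<^sub>R y) = distr gam borel (interpolate t)"
    unfolding m[OF interpolate_measurable] by (simp add: interpolate_def[abs_def] case_prod_unfold add.commute)
  have I: "(\<integral>(y, z). norm (y - z) ^ 2 \<partial>distr Ga borel (\<lambda>(x, y, z). (y, z))) = (LINT q|gam. norm (fst q - snd q) ^ 2)"
    unfolding gam_def by (simp add: case_prod_unfold)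
  have gamP: "distr gam borel (interpolate t) \<in> P2"
    by (rule distr_interpolate_P2[OF transport_plan_second_moment(1)[OF plan P(2,3)] t])
  define N where "N = (LINT q|gam. norm (fst q - snd q) ^ 2)"
  consider (fin) e1 e2 where "energy V W f nu = ereal e1" "energy V W f rho = ereal e2"
    | (inf) "energy V W f nu = \<infinity> \<or> energy V W f rho = \<infinity>"
    using energy_not_minus_infinity[OF P(2)] energy_not_minus_infinity[OF P(3)]
    by (cases "energy V W f nu"; cases "energy V W f rho") auto
  then have "energy V W f (distr gam borel (interpolate t)) \<le> ereal t * energy V W f rho + ereal (1 - t) * energy V W f nu
      - ereal (- 4 * (L + M) / 2 * t * (1 - t) * N)"
  proof cases
    case fin
    have "energy V W f (distr gam borel (interpolate t)) \<le> ereal (t * e2 + (1 - t) * e1 - (- 4 * (L + M) / 2 * t * (1 - t) * N))"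
      unfolding energy_le_iff[OF gamP]
    proof (rule energy_le_mono)
      show "energy_le (distr gam borel (interpolate t)) ((1 - t) * (e1 - pair_energy Phi nu) + t * (e2 - pair_energy Phi rho))"
        using en[OF fin] t unfolding m[OF interpolate_measurable] by blast
      show "(1 - t) * (e1 - pair_energy Phi nu) + t * (e2 - pair_energy Phi rho)
          \<le> t * e2 + (1 - t) * e1 - (- 4 * (L + M) / 2 * t * (1 - t) * N) - pair_energy Phi (distr gam borel (interpolate t))"
      proof -
        have "- 4 * (L + M) / 2 * t * (1 - t) * N = - (2 * (L + M) * (t * (1 - t)) * N)" by (simp add: field_simps)
        then show ?thesis
          using pair_energy_interpolate_le[OF plan P(2,3) t quad_bound_Phi] unfolding N_def[symmetric] right_diff_distrib by linarith
      qed
    qed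
    then show ?thesis by (simp add: fin)
  next
    case inf
    have e0: "interpolate 0 = (fst :: 'a \<times> 'a \<Rightarrow> 'a)" and e1: "interpolate 1 = (snd :: 'a \<times> 'a \<Rightarrow> 'a)"
      by (auto simp: interpolate_def)
    consider "t = 0" | "t = 1" | "0 < t" "t < 1" using t by fastforce
    then show ?thesis
    proof cases
      case 1 then show ?thesis using transport_plansD(3)[OF plan] by (simp add: e0 zero_ereal_def[symmetric] one_ereal_def[symmetric])
    next
      case 2 then show ?thesis using transport_plansD(4)[OF plan] by (simp add: e1 zero_ereal_def[symmetric] one_ereal_def[symmetric])
    next
      case 3
      then have "ereal t * energy V W f rho + ereal (1 - t) * energy V W f nu = \<infinity>"
        using inf energy_not_minus_infinity[OF P(2)] energy_not_minus_infinity[OF P(3)]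
        by (cases "energy V W f nu"; cases "energy V W f rho") auto
      then show ?thesis by (simp only:) simp
    qed
  qed
  then show "energy V W f (distr Ga borel (\<lambda>(x, y, z). t *\<^sub>R z + (1 - t) *\<^sub>R y))
      \<le> ereal t * energy V W f rho + ereal (1 - t) * energy V W f nu
        - ereal (- 4 * (L + M) / 2 * t * (1 - t) * (\<integral>(y, z). norm (y - z) ^ 2 \<partial>distr Ga borel (\<lambda>(x, y, z). (y, z))))"
    unfolding D I N_def .
qed

lemma energy_convex_along_gen_geodesics: "convex_along_gen_geodesics (- 4 * (L + M)) (energy V W f)"
  unfolding convex_along_gen_geodesics_def
proof (intro ballI)
  fix mu nu rho :: "'a measure" assume P: "mu \<in> P2" "nu \<in> P2" "rho \<in> P2"
  \<comment> \<open>For an infinite energy this real has no meaning;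
    \<open>convex_along_planI\<close> asks for an energy bound only when both energies are
    finite.\<close>
  define u where "u = real_of_ereal (energy V W f nu) - pair_energy Phi nu"
  define v where "v = real_of_ereal (energy V W f rho) - pair_energy Phi rho"
  obtain Ga where Ga: "Ga \<in> gen_geodesic_plans mu nu rho"
    and en: "energy_le nu u \<and> energy_le rho v \<longrightarrow>
      (\<forall>t\<in>{0..1}. energy_le (distr Ga borel (\<lambda>q. interpolate t (snd q))) ((1 - t) * u + t * v))"
    using generalized_geodesic_energy[OF dim_eq P, of u v] by blast
  have c: "convex_along_plan (- 4 * (L + M)) (energy V W f) nu rho Ga"
  proof (rule convex_along_planI[OF Ga P])
    fix e1 e2 assume e: "energy V W f nu = ereal e1" "energy V W f rho = ereal e2"
    then have uv: "u = e1 - pair_energy Phi nu" "v = e2 - pair_energy Phi rho" by (simp_all add: u_def v_def)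
    have "energy_le nu u" "energy_le rho v"
      unfolding uv energy_le_iff[OF P(2), symmetric] energy_le_iff[OF P(3), symmetric] e by simp_all
    with en show "\<forall>t\<in>{0..1}. energy_le (distr Ga borel (\<lambda>q. interpolate t (snd q)))
        ((1 - t) * (e1 - pair_energy Phi nu) + t * (e2 - pair_energy Phi rho))" unfolding uv by blast
  qed
  \<comment> \<open>Over an absolutely continuous mu the plan just found is the only one, so the
    inequality holds along every plan.\<close>
  with Ga show "(absolutely_continuous lborel mu \<longrightarrow>
      (\<forall>Ga\<in>gen_geodesic_plans mu nu rho. convex_along_plan (- 4 * (L + M)) (energy V W f) nu rho Ga)) \<and>
    (\<exists>Ga\<in>gen_geodesic_plans mu nu rho. convex_along_plan (- 4 * (L + M)) (energy V W f) nu rho Ga)"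
    using gen_geodesic_plan_unique[OF P _ _ Ga] by metis
qed

end

subsection \<open>Convolution with a symmetric measure\<close>

lemma nn_integral_lborel_shift:
  fixes g :: "'a::euclidean_space \<Rightarrow> ennreal"
  assumes [measurable]: "g \<in> borel_measurable borel"
  shows "(\<integral>\<^sup>+x. g (x - w) \<partial>lborel) = (\<integral>\<^sup>+x. g x \<partial>lborel)"
proof -
  have "(\<integral>\<^sup>+x. g x \<partial>lborel) = (\<integral>\<^sup>+x. g x \<partial>distr lborel borel ((+) (- w)))" by (simp only: lborel_distr_plus)
  also have "\<dots> = (\<integral>\<^sup>+x. g (- w + x) \<partial>lborel)" by (rule nn_integral_distr) auto
  finally show ?thesis by simp
qed

lemma integral_lborel_shift:
  fixes g :: "'a::euclidean_space \<Rightarrow> real"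
  assumes [measurable]: "g \<in> borel_measurable borel"
  shows "(LBINT x. g (x - w)) = (LBINT x. g x)"
proof -
  have "(LBINT x. g x) = (\<integral>x. g x \<partial>distr lborel borel ((+) (- w)))" by (simp only: lborel_distr_plus)
  also have "\<dots> = (LBINT x. g (- w + x))" by (rule integral_distr) auto
  finally show ?thesis by simp
qed

text \<open>By translation invariance the inner integral over x does not depend on w; Tonelli turns
  this into integrability and Fubini into the value.\<close>

lemma integrable_shifts:
  fixes g :: "'a::euclidean_space \<Rightarrow> real"
  assumes g: "integrable lborel g" and si: "prob_space si" and s[measurable_cong]: "sets si = sets borel"
  shows "integrable (lborel \<Otimes>\<^sub>M si) (\<lambda>p. g (fst p - snd p))"
    "(LBINT x. (LINT w|si. g (x - w))) = (LBINT x. g x)"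
proof -
  interpret s: prob_space si by fact
  interpret pair_sigma_finite lborel si ..
  have [measurable]: "g \<in> borel_measurable borel" using g by simp
  show int: "integrable (lborel \<Otimes>\<^sub>M si) (\<lambda>p. g (fst p - snd p))"
    unfolding integrable_iff_bounded
  proof
    have "(\<integral>\<^sup>+p. ennreal (norm (g (fst p - snd p))) \<partial>(lborel \<Otimes>\<^sub>M si)) = (\<integral>\<^sup>+w. \<integral>\<^sup>+x. ennreal (norm (g (x - w))) \<partial>lborel \<partial>si)"
      by (subst nn_integral_snd[symmetric]) (auto simp: case_prod_unfold)
    also have "\<dots> = (\<integral>\<^sup>+w. \<integral>\<^sup>+x. ennreal (norm (g x)) \<partial>lborel \<partial>si)"
      by (intro nn_integral_cong nn_integral_lborel_shift[of "\<lambda>x. ennreal (norm (g x))"]) measurable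
    also have "\<dots> = (\<integral>\<^sup>+x. ennreal (norm (g x)) \<partial>lborel)" by (simp add: s.emeasure_space_1)
    also have "\<dots> < \<infinity>" using g by (simp add: integrable_iff_bounded)
    finally show "(\<integral>\<^sup>+p. ennreal (norm (g (fst p - snd p))) \<partial>(lborel \<Otimes>\<^sub>M si)) < \<infinity>" .
  qed measurable
  have "(LBINT x. (LINT w|si. g (x - w))) = (LINT w|si. (LBINT x. g (x - w)))"
    using int by (intro Fubini_integral[symmetric]) (simp add: case_prod_unfold)
  also have "\<dots> = (LBINT x. g x)" by (simp add: integral_lborel_shift s.prob_space)
  finally show "(LBINT x. (LINT w|si. g (x - w))) = (LBINT x. g x)" .
qed

lemma sum_P2:
  fixes mu si :: "'a::euclidean_space measure"
  assumes mu: "mu \<in> P2" and si: "si \<in> P2"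
  shows "distr (mu \<Otimes>\<^sub>M si) borel (\<lambda>p. fst p + snd p) \<in> P2"
proof -
  have P: "mu \<Otimes>\<^sub>M si \<in> P2" using transport_plan_second_moment(1)[OF pair_measure_plan[OF mu si] mu si] .
  interpret prob_space "mu \<Otimes>\<^sub>M si" using P by (rule P2_prob)
  have m: "(\<lambda>p. fst p + snd p) \<in> borel_measurable (mu \<Otimes>\<^sub>M si)"
    by (rule borel_measurable_sets_eq[OF P2_sets[OF P]]) measurable
  have "(norm (fst p + snd p))\<^sup>2 \<le> 2 * norm p ^ 2" for p :: "'a \<times> 'a"
    using norm_diff_sq_le[of "fst p" "- snd p"] unfolding norm_prod_sq[of p] by simp
  then have "(\<integral>\<^sup>+p. ennreal (norm (fst p + snd p) ^ 2) \<partial>(mu \<Otimes>\<^sub>M si)) \<le> (\<integral>\<^sup>+p. ennreal (2 * norm p ^ 2) \<partial>(mu \<Otimes>\<^sub>M si))"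
    by (intro nn_integral_mono ennreal_leI)
  also have "\<dots> < \<infinity>" using P2_integrable[OF P] by (subst nn_integral_eq_integral) auto
  finally show ?thesis by (simp add: distr_in_P2_iff[OF m])
qed

lemma density_sum:
  fixes r :: "'a::euclidean_space \<Rightarrow> real"
  assumes [measurable]: "r \<in> borel_measurable borel" and r0: "\<And>x. 0 \<le> r x"
    and mu: "mu = lebesgue_density r" "prob_space mu"
    and si: "prob_space si" and s[measurable_cong]: "sets si = sets borel"
  shows "distr (mu \<Otimes>\<^sub>M si) borel (\<lambda>p. fst p + snd p) = density lborel (\<lambda>x. ennreal (LINT w|si. r (x - w)))"
proof (rule measure_eqI)
  interpret s: prob_space si by fact
  interpret m: prob_space mu by fact
  interpret ls: pair_sigma_finite lborel si ..
  interpret ms: pair_sigma_finite mu si ..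
  have smu[measurable_cong]: "sets mu = sets borel" by (simp add: mu)
  have ri: "integrable lborel r" by (rule density_prob_integrable(1)[OF assms(1) r0 mu])
  have ae: "AE x in lborel. ennreal (LINT w|si. r (x - w)) = (\<integral>\<^sup>+w. ennreal (r (x - w)) \<partial>si)"
    using ls.AE_integrable_fst'[OF integrable_shifts(1)[OF ri si s]]
    by eventually_elim (subst nn_integral_eq_integral, auto simp: r0)
  fix A assume "A \<in> sets (distr (mu \<Otimes>\<^sub>M si) borel (\<lambda>p. fst p + snd p))"
  then have A[measurable]: "A \<in> sets borel" by simp
  have "emeasure (distr (mu \<Otimes>\<^sub>M si) borel (\<lambda>p. fst p + snd p)) A = (\<integral>\<^sup>+x. indicator A x \<partial>distr (mu \<Otimes>\<^sub>M si) borel (\<lambda>p. fst p + snd p))"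
    by simp
  also have "\<dots> = (\<integral>\<^sup>+p. indicator A (fst p + snd p) \<partial>(mu \<Otimes>\<^sub>M si))"
    by (rule nn_integral_distr) measurable
  also have "\<dots> = (\<integral>\<^sup>+w. \<integral>\<^sup>+x. indicator A (x + w) \<partial>mu \<partial>si)"
    by (subst ms.nn_integral_snd[symmetric]) (auto simp: case_prod_unfold)
  also have "\<dots> = (\<integral>\<^sup>+w. \<integral>\<^sup>+x. ennreal (r (x - w)) * indicator A x \<partial>lborel \<partial>si)"
  proof (rule nn_integral_cong)
    fix w
    have "(\<integral>\<^sup>+x. indicator A (x + w) \<partial>mu) = (\<integral>\<^sup>+x. ennreal (r x) * indicator A (x + w) \<partial>lborel)"
      unfolding mu(1) by (rule nn_integral_density) measurable
    also have "\<dots> = (\<integral>\<^sup>+x. ennreal (r (x - w)) * indicator A x \<partial>lborel)"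
      by (subst nn_integral_lborel_shift[of _ w, symmetric]) auto
    finally show "(\<integral>\<^sup>+x. indicator A (x + w) \<partial>mu) = (\<integral>\<^sup>+x. ennreal (r (x - w)) * indicator A x \<partial>lborel)" .
  qed
  also have "\<dots> = (\<integral>\<^sup>+x. \<integral>\<^sup>+w. ennreal (r (x - w)) * indicator A x \<partial>si \<partial>lborel)"
    by (rule ls.Fubini') (simp add: case_prod_unfold)
  also have "\<dots> = (\<integral>\<^sup>+x. (\<integral>\<^sup>+w. ennreal (r (x - w)) \<partial>si) * indicator A x \<partial>lborel)"
    by (intro nn_integral_cong nn_integral_multc) measurable
  also have "\<dots> = (\<integral>\<^sup>+x. ennreal (LINT w|si. r (x - w)) * indicator A x \<partial>lborel)"
    using ae by (intro nn_integral_cong_AE) (auto elim!: eventually_mono)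
  also have "\<dots> = emeasure (density lborel (\<lambda>x. ennreal (LINT w|si. r (x - w)))) A"
    by (subst emeasure_density) auto
  finally show "emeasure (distr (mu \<Otimes>\<^sub>M si) borel (\<lambda>p. fst p + snd p)) A = emeasure (density lborel (\<lambda>x. ennreal (LINT w|si. r (x - w)))) A" .
qed simp

context mccann_energy
begin

text \<open>The supporting line at the mean, integrated. Mean 0 is treated apart, as f may have no
  supporting line there; X then vanishes almost everywhere.\<close>

lemma jensen:
  assumes "prob_space si" and X: "integrable si X" "\<And>w. 0 \<le> X w" and fX: "integrable si (\<lambda>w. f (X w))"
  shows "f (LINT w|si. X w) \<le> (LINT w|si. f (X w))"
proof -
  interpret prob_space si by fact
  let ?s = "LINT w|si. X w"
  show ?thesis
  proof (cases "?s = 0")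
    case True
    then have "AE w in si. X w = 0" using X by (subst (asm) integral_nonneg_eq_0_iff_AE) auto
    then have "(LINT w|si. f (X w)) = (LINT w|si. 0)"
      using fX by (intro integral_cong_AE) (auto simp: f0 elim!: eventually_mono)
    then show ?thesis by (simp add: True f0)
  next
    case False
    then have s: "0 < ?s" using X(2) by (simp add: less_le)
    have ti: "integrable si (\<lambda>w. tangent ?s (X w))" unfolding tangent_def using X(1) by simp
    have "f ?s = tangent ?s ?s" using tangent_self[OF s] by simp
    also have "\<dots> = (LINT w|si. tangent ?s (X w))" unfolding tangent_def using X(1) by (simp add: prob_space)
    also have "\<dots> \<le> (LINT w|si. f (X w))" by (rule integral_mono[OF ti fX]) (rule tangent_le[OF X(2)])
    finally show ?thesis .
  qed
qed

text \<open>The density k of the sum is an average of translates of r, so by Jensen f (k x) is at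
  most the average H x of the translates of f (r), and H has the same integral as f (r).\<close>

lemma energy_le_sum:
  fixes mu si :: "'a::euclidean_space measure"
  assumes mu: "mu \<in> P2" and si: "si \<in> P2" and en: "energy_le mu u"
  shows "energy_le (distr (mu \<Otimes>\<^sub>M si) borel (\<lambda>p. fst p + snd p)) u"
proof -
  note [measurable_cong] = P2_sets[OF si]
  interpret s: prob_space si using si by (rule P2_prob)
  interpret ls: pair_sigma_finite lborel si ..
  obtain r where r[measurable]: "r \<in> borel_measurable borel" and r0: "\<And>x. 0 \<le> r x"
    and mur: "mu = lebesgue_density r" and fr: "integrable lborel (\<lambda>x. f (r x))" "(LBINT x. f (r x)) \<le> u"
    using en unfolding energy_le_def by blast
  define k where "k x = (LINT w|si. r (x - w))" for x
  define H where "H x = (LINT w|si. f (r (x - w)))" for x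
  have km[measurable]: "k \<in> borel_measurable borel"
    unfolding k_def
  proof (rule s.borel_measurable_lebesgue_integral)
    have "(\<lambda>p. r (fst p - snd p)) \<in> borel_measurable (borel :: ('a \<times> 'a) measure)" by measurable
    moreover have "sets ((borel :: 'a measure) \<Otimes>\<^sub>M si) = sets borel"
      using sets_pair_measure_cong[OF refl P2_sets[OF si], of "borel :: 'a measure"] unfolding borel_prod .
    ultimately have "(\<lambda>p. r (fst p - snd p)) \<in> borel_measurable ((borel :: 'a measure) \<Otimes>\<^sub>M si)"
      by (rule borel_measurable_sets_eq[rotated])
    then
    show "(\<lambda>(x, w). r (x - w)) \<in> borel_measurable (borel \<Otimes>\<^sub>M si)" by (simp add: case_prod_unfold)
  qed
  have k0: "0 \<le> k x" for x unfolding k_def by (simp add: r0)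
  note D = density_sum[OF r r0 mur P2_prob[OF mu] P2_prob[OF si] P2_sets[OF si], folded k_def]
  have ri: "integrable lborel r" by (rule density_prob_integrable(1)[OF r r0 mur P2_prob[OF mu]])
  note R = integrable_shifts[OF ri P2_prob[OF si] P2_sets[OF si]]
  note F = integrable_shifts[OF fr(1) P2_prob[OF si] P2_sets[OF si]]
  have HI: "integrable lborel H" unfolding H_def using ls.integrable_fst'[OF F(1)] by simp
  have HE: "(LBINT x. H x) = (LBINT x. f (r x))" unfolding H_def by (rule F(2))
  have le: "AE x in lborel. f (k x) \<le> H x"
    using ls.AE_integrable_fst'[OF R(1)] ls.AE_integrable_fst'[OF F(1)]
    unfolding k_def H_def by eventually_elim (rule jensen[OF P2_prob[OF si] _ r0], simp_all)
  have DP: "lebesgue_density k \<in> P2" using sum_P2[OF mu si] unfolding D .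
  have n1: "integrable lborel (\<lambda>x. k x * norm1 x)"
    using P2_norm1_integrable[OF DP] by (subst (asm) integrable_real_density) (auto simp: k0)
  \<comment> \<open>f (k x) lies between minus the term added in \<open>shifted\<close> and H x,
    hence is dominated by this function.\<close>
  have Bi: "integrable lborel (\<lambda>x. \<bar>H x\<bar> + c * (norm1 x * k x + exp (- norm1 x - 1)))"
    using n1 by (intro Bochner_Integration.integrable_add integrable_mult_right integrable_abs HI exp_norm1_integrable) (simp add: mult.commute)
  have fk: "integrable lborel (\<lambda>x. f (k x))"
  proof (rule Bochner_Integration.integrable_bound[OF Bi])
    show "(\<lambda>x. f (k x)) \<in> borel_measurable lborel" by (rule f_measurable) (use k0 in auto)
    show "AE x in lborel. norm (f (k x)) \<le> norm (\<bar>H x\<bar> + c * (norm1 x * k x + exp (- norm1 x - 1)))"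
      using le
    proof eventually_elim
      fix x :: 'a assume "f (k x) \<le> H x"
      moreover have "0 \<le> f (k x) + c * (norm1 x * k x + exp (- norm1 x - 1))"
        using shifted_nonneg[OF k0, of x x] unfolding shifted_def .
      moreover have "0 \<le> c * (norm1 x * k x + exp (- norm1 x - 1))"
        using c0 k0 norm1_nonneg[of x] by (intro mult_nonneg_nonneg add_nonneg_nonneg) auto
      ultimately show "norm (f (k x)) \<le> norm (\<bar>H x\<bar> + c * (norm1 x * k x + exp (- norm1 x - 1)))" by simp
    qed
  qed
  have "(LBINT x. f (k x)) \<le> (LBINT x. H x)" by (rule integral_mono_AE[OF fk HI le])
  then show ?thesis
    unfolding energy_le_def D using fk fr(2) k0 by (intro bexI[OF _ km] conjI allI refl) (auto simp: HE)
qed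

end

lemma integral_marginal:
  fixes g :: "'b \<Rightarrow> real"
  assumes "distr M N X = K" "X \<in> measurable M N" "integrable K g"
  shows "integrable M (\<lambda>q. g (X q))" "(LINT q|M. g (X q)) = (LINT x|K. g x)"
proof -
  have i: "integrable (distr M N X) g" using assms(1,3) by simp
  show "integrable M (\<lambda>q. g (X q))" by (rule integrable_distr[OF assms(2) i])
  have "g \<in> borel_measurable N" using borel_measurable_integrable[OF i] by simp
  then show "(LINT q|M. g (X q)) = (LINT x|K. g x)" unfolding assms(1)[symmetric] by (rule integral_distr[OF assms(2), symmetric])
qed

context
  fixes mu si :: "'a::euclidean_space measure" and Phi :: "'a \<times> 'a \<Rightarrow> real" and L :: real
  assumes mu: "mu \<in> P2" and si: "si \<in> P2" and sym: "distr si borel uminus = si"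
    and qb: "quad_bound Phi L" "0 \<le> L"
begin

lemma distr_difference: "distr (mu \<Otimes>\<^sub>M si) borel (\<lambda>p. fst p - snd p) = distr (mu \<Otimes>\<^sub>M si) borel (\<lambda>p. fst p + snd p)"
proof -
  note [measurable_cong] = P2_sets[OF mu] P2_sets[OF si]
  have "prob_space (distr si borel uminus)" using P2_prob[OF si] unfolding sym .
  then have "mu \<Otimes>\<^sub>M si = distr (mu \<Otimes>\<^sub>M si) (borel \<Otimes>\<^sub>M borel) (\<lambda>(x, y). (x, - y))"
    using pair_measure_distr[of "\<lambda>x. x" mu borel uminus si borel] distr_id2[OF P2_sets[OF mu, symmetric]]
    by (simp add: sym prob_space_imp_sigma_finite)
  then have "distr (mu \<Otimes>\<^sub>M si) borel (\<lambda>p. fst p + snd p)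
      = distr (distr (mu \<Otimes>\<^sub>M si) (borel \<Otimes>\<^sub>M borel) (\<lambda>(x, y). (x, - y))) borel (\<lambda>p. fst p + snd p)"
    by (rule arg_cong)
  also have "\<dots> = distr (mu \<Otimes>\<^sub>M si) borel (\<lambda>p. fst p - snd p)"
    by (subst distr_distr) (auto simp: comp_def case_prod_unfold)
  finally show ?thesis ..
qed

text \<open>By symmetry, adding and subtracting the noise give the same law. Averaging the two signs
  cancels the first order term of \<open>Phi\<close>, and the two independent noises leave 2 L times
  the second moment.\<close>

lemma pair_energy_sum_le:
  "pair_energy Phi (distr (mu \<Otimes>\<^sub>M si) borel (\<lambda>p. fst p + snd p)) \<le> pair_energy Phi mu + 2 * L * (LINT w|si. norm w ^ 2)"
proof -
  note pl = pair_measure_plan[OF mu si]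
  have P: "mu \<Otimes>\<^sub>M si \<in> P2" by (rule transport_plan_second_moment(1)[OF pl mu si])
  note [measurable] = quad_bound_measurable[OF qb]
  define Th where "Th = (mu \<Otimes>\<^sub>M si) \<Otimes>\<^sub>M (mu \<Otimes>\<^sub>M si)"
  obtain A where A: "\<And>p. \<bar>Phi p\<bar> \<le> A * (1 + norm p ^ 2)" using quad_bound_growth[OF qb] by blast
  have main: "integrable Th (\<lambda>q. Phi (g (fst q), g (snd q))) \<and> (LINT q|Th. Phi (g (fst q), g (snd q))) = pair_energy Phi (distr (mu \<Otimes>\<^sub>M si) borel g)"
    if g: "g \<in> borel_measurable borel" and gP: "distr (mu \<Otimes>\<^sub>M si) borel g \<in> P2" for g :: "'a \<times> 'a \<Rightarrow> 'a"
  proof -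
    have gm[measurable]: "g \<in> borel_measurable (mu \<Otimes>\<^sub>M si)" by (rule borel_measurable_sets_eq[OF P2_sets[OF P] g])
    have "integrable (distr (mu \<Otimes>\<^sub>M si) borel g \<Otimes>\<^sub>M distr (mu \<Otimes>\<^sub>M si) borel g) Phi"
      by (rule integrable_growth(1)[OF pair_P2(1)[OF gP] _ A]) measurable
    then have "integrable Th (\<lambda>q. Phi (g (fst q), g (snd q)))"
      unfolding pair_measure_distr_self[OF P2_prob[OF P] gm] Th_def by (subst (asm) integrable_distr_eq) auto
    then show ?thesis unfolding Th_def pair_energy_distr[OF P2_prob[OF P] gm quad_bound_measurable[OF qb]] by blast
  qed
  have plus: "integrable Th (\<lambda>q. Phi (fst (fst q) + snd (fst q), fst (snd q) + snd (snd q)))"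
    "(LINT q|Th. Phi (fst (fst q) + snd (fst q), fst (snd q) + snd (snd q))) = pair_energy Phi (distr (mu \<Otimes>\<^sub>M si) borel (\<lambda>p. fst p + snd p))"
    using main[of "\<lambda>p. fst p + snd p"] sum_P2[OF mu si] by simp_all
  have minus: "integrable Th (\<lambda>q. Phi (fst (fst q) - snd (fst q), fst (snd q) - snd (snd q)))"
    "(LINT q|Th. Phi (fst (fst q) - snd (fst q), fst (snd q) - snd (snd q))) = pair_energy Phi (distr (mu \<Otimes>\<^sub>M si) borel (\<lambda>p. fst p + snd p))"
    using main[of "\<lambda>p. fst p - snd p"] sum_P2[OF mu si] by (simp_all add: distr_difference)
  have mid: "integrable Th (\<lambda>q. Phi (fst (fst q), fst (snd q)))" "(LINT q|Th. Phi (fst (fst q), fst (snd q))) = pair_energy Phi mu"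
    using main[of fst] transport_plansD(3)[OF pl] mu by simp_all
  let ?n = "\<lambda>p. norm (snd p) ^ 2 :: real"
  have n: "integrable (mu \<Otimes>\<^sub>M si) ?n" "(LINT p|(mu \<Otimes>\<^sub>M si). ?n p) = (LINT w|si. norm w ^ 2)"
    by (rule integral_marginal[OF transport_plansD(4)[OF pl] borel_measurable_sets_eq[OF P2_sets[OF P] fst_snd_borel(2)] P2_integrable[OF si]])+
  have n1: "integrable Th (\<lambda>q. ?n (fst q))" "(LINT q|Th. ?n (fst q)) = (LINT w|si. norm w ^ 2)"
    and n2: "integrable Th (\<lambda>q. ?n (snd q))" "(LINT q|Th. ?n (snd q)) = (LINT w|si. norm w ^ 2)"
    unfolding Th_def using integral_marginal[OF prob_space.distr_pair_fst[OF P2_prob[OF P]] measurable_fst n(1)]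
      integral_marginal[OF distr_pair_self_snd[OF P2_prob[OF P]] measurable_snd n(1)] n(2) by simp_all
  have "(LINT q|Th. Phi (fst (fst q) + snd (fst q), fst (snd q) + snd (snd q)) + Phi (fst (fst q) - snd (fst q), fst (snd q) - snd (snd q)))
      \<le> (LINT q|Th. 2 * Phi (fst (fst q), fst (snd q)) + 2 * L * (?n (fst q) + ?n (snd q)))"
  proof (rule integral_mono)
    show "Phi (fst (fst q) + snd (fst q), fst (snd q) + snd (snd q)) + Phi (fst (fst q) - snd (fst q), fst (snd q) - snd (snd q))
      \<le> 2 * Phi (fst (fst q), fst (snd q)) + 2 * L * (?n (fst q) + ?n (snd q))" for q
      using quad_bound_sym[OF qb, of "(fst (fst q), fst (snd q))" "(snd (fst q), snd (snd q))"] by (simp add: norm_prod_sq)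
  qed (use plus minus mid n1 n2 in auto)
  then show ?thesis using plus minus mid n1 n2 by (simp add: distrib_left)
qed

end

section \<open>The Gaussian measure\<close>

lemma distr_lborel_uminus: "distr lborel borel uminus = (lborel :: 'a::euclidean_space measure)"
  by (subst (2) lborel_affine[of "-1" 0]) (auto simp: density_1 one_ennreal_def[symmetric])

lemma norm_sq_eq_sum: "(norm x)\<^sup>2 = (\<Sum>b\<in>Basis. (x \<bullet> b)\<^sup>2)" for x :: "'a::euclidean_space"
  unfolding power2_norm_eq_inner by (subst euclidean_inner) (simp add: power2_eq_square)

context
  fixes t :: real
  assumes t: "0 < t"
begin

abbreviation (input) "\<phi> \<equiv> normal_density 0 (sqrt t)"

lemma gaussian_eq_prod:
  "(2 * pi * t) powr (- (real DIM('a) / 2)) * exp (- (norm x ^ 2 / (2 * t))) = (\<Prod>b\<in>Basis. \<phi> (x \<bullet> b))"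
  for x :: "'a::euclidean_space"
proof -
  have "(\<Prod>b\<in>Basis. \<phi> (x \<bullet> b)) = (\<Prod>b\<in>(Basis::'a set). 1 / sqrt (2 * pi * t)) * (\<Prod>b\<in>Basis. exp (- ((x \<bullet> b)\<^sup>2 / (2 * t))))"
    using t unfolding prod.distrib[symmetric] by (intro prod.cong refl) (simp add: normal_density_def)
  also have "(\<Prod>b\<in>Basis. exp (- ((x \<bullet> b)\<^sup>2 / (2 * t)))) = exp (- (norm x ^ 2 / (2 * t)))"
    unfolding norm_sq_eq_sum by (simp add: exp_sum[symmetric] sum_negf sum_divide_distrib)
  also have "(\<Prod>b\<in>(Basis::'a set). 1 / sqrt (2 * pi * t)) = (2 * pi * t) powr (- (real DIM('a) / 2))"
  proof -
    have "1 / sqrt (2 * pi * t) = (2 * pi * t) powr (- (1 / 2))"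
      unfolding powr_minus_divide by (subst powr_half_sqrt) (use t in auto)
    then have "(\<Prod>b\<in>(Basis::'a set). 1 / sqrt (2 * pi * t)) = ((2 * pi * t) powr (- (1 / 2))) ^ DIM('a)"
      by (simp only: prod_constant)
    also have "\<dots> = (2 * pi * t) powr (real DIM('a) * - (1 / 2))" by (rule powr_power) (use t in simp)
    finally show ?thesis by simp
  qed
  finally show ?thesis ..
qed

lemma gaussian_marginals:
  "(\<integral>\<^sup>+y. ennreal (\<phi> y) \<partial>lborel) = 1" "(\<integral>\<^sup>+y. ennreal (\<phi> y * y\<^sup>2) \<partial>lborel) = ennreal t"
proof -
  have m: "(\<integral>\<^sup>+y. ennreal (\<phi> y * y ^ (2 * k)) \<partial>lborel) = ennreal (fact (2 * k) / ((2 / (sqrt t)\<^sup>2) ^ k * fact k))" for k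
    using normal_moment_even[where \<mu>=0 and \<sigma>="sqrt t" and k=k] t
    by (subst nn_integral_eq_integral) (auto simp: has_bochner_integral_iff)
  show "(\<integral>\<^sup>+y. ennreal (\<phi> y) \<partial>lborel) = 1" using m[of 0] by simp
  show "(\<integral>\<^sup>+y. ennreal (\<phi> y * y\<^sup>2) \<partial>lborel) = ennreal t" using m[of 1] t by (simp add: fact_numeral)
qed

lemma heat_measure_eq: "heat_measure t = density lborel (\<lambda>x::'a::euclidean_space. ennreal (\<Prod>b\<in>Basis. \<phi> (x \<bullet> b)))"
  using t by (simp add: heat_measure_def gaussian_eq_prod)

text \<open>The density is a product over the coordinates, so the integrals factorize; the second
  moment is a sum of one-dimensional variances, each equal to t.\<close>

lemma heat_measure_moments:
  "prob_space (heat_measure t :: 'a::euclidean_space measure)"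
  "(\<integral>\<^sup>+x. ennreal (norm (x::'a) ^ 2) \<partial>heat_measure t) = ennreal (DIM('a) * t)"
proof -
  have m[measurable]: "\<phi> \<in> borel_measurable borel" by simp
  have nn: "0 \<le> (\<Prod>b\<in>Basis. \<phi> (x \<bullet> b))" for x :: 'a by (intro prod_nonneg) simp
  show "prob_space (heat_measure t :: 'a measure)"
  proof
    have "emeasure (heat_measure t :: 'a measure) UNIV = (\<integral>\<^sup>+x. (\<Prod>b\<in>(Basis::'a set). ennreal (\<phi> (x \<bullet> b))) \<partial>lborel)"
      unfolding heat_measure_eq by (subst emeasure_density) (auto simp: prod_ennreal)
    also have "\<dots> = 1" by (subst nn_integral_lborel_prod) (auto simp: gaussian_marginals)
    finally show "emeasure (heat_measure t :: 'a measure) (space (heat_measure t)) = 1" by (simp add: heat_measure_eq)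
  qed
  have one: "(\<integral>\<^sup>+x. ennreal ((\<Prod>b\<in>(Basis::'a set). \<phi> (x \<bullet> b)) * (x \<bullet> e)\<^sup>2) \<partial>lborel) = ennreal t" if e: "e \<in> Basis" for e
  proof -
    have "(\<Prod>b\<in>(Basis::'a set). \<phi> (x \<bullet> b)) * (x \<bullet> e)\<^sup>2 = (\<Prod>b\<in>Basis. \<phi> (x \<bullet> b) * (if b = e then (x \<bullet> b)\<^sup>2 else 1))" for x
      using e by (simp add: prod.distrib prod.delta)
    then have "(\<integral>\<^sup>+x. ennreal ((\<Prod>b\<in>(Basis::'a set). \<phi> (x \<bullet> b)) * (x \<bullet> e)\<^sup>2) \<partial>lborel)
        = (\<integral>\<^sup>+x. (\<Prod>b\<in>(Basis::'a set). ennreal (\<phi> (x \<bullet> b) * (if b = e then (x \<bullet> b)\<^sup>2 else 1))) \<partial>lborel)"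
      by (simp add: prod_ennreal)
    also have "\<dots> = (\<Prod>b\<in>(Basis::'a set). \<integral>\<^sup>+y. ennreal (\<phi> y * (if b = e then y\<^sup>2 else 1)) \<partial>lborel)"
      by (rule nn_integral_lborel_prod) auto
    also have "\<dots> = (\<Prod>b\<in>(Basis::'a set). if b = e then ennreal t else 1)"
      by (intro prod.cong refl) (simp add: gaussian_marginals)
    finally show ?thesis using e by (simp add: prod.delta)
  qed
  have "(\<integral>\<^sup>+x. ennreal (norm (x::'a) ^ 2) \<partial>heat_measure t)
      = (\<integral>\<^sup>+x. (\<Sum>e\<in>(Basis::'a set). ennreal ((\<Prod>b\<in>(Basis::'a set). \<phi> (x \<bullet> b)) * (x \<bullet> e)\<^sup>2)) \<partial>lborel)"
    unfolding heat_measure_eq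
  proof (subst nn_integral_density)
    have "ennreal (\<Prod>b\<in>Basis. \<phi> (x \<bullet> b)) * ennreal (norm x ^ 2) = (\<Sum>e\<in>Basis. ennreal ((\<Prod>b\<in>Basis. \<phi> (x \<bullet> b)) * (x \<bullet> e)\<^sup>2))" for x :: 'a
    proof -
      show ?thesis using nn[of x] unfolding norm_sq_eq_sum by (simp add: sum_ennreal ennreal_mult'[symmetric] sum_distrib_left)
    qed
    then show "(\<integral>\<^sup>+x. ennreal (\<Prod>b\<in>Basis. \<phi> (x \<bullet> b)) * ennreal (norm (x::'a) ^ 2) \<partial>lborel)
      = (\<integral>\<^sup>+x. (\<Sum>e\<in>(Basis::'a set). ennreal ((\<Prod>b\<in>(Basis::'a set). \<phi> (x \<bullet> b)) * (x \<bullet> e)\<^sup>2)) \<partial>lborel)" by simp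
  qed auto
  also have "\<dots> = (\<Sum>e\<in>(Basis::'a set). ennreal t)"
    by (subst nn_integral_sum) (auto simp: one)
  also have "\<dots> = ennreal (DIM('a) * t)" using t by (simp add: ennreal_mult' ennreal_of_nat_eq_real_of_nat)
  finally show "(\<integral>\<^sup>+x. ennreal (norm (x::'a) ^ 2) \<partial>heat_measure t) = ennreal (DIM('a) * t)" .
qed

lemma heat_measure_symmetric: "distr (heat_measure t) borel uminus = (heat_measure t :: 'a::euclidean_space measure)"
proof (rule measure_eqI)
  have [measurable]: "\<phi> \<in> borel_measurable borel" by simp
  let ?G = "\<lambda>x::'a. ennreal (\<Prod>b\<in>Basis. \<phi> (x \<bullet> b))"
  have even: "\<phi> (- y) = \<phi> y" for y by (simp add: normal_density_def)
  fix A assume "A \<in> sets (distr (heat_measure t) (borel :: 'a measure) uminus)"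
  then have A[measurable]: "A \<in> sets borel" by simp
  have "emeasure (distr (heat_measure t) borel uminus) A = (\<integral>\<^sup>+x. indicator A x \<partial>distr (heat_measure t) (borel :: 'a measure) uminus)" by simp
  also have "\<dots> = (\<integral>\<^sup>+x. indicator A (- x) \<partial>heat_measure t)"
    unfolding heat_measure_eq by (rule nn_integral_distr) auto
  also have "\<dots> = (\<integral>\<^sup>+x. ?G x * indicator A (- x) \<partial>lborel)"
    unfolding heat_measure_eq by (rule nn_integral_density) auto
  also have "\<dots> = (\<integral>\<^sup>+x. ?G (- x) * indicator A (- x) \<partial>lborel)" by (simp add: even)
  also have "\<dots> = (\<integral>\<^sup>+x. ?G x * indicator A x \<partial>distr lborel borel uminus)"
    by (rule nn_integral_distr[symmetric]) auto
  also have "\<dots> = emeasure (heat_measure t) A"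
    unfolding distr_lborel_uminus heat_measure_eq by (rule emeasure_density[symmetric]) auto
  finally show "emeasure (distr (heat_measure t) borel uminus) A = emeasure (heat_measure t) A" .
qed (simp add: heat_measure_eq)

end

lemma heat_measure_P2:
  fixes t :: real
  assumes "0 \<le> t"
  shows "(heat_measure t :: 'a::euclidean_space measure) \<in> P2" "distr (heat_measure t) borel uminus = (heat_measure t :: 'a measure)"
    "(\<integral>x. norm (x::'a) ^ 2 \<partial>heat_measure t) \<le> DIM('a) * t"
proof -
  have *: "(heat_measure t :: 'a measure) \<in> P2 \<and> distr (heat_measure t) borel uminus = (heat_measure t :: 'a measure) \<and>
    (\<integral>\<^sup>+x. ennreal (norm (x::'a) ^ 2) \<partial>heat_measure t) \<le> ennreal (DIM('a) * t)"
  proof (cases "t = 0")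
    case True
    then show ?thesis
      by (auto simp: heat_measure_def P2_iff_nn_integral prob_space_return nn_integral_return distr_return)
  next
    case False
    with assms have t: "0 < t" by simp
    show ?thesis
      using heat_measure_moments[OF t, where 'a='a] heat_measure_symmetric[OF t, where 'a='a]
      by (simp add: P2_iff_nn_integral) (simp add: heat_measure_eq[OF t])
  qed
  then show "(heat_measure t :: 'a measure) \<in> P2" "distr (heat_measure t) borel uminus = (heat_measure t :: 'a measure)" by blast+
  from second_moment_le_iff[OF this(1), of "DIM('a) * t"] *
  show "(\<integral>x. norm (x::'a) ^ 2 \<partial>heat_measure t) \<le> DIM('a) * t" using assms by simp
qed

text \<open>The internal part does not grow. The pair energy grows by at most 2 (L + M) times the
  second moment of the noise, which is at most d t; written as K t / 2 this gives K = 4 (L + M)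
  d.\<close>

lemma (in interaction_energy) energy_heat:
  fixes t :: real
  assumes mu: "mu \<in> P2" and t: "0 \<le> t"
  shows "energy V W f (distr (mu \<Otimes>\<^sub>M heat_measure t) borel (\<lambda>p. fst p + snd p))
    \<le> energy V W f mu + ereal (4 * (L + M) * DIM('a) * (t / 2))"
proof (cases "energy V W f mu")
  case (real e)
  note h = heat_measure_P2[OF t, where 'a='a]
  note P = sum_P2[OF mu h(1)]
  have "energy_le mu (e - pair_energy Phi mu)" using energy_le_iff[OF mu, of e] real by simp
  from energy_le_sum[OF mu h(1) this]
  have "energy_le (distr (mu \<Otimes>\<^sub>M heat_measure t) borel (\<lambda>p. fst p + snd p)) (e - pair_energy Phi mu)" .
  moreover have "2 * (L + M) * (\<integral>x. norm (x::'a) ^ 2 \<partial>heat_measure t) \<le> 2 * (L + M) * (DIM('a) * t)"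
    using h(3) quad_bound_Phi(2) by (intro mult_left_mono) auto
  then have "e - pair_energy Phi mu \<le> e + 4 * (L + M) * DIM('a) * (t / 2)
      - pair_energy Phi (distr (mu \<Otimes>\<^sub>M heat_measure t) borel (\<lambda>p. fst p + snd p))"
    using pair_energy_sum_le[OF mu h(1,2) quad_bound_Phi] by (simp add: algebra_simps)
  ultimately have "energy_le (distr (mu \<Otimes>\<^sub>M heat_measure t) borel (\<lambda>p. fst p + snd p))
      (e + 4 * (L + M) * DIM('a) * (t / 2) - pair_energy Phi (distr (mu \<Otimes>\<^sub>M heat_measure t) borel (\<lambda>p. fst p + snd p)))"
    by (rule energy_le_mono)
  then show ?thesis unfolding energy_le_iff[OF P, symmetric] real by simp
qed (use energy_not_minus_infinity[OF mu] in auto)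

text \<open>McCann's monotonicity, compared at n + 1 and at 1, gives f (1 / (n + 1)^d) <= f 1 / (n +
  1)^d, and the right side tends to 0. For nonnegative f this forces f 0 = 0, so that empty space
  carries no energy.\<close>

lemma mccann_at_zero:
  fixes f :: "real \<Rightarrow> real"
  assumes cont: "continuous_on {0..} f" and d: "0 < d"
    and mono: "antimono_on {0<..} (\<lambda>s. s ^ d * f (1 / s ^ d))"
  shows "f 0 \<le> 0"
proof -
  define x where "x n = 1 / real (Suc n) ^ d" for n
  have "(\<lambda>n. (1 / real (Suc n)) ^ d) \<longlonglongrightarrow> 0 ^ d"
    using LIMSEQ_inverse_real_of_nat by (intro tendsto_power) (simp add: divide_inverse)
  then have x: "x \<longlonglongrightarrow> 0" using d by (simp add: x_def[abs_def] power_one_over zero_power)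
  have "(\<lambda>n. f (x n)) \<longlonglongrightarrow> f 0"
    by (rule continuous_on_tendsto_compose[OF cont x]) (auto simp: x_def)
  moreover have "f (x n) \<le> f 1 * x n" for n
  proof -
    have "real (Suc n) ^ d * f (1 / real (Suc n) ^ d) \<le> f 1"
      using monotone_onD[OF mono, of 1 "real (Suc n)"] by simp
    then show ?thesis by (simp add: x_def field_simps del: of_nat_Suc)
  qed
  moreover have "(\<lambda>n. f 1 * x n) \<longlonglongrightarrow> f 1 * 0" by (intro tendsto_intros x)
  ultimately show ?thesis using LIMSEQ_le[of "\<lambda>n. f (x n)" "f 0" "\<lambda>n. f 1 * x n" 0] by simp
qed

text \<open>For s > 0 and y = ln s + a + 1 the expression equals s (exp (- y) - 1 + y), which is
  nonnegative because exp (- y) >= 1 - y.\<close>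

lemma entropy_lower_bound:
  fixes s a :: real
  assumes "0 \<le> s"
  shows "0 \<le> s * ln s + (a * s + exp (- a - 1))"
proof (cases "s = 0")
  case False
  with assms have s: "0 < s" by simp
  define y where "y = ln s + a + 1"
  have "exp (- a - 1) = exp (ln s) * exp (- y)" unfolding exp_add[symmetric] y_def by simp
  then have "s * ln s + (a * s + exp (- a - 1)) = s * (exp (- y) - (1 + (- y)))" using s by (simp add: y_def algebra_simps)
  moreover have "0 \<le> s * (exp (- y) - (1 + (- y)))"
    using s exp_ge_add_one_self[of "- y"] by (intro mult_nonneg_nonneg) linarith+
  ultimately show ?thesis by simp
qed simp

theorem proposition1p6:
  fixes V W :: "real ^ 'n \<Rightarrow> real" and f :: "real \<Rightarrow> real"
  assumes "continuous_on {0..} f"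
    and "\<And>x. V x \<ge> 0" and "\<And>x. W x \<ge> 0"
    and "(\<forall>s\<ge>0. f s \<ge> 0) \<or> (\<exists>c>0. \<forall>s\<ge>0. f s = c * (s * ln s))"
    and "C1_Lipschitz_deriv V" and "C1_Lipschitz_deriv W"
    and "convex_on {0..} f"
    and "filterlim (\<lambda>s. f s / s) at_top at_top"
    and "convex_on {0<..} (\<lambda>s. s ^ CARD('n) * f (1 / s ^ CARD('n)))"
    and "antimono_on {0<..} (\<lambda>s. s ^ CARD('n) * f (1 / s ^ CARD('n)))"
  shows "\<exists>lam K. hypothesis_A lam K (energy V W f)"
proof -
  obtain L M where L: "0 \<le> L" "quad_bound V L" and M: "0 \<le> M" "quad_bound W M"
    using C1_Lipschitz_deriv_quad_bound assms(5,6) by meson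
  \<comment> \<open>The constant of the locale: c = 0 for nonnegative f, and the positive factor of
    s ln s for the entropy.\<close>
  have "\<exists>c\<ge>0. f 0 = 0 \<and> (\<forall>a\<ge>0. \<forall>s\<ge>0. 0 \<le> f s + c * (a * s + exp (- a - 1)))"
    using assms(4)
  proof
    assume nonneg: "\<forall>s\<ge>0. 0 \<le> f s"
    moreover have "f 0 \<le> 0" by (rule mccann_at_zero[OF assms(1) _ assms(10)]) simp
    ultimately show ?thesis by (intro exI[of _ 0]) (auto intro: order_antisym)
  next
    assume "\<exists>c>0. \<forall>s\<ge>0. f s = c * (s * ln s)"
    then obtain c where c: "0 < c" "\<And>s. 0 \<le> s \<Longrightarrow> f s = c * (s * ln s)" by blast
    have "0 \<le> f s + c * (a * s + exp (- a - 1))" if "0 \<le> s" for a s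
      unfolding c(2)[OF that] distrib_left[symmetric] using c(1) entropy_lower_bound[OF that] by (intro mult_nonneg_nonneg) auto
    then show ?thesis using c by (intro exI[of _ c]) auto
  qed
  then obtain c where c: "0 \<le> c" "f 0 = 0" "\<And>a s. 0 \<le> a \<Longrightarrow> 0 \<le> s \<Longrightarrow> 0 \<le> f s + c * (a * s + exp (- a - 1))" by blast
  interpret interaction_energy f c "CARD('n)" V W L M
    by unfold_locales (use assms c L M in "simp_all")
  have "hypothesis_A (- 4 * (L + M)) (4 * (L + M) * DIM(real ^ 'n)) (energy V W f)"
    unfolding hypothesis_A_def
  proof (intro conjI ballI allI impI)
    show "energy V W f mu \<noteq> - \<infinity>" if "mu \<in> P2" for mu by (rule energy_not_minus_infinity[OF that])
    show "convex_along_gen_geodesics (- 4 * (L + M)) (energy V W f)" by (rule energy_convex_along_gen_geodesics)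
    show "energy V W f (mu \<star> heat_measure t) \<le> energy V W f mu + ereal (4 * (L + M) * DIM(real ^ 'n) * (t / 2))"
      if "mu \<in> P2" "0 \<le> t" for mu t
      using energy_heat[OF that] by (simp only: convolution_def case_prod_unfold)
    show "energy V W f mu \<le> liminf (\<lambda>k. energy V W f (Ms k))"
      if "range Ms \<subseteq> P2 \<and> mu \<in> P2 \<and> narrowly_converges Ms mu \<and> (\<exists>C. \<forall>k. (\<integral>x. norm x ^ 2 \<partial>Ms k) \<le> C)" for Ms mu
      using that energy_lower_semicontinuous[of Ms mu] by blast
  qed
  then show ?thesis by blast
qed

end
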